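(* Let $X,Y$ be $k$-varieties and let $g\colon Y\to X$, $f\colon X\to\mathbb{A}^1_k$ be morphisms of $k$-varieties. Then there exists a triangulated functor $$\Psi^{\infty}_{f,g}\colon \mathbf{SH}_{\mathfrak M}(Y_\eta)\longrightarrow \mathbf{SH}_{\mathfrak M}(X_\sigma)$$ fitting into a distinguished triangle (of triangulated functors) $$g_{\sigma!}\Psi_{f\circ g}\xrightarrow{\ \mu_g\ }\Psi_f\, g_{\eta!}\longrightarrow \Psi^{\infty}_{f,g}\longrightarrow +1 .$$
   Context: $k$ is a field of characteristic $0$; a $k$-variety is a separated $k$-scheme of finite type. $\mathbf{SH}_{\mathfrak M}(X)$ is the Morel–Voevodsky–Ayoub motivic stable homotopy category of $X$ with coefficients in a fixed category of coefficients $\mathfrak M$ in Ayoub's sense (e.g. symmetric $S^1$-spectra, or complexes of $\Lambda$-modules giving étale motives), with its six operations; $f_\#$ is the left adjoint of $f^*$ for $f$ smooth. Algebraic derivator. A diagram of $k$-varieties $(\mathscr F,I)$ is a functor $\mathscr F\colon I\to \mathrm{Var}_k$ from a small category $I$; a morphism $(f,\alpha)\colon(\mathscr G,J)\to(\mathscr F,I)$ is a functor $\alpha\colon J\to I$ with a natural transformation $\mathscr G\to\mathscr F\circ\alpha$ (written $f$ if $\alpha=\mathrm{id}$). $(X,I)$ is the constant diagram and $p_I\colon (X,I)\to X$ the projection. $\mathbb{SH}_{\mathfrak M}(\mathscr F,I)$ is Ayoub's stable homotopical algebraic derivator extending $\mathbf{SH}_{\mathfrak M}$, with functors $(f,\alpha)^*\dashv(f,\alpha)_*$,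 and $(f,\alpha)_\#\dashv(f,\alpha)^*$ if $(f,\alpha)$ is smooth argument by argument. Nearby cycles. For $f\colon X\to\mathbb A^1_k$, let $X_\eta=X\times_{\mathbb A^1_k}\mathbb G_{m,k}$, let $X_\sigma$ be the fibre over the zero section $\sigma=\mathrm{Spec}(k)$, let $j_f\colon X_\eta\to X$, $i_f\colon X_\sigma\to X$ be the immersions, and for a morphism $g$ over $\mathbb A^1_k$ let $g_\eta,g_\sigma$ be its base changes. Let $\Delta$ be the category of finite ordinals, $\mathbb N^\times$ the positive integers ordered by the opposite of divisibility, $I=\Delta\times\mathbb N^\times$, and $\theta_{\mathrm{id}}\colon(\mathscr R,I)\to\mathbb G_{m,k}$ Ayoub's diagram of $\mathbb G_{m,k}$-schemes: $\mathscr R(\mathbf n,r)=\mathbb G_{m,k}\times_k(\mathbb G_{m,k})^n$ with structural morphism the first projection followed by the $r$-th power map $e_r$; the cosimplicial structure has cofaces repeating a coordinate or appending the coordinate $1$ at the end and codegeneracies forgetting coordinates, and the transition maps in the $\mathbb N^\times$-direction are power maps. Let $\mathscr R_X=\mathscr R\times_{\mathbb G_{m,k}}X_\eta$ and $\theta_f\colon(\mathscr R_X,I)\to(X_\eta,I)$ the projection. The motivic nearby cycles functor is $$\Psi_f=(p_I)_\#(i_f)^*(j_f\circ\theta_f)_*(\theta_f)^*(p_I)^*\colon \mathbf{SH}_{\mathfrak M}(X_\eta)\to\mathbf{SH}_{\mathfrak M}(X_\sigma).$$ Base change morphisms. For $g\colon Y\to X$ there are canonical exchange morphisms $\alpha_g\colon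 g_\sigma^*\Psi_f\to\Psi_{f\circ g}g_\eta^*$ (invertible for $g$ smooth) and $\beta_g\colon\Psi_fg_{\eta*}\to g_{\sigma*}\Psi_{f\circ g}$ (invertible for $g$ proper). For $u$ smooth let $\gamma_u\colon u_{\sigma\#}\Psi_{f\circ u}\to\Psi_fu_{\eta\#}$ be obtained by adjunction from $\alpha_u^{-1}$. Choosing a Nagata compactification $g=\overline g\circ u$ ($u\colon Y\to\overline Y$ an open immersion, $\overline g$ proper), $g_!=\overline g_*u_\#$ and $\mu_g\colon g_{\sigma!}\Psi_{f\circ g}\to\Psi_fg_{\eta!}$ is the composite $$\overline g_{\sigma*}u_{\sigma\#}\Psi_{f\circ g}\xrightarrow{\gamma_u}\overline g_{\sigma*}\Psi_{f\circ\overline g}u_{\eta\#}\xrightarrow{\beta_{\overline g}^{-1}}\Psi_f\overline g_{\eta*}u_{\eta\#}.$$ A distinguished triangle of triangulated functors consists of natural transformations which give a distinguished triangle when evaluated on every object. *)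

theory Defs
  imports
    "HOL-Analysis.Abstract_Topology"
    "HOL-Algebra.Generated_Rings"
    "HOL-Algebra.QuotRing"
    "HOL-Computational_Algebra.Polynomial"
begin

section \<open>Categories, functors, triangulated categories\<close>

record ('o, 'm) cat =
  obs :: "'o set"
  ars :: "'m set"
  dm :: "'m \<Rightarrow> 'o"
  cd :: "'m \<Rightarrow> 'o"
  idn :: "'o \<Rightarrow> 'm"
  cmp :: "'m \<Rightarrow> 'm \<Rightarrow> 'm"  (infixl \<open>\<cdot>\<index>\<close> 70)

definition homs :: "('o, 'm, 'z) cat_scheme \<Rightarrow> 'o \<Rightarrow> 'o \<Rightarrow> 'm set" where
  "homs C a b = {f \<in> ars C. dm C f = a \<and> cd C f = b}"

definition category :: "('o, 'm, 'z) cat_scheme \<Rightarrow> bool" where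
  "category C \<longleftrightarrow>
     (\<forall>f\<in>ars C. dm C f \<in> obs C \<and> cd C f \<in> obs C) \<and>
     (\<forall>a\<in>obs C. idn C a \<in> homs C a a) \<and>
     (\<forall>f\<in>ars C. \<forall>g\<in>ars C. cd C f = dm C g \<longrightarrow> g \<cdot>\<^bsub>C\<^esub> f \<in> homs C (dm C f) (cd C g)) \<and>
     (\<forall>f\<in>ars C. f \<cdot>\<^bsub>C\<^esub> idn C (dm C f) = f \<and> idn C (cd C f) \<cdot>\<^bsub>C\<^esub> f = f) \<and>
     (\<forall>f\<in>ars C. \<forall>g\<in>ars C. \<forall>h\<in>ars C. cd C f = dm C g \<and> cd C g = dm C h \<longrightarrow>
        (h \<cdot>\<^bsub>C\<^esub> g) \<cdot>\<^bsub>C\<^esub> f = h \<cdot>\<^bsub>C\<^esub> (g \<cdot>\<^bsub>C\<^esub> f))"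

definition is_inverse :: "('o, 'm, 'z) cat_scheme \<Rightarrow> 'm \<Rightarrow> 'm \<Rightarrow> bool" where
  "is_inverse C f g \<longleftrightarrow> f \<in> ars C \<and> g \<in> homs C (cd C f) (dm C f) \<and>
     g \<cdot>\<^bsub>C\<^esub> f = idn C (dm C f) \<and> f \<cdot>\<^bsub>C\<^esub> g = idn C (cd C f)"

definition is_iso :: "('o, 'm, 'z) cat_scheme \<Rightarrow> 'm \<Rightarrow> bool" where
  "is_iso C f \<longleftrightarrow> (\<exists>g. is_inverse C f g)"

definition inver :: "('o, 'm, 'z) cat_scheme \<Rightarrow> 'm \<Rightarrow> 'm" where
  "inver C f = (THE g. is_inverse C f g)"

definition is_functor ::
  "('o, 'm, 'z) cat_scheme \<Rightarrow> ('o2, 'm2, 'z2) cat_scheme \<Rightarrow> ('o \<Rightarrow> 'o2) \<Rightarrow> ('m \<Rightarrow> 'm2) \<Rightarrow> bool" where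
  "is_functor C D F G \<longleftrightarrow>
     (\<forall>a\<in>obs C. F a \<in> obs D \<and> G (idn C a) = idn D (F a)) \<and>
     (\<forall>f\<in>ars C. G f \<in> homs D (F (dm C f)) (F (cd C f))) \<and>
     (\<forall>f\<in>ars C. \<forall>g\<in>ars C. cd C f = dm C g \<longrightarrow> G (g \<cdot>\<^bsub>C\<^esub> f) = G g \<cdot>\<^bsub>D\<^esub> G f)"

definition is_product ::
  "('o, 'm, 'z) cat_scheme \<Rightarrow> nat set \<Rightarrow> 'o \<Rightarrow> (nat \<Rightarrow> 'm) \<Rightarrow> (nat \<Rightarrow> 'o) \<Rightarrow> bool" where
  "is_product C J P q X \<longleftrightarrow> P \<in> obs C \<and> (\<forall>j\<in>J. q j \<in> homs C P (X j)) \<and>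
     (\<forall>T\<in>obs C. \<forall>h. (\<forall>j\<in>J. h j \<in> homs C T (X j)) \<longrightarrow>
        (\<exists>!m. m \<in> homs C T P \<and> (\<forall>j\<in>J. q j \<cdot>\<^bsub>C\<^esub> m = h j)))"

text \<open>In \<open>is_pullback C p q a b\<close> the square is \<open>p \<cdot> a = q \<cdot> b\<close>, with
  \<open>a\<close> parallel to \<open>q\<close> and \<open>b\<close> parallel to \<open>p\<close>.\<close>

definition is_pullback :: "('o, 'm, 'z) cat_scheme \<Rightarrow> 'm \<Rightarrow> 'm \<Rightarrow> 'm \<Rightarrow> 'm \<Rightarrow> bool" where
  "is_pullback C p q a b \<longleftrightarrow>
     p \<in> ars C \<and> q \<in> ars C \<and> a \<in> ars C \<and> b \<in> ars C \<and>
     cd C p = cd C q \<and> dm C a = dm C b \<and> cd C a = dm C p \<and> cd C b = dm C q \<and>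
     p \<cdot>\<^bsub>C\<^esub> a = q \<cdot>\<^bsub>C\<^esub> b \<and>
     (\<forall>x\<in>ars C. \<forall>y\<in>ars C.
        dm C x = dm C y \<and> cd C x = dm C p \<and> cd C y = dm C q \<and> p \<cdot>\<^bsub>C\<^esub> x = q \<cdot>\<^bsub>C\<^esub> y \<longrightarrow>
        (\<exists>!m. m \<in> homs C (dm C x) (dm C a) \<and> a \<cdot>\<^bsub>C\<^esub> m = x \<and> b \<cdot>\<^bsub>C\<^esub> m = y))"

definition pb_lift :: "('o, 'm, 'z) cat_scheme \<Rightarrow> 'm \<Rightarrow> 'm \<Rightarrow> 'm \<Rightarrow> 'm \<Rightarrow> 'm" where
  "pb_lift C a b x y =
     (THE m. m \<in> homs C (dm C x) (dm C a) \<and> a \<cdot>\<^bsub>C\<^esub> m = x \<and> b \<cdot>\<^bsub>C\<^esub> m = y)"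

record ('o, 'm) tcat = "('o, 'm) cat" +
  hadd :: "'o \<Rightarrow> 'o \<Rightarrow> 'm \<Rightarrow> 'm \<Rightarrow> 'm"
  hzero :: "'o \<Rightarrow> 'o \<Rightarrow> 'm"
  sho :: "'o \<Rightarrow> 'o"
  sha :: "'m \<Rightarrow> 'm"
  tri :: "('m \<times> 'm \<times> 'm) set"

definition hom_grp :: "('o, 'm, 'z) tcat_scheme \<Rightarrow> 'o \<Rightarrow> 'o \<Rightarrow> 'm monoid" where
  "hom_grp C a b = \<lparr>carrier = homs C a b, monoid.mult = hadd C a b, one = hzero C a b\<rparr>"

definition hneg :: "('o, 'm, 'z) tcat_scheme \<Rightarrow> 'm \<Rightarrow> 'm" where
  "hneg C f = m_inv (hom_grp C (dm C f) (cd C f)) f"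

definition zero_ob :: "('o, 'm, 'z) tcat_scheme \<Rightarrow> 'o \<Rightarrow> bool" where
  "zero_ob C a \<longleftrightarrow> a \<in> obs C \<and> idn C a = hzero C a a"

definition additive_cat :: "('o, 'm, 'z) tcat_scheme \<Rightarrow> bool" where
  "additive_cat C \<longleftrightarrow> category C \<and>
     (\<forall>a\<in>obs C. \<forall>b\<in>obs C. comm_group (hom_grp C a b)) \<and>
     (\<forall>a\<in>obs C. \<forall>b\<in>obs C. \<forall>c\<in>obs C. \<forall>f\<in>homs C a b. \<forall>f'\<in>homs C a b. \<forall>g\<in>homs C b c. \<forall>g'\<in>homs C b c.
        g \<cdot>\<^bsub>C\<^esub> hadd C a b f f' = hadd C a c (g \<cdot>\<^bsub>C\<^esub> f) (g \<cdot>\<^bsub>C\<^esub> f') \<and>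
        hadd C b c g g' \<cdot>\<^bsub>C\<^esub> f = hadd C a c (g \<cdot>\<^bsub>C\<^esub> f) (g' \<cdot>\<^bsub>C\<^esub> f)) \<and>
     (\<exists>z. zero_ob C z) \<and>
     (\<forall>a\<in>obs C. \<forall>b\<in>obs C. \<exists>s\<in>obs C. \<exists>p\<in>homs C s a. \<exists>q\<in>homs C s b.
        \<exists>i\<in>homs C a s. \<exists>j\<in>homs C b s.
          p \<cdot>\<^bsub>C\<^esub> i = idn C a \<and> q \<cdot>\<^bsub>C\<^esub> j = idn C b \<and>
          p \<cdot>\<^bsub>C\<^esub> j = hzero C b a \<and> q \<cdot>\<^bsub>C\<^esub> i = hzero C a b \<and>
          hadd C s s (i \<cdot>\<^bsub>C\<^esub> p) (j \<cdot>\<^bsub>C\<^esub> q) = idn C s)"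

definition additive_functor ::
  "('o, 'm, 'z) tcat_scheme \<Rightarrow> ('o2, 'm2, 'z2) tcat_scheme \<Rightarrow> ('o \<Rightarrow> 'o2) \<Rightarrow> ('m \<Rightarrow> 'm2) \<Rightarrow> bool" where
  "additive_functor C D F G \<longleftrightarrow> is_functor C D F G \<and>
     (\<forall>a\<in>obs C. \<forall>b\<in>obs C. \<forall>f\<in>homs C a b. \<forall>g\<in>homs C a b.
        G (hadd C a b f g) = hadd D (F a) (F b) (G f) (G g))"

definition equivalence ::
  "('o, 'm, 'z) cat_scheme \<Rightarrow> ('o2, 'm2, 'z2) cat_scheme \<Rightarrow> ('o \<Rightarrow> 'o2) \<Rightarrow> ('m \<Rightarrow> 'm2) \<Rightarrow> bool" where
  "equivalence C D F G \<longleftrightarrow> is_functor C D F G \<and>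
     (\<forall>a\<in>obs C. \<forall>b\<in>obs C. bij_betw G (homs C a b) (homs D (F a) (F b))) \<and>
     (\<forall>d\<in>obs D. \<exists>a\<in>obs C. \<exists>e\<in>homs D (F a) d. is_iso D e)"

definition pre_triangle :: "('o, 'm, 'z) tcat_scheme \<Rightarrow> 'm \<Rightarrow> 'm \<Rightarrow> 'm \<Rightarrow> bool" where
  "pre_triangle C f g h \<longleftrightarrow> f \<in> ars C \<and> g \<in> ars C \<and> h \<in> ars C \<and>
     cd C f = dm C g \<and> cd C g = dm C h \<and> cd C h = sho C (dm C f)"

text \<open>The octahedral axiom is the last clause.  The shift is only required to be an
  autoequivalence.\<close>

definition triangulated :: "('o, 'm, 'z) tcat_scheme \<Rightarrow> bool" where
  "triangulated C \<longleftrightarrow> additive_cat C \<and>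
     additive_functor C C (sho C) (sha C) \<and> equivalence C C (sho C) (sha C) \<and>
     (\<forall>(f, g, h)\<in>tri C. pre_triangle C f g h) \<and>
     (\<forall>f g h f' g' h' x y z. (f, g, h) \<in> tri C \<and> pre_triangle C f' g' h' \<and>
        x \<in> homs C (dm C f) (dm C f') \<and> y \<in> homs C (dm C g) (dm C g') \<and> z \<in> homs C (dm C h) (dm C h') \<and>
        is_iso C x \<and> is_iso C y \<and> is_iso C z \<and>
        y \<cdot>\<^bsub>C\<^esub> f = f' \<cdot>\<^bsub>C\<^esub> x \<and> z \<cdot>\<^bsub>C\<^esub> g = g' \<cdot>\<^bsub>C\<^esub> y \<and> sha C x \<cdot>\<^bsub>C\<^esub> h = h' \<cdot>\<^bsub>C\<^esub> z
        \<longrightarrow> (f', g', h') \<in> tri C) \<and>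
     (\<forall>a\<in>obs C. \<forall>z. zero_ob C z \<longrightarrow> (idn C a, hzero C a z, hzero C z (sho C a)) \<in> tri C) \<and>
     (\<forall>f\<in>ars C. \<exists>g h. (f, g, h) \<in> tri C) \<and>
     (\<forall>f g h. pre_triangle C f g h \<longrightarrow>
        ((f, g, h) \<in> tri C \<longleftrightarrow> (g, h, hneg C (sha C f)) \<in> tri C)) \<and>
     (\<forall>f g h f' g' h' x y. (f, g, h) \<in> tri C \<and> (f', g', h') \<in> tri C \<and>
        x \<in> homs C (dm C f) (dm C f') \<and> y \<in> homs C (dm C g) (dm C g') \<and> y \<cdot>\<^bsub>C\<^esub> f = f' \<cdot>\<^bsub>C\<^esub> x \<longrightarrow>
        (\<exists>z\<in>homs C (dm C h) (dm C h'). z \<cdot>\<^bsub>C\<^esub> g = g' \<cdot>\<^bsub>C\<^esub> y \<and> sha C x \<cdot>\<^bsub>C\<^esub> h = h' \<cdot>\<^bsub>C\<^esub> z)) \<and>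
     (\<forall>f g a a' b b' c c'. (f, a, a') \<in> tri C \<and> (g, b, b') \<in> tri C \<and> cd C f = dm C g \<and>
        (g \<cdot>\<^bsub>C\<^esub> f, c, c') \<in> tri C \<longrightarrow>
        (\<exists>u\<in>homs C (cd C a) (cd C c). \<exists>v\<in>homs C (cd C c) (cd C b).
           (u, v, sha C a \<cdot>\<^bsub>C\<^esub> b') \<in> tri C \<and>
           u \<cdot>\<^bsub>C\<^esub> a = c \<cdot>\<^bsub>C\<^esub> g \<and> c' \<cdot>\<^bsub>C\<^esub> u = a' \<and> v \<cdot>\<^bsub>C\<^esub> c = b \<and> b' \<cdot>\<^bsub>C\<^esub> v = sha C f \<cdot>\<^bsub>C\<^esub> c'))"

record ('o, 'm) ftr =
  onO :: "'o \<Rightarrow> 'o"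
  onA :: "'m \<Rightarrow> 'm"

definition ftr_comp :: "('o, 'm) ftr \<Rightarrow> ('o, 'm) ftr \<Rightarrow> ('o, 'm) ftr"  (infixr \<open>\<odot>\<close> 70) where
  "G \<odot> F = \<lparr>onO = onO G \<circ> onO F, onA = onA G \<circ> onA F\<rparr>"

definition shift_ftr :: "('o, 'm, 'z) tcat_scheme \<Rightarrow> ('o, 'm) ftr" where
  "shift_ftr C = \<lparr>onO = sho C, onA = sha C\<rparr>"

definition nat_trans ::
  "('o, 'm, 'z) cat_scheme \<Rightarrow> ('o, 'm, 'z2) cat_scheme \<Rightarrow> ('o, 'm) ftr \<Rightarrow> ('o, 'm) ftr
    \<Rightarrow> ('o \<Rightarrow> 'm) \<Rightarrow> bool" where
  "nat_trans C D F G t \<longleftrightarrow> (\<forall>a\<in>obs C. t a \<in> homs D (onO F a) (onO G a)) \<and>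
     (\<forall>f\<in>ars C. t (cd C f) \<cdot>\<^bsub>D\<^esub> onA F f = onA G f \<cdot>\<^bsub>D\<^esub> t (dm C f))"

definition triangulated_functor ::
  "('o, 'm, 'z) tcat_scheme \<Rightarrow> ('o, 'm, 'z2) tcat_scheme \<Rightarrow> ('o, 'm) ftr \<Rightarrow> bool" where
  "triangulated_functor C D F \<longleftrightarrow> additive_functor C D (onO F) (onA F) \<and>
     (\<exists>s. nat_trans C D (F \<odot> shift_ftr C) (shift_ftr D \<odot> F) s \<and> (\<forall>a\<in>obs C. is_iso D (s a)) \<and>
        (\<forall>(f, g, h)\<in>tri C. (onA F f, onA F g, s (dm C f) \<cdot>\<^bsub>D\<^esub> onA F h) \<in> tri D))"

definition adjunction ::
  "('o, 'm, 'z) cat_scheme \<Rightarrow> ('o, 'm, 'z2) cat_scheme \<Rightarrow> ('o, 'm) ftr \<Rightarrow> ('o, 'm) ftr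
    \<Rightarrow> ('o \<Rightarrow> 'm) \<Rightarrow> ('o \<Rightarrow> 'm) \<Rightarrow> bool" where
  "adjunction C D L R un co \<longleftrightarrow>
     is_functor C D (onO L) (onA L) \<and> is_functor D C (onO R) (onA R) \<and>
     nat_trans C C \<lparr>onO = \<lambda>a. a, onA = \<lambda>f. f\<rparr> (R \<odot> L) un \<and>
     nat_trans D D (L \<odot> R) \<lparr>onO = \<lambda>a. a, onA = \<lambda>f. f\<rparr> co \<and>
     (\<forall>a\<in>obs C. co (onO L a) \<cdot>\<^bsub>D\<^esub> onA L (un a) = idn D (onO L a)) \<and>
     (\<forall>b\<in>obs D. onA R (co b) \<cdot>\<^bsub>C\<^esub> un (onO R b) = idn C (onO R b))"


section \<open>Schemes and varieties over a field\<close>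

text \<open>
  A ringed space is given by a topology, the stalks of its structure sheaf, and, for every open
  set, the sections regarded as functions into the stalks (as in the usual construction of the
  structure sheaf of a spectrum).  Restriction is restriction of functions, and every sheaf of
  rings is of this form up to isomorphism.  The structural morphism to the spectrum of the field
  is given by the homomorphisms from the field to the stalks.

  Points and germs live in arbitrary types.  As soon as both types have at least as many elements
  as the field (which is infinite in characteristic 0), every variety over the field is isomorphic
  to one of this form, and fibre products of varieties exist.
\<close>

record ('p, 'r, 'k) kspace =
  ktop :: "'p topology"
  stalk :: "'p \<Rightarrow> 'r ring"
  secs :: "'p set \<Rightarrow> ('p \<Rightarrow> 'r) set"
  scal :: "'p \<Rightarrow> 'k \<Rightarrow> 'r"

abbreviation pts :: "('p, 'r, 'k) kspace \<Rightarrow> 'p set" where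
  "pts X \<equiv> topspace (ktop X)"

definition field_ring :: "('k::field) ring" where
  "field_ring = \<lparr>carrier = UNIV, monoid.mult = (*), one = 1, zero = 0, add = (+)\<rparr>"

definition sec_ring :: "('p, 'r, 'k) kspace \<Rightarrow> 'p set \<Rightarrow> ('p \<Rightarrow> 'r) ring" where
  "sec_ring X U = \<lparr>carrier = secs X U,
     monoid.mult = \<lambda>s t. \<lambda>x\<in>U. s x \<otimes>\<^bsub>stalk X x\<^esub> t x, one = \<lambda>x\<in>U. \<one>\<^bsub>stalk X x\<^esub>,
     zero = \<lambda>x\<in>U. \<zero>\<^bsub>stalk X x\<^esub>, add = \<lambda>s t. \<lambda>x\<in>U. s x \<oplus>\<^bsub>stalk X x\<^esub> t x\<rparr>"

definition local_ring :: "'r ring \<Rightarrow> bool" where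
  "local_ring R \<longleftrightarrow> cring R \<and> \<one>\<^bsub>R\<^esub> \<noteq> \<zero>\<^bsub>R\<^esub> \<and>
     (\<forall>a\<in>carrier R. \<forall>b\<in>carrier R. a \<oplus>\<^bsub>R\<^esub> b \<in> Units R \<longrightarrow> a \<in> Units R \<or> b \<in> Units R)"

definition lrs :: "('p, 'r, 'k::field) kspace \<Rightarrow> bool" where
  "lrs X \<longleftrightarrow>
     (\<forall>x\<in>pts X. local_ring (stalk X x)) \<and>
     (\<forall>U. openin (ktop X) U \<longrightarrow>
        secs X U \<subseteq> (\<Pi>\<^sub>E x\<in>U. carrier (stalk X x)) \<and> cring (sec_ring X U) \<and>
        (\<forall>V s. openin (ktop X) V \<and> V \<subseteq> U \<and> s \<in> secs X U \<longrightarrow> restrict s V \<in> secs X V) \<and>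
        (\<forall>s\<in>(\<Pi>\<^sub>E x\<in>U. carrier (stalk X x)).
           (\<forall>x\<in>U. \<exists>V. openin (ktop X) V \<and> x \<in> V \<and> V \<subseteq> U \<and> restrict s V \<in> secs X V)
           \<longrightarrow> s \<in> secs X U)) \<and>
     (\<forall>x\<in>pts X. \<forall>r\<in>carrier (stalk X x). \<exists>U s. openin (ktop X) U \<and> x \<in> U \<and> s \<in> secs X U \<and> s x = r) \<and>
     (\<forall>U V s t x. openin (ktop X) U \<and> openin (ktop X) V \<and> s \<in> secs X U \<and> t \<in> secs X V \<and>
        x \<in> U \<inter> V \<and> s x = t x \<longrightarrow>
        (\<exists>W. openin (ktop X) W \<and> x \<in> W \<and> W \<subseteq> U \<inter> V \<and> (\<forall>y\<in>W. s y = t y))) \<and>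
     (\<forall>x\<in>pts X. scal X x \<in> ring_hom field_ring (stalk X x)) \<and>
     (\<forall>c. (\<lambda>x\<in>pts X. scal X x c) \<in> secs X (pts X))"

definition open_sub :: "('p, 'r, 'k) kspace \<Rightarrow> 'p set \<Rightarrow> ('p, 'r, 'k) kspace" where
  "open_sub X U = X\<lparr>ktop := subtopology (ktop X) U\<rparr>"

text \<open>A locally ringed space is affine if its canonical morphism to the spectrum of its ring
  of global sections is an isomorphism: it is a bijection onto the prime ideals, a
  homeomorphism for the Zariski topology, and the stalk at \<open>x\<close> is the localization of
  the global sections at the prime ideal of \<open>x\<close>.\<close>

definition affine :: "('p, 'r, 'k::field) kspace \<Rightarrow> bool" where
  "affine X \<longleftrightarrow> lrs X \<and> (let A = sec_ring X (pts X) in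
     bij_betw (\<lambda>x. {a \<in> carrier A. a x \<notin> Units (stalk X x)}) (pts X) {P. primeideal P A} \<and>
     (\<forall>U. openin (ktop X) U \<longleftrightarrow> U \<subseteq> pts X \<and>
        (\<forall>x\<in>U. \<exists>a\<in>carrier A. a x \<in> Units (stalk X x) \<and> {y \<in> pts X. a y \<in> Units (stalk X y)} \<subseteq> U)) \<and>
     (\<forall>x\<in>pts X.
        (\<forall>r\<in>carrier (stalk X x). \<exists>a\<in>carrier A. \<exists>b\<in>carrier A.
           b x \<in> Units (stalk X x) \<and> r \<otimes>\<^bsub>stalk X x\<^esub> b x = a x) \<and>
        (\<forall>a\<in>carrier A. a x = \<zero>\<^bsub>stalk X x\<^esub> \<longrightarrow>
           (\<exists>b\<in>carrier A. b x \<in> Units (stalk X x) \<and> b \<otimes>\<^bsub>A\<^esub> a = \<zero>\<^bsub>A\<^esub>))))"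

definition affine_open :: "('p, 'r, 'k::field) kspace \<Rightarrow> 'p set \<Rightarrow> bool" where
  "affine_open X U \<longleftrightarrow> openin (ktop X) U \<and> affine (open_sub X U)"

definition kscheme :: "('p, 'r, 'k::field) kspace \<Rightarrow> bool" where
  "kscheme X \<longleftrightarrow> lrs X \<and> (\<forall>x\<in>pts X. \<exists>U. x \<in> U \<and> affine_open X U)"

definition finite_type :: "('p, 'r, 'k::field) kspace \<Rightarrow> bool" where
  "finite_type X \<longleftrightarrow> (\<exists>\<U>. finite \<U> \<and> \<Union>\<U> = pts X \<and>
     (\<forall>U\<in>\<U>. affine_open X U \<and>
        (\<exists>S. finite S \<and> S \<subseteq> secs X U \<and>
           generate_ring (sec_ring X U) (S \<union> range (\<lambda>c. \<lambda>x\<in>U. scal X x c)) = secs X U)))"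

text \<open>A morphism \<open>f\<close> is given by a map of points and by its homomorphisms
  \<open>shf f y\<close> from the stalk of the target at \<open>bas f y\<close> to the stalk of the source at
  \<open>y\<close>.\<close>

record ('p, 'r, 'k) kmor =
  src :: "('p, 'r, 'k) kspace"
  tgt :: "('p, 'r, 'k) kspace"
  bas :: "'p \<Rightarrow> 'p"
  shf :: "'p \<Rightarrow> 'r \<Rightarrow> 'r"

definition preim :: "('p, 'r, 'k) kmor \<Rightarrow> 'p set \<Rightarrow> 'p set" where
  "preim f U = {y \<in> pts (src f). bas f y \<in> U}"

definition pullsec :: "('p, 'r, 'k) kmor \<Rightarrow> 'p set \<Rightarrow> ('p \<Rightarrow> 'r) \<Rightarrow> ('p \<Rightarrow> 'r)" where
  "pullsec f V s = (\<lambda>y\<in>V. shf f y (s (bas f y)))"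

definition is_kmor :: "('p, 'r, 'k::field) kmor \<Rightarrow> bool" where
  "is_kmor f \<longleftrightarrow>
     continuous_map (ktop (src f)) (ktop (tgt f)) (bas f) \<and>
     bas f \<in> extensional (pts (src f)) \<and> shf f \<in> extensional (pts (src f)) \<and>
     (\<forall>y\<in>pts (src f).
        shf f y \<in> ring_hom (stalk (tgt f) (bas f y)) (stalk (src f) y) \<and>
        shf f y \<in> extensional (carrier (stalk (tgt f) (bas f y))) \<and>
        (\<forall>a\<in>carrier (stalk (tgt f) (bas f y)).
           shf f y a \<in> Units (stalk (src f) y) \<longrightarrow> a \<in> Units (stalk (tgt f) (bas f y))) \<and>
        (\<forall>c. shf f y (scal (tgt f) (bas f y) c) = scal (src f) y c)) \<and>
     (\<forall>U. openin (ktop (tgt f)) U \<longrightarrow>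
        (\<forall>s\<in>secs (tgt f) U. pullsec f (preim f U) s \<in> secs (src f) (preim f U)))"

definition kid :: "('p, 'r, 'k) kspace \<Rightarrow> ('p, 'r, 'k) kmor" where
  "kid X = \<lparr>src = X, tgt = X, bas = (\<lambda>x\<in>pts X. x),
            shf = (\<lambda>x\<in>pts X. \<lambda>r\<in>carrier (stalk X x). r)\<rparr>"

definition kcomp :: "('p, 'r, 'k) kmor \<Rightarrow> ('p, 'r, 'k) kmor \<Rightarrow> ('p, 'r, 'k) kmor" where
  "kcomp g f = \<lparr>src = src f, tgt = tgt g, bas = (\<lambda>x\<in>pts (src f). bas g (bas f x)),
     shf = (\<lambda>x\<in>pts (src f). \<lambda>r\<in>carrier (stalk (tgt g) (bas g (bas f x))).
              shf f x (shf g (bas f x) r))\<rparr>"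

definition spaces_cat ::
  "(('p, 'r, 'k::field) kspace \<Rightarrow> bool) \<Rightarrow> (('p, 'r, 'k) kspace, ('p, 'r, 'k) kmor) cat" where
  "spaces_cat P = \<lparr>obs = {X. P X}, ars = {f. is_kmor f \<and> P (src f) \<and> P (tgt f)},
     dm = src, cd = tgt, idn = kid, cmp = kcomp\<rparr>"

definition closed_immersion :: "('p, 'r, 'k::field) kmor \<Rightarrow> bool" where
  "closed_immersion f \<longleftrightarrow> is_kmor f \<and> embedding_map (ktop (src f)) (ktop (tgt f)) (bas f) \<and>
     closedin (ktop (tgt f)) (bas f ` pts (src f)) \<and>
     (\<forall>y\<in>pts (src f). shf f y ` carrier (stalk (tgt f) (bas f y)) = carrier (stalk (src f) y))"

definition open_immersion :: "('p, 'r, 'k::field) kmor \<Rightarrow> bool" where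
  "open_immersion f \<longleftrightarrow> is_kmor f \<and> embedding_map (ktop (src f)) (ktop (tgt f)) (bas f) \<and>
     openin (ktop (tgt f)) (bas f ` pts (src f)) \<and>
     (\<forall>y\<in>pts (src f).
        bij_betw (shf f y) (carrier (stalk (tgt f) (bas f y))) (carrier (stalk (src f) y)))"

definition separated :: "('p, 'r, 'k::field) kspace \<Rightarrow> bool" where
  "separated X \<longleftrightarrow> (\<exists>P q d. is_product (spaces_cat kscheme) {0, 1} P q (\<lambda>_. X) \<and>
     d \<in> homs (spaces_cat kscheme) X P \<and> kcomp (q 0) d = kid X \<and> kcomp (q 1) d = kid X \<and>
     closed_immersion d)"

definition kvariety :: "('p, 'r, 'k::field) kspace \<Rightarrow> bool" where
  "kvariety X \<longleftrightarrow> kscheme X \<and> separated X \<and> finite_type X"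

definition Var :: "(('p, 'r, 'k::field) kspace, ('p, 'r, 'k) kmor) cat" where
  "Var = spaces_cat kvariety"

text \<open>Formal smoothness of \<open>\<phi> : A \<rightarrow> B\<close>.  The test rings are carried by
  the type of sections; this is no restriction, since for \<open>B\<close> of finite presentation,
  \<open>B = P/J\<close> with \<open>P\<close> a polynomial algebra, it suffices to test with
  \<open>P/J\<^sup>2 \<rightarrow> P/J\<close>, and \<open>P/J\<^sup>2\<close> fits into that type (which is infinite, unless
  the spectra are empty).\<close>

definition formally_smooth :: "'c ring \<Rightarrow> 'c ring \<Rightarrow> ('c \<Rightarrow> 'c) \<Rightarrow> bool" where
  "formally_smooth A B \<phi> \<longleftrightarrow>
     (\<forall>(C :: 'c ring) I h g. cring C \<and> ideal I C \<and> (\<forall>a\<in>I. \<forall>b\<in>I. a \<otimes>\<^bsub>C\<^esub> b = \<zero>\<^bsub>C\<^esub>) \<and>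
        h \<in> ring_hom A C \<and> g \<in> ring_hom B (C Quot I) \<and>
        (\<forall>a\<in>carrier A. g (\<phi> a) = I +>\<^bsub>C\<^esub> h a) \<longrightarrow>
        (\<exists>g'\<in>ring_hom B C. (\<forall>a\<in>carrier A. g' (\<phi> a) = h a) \<and>
           (\<forall>b\<in>carrier B. I +>\<^bsub>C\<^esub> g' b = g b)))"

text \<open>Smooth means locally of finite presentation and formally smooth; the first condition is
  automatic for morphisms of varieties.\<close>

definition smooth :: "('p, 'r, 'k::field) kmor \<Rightarrow> bool" where
  "smooth f \<longleftrightarrow> f \<in> ars Var \<and>
     (\<forall>y\<in>pts (src f). \<exists>V U. y \<in> V \<and> affine_open (src f) V \<and> affine_open (tgt f) U \<and>
        V \<subseteq> preim f U \<and>
        formally_smooth (sec_ring (tgt f) U) (sec_ring (src f) V) (pullsec f V))"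

text \<open>Morphisms of varieties are separated and of finite type, and universal closedness may be
  tested on base changes along morphisms of varieties.\<close>

definition proper :: "('p, 'r, 'k::field) kmor \<Rightarrow> bool" where
  "proper f \<longleftrightarrow> f \<in> ars Var \<and>
     (\<forall>p a b. is_pullback Var p f a b \<longrightarrow> closed_map (ktop (src a)) (ktop (tgt a)) (bas a))"

definition coord_line :: "('p, 'r, 'k::field) kspace \<Rightarrow> ('p \<Rightarrow> 'r) \<Rightarrow> bool" where
  "coord_line A T \<longleftrightarrow> kvariety A \<and> affine A \<and> T \<in> secs A (pts A) \<and>
     bij_betw (\<lambda>c :: 'k poly. \<lambda>x\<in>pts A.
         \<Oplus>\<^bsub>stalk A x\<^esub>i\<in>{..degree c}. scal A x (coeff c i) \<otimes>\<^bsub>stalk A x\<^esub> (T x [^]\<^bsub>stalk A x\<^esub> i))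
       UNIV (secs A (pts A))"


section \<open>Diagrams of varieties\<close>

text \<open>The index categories are the small categories with countably many objects and arrows,
  realized on fixed types that contain the index category of the nearby cycles functor.\<close>

type_synonym iob = "nat \<times> nat"
type_synonym iar = "iob \<times> iob \<times> nat list"
type_synonym icat = "(iob, iar) cat"

record ('p, 'r, 'k) diag =
  idx :: icat
  dob :: "iob \<Rightarrow> ('p, 'r, 'k) kspace"
  dar :: "iar \<Rightarrow> ('p, 'r, 'k) kmor"

definition is_diag :: "('p, 'r, 'k::field) diag \<Rightarrow> bool" where
  "is_diag F \<longleftrightarrow> category (idx F) \<and> is_functor (idx F) Var (dob F) (dar F)"

record ('p, 'r, 'k) dmor =
  dsrc :: "('p, 'r, 'k) diag"
  dtgt :: "('p, 'r, 'k) diag"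
  ixO :: "iob \<Rightarrow> iob"
  ixA :: "iar \<Rightarrow> iar"
  comp_at :: "iob \<Rightarrow> ('p, 'r, 'k) kmor"

definition is_dmor :: "('p, 'r, 'k::field) dmor \<Rightarrow> bool" where
  "is_dmor f \<longleftrightarrow> is_diag (dsrc f) \<and> is_diag (dtgt f) \<and>
     (let G = dsrc f; F = dtgt f; J = idx G in
       ixO f \<in> extensional (obs J) \<and> ixA f \<in> extensional (ars J) \<and>
       comp_at f \<in> extensional (obs J) \<and>
       is_functor J (idx F) (ixO f) (ixA f) \<and>
       (\<forall>j\<in>obs J. comp_at f j \<in> homs Var (dob G j) (dob F (ixO f j))) \<and>
       (\<forall>a\<in>ars J. comp_at f (cd J a) \<cdot>\<^bsub>Var\<^esub> dar G a = dar F (ixA f a) \<cdot>\<^bsub>Var\<^esub> comp_at f (dm J a)))"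

definition DiaVar :: "(('p, 'r, 'k::field) diag, ('p, 'r, 'k) dmor) cat" where
  "DiaVar = \<lparr>obs = {F. is_diag F}, ars = {f. is_dmor f}, dm = dsrc, cd = dtgt,
     idn = (\<lambda>F. \<lparr>dsrc = F, dtgt = F, ixO = (\<lambda>i\<in>obs (idx F). i), ixA = (\<lambda>a\<in>ars (idx F). a),
                  comp_at = (\<lambda>i\<in>obs (idx F). kid (dob F i))\<rparr>),
     cmp = (\<lambda>g f. \<lparr>dsrc = dsrc f, dtgt = dtgt g,
                  ixO = (\<lambda>j\<in>obs (idx (dsrc f)). ixO g (ixO f j)),
                  ixA = (\<lambda>a\<in>ars (idx (dsrc f)). ixA g (ixA f a)),
                  comp_at = (\<lambda>j\<in>obs (idx (dsrc f)). comp_at g (ixO f j) \<cdot>\<^bsub>Var\<^esub> comp_at f j)\<rparr>)\<rparr>"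

definition term_cat :: icat where
  "term_cat = \<lparr>obs = {(0, 1)}, ars = {((0, 1), (0, 1), [0])},
     dm = fst, cd = fst \<circ> snd, idn = (\<lambda>_. ((0, 1), (0, 1), [0])), cmp = (\<lambda>g f. f)\<rparr>"

definition cdiag :: "icat \<Rightarrow> ('p, 'r, 'k) kspace \<Rightarrow> ('p, 'r, 'k) diag" where
  "cdiag I X = \<lparr>idx = I, dob = (\<lambda>_. X), dar = (\<lambda>_. kid X)\<rparr>"

definition cmor :: "icat \<Rightarrow> ('p, 'r, 'k) kmor \<Rightarrow> ('p, 'r, 'k) dmor" where
  "cmor I g = \<lparr>dsrc = cdiag I (src g), dtgt = cdiag I (tgt g),
     ixO = (\<lambda>i\<in>obs I. i), ixA = (\<lambda>a\<in>ars I. a), comp_at = (\<lambda>i\<in>obs I. g)\<rparr>"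

definition rdiag :: "('p, 'r, 'k) diag \<Rightarrow> icat \<Rightarrow> (iob \<Rightarrow> iob) \<Rightarrow> (iar \<Rightarrow> iar) \<Rightarrow> ('p, 'r, 'k) diag" where
  "rdiag F J \<alpha> \<alpha>' = \<lparr>idx = J, dob = (\<lambda>j. dob F (\<alpha> j)), dar = (\<lambda>a. dar F (\<alpha>' a))\<rparr>"

text \<open>For a functor \<open>\<alpha>\<close> from \<open>J\<close> to the index category of \<open>F\<close>
  (with action \<open>\<alpha>'\<close> on arrows), the morphism from \<open>F \<circ> \<alpha>\<close> to \<open>F\<close> it induces, and the
  restriction along \<open>\<alpha>\<close> of a morphism of diagrams over the identity of the index category.\<close>

definition reindex ::
  "('p, 'r, 'k) diag \<Rightarrow> icat \<Rightarrow> (iob \<Rightarrow> iob) \<Rightarrow> (iar \<Rightarrow> iar) \<Rightarrow> ('p, 'r, 'k) dmor" where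
  "reindex F J \<alpha> \<alpha>' = \<lparr>dsrc = rdiag F J \<alpha> \<alpha>', dtgt = F, ixO = restrict \<alpha> (obs J),
     ixA = restrict \<alpha>' (ars J), comp_at = (\<lambda>j\<in>obs J. kid (dob F (\<alpha> j)))\<rparr>"

definition restr_mor ::
  "('p, 'r, 'k) dmor \<Rightarrow> icat \<Rightarrow> (iob \<Rightarrow> iob) \<Rightarrow> (iar \<Rightarrow> iar) \<Rightarrow> ('p, 'r, 'k) dmor" where
  "restr_mor f J \<alpha> \<alpha>' = \<lparr>dsrc = rdiag (dsrc f) J \<alpha> \<alpha>', dtgt = rdiag (dtgt f) J \<alpha> \<alpha>',
     ixO = (\<lambda>j\<in>obs J. j), ixA = (\<lambda>a\<in>ars J. a), comp_at = (\<lambda>j\<in>obs J. comp_at f (\<alpha> j))\<rparr>"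

definition proj :: "icat \<Rightarrow> ('p, 'r, 'k) kspace \<Rightarrow> ('p, 'r, 'k) dmor" where
  "proj I X = reindex (cdiag term_cat X) I (\<lambda>_. (0, 1)) (\<lambda>_. ((0, 1), (0, 1), [0]))"

definition point :: "('p, 'r, 'k) diag \<Rightarrow> iob \<Rightarrow> ('p, 'r, 'k) dmor" where
  "point F i = reindex F term_cat (\<lambda>_. i) (\<lambda>_. idn (idx F) i)"

definition over_id :: "('p, 'r, 'k::field) dmor \<Rightarrow> bool" where
  "over_id f \<longleftrightarrow> f \<in> ars DiaVar \<and> idx (dsrc f) = idx (dtgt f) \<and>
     ixO f = (\<lambda>i\<in>obs (idx (dsrc f)). i) \<and> ixA f = (\<lambda>a\<in>ars (idx (dsrc f)). a)"

definition argwise :: "(('p, 'r, 'k) kmor \<Rightarrow> bool) \<Rightarrow> ('p, 'r, 'k) dmor \<Rightarrow> bool" where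
  "argwise P f \<longleftrightarrow> (\<forall>j\<in>obs (idx (dsrc f)). P (comp_at f j))"

definition cartesian_mor :: "('p, 'r, 'k::field) dmor \<Rightarrow> bool" where
  "cartesian_mor f \<longleftrightarrow> over_id f \<and> (\<forall>a\<in>ars (idx (dsrc f)).
     is_pullback Var (dar (dtgt f) a) (comp_at f (cd (idx (dsrc f)) a))
                     (comp_at f (dm (idx (dsrc f)) a)) (dar (dsrc f) a))"

definition argwise_pullback ::
  "('p, 'r, 'k::field) dmor \<Rightarrow> ('p, 'r, 'k) dmor \<Rightarrow> ('p, 'r, 'k) dmor \<Rightarrow> ('p, 'r, 'k) dmor \<Rightarrow> bool" where
  "argwise_pullback p q a b \<longleftrightarrow> over_id p \<and> over_id q \<and> over_id a \<and> over_id b \<and>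
     dtgt p = dtgt q \<and> dsrc a = dsrc b \<and> dtgt a = dsrc p \<and> dtgt b = dsrc q \<and>
     (\<forall>i\<in>obs (idx (dsrc a)). is_pullback Var (comp_at p i) (comp_at q i) (comp_at a i) (comp_at b i))"

text \<open>A 2-cell \<open>t\<close> from \<open>(f, \<alpha>)\<close> to \<open>(g, \<beta>)\<close> is a natural transformation from
  \<open>\<alpha>\<close> to \<open>\<beta>\<close> compatible with \<open>f\<close> and \<open>g\<close>.\<close>

definition is_cell ::
  "('p, 'r, 'k::field) dmor \<Rightarrow> ('p, 'r, 'k) dmor \<Rightarrow> (iob \<Rightarrow> iar) \<Rightarrow> bool" where
  "is_cell f g t \<longleftrightarrow> f \<in> ars DiaVar \<and> g \<in> ars DiaVar \<and> dsrc f = dsrc g \<and> dtgt f = dtgt g \<and>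
     (let J = idx (dsrc f); F = dtgt f; I = idx F in
       t \<in> extensional (obs J) \<and>
       (\<forall>j\<in>obs J. t j \<in> homs I (ixO f j) (ixO g j) \<and>
          dar F (t j) \<cdot>\<^bsub>Var\<^esub> comp_at f j = comp_at g j) \<and>
       (\<forall>a\<in>ars J. t (cd J a) \<cdot>\<^bsub>I\<^esub> ixA f a = ixA g a \<cdot>\<^bsub>I\<^esub> t (dm J a)))"


section \<open>Stable homotopical algebraic derivators\<close>

text \<open>
  For a diagram \<open>F\<close>, \<open>tc D F\<close> is the triangulated category attached to it.  For a
  morphism of diagrams there are the functors \<open>ls\<close> (inverse image), \<open>us\<close> (direct image, right
  adjoint of \<open>ls\<close>) and \<open>sh\<close> (left adjoint of \<open>ls\<close>, meaningful if the morphism is smooth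
  argument by argument), with units and counits \<open>us_un\<close>, \<open>us_co\<close>, \<open>sh_un\<close>, \<open>sh_co\<close>.
  \<open>cc D p a A\<close> is the structural isomorphism from \<open>a\<^sup>* p\<^sup>* A\<close> to
  \<open>(p a)\<^sup>* A\<close>, \<open>cu D F A\<close> the one from \<open>A\<close> to \<open>id\<^sup>* A\<close>, and
  \<open>cell D f g t A\<close> the morphism from \<open>g\<^sup>* A\<close> to \<open>f\<^sup>* A\<close> attached to a
  2-cell from \<open>f\<close> to \<open>g\<close>.
\<close>

record ('p, 'r, 'k, 'o, 'm) deriv =
  tc :: "('p, 'r, 'k) diag \<Rightarrow> ('o, 'm) tcat"
  ls :: "('p, 'r, 'k) dmor \<Rightarrow> ('o, 'm) ftr"
  cc :: "('p, 'r, 'k) dmor \<Rightarrow> ('p, 'r, 'k) dmor \<Rightarrow> 'o \<Rightarrow> 'm"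
  cu :: "('p, 'r, 'k) diag \<Rightarrow> 'o \<Rightarrow> 'm"
  cell :: "('p, 'r, 'k) dmor \<Rightarrow> ('p, 'r, 'k) dmor \<Rightarrow> (iob \<Rightarrow> iar) \<Rightarrow> 'o \<Rightarrow> 'm"
  us :: "('p, 'r, 'k) dmor \<Rightarrow> ('o, 'm) ftr"
  us_un :: "('p, 'r, 'k) dmor \<Rightarrow> 'o \<Rightarrow> 'm"
  us_co :: "('p, 'r, 'k) dmor \<Rightarrow> 'o \<Rightarrow> 'm"
  sh :: "('p, 'r, 'k) dmor \<Rightarrow> ('o, 'm) ftr"
  sh_un :: "('p, 'r, 'k) dmor \<Rightarrow> 'o \<Rightarrow> 'm"
  sh_co :: "('p, 'r, 'k) dmor \<Rightarrow> 'o \<Rightarrow> 'm"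

definition SH :: "('p, 'r, 'k, 'o, 'm) deriv \<Rightarrow> ('p, 'r, 'k) kspace \<Rightarrow> ('o, 'm) tcat" where
  "SH D X = tc D (cdiag term_cat X)"

abbreviation vmor :: "('p, 'r, 'k) kmor \<Rightarrow> ('p, 'r, 'k) dmor"  (\<open>\<langle>_\<rangle>\<close>) where
  "\<langle>g\<rangle> \<equiv> cmor term_cat g"

text \<open>Exchange morphisms of a commutative square \<open>p a = q b\<close>:
  \<open>ex_ls\<close> from \<open>a\<^sup>* p\<^sup>*\<close> to \<open>b\<^sup>* q\<^sup>*\<close>,
  \<open>ex_us\<close> from \<open>p\<^sup>* q\<^sub>*\<close> to \<open>a\<^sub>* b\<^sup>*\<close>,
  \<open>ex_sh\<close> from \<open>b\<^sub># a\<^sup>*\<close> to \<open>q\<^sup>* p\<^sub>#\<close>,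
  \<open>ex_usus\<close> from \<open>p\<^sub>* a\<^sub>*\<close> to \<open>q\<^sub>* b\<^sub>*\<close>, and
  \<open>ex_shus\<close> from \<open>p\<^sub># a\<^sub>*\<close> to \<open>q\<^sub>* b\<^sub>#\<close>,
  the last one if \<open>ex_us\<close> is invertible.\<close>

definition ex_ls ::
  "('p, 'r, 'k::field, 'o, 'm) deriv \<Rightarrow> ('p, 'r, 'k) dmor \<Rightarrow> ('p, 'r, 'k) dmor
    \<Rightarrow> ('p, 'r, 'k) dmor \<Rightarrow> ('p, 'r, 'k) dmor \<Rightarrow> 'o \<Rightarrow> 'm" where
  "ex_ls D p q a b A =
     (let C = tc D (dsrc a) in inver C (cc D q b A) \<cdot>\<^bsub>C\<^esub> cc D p a A)"

definition ex_us ::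
  "('p, 'r, 'k::field, 'o, 'm) deriv \<Rightarrow> ('p, 'r, 'k) dmor \<Rightarrow> ('p, 'r, 'k) dmor
    \<Rightarrow> ('p, 'r, 'k) dmor \<Rightarrow> ('p, 'r, 'k) dmor \<Rightarrow> 'o \<Rightarrow> 'm" where
  "ex_us D p q a b B =
     (let W = tc D (dsrc a); U = tc D (dtgt a); M = onO (us D q) B in
        onA (us D a) (onA (ls D b) (us_co D q B) \<cdot>\<^bsub>W\<^esub> ex_ls D p q a b M)
        \<cdot>\<^bsub>U\<^esub> us_un D a (onO (ls D p) M))"

definition ex_sh ::
  "('p, 'r, 'k::field, 'o, 'm) deriv \<Rightarrow> ('p, 'r, 'k) dmor \<Rightarrow> ('p, 'r, 'k) dmor
    \<Rightarrow> ('p, 'r, 'k) dmor \<Rightarrow> ('p, 'r, 'k) dmor \<Rightarrow> 'o \<Rightarrow> 'm" where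
  "ex_sh D p q a b B =
     (let W = tc D (dsrc a); V = tc D (dtgt b); M = onO (sh D p) B in
        sh_co D b (onO (ls D q) M)
        \<cdot>\<^bsub>V\<^esub> onA (sh D b) (ex_ls D p q a b M \<cdot>\<^bsub>W\<^esub> onA (ls D a) (sh_un D p B)))"

definition ex_usus ::
  "('p, 'r, 'k::field, 'o, 'm) deriv \<Rightarrow> ('p, 'r, 'k) dmor \<Rightarrow> ('p, 'r, 'k) dmor
    \<Rightarrow> ('p, 'r, 'k) dmor \<Rightarrow> ('p, 'r, 'k) dmor \<Rightarrow> 'o \<Rightarrow> 'm" where
  "ex_usus D p q a b B =
     (let W = tc D (dsrc a); V = tc D (dtgt b); X = tc D (dtgt p);
          N = onO (us D a) B; M = onO (us D p) N in
        onA (us D q)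
          (onA (us D b) (us_co D a B \<cdot>\<^bsub>W\<^esub> onA (ls D a) (us_co D p N) \<cdot>\<^bsub>W\<^esub> ex_ls D q p b a M)
           \<cdot>\<^bsub>V\<^esub> us_un D b (onO (ls D q) M))
        \<cdot>\<^bsub>X\<^esub> us_un D q M)"

definition ex_shus ::
  "('p, 'r, 'k::field, 'o, 'm) deriv \<Rightarrow> ('p, 'r, 'k) dmor \<Rightarrow> ('p, 'r, 'k) dmor
    \<Rightarrow> ('p, 'r, 'k) dmor \<Rightarrow> ('p, 'r, 'k) dmor \<Rightarrow> 'o \<Rightarrow> 'm" where
  "ex_shus D p q a b B =
     (let U = tc D (dtgt a); X = tc D (dtgt p); M = onO (sh D b) B in
        sh_co D p (onO (us D q) M)
        \<cdot>\<^bsub>X\<^esub> onA (sh D p) (inver U (ex_us D p q a b M) \<cdot>\<^bsub>U\<^esub> onA (us D a) (sh_un D b B)))"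

text \<open>The pseudofunctor on the 2-category of diagrams, contravariant in 1-cells and in 2-cells,
  with values in triangulated categories.\<close>

definition pre_derivator :: "('p, 'r, 'k::field, 'o, 'm) deriv \<Rightarrow> bool" where
  "pre_derivator D \<longleftrightarrow>
     (\<forall>F\<in>obs DiaVar. triangulated (tc D F) \<and>
        nat_trans (tc D F) (tc D F) \<lparr>onO = \<lambda>a. a, onA = \<lambda>f. f\<rparr> (ls D (idn DiaVar F)) (cu D F) \<and>
        (\<forall>A\<in>obs (tc D F). is_iso (tc D F) (cu D F A))) \<and>
     (\<forall>f\<in>ars DiaVar. triangulated_functor (tc D (dtgt f)) (tc D (dsrc f)) (ls D f)) \<and>
     (\<forall>p\<in>ars DiaVar. \<forall>a\<in>ars DiaVar. dtgt a = dsrc p \<longrightarrow>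
        nat_trans (tc D (dtgt p)) (tc D (dsrc a)) (ls D a \<odot> ls D p) (ls D (p \<cdot>\<^bsub>DiaVar\<^esub> a)) (cc D p a) \<and>
        (\<forall>A\<in>obs (tc D (dtgt p)). is_iso (tc D (dsrc a)) (cc D p a A))) \<and>
     (\<forall>f\<in>ars DiaVar. \<forall>A\<in>obs (tc D (dtgt f)). let C = tc D (dsrc f) in
        cc D f (idn DiaVar (dsrc f)) A \<cdot>\<^bsub>C\<^esub> cu D (dsrc f) (onO (ls D f) A) = idn C (onO (ls D f) A) \<and>
        cc D (idn DiaVar (dtgt f)) f A \<cdot>\<^bsub>C\<^esub> onA (ls D f) (cu D (dtgt f) A) = idn C (onO (ls D f) A)) \<and>
     (\<forall>p\<in>ars DiaVar. \<forall>a\<in>ars DiaVar. \<forall>x\<in>ars DiaVar. dtgt a = dsrc p \<and> dtgt x = dsrc a \<longrightarrow>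
        (\<forall>A\<in>obs (tc D (dtgt p)). let C = tc D (dsrc x) in
           cc D p (a \<cdot>\<^bsub>DiaVar\<^esub> x) A \<cdot>\<^bsub>C\<^esub> cc D a x (onO (ls D p) A)
           = cc D (p \<cdot>\<^bsub>DiaVar\<^esub> a) x A \<cdot>\<^bsub>C\<^esub> onA (ls D x) (cc D p a A))) \<and>
     (\<forall>f g t. is_cell f g t \<longrightarrow>
        nat_trans (tc D (dtgt f)) (tc D (dsrc f)) (ls D g) (ls D f) (cell D f g t)) \<and>
     (\<forall>f\<in>ars DiaVar. \<forall>A\<in>obs (tc D (dtgt f)).
        cell D f f (\<lambda>j\<in>obs (idx (dsrc f)). idn (idx (dtgt f)) (ixO f j)) A
        = idn (tc D (dsrc f)) (onO (ls D f) A)) \<and>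
     (\<forall>f g h t s. is_cell f g t \<and> is_cell g h s \<longrightarrow> (\<forall>A\<in>obs (tc D (dtgt f)).
        cell D f h (\<lambda>j\<in>obs (idx (dsrc f)). s j \<cdot>\<^bsub>idx (dtgt f)\<^esub> t j) A
        = cell D f g t A \<cdot>\<^bsub>tc D (dsrc f)\<^esub> cell D g h s A)) \<and>
     (\<forall>f g t x. is_cell f g t \<and> x \<in> ars DiaVar \<and> dtgt x = dsrc f \<longrightarrow>
        (\<forall>A\<in>obs (tc D (dtgt f)). let C = tc D (dsrc x) in
           cc D f x A \<cdot>\<^bsub>C\<^esub> onA (ls D x) (cell D f g t A)
           = cell D (f \<cdot>\<^bsub>DiaVar\<^esub> x) (g \<cdot>\<^bsub>DiaVar\<^esub> x) (\<lambda>j\<in>obs (idx (dsrc x)). t (ixO x j)) A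
             \<cdot>\<^bsub>C\<^esub> cc D g x A)) \<and>
     (\<forall>f g t y. is_cell f g t \<and> y \<in> ars DiaVar \<and> dsrc y = dtgt f \<longrightarrow>
        (\<forall>A\<in>obs (tc D (dtgt y)). let C = tc D (dsrc f) in
           cc D y f A \<cdot>\<^bsub>C\<^esub> cell D f g t (onO (ls D y) A)
           = cell D (y \<cdot>\<^bsub>DiaVar\<^esub> f) (y \<cdot>\<^bsub>DiaVar\<^esub> g) (\<lambda>j\<in>obs (idx (dsrc f)). ixA y (t j)) A
             \<cdot>\<^bsub>C\<^esub> cc D y g A))"

definition has_adjoints :: "('p, 'r, 'k::field, 'o, 'm) deriv \<Rightarrow> bool" where
  "has_adjoints D \<longleftrightarrow>
     (\<forall>f\<in>ars DiaVar. triangulated_functor (tc D (dsrc f)) (tc D (dtgt f)) (us D f) \<and>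
        adjunction (tc D (dtgt f)) (tc D (dsrc f)) (ls D f) (us D f) (us_un D f) (us_co D f)) \<and>
     (\<forall>f\<in>ars DiaVar. argwise smooth f \<longrightarrow>
        triangulated_functor (tc D (dsrc f)) (tc D (dtgt f)) (sh D f) \<and>
        adjunction (tc D (dsrc f)) (tc D (dtgt f)) (sh D f) (ls D f) (sh_un D f) (sh_co D f))"

text \<open>\<open>K\<close> with \<open>Q\<close> and \<open>l\<close> is the comma category of the pairs
  \<open>(j, i \<rightarrow> \<alpha> j)\<close>, respectively \<open>(j, \<alpha> j \<rightarrow> i)\<close>.\<close>

definition under_comma ::
  "icat \<Rightarrow> icat \<Rightarrow> (iob \<Rightarrow> iob) \<Rightarrow> (iar \<Rightarrow> iar) \<Rightarrow> iob \<Rightarrow> icat \<Rightarrow> (iob \<Rightarrow> iob) \<Rightarrow> (iar \<Rightarrow> iar)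
    \<Rightarrow> (iob \<Rightarrow> iar) \<Rightarrow> bool" where
  "under_comma J I \<alpha> \<alpha>' i K Q Q' l \<longleftrightarrow> category K \<and> is_functor K J Q Q' \<and> l \<in> extensional (obs K) \<and>
     bij_betw (\<lambda>k. (Q k, l k)) (obs K) {(j, a). j \<in> obs J \<and> a \<in> homs I i (\<alpha> j)} \<and>
     (\<forall>k\<in>obs K. \<forall>k'\<in>obs K.
        bij_betw Q' (homs K k k') {b \<in> homs J (Q k) (Q k'). \<alpha>' b \<cdot>\<^bsub>I\<^esub> l k = l k'})"

definition over_comma ::
  "icat \<Rightarrow> icat \<Rightarrow> (iob \<Rightarrow> iob) \<Rightarrow> (iar \<Rightarrow> iar) \<Rightarrow> iob \<Rightarrow> icat \<Rightarrow> (iob \<Rightarrow> iob) \<Rightarrow> (iar \<Rightarrow> iar)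
    \<Rightarrow> (iob \<Rightarrow> iar) \<Rightarrow> bool" where
  "over_comma J I \<alpha> \<alpha>' i K Q Q' l \<longleftrightarrow> category K \<and> is_functor K J Q Q' \<and> l \<in> extensional (obs K) \<and>
     bij_betw (\<lambda>k. (Q k, l k)) (obs K) {(j, a). j \<in> obs J \<and> a \<in> homs I (\<alpha> j) i} \<and>
     (\<forall>k\<in>obs K. \<forall>k'\<in>obs K.
        bij_betw Q' (homs K k k') {b \<in> homs J (Q k) (Q k'). l k' \<cdot>\<^bsub>I\<^esub> \<alpha>' b = l k})"

text \<open>The axioms of an algebraic derivator: the value on a diagram with discrete index category is
  a product; isomorphisms are detected pointwise; restriction along a functor of index categories
  commutes with direct images, and with left adjoints for smooth cartesian morphisms; smooth
  cartesian inverse images commute with direct images along functors of index categories; and over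
  a fixed variety direct images (left adjoints) along functors of index categories are computed
  pointwise as homotopy limits (colimits) over comma categories.  (An object over a constant
  diagram is contravariant in the index.)\<close>

definition derivator_axioms :: "('p, 'r, 'k::field, 'o, 'm) deriv \<Rightarrow> bool" where
  "derivator_axioms D \<longleftrightarrow>
     (\<forall>F\<in>obs DiaVar. ars (idx F) = idn (idx F) ` obs (idx F) \<longrightarrow>
        (\<forall>A\<in>obs (tc D F). \<forall>B\<in>obs (tc D F). \<forall>h.
           (\<forall>i\<in>obs (idx F). h i \<in> homs (SH D (dob F i)) (onO (ls D (point F i)) A) (onO (ls D (point F i)) B)) \<longrightarrow>
           (\<exists>!m. m \<in> homs (tc D F) A B \<and> (\<forall>i\<in>obs (idx F). onA (ls D (point F i)) m = h i))) \<and>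
        (\<forall>B. (\<forall>i\<in>obs (idx F). B i \<in> obs (SH D (dob F i))) \<longrightarrow>
           (\<exists>A\<in>obs (tc D F). \<forall>i\<in>obs (idx F).
              \<exists>e\<in>homs (SH D (dob F i)) (onO (ls D (point F i)) A) (B i). is_iso (SH D (dob F i)) e))) \<and>
     (\<forall>F\<in>obs DiaVar. \<forall>m\<in>ars (tc D F).
        (\<forall>i\<in>obs (idx F). is_iso (SH D (dob F i)) (onA (ls D (point F i)) m)) \<longrightarrow> is_iso (tc D F) m) \<and>
     (\<forall>f J \<alpha> \<alpha>'. over_id f \<and> category J \<and> is_functor J (idx (dtgt f)) \<alpha> \<alpha>' \<longrightarrow>
        (\<forall>B\<in>obs (tc D (dsrc f)). is_iso (tc D (rdiag (dtgt f) J \<alpha> \<alpha>'))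
           (ex_us D (reindex (dtgt f) J \<alpha> \<alpha>') f (restr_mor f J \<alpha> \<alpha>') (reindex (dsrc f) J \<alpha> \<alpha>') B))) \<and>
     (\<forall>f J \<alpha> \<alpha>'. cartesian_mor f \<and> argwise smooth f \<and> category J \<and> is_functor J (idx (dtgt f)) \<alpha> \<alpha>' \<longrightarrow>
        (\<forall>B\<in>obs (tc D (dsrc f)). is_iso (tc D (rdiag (dtgt f) J \<alpha> \<alpha>'))
           (ex_sh D f (reindex (dtgt f) J \<alpha> \<alpha>') (reindex (dsrc f) J \<alpha> \<alpha>') (restr_mor f J \<alpha> \<alpha>') B)) \<and>
        (\<forall>B\<in>obs (tc D (rdiag (dtgt f) J \<alpha> \<alpha>')). is_iso (tc D (dsrc f))
           (ex_us D f (reindex (dtgt f) J \<alpha> \<alpha>') (reindex (dsrc f) J \<alpha> \<alpha>') (restr_mor f J \<alpha> \<alpha>') B))) \<and>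
     (\<forall>X\<in>obs Var. \<forall>J I \<alpha> \<alpha>' i K Q Q' l.
        category J \<and> category I \<and> is_functor J I \<alpha> \<alpha>' \<and> i \<in> obs I \<and> under_comma J I \<alpha> \<alpha>' i K Q Q' l \<longrightarrow>
        (\<forall>B\<in>obs (tc D (cdiag J X)).
           let r = reindex (cdiag I X) J \<alpha> \<alpha>'; w = reindex (cdiag J X) K Q Q';
               n = point (cdiag I X) i; p = proj K X; C = tc D (cdiag K X); M = onO (sh D r) B
           in is_iso (SH D X)
                (sh_co D p (onO (ls D n) M) \<cdot>\<^bsub>SH D X\<^esub>
                 onA (sh D p) (inver C (cc D n p M)
                    \<cdot>\<^bsub>C\<^esub> cell D (n \<cdot>\<^bsub>DiaVar\<^esub> p) (r \<cdot>\<^bsub>DiaVar\<^esub> w) l M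
                    \<cdot>\<^bsub>C\<^esub> cc D r w M \<cdot>\<^bsub>C\<^esub> onA (ls D w) (sh_un D r B))))) \<and>
     (\<forall>X\<in>obs Var. \<forall>J I \<alpha> \<alpha>' i K Q Q' l.
        category J \<and> category I \<and> is_functor J I \<alpha> \<alpha>' \<and> i \<in> obs I \<and> over_comma J I \<alpha> \<alpha>' i K Q Q' l \<longrightarrow>
        (\<forall>B\<in>obs (tc D (cdiag J X)).
           let r = reindex (cdiag I X) J \<alpha> \<alpha>'; w = reindex (cdiag J X) K Q Q';
               n = point (cdiag I X) i; p = proj K X; C = tc D (cdiag K X); M = onO (us D r) B
           in is_iso (SH D X)
                (onA (us D p) (onA (ls D w) (us_co D r B) \<cdot>\<^bsub>C\<^esub> inver C (cc D r w M)
                    \<cdot>\<^bsub>C\<^esub> cell D (r \<cdot>\<^bsub>DiaVar\<^esub> w) (n \<cdot>\<^bsub>DiaVar\<^esub> p) l M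
                    \<cdot>\<^bsub>C\<^esub> cc D n p M)
                 \<cdot>\<^bsub>SH D X\<^esub> us_un D p (onO (ls D n) M))))"

text \<open>The axioms of a stable homotopical 2-functor: triviality on the empty scheme, smooth base
  change (stated for diagrams), localization, homotopy invariance and stability.\<close>

definition homotopical_axioms :: "('p, 'r, 'k::field, 'o, 'm) deriv \<Rightarrow> bool" where
  "homotopical_axioms D \<longleftrightarrow>
     (\<forall>X\<in>obs Var. pts X = {} \<longrightarrow> (\<forall>A\<in>obs (SH D X). zero_ob (SH D X) A)) \<and>
     (\<forall>p q a b. argwise_pullback p q a b \<and> argwise smooth p \<longrightarrow>
        (\<forall>B\<in>obs (tc D (dsrc q)). is_iso (tc D (dsrc p)) (ex_us D p q a b B))) \<and>
     (\<forall>i\<in>ars Var. closed_immersion i \<longrightarrow>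
        (\<forall>B\<in>obs (SH D (src i)). is_iso (SH D (src i)) (us_co D \<langle>i\<rangle> B))) \<and>
     (\<forall>i\<in>ars Var. \<forall>j\<in>ars Var. closed_immersion i \<and> open_immersion j \<and> tgt i = tgt j \<and>
        bas i ` pts (src i) = pts (tgt i) - bas j ` pts (src j) \<longrightarrow>
        (\<forall>m\<in>ars (SH D (tgt i)). is_iso (SH D (src i)) (onA (ls D \<langle>i\<rangle>) m) \<and>
           is_iso (SH D (src j)) (onA (ls D \<langle>j\<rangle>) m) \<longrightarrow> is_iso (SH D (tgt i)) m)) \<and>
     (\<forall>X\<in>obs Var. \<forall>A T P q s. coord_line A T \<and>
        is_product Var {0, 1} P q (\<lambda>n. if n = 0 then X else A) \<longrightarrow>
        (\<forall>B\<in>obs (SH D X). is_iso (SH D X) (us_un D \<langle>q 0\<rangle> B)) \<and>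
        (s \<in> homs Var X P \<and> q 0 \<cdot>\<^bsub>Var\<^esub> s = kid X \<and>
         pullsec (q 1 \<cdot>\<^bsub>Var\<^esub> s) (pts X) T = (\<lambda>x\<in>pts X. \<zero>\<^bsub>stalk X x\<^esub>) \<longrightarrow>
         equivalence (SH D X) (SH D X) (onO (sh D \<langle>q 0\<rangle> \<odot> us D \<langle>s\<rangle>)) (onA (sh D \<langle>q 0\<rangle> \<odot> us D \<langle>s\<rangle>))))"

text \<open>Properties of direct images along proper morphisms, which belong to the formalism of the
  six operations: proper base change (for diagrams), and compatibility with homotopy
  colimits.\<close>

definition proper_axioms :: "('p, 'r, 'k::field, 'o, 'm) deriv \<Rightarrow> bool" where
  "proper_axioms D \<longleftrightarrow>
     (\<forall>p q a b. argwise_pullback p q a b \<and> argwise proper q \<longrightarrow>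
        (\<forall>B\<in>obs (tc D (dsrc q)). is_iso (tc D (dsrc p)) (ex_us D p q a b B))) \<and>
     (\<forall>g I. proper g \<and> category I \<longrightarrow> (\<forall>B\<in>obs (tc D (cdiag I (src g))).
        is_iso (SH D (tgt g)) (ex_shus D (proj I (tgt g)) \<langle>g\<rangle> (cmor I g) (proj I (src g)) B)))"

text \<open>Of the axioms on derivators over a fixed variety, those comparing coherent with incoherent
  diagrams indexed by an arrow or a square are not imposed.\<close>

definition stable_homotopical_derivator :: "('p, 'r, 'k::field, 'o, 'm) deriv \<Rightarrow> bool" where
  "stable_homotopical_derivator D \<longleftrightarrow> pre_derivator D \<and> has_adjoints D \<and> derivator_axioms D \<and>
     homotopical_axioms D \<and> proper_axioms D"


section \<open>Nearby cycles\<close>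

text \<open>The category \<open>\<Delta> \<times> \<nat>\<^sup>\<times>\<close>.  The object \<open>(n, r)\<close> stands for the ordinal
  \<open>{0, \<dots>, n}\<close> and the positive integer \<open>r\<close>; an arrow is a nondecreasing map, given
  as the list of its values, together with the relation that the second integer divides the
  first.\<close>

definition DeltaN :: icat where
  "DeltaN = \<lparr>obs = {(n, r). r > 0},
     ars = {((m, r), (n, s), \<phi>) | m r n s \<phi>. r > 0 \<and> s > 0 \<and> s dvd r \<and>
              length \<phi> = Suc m \<and> sorted \<phi> \<and> (\<forall>i\<in>set \<phi>. i \<le> n)},
     dm = fst, cd = fst \<circ> snd, idn = (\<lambda>(n, r). ((n, r), (n, r), [0..<Suc n])),
     cmp = (\<lambda>(_, z, \<psi>) (x, _, \<phi>). (x, z, map (\<lambda>i. \<psi> ! i) \<phi>))\<rparr>"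

text \<open>The action of \<open>\<phi> : {0, \<dots>, m} \<rightarrow> {0, \<dots>, n}\<close> on coordinates, from
  \<open>(x\<^sub>0, \<dots>, x\<^sub>m)\<close> to \<open>(y\<^sub>0, \<dots>, y\<^sub>n)\<close>: with the convention
  \<open>x\<^bsub>m+1\<^esub> = 1\<close>, the coordinate \<open>y\<^sub>j\<close> is \<open>x\<^sub>i\<close> for the least \<open>i\<close> with
  \<open>\<phi> i \<ge> j\<close>, and \<open>i = m + 1\<close> if there is none.  The \<open>i\<close>-th coface thus repeats
  \<open>x\<^sub>i\<close>, the last one appends 1, and the \<open>i\<close>-th codegeneracy forgets the coordinate
  with index \<open>i + 1\<close>.\<close>

definition coord_src :: "nat list \<Rightarrow> nat \<Rightarrow> nat" where
  "coord_src \<phi> j = (LEAST i. length \<phi> \<le> i \<or> j \<le> \<phi> ! i)"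

record ('p, 'r, 'k) base =
  A1 :: "('p, 'r, 'k) kspace"
  Tc :: "'p \<Rightarrow> 'r"
  Gm :: "('p, 'r, 'k) kspace"
  jm :: "('p, 'r, 'k) kmor"
  zsec :: "('p, 'r, 'k) kmor"
  RR :: "('p, 'r, 'k) diag"
  th :: "iob \<Rightarrow> ('p, 'r, 'k) kmor"
  pr :: "iob \<Rightarrow> nat \<Rightarrow> ('p, 'r, 'k) kmor"

definition coord :: "('p, 'r, 'k) base \<Rightarrow> ('p, 'r, 'k) kmor \<Rightarrow> 'p \<Rightarrow> 'r" where
  "coord S h = pullsec (kcomp (jm S) h) (pts (src h)) (Tc S)"

text \<open>The affine line with its coordinate, the open immersion of the multiplicative group, the
  zero section of the affine line, and the diagram \<open>(\<R>, \<Delta> \<times> \<nat>\<^sup>\<times>)\<close> with its structural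
  morphism \<open>th\<close>.  The object \<open>\<R>(n, r)\<close> is a product of \<open>n + 1\<close> copies of the
  multiplicative group, with projections \<open>pr (n, r) 0, \<dots>, pr (n, r) n\<close>.  A morphism to
  the multiplicative group is determined by its coordinate, an invertible function, and composing
  it with the power map \<open>e\<^sub>r\<close> raises the coordinate to the power \<open>r\<close>.\<close>

definition base_data :: "('p, 'r, 'k::field) base \<Rightarrow> bool" where
  "base_data S \<longleftrightarrow>
     coord_line (A1 S) (Tc S) \<and>
     jm S \<in> homs Var (Gm S) (A1 S) \<and> open_immersion (jm S) \<and>
     bas (jm S) ` pts (Gm S) = {x \<in> pts (A1 S). Tc S x \<in> Units (stalk (A1 S) x)} \<and>
     zsec S \<in> ars Var \<and> tgt (zsec S) = A1 S \<and>
     (\<exists>x. pts (src (zsec S)) = {x} \<and>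
        bij_betw (scal (src (zsec S)) x) UNIV (carrier (stalk (src (zsec S)) x)) \<and>
        shf (zsec S) x (Tc S (bas (zsec S) x)) = \<zero>\<^bsub>stalk (src (zsec S)) x\<^esub>) \<and>
     RR S \<in> obs DiaVar \<and> idx (RR S) = DeltaN \<and>
     (\<forall>(n, r)\<in>obs DeltaN. let P = dob (RR S) (n, r) in
        is_product Var {..n} P (pr S (n, r)) (\<lambda>_. Gm S) \<and>
        th S (n, r) \<in> homs Var P (Gm S) \<and>
        coord S (th S (n, r)) = (\<lambda>x\<in>pts P. coord S (pr S (n, r) 0) x [^]\<^bsub>stalk P x\<^esub> r)) \<and>
     (\<forall>((m, r), (n, s), \<phi>)\<in>ars DeltaN. \<forall>j\<le>n.
        let P = dob (RR S) (m, r); i = coord_src \<phi> j in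
        coord S (pr S (n, s) j \<cdot>\<^bsub>Var\<^esub> dar (RR S) ((m, r), (n, s), \<phi>)) =
          (\<lambda>x\<in>pts P. if i \<le> m then coord S (pr S (m, r) i) x [^]\<^bsub>stalk P x\<^esub> (r div s)
                      else \<one>\<^bsub>stalk P x\<^esub>))"

text \<open>The choices of fibre products involved in the nearby cycles functor of \<open>f\<close>:
  \<open>jj\<close> and \<open>ii\<close> are the immersions of the generic part and of the special fibre,
  \<open>fe\<close> and \<open>fs\<close> the restrictions of \<open>f\<close> to them, \<open>th_f\<close> is the morphism
  of diagrams from \<open>\<R>\<^sub>X\<close> to the constant diagram \<open>X\<^sub>\<eta>\<close>, and \<open>rp\<close> the
  projection from \<open>\<R>\<^sub>X\<close> to \<open>\<R>\<close>.\<close>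

record ('p, 'r, 'k) fibres =
  jj :: "('p, 'r, 'k) kmor"
  ii :: "('p, 'r, 'k) kmor"
  fe :: "('p, 'r, 'k) kmor"
  fs :: "('p, 'r, 'k) kmor"
  th_f :: "('p, 'r, 'k) dmor"
  rp :: "('p, 'r, 'k) dmor"

abbreviation eta :: "('p, 'r, 'k) fibres \<Rightarrow> ('p, 'r, 'k) kspace" where
  "eta N \<equiv> src (jj N)"

abbreviation sig :: "('p, 'r, 'k) fibres \<Rightarrow> ('p, 'r, 'k) kspace" where
  "sig N \<equiv> src (ii N)"

definition fibre_data ::
  "('p, 'r, 'k::field) base \<Rightarrow> ('p, 'r, 'k) kmor \<Rightarrow> ('p, 'r, 'k) fibres \<Rightarrow> bool" where
  "fibre_data S f N \<longleftrightarrow>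
     is_pullback Var f (jm S) (jj N) (fe N) \<and>
     is_pullback Var f (zsec S) (ii N) (fs N) \<and>
     over_id (th_f N) \<and> dtgt (th_f N) = cdiag DeltaN (eta N) \<and>
     over_id (rp N) \<and> dtgt (rp N) = RR S \<and> dsrc (rp N) = dsrc (th_f N) \<and>
     (\<forall>i\<in>obs DeltaN. is_pullback Var (fe N) (th S i) (comp_at (th_f N) i) (comp_at (rp N) i))"

definition jth :: "('p, 'r, 'k::field) fibres \<Rightarrow> ('p, 'r, 'k) dmor" where
  "jth N = cmor DeltaN (jj N) \<cdot>\<^bsub>DiaVar\<^esub> th_f N"

definition Psi ::
  "('p, 'r, 'k::field, 'o, 'm) deriv \<Rightarrow> ('p, 'r, 'k) fibres \<Rightarrow> ('o, 'm) ftr" where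
  "Psi D N = sh D (proj DeltaN (sig N)) \<odot> ls D (cmor DeltaN (ii N)) \<odot> us D (jth N) \<odot>
             ls D (th_f N) \<odot> ls D (proj DeltaN (eta N))"

text \<open>Base changes of \<open>g : Y \<rightarrow> X\<close>, where \<open>N\<close> belongs to \<open>f\<close> on \<open>X\<close>
  and \<open>N'\<close> to \<open>f \<circ> g\<close> on \<open>Y\<close>.\<close>

definition g_eta ::
  "('p, 'r, 'k::field) fibres \<Rightarrow> ('p, 'r, 'k) fibres \<Rightarrow> ('p, 'r, 'k) kmor \<Rightarrow> ('p, 'r, 'k) kmor" where
  "g_eta N N' g = pb_lift Var (jj N) (fe N) (g \<cdot>\<^bsub>Var\<^esub> jj N') (fe N')"

definition g_sig ::
  "('p, 'r, 'k::field) fibres \<Rightarrow> ('p, 'r, 'k) fibres \<Rightarrow> ('p, 'r, 'k) kmor \<Rightarrow> ('p, 'r, 'k) kmor" where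
  "g_sig N N' g = pb_lift Var (ii N) (fs N) (g \<cdot>\<^bsub>Var\<^esub> ii N') (fs N')"

definition g_R ::
  "('p, 'r, 'k::field) fibres \<Rightarrow> ('p, 'r, 'k) fibres \<Rightarrow> ('p, 'r, 'k) kmor \<Rightarrow> ('p, 'r, 'k) dmor" where
  "g_R N N' g = \<lparr>dsrc = dsrc (th_f N'), dtgt = dsrc (th_f N),
     ixO = (\<lambda>i\<in>obs DeltaN. i), ixA = (\<lambda>a\<in>ars DeltaN. a),
     comp_at = (\<lambda>i\<in>obs DeltaN. pb_lift Var (comp_at (th_f N) i) (comp_at (rp N) i)
                  (g_eta N N' g \<cdot>\<^bsub>Var\<^esub> comp_at (th_f N') i) (comp_at (rp N') i))\<rparr>"

text \<open>\<open>nc_alpha D N N' g A\<close> is the component at \<open>A\<close> of the exchange morphism from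
  \<open>g\<^sub>\<sigma>\<^sup>* \<Psi>\<^sub>f\<close> to \<open>\<Psi>\<^bsub>f \<circ> g\<^esub> g\<^sub>\<eta>\<^sup>*\<close>,
  and \<open>nc_beta D N N' g B\<close> the component at \<open>B\<close> of the one from
  \<open>\<Psi>\<^sub>f g\<^bsub>\<eta>*\<^esub>\<close> to \<open>g\<^bsub>\<sigma>*\<^esub> \<Psi>\<^bsub>f \<circ> g\<^esub>\<close>.\<close>

definition nc_alpha ::
  "('p, 'r, 'k::field, 'o, 'm) deriv \<Rightarrow> ('p, 'r, 'k) fibres \<Rightarrow> ('p, 'r, 'k) fibres
    \<Rightarrow> ('p, 'r, 'k) kmor \<Rightarrow> 'o \<Rightarrow> 'm" where
  "nc_alpha D N N' g A =
     (let I = DeltaN; ge = g_eta N N' g; gs = g_sig N N' g; gR = g_R N N' g;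
          C = SH D (sig N'); CI = tc D (cdiag I (sig N')); CX = tc D (cdiag I (tgt (jj N')));
          CR = tc D (dsrc (th_f N'));
          M1 = onO (ls D (proj I (eta N))) A; M2 = onO (ls D (th_f N)) M1;
          M3 = onO (us D (jth N)) M2; M4 = onO (ls D (cmor I (ii N))) M3;
          s1 = inver C (ex_sh D (proj I (sig N)) \<langle>gs\<rangle> (cmor I gs) (proj I (sig N')) M4);
          s2 = ex_ls D (cmor I (ii N)) (cmor I g) (cmor I gs) (cmor I (ii N')) M3;
          s3 = ex_us D (cmor I g) (jth N) (jth N') gR M2;
          s4 = ex_ls D (th_f N) (cmor I ge) gR (th_f N') M1;
          s5 = ex_ls D (proj I (eta N)) \<langle>ge\<rangle> (cmor I ge) (proj I (eta N')) A
      in onA (sh D (proj I (sig N')))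
           (onA (ls D (cmor I (ii N')))
              (onA (us D (jth N')) (onA (ls D (th_f N')) s5 \<cdot>\<^bsub>CR\<^esub> s4) \<cdot>\<^bsub>CX\<^esub> s3)
            \<cdot>\<^bsub>CI\<^esub> s2)
         \<cdot>\<^bsub>C\<^esub> s1)"

definition nc_beta ::
  "('p, 'r, 'k::field, 'o, 'm) deriv \<Rightarrow> ('p, 'r, 'k) fibres \<Rightarrow> ('p, 'r, 'k) fibres
    \<Rightarrow> ('p, 'r, 'k) kmor \<Rightarrow> 'o \<Rightarrow> 'm" where
  "nc_beta D N N' g B =
     (let I = DeltaN; ge = g_eta N N' g; gs = g_sig N N' g; gR = g_R N N' g;
          C = SH D (sig N); CI = tc D (cdiag I (sig N)); CX = tc D (cdiag I (tgt (jj N)));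
          CR = tc D (dsrc (th_f N));
          M1 = onO (ls D (proj I (eta N'))) B; M2 = onO (ls D (th_f N')) M1;
          M3 = onO (us D (jth N')) M2; M4 = onO (ls D (cmor I (ii N'))) M3;
          s1 = ex_us D (proj I (eta N)) \<langle>ge\<rangle> (cmor I ge) (proj I (eta N')) B;
          s2 = ex_us D (th_f N) (cmor I ge) gR (th_f N') M1;
          s3 = ex_usus D (jth N) (cmor I g) gR (jth N') M2;
          s4 = ex_us D (cmor I (ii N)) (cmor I g) (cmor I gs) (cmor I (ii N')) M3;
          s5 = ex_shus D (proj I (sig N)) \<langle>gs\<rangle> (cmor I gs) (proj I (sig N')) M4
      in s5 \<cdot>\<^bsub>C\<^esub> onA (sh D (proj I (sig N)))
           (s4 \<cdot>\<^bsub>CI\<^esub> onA (ls D (cmor I (ii N)))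
              (s3 \<cdot>\<^bsub>CX\<^esub> onA (us D (jth N)) (s2 \<cdot>\<^bsub>CR\<^esub> onA (ls D (th_f N)) s1))))"

text \<open>The component at \<open>B\<close> of the morphism from \<open>u\<^bsub>\<sigma>#\<^esub> \<Psi>\<^bsub>f \<circ> u\<^esub>\<close> to
  \<open>\<Psi>\<^sub>f u\<^bsub>\<eta>#\<^esub>\<close>.\<close>

definition nc_gamma ::
  "('p, 'r, 'k::field, 'o, 'm) deriv \<Rightarrow> ('p, 'r, 'k) fibres \<Rightarrow> ('p, 'r, 'k) fibres
    \<Rightarrow> ('p, 'r, 'k) kmor \<Rightarrow> 'o \<Rightarrow> 'm" where
  "nc_gamma D N N' u B =
     (let ue = \<langle>g_eta N N' u\<rangle>; us' = \<langle>g_sig N N' u\<rangle>; C = SH D (sig N'); E = SH D (sig N);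
          M = onO (sh D ue) B
      in sh_co D us' (onO (Psi D N) M) \<cdot>\<^bsub>E\<^esub>
         onA (sh D us') (inver C (nc_alpha D N N' u M) \<cdot>\<^bsub>C\<^esub> onA (Psi D N') (sh_un D ue B)))"

text \<open>For a compactification \<open>g = v \<circ> u\<close> with \<open>u : Y \<rightarrow> Z\<close> an open immersion
  and \<open>v : Z \<rightarrow> X\<close> proper: the functors \<open>g\<^bsub>\<eta>!\<^esub>\<close> and
  \<open>g\<^bsub>\<sigma>!\<^esub>\<close>, and the component at \<open>B\<close> of \<open>\<mu>\<^sub>g\<close>.  \<open>N\<close>, \<open>NZ\<close>
  and \<open>NY\<close> belong to \<open>X\<close>, \<open>Z\<close> and \<open>Y\<close>.\<close>

definition eta_shriek ::
  "('p, 'r, 'k::field, 'o, 'm) deriv \<Rightarrow> ('p, 'r, 'k) fibres \<Rightarrow> ('p, 'r, 'k) fibres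
    \<Rightarrow> ('p, 'r, 'k) fibres \<Rightarrow> ('p, 'r, 'k) kmor \<Rightarrow> ('p, 'r, 'k) kmor \<Rightarrow> ('o, 'm) ftr" where
  "eta_shriek D N NZ NY v u = us D \<langle>g_eta N NZ v\<rangle> \<odot> sh D \<langle>g_eta NZ NY u\<rangle>"

definition sig_shriek ::
  "('p, 'r, 'k::field, 'o, 'm) deriv \<Rightarrow> ('p, 'r, 'k) fibres \<Rightarrow> ('p, 'r, 'k) fibres
    \<Rightarrow> ('p, 'r, 'k) fibres \<Rightarrow> ('p, 'r, 'k) kmor \<Rightarrow> ('p, 'r, 'k) kmor \<Rightarrow> ('o, 'm) ftr" where
  "sig_shriek D N NZ NY v u = us D \<langle>g_sig N NZ v\<rangle> \<odot> sh D \<langle>g_sig NZ NY u\<rangle>"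

definition nc_mu ::
  "('p, 'r, 'k::field, 'o, 'm) deriv \<Rightarrow> ('p, 'r, 'k) fibres \<Rightarrow> ('p, 'r, 'k) fibres
    \<Rightarrow> ('p, 'r, 'k) fibres \<Rightarrow> ('p, 'r, 'k) kmor \<Rightarrow> ('p, 'r, 'k) kmor \<Rightarrow> 'o \<Rightarrow> 'm" where
  "nc_mu D N NZ NY v u B =
     inver (SH D (sig N)) (nc_beta D N NZ v (onO (sh D \<langle>g_eta NZ NY u\<rangle>) B))
     \<cdot>\<^bsub>SH D (sig N)\<^esub> onA (us D \<langle>g_sig N NZ v\<rangle>) (nc_gamma D NZ NY u B)"

definition nagata ::
  "('p, 'r, 'k::field) kmor \<Rightarrow> ('p, 'r, 'k) kmor \<Rightarrow> ('p, 'r, 'k) kmor \<Rightarrow> bool" where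
  "nagata g v u \<longleftrightarrow> u \<in> ars Var \<and> open_immersion u \<and> proper v \<and>
     tgt u = src v \<and> g = v \<cdot>\<^bsub>Var\<^esub> u"

end

theory Submission
  imports Defs "HOL-Algebra.Ring_Divisibility"
begin

text \<open>Write \<open>g = v u\<close> with \<open>u\<close> an open immersion and \<open>v\<close> proper. Since \<open>\<alpha>\<close> for \<open>u\<close> is invertible and
  \<open>u_\<eta>^* u_\<eta>#\<close> is the identity, the morphism \<open>\<gamma>\<close> for \<open>u\<close> is, up to an isomorphism of its source, the counit
  \<open>u_\<sigma># u_\<sigma>^* \<rightarrow> id\<close> evaluated at \<open>\<Psi> u_\<eta>#\<close>. The cone of the counit of a triangulated adjunction whose left
  adjoint is fully faithful is a triangulated functor: its value at \<open>M\<close> is the universal object under \<open>M\<close>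
  that is killed by the right adjoint. No complement of the open subspace is therefore needed. Applying
  \<open>v_\<sigma>*\<close> to the resulting triangle and replacing its middle term along the isomorphism \<open>\<beta>\<close> for \<open>v\<close> gives
  the triangle on \<open>\<mu>\<close>.

  What has to be checked is that \<open>\<alpha>\<close> for \<open>u\<close> and \<open>\<beta>\<close> for \<open>v\<close> are invertible. Each is a composite of
  exchange morphisms that are mates of those of the derivator, so smooth and proper base change apply. They
  need that open immersions are smooth and stable under the pullbacks of varieties, which are only
  known by their universal property; the main step there is that a basic open subset \<open>D(f)\<close> of an affine
  variety is again affine.\<close>

section \<open>Categories, natural transformations and mates\<close>

text \<open>A cone in a triangulated category is unique only up to non-unique isomorphism, and the
  hypotheses contain no axiom comparing coherent with incoherent arrows from which a cone functor
  could be built. Orthogonality takes its place. If R w = 0, then Hom(L x, w) = 0 by adjunction, and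
  the same holds for the shifts of L x because L commutes with the shift. Applying Hom(_, w) to the
  triangle on L R M -> M then shows that two maps from the cone to such a w are equal as soon as
  they agree on M. Functoriality, additivity and compatibility with the shift thus become equalities
  checked after composition with M -> cone, and exactness becomes a five lemma for Hom(_, w). Full
  faithfulness of L enters where the cone has to be killed by R: the unit is invertible, so a
  triangle identity makes R of the counit invertible. For L = u_sigma# it comes from base change
  along the square of the monomorphism u_sigma with itself.\<close>

lemma homsD:
  assumes "f \<in> homs C a b"
  shows "f \<in> ars C" "dm C f = a" "cd C f = b"
  using assms by (auto simp: homs_def)

context
  fixes C :: "('o, 'm, 'z) cat_scheme"
  assumes C: "category C"
begin

lemma dm_obs: "f \<in> ars C \<Longrightarrow> dm C f \<in> obs C"
  and cd_obs: "f \<in> ars C \<Longrightarrow> cd C f \<in> obs C"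
  using C by (auto simp: category_def)

lemma idn_ars: "a \<in> obs C \<Longrightarrow> idn C a \<in> ars C"
  and dm_idn: "a \<in> obs C \<Longrightarrow> dm C (idn C a) = a"
  and cd_idn: "a \<in> obs C \<Longrightarrow> cd C (idn C a) = a"
  using C by (auto simp: category_def homs_def)

lemma idn_homs: "a \<in> obs C \<Longrightarrow> idn C a \<in> homs C a a"
  using C by (auto simp: category_def)

lemma cmp_ars: "f \<in> ars C \<Longrightarrow> g \<in> ars C \<Longrightarrow> cd C f = dm C g \<Longrightarrow> g \<cdot>\<^bsub>C\<^esub> f \<in> ars C"
  and dm_cmp: "f \<in> ars C \<Longrightarrow> g \<in> ars C \<Longrightarrow> cd C f = dm C g \<Longrightarrow> dm C (g \<cdot>\<^bsub>C\<^esub> f) = dm C f"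
  and cd_cmp: "f \<in> ars C \<Longrightarrow> g \<in> ars C \<Longrightarrow> cd C f = dm C g \<Longrightarrow> cd C (g \<cdot>\<^bsub>C\<^esub> f) = cd C g"
  using C by (auto simp: category_def homs_def)

lemma cmp_homs: "f \<in> homs C a b \<Longrightarrow> g \<in> homs C b c \<Longrightarrow> g \<cdot>\<^bsub>C\<^esub> f \<in> homs C a c"
  by (auto simp: homs_def cmp_ars dm_cmp cd_cmp)

lemma cmp_idn: "f \<in> ars C \<Longrightarrow> dm C f = a \<Longrightarrow> f \<cdot>\<^bsub>C\<^esub> idn C a = f"
  and idn_cmp: "f \<in> ars C \<Longrightarrow> cd C f = b \<Longrightarrow> idn C b \<cdot>\<^bsub>C\<^esub> f = f"
  using C by (auto simp: category_def)

lemma cmp_assoc: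
  "f \<in> ars C \<Longrightarrow> g \<in> ars C \<Longrightarrow> h \<in> ars C \<Longrightarrow> cd C f = dm C g \<Longrightarrow> cd C g = dm C h
    \<Longrightarrow> (h \<cdot>\<^bsub>C\<^esub> g) \<cdot>\<^bsub>C\<^esub> f = h \<cdot>\<^bsub>C\<^esub> (g \<cdot>\<^bsub>C\<^esub> f)"
  using C by (auto simp: category_def)

lemma cmp_assoc_homs:
  "f \<in> homs C a b \<Longrightarrow> g \<in> homs C b c \<Longrightarrow> h \<in> homs C c d \<Longrightarrow> (h \<cdot>\<^bsub>C\<^esub> g) \<cdot>\<^bsub>C\<^esub> f = h \<cdot>\<^bsub>C\<^esub> (g \<cdot>\<^bsub>C\<^esub> f)"
  by (rule cmp_assoc) (auto simp: homs_def)

lemma cmp_extend: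
  "h \<cdot>\<^bsub>C\<^esub> g = k \<Longrightarrow> f \<in> ars C \<Longrightarrow> g \<in> ars C \<Longrightarrow> h \<in> ars C \<Longrightarrow> cd C f = dm C g \<Longrightarrow> cd C g = dm C h
    \<Longrightarrow> h \<cdot>\<^bsub>C\<^esub> (g \<cdot>\<^bsub>C\<^esub> f) = k \<cdot>\<^bsub>C\<^esub> f"
  by (simp add: cmp_assoc[symmetric])

lemma is_isoI:
  "f \<in> homs C a b \<Longrightarrow> g \<in> homs C b a \<Longrightarrow> g \<cdot>\<^bsub>C\<^esub> f = idn C a \<Longrightarrow> f \<cdot>\<^bsub>C\<^esub> g = idn C b \<Longrightarrow> is_iso C f"
  by (auto simp: is_iso_def is_inverse_def homs_def)

text \<open>\<open>inver\<close> is a definite description, so it denotes an inverse only once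
  uniqueness is known: two inverses \<open>g\<close> and \<open>h\<close> of \<open>f\<close> agree
  because h = h f g = g.\<close>

lemma is_inverse_inver:
  assumes "is_iso C f"
  shows "is_inverse C f (inver C f)"
proof -
  obtain g where g: "is_inverse C f g" using assms by (auto simp: is_iso_def)
  have "h = g" if h: "is_inverse C f h" for h
  proof -
    have "h = h \<cdot>\<^bsub>C\<^esub> (f \<cdot>\<^bsub>C\<^esub> g)" using g h by (simp add: is_inverse_def homs_def cmp_idn)
    also have "\<dots> = (h \<cdot>\<^bsub>C\<^esub> f) \<cdot>\<^bsub>C\<^esub> g"
      by (rule cmp_assoc[symmetric]) (use g h in \<open>auto simp: is_inverse_def homs_def\<close>)
    also have "\<dots> = g" using g h by (simp add: is_inverse_def homs_def idn_cmp)
    finally show ?thesis .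
  qed
  with g show ?thesis unfolding inver_def by (rule theI)
qed

lemma
  assumes "is_iso C f"
  shows inver_ars: "inver C f \<in> ars C" and dm_inver: "dm C (inver C f) = cd C f"
    and cd_inver: "cd C (inver C f) = dm C f"
    and inver_cmp: "inver C f \<cdot>\<^bsub>C\<^esub> f = idn C (dm C f)"
    and cmp_inver: "f \<cdot>\<^bsub>C\<^esub> inver C f = idn C (cd C f)"
    and iso_ars: "f \<in> ars C"
  using is_inverse_inver[OF assms] by (auto simp: is_inverse_def homs_def)

lemma inver_homs: "is_iso C f \<Longrightarrow> f \<in> homs C a b \<Longrightarrow> inver C f \<in> homs C b a"
  by (auto simp: homs_def inver_ars dm_inver cd_inver)

lemma is_iso_inver: "is_iso C f \<Longrightarrow> is_iso C (inver C f)"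
  by (rule is_isoI[of _ "cd C f" "dm C f" f])
    (auto simp: homs_def inver_ars dm_inver cd_inver inver_cmp cmp_inver iso_ars)

lemma is_iso_idn: "a \<in> obs C \<Longrightarrow> is_iso C (idn C a)"
  by (rule is_isoI[of _ a a "idn C a"]) (auto simp: idn_homs cmp_idn idn_ars dm_idn)

lemma is_iso_cmp:
  assumes "is_iso C f" "is_iso C g" "cd C f = dm C g"
  shows "is_iso C (g \<cdot>\<^bsub>C\<^esub> f)"
proof -
  note [simp] = assms iso_ars[OF assms(1)] iso_ars[OF assms(2)] inver_ars dm_inver cd_inver
    cmp_ars dm_cmp cd_cmp dm_obs cd_obs
  have "inver C g \<cdot>\<^bsub>C\<^esub> (g \<cdot>\<^bsub>C\<^esub> f) = f"
    using cmp_extend[OF inver_cmp[OF assms(2)]] by (simp add: idn_cmp)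
  moreover have "f \<cdot>\<^bsub>C\<^esub> (inver C f \<cdot>\<^bsub>C\<^esub> inver C g) = inver C g"
    using cmp_extend[OF cmp_inver[OF assms(1)]] by (simp add: idn_cmp)
  ultimately show ?thesis
    by (intro is_isoI[of _ "dm C f" "cd C g" "inver C f \<cdot>\<^bsub>C\<^esub> inver C g"])
      (auto simp: homs_def cmp_assoc inver_cmp cmp_inver)
qed

lemma iso_epi:
  assumes "is_iso C m" "m \<in> homs C a b" "x \<in> homs C b c" "y \<in> homs C b c" "x \<cdot>\<^bsub>C\<^esub> m = y \<cdot>\<^bsub>C\<^esub> m"
  shows "x = y"
proof -
  have "x = (x \<cdot>\<^bsub>C\<^esub> m) \<cdot>\<^bsub>C\<^esub> inver C m" "y = (y \<cdot>\<^bsub>C\<^esub> m) \<cdot>\<^bsub>C\<^esub> inver C m"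
    using assms(1-4) by (auto simp: homs_def cmp_assoc inver_ars dm_inver cd_inver cmp_inver cmp_idn)
  then show ?thesis using assms(5) by simp
qed

lemma iso_mono:
  assumes "is_iso C m" "m \<in> homs C b c" "x \<in> homs C a b" "y \<in> homs C a b" "m \<cdot>\<^bsub>C\<^esub> x = m \<cdot>\<^bsub>C\<^esub> y"
  shows "x = y"
proof -
  have "x = inver C m \<cdot>\<^bsub>C\<^esub> (m \<cdot>\<^bsub>C\<^esub> x)" "y = inver C m \<cdot>\<^bsub>C\<^esub> (m \<cdot>\<^bsub>C\<^esub> y)"
    using assms(1-4)
    by (auto simp: homs_def cmp_assoc[symmetric] inver_ars cd_inver dm_inver inver_cmp idn_cmp)
  then show ?thesis using assms(5) by simp
qed

lemma iso_post_bij: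
  assumes "is_iso C m" "m \<in> homs C b c" "a \<in> obs C"
  shows "bij_betw (\<lambda>x. m \<cdot>\<^bsub>C\<^esub> x) (homs C a b) (homs C a c)"
proof (rule bij_betwI[where g = "\<lambda>x. inver C m \<cdot>\<^bsub>C\<^esub> x"])
  note [simp] = homs_def inver_ars dm_inver cd_inver cmp_ars dm_cmp cd_cmp cmp_assoc[symmetric]
    inver_cmp cmp_inver idn_cmp
  show "(\<lambda>x. m \<cdot>\<^bsub>C\<^esub> x) \<in> homs C a b \<rightarrow> homs C a c" "(\<lambda>x. inver C m \<cdot>\<^bsub>C\<^esub> x) \<in> homs C a c \<rightarrow> homs C a b"
    "\<And>x. x \<in> homs C a b \<Longrightarrow> inver C m \<cdot>\<^bsub>C\<^esub> (m \<cdot>\<^bsub>C\<^esub> x) = x"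
    "\<And>x. x \<in> homs C a c \<Longrightarrow> m \<cdot>\<^bsub>C\<^esub> (inver C m \<cdot>\<^bsub>C\<^esub> x) = x"
    using assms by auto
qed

lemma iso_pre_bij:
  assumes "is_iso C m" "m \<in> homs C a b" "c \<in> obs C"
  shows "bij_betw (\<lambda>x. x \<cdot>\<^bsub>C\<^esub> m) (homs C b c) (homs C a c)"
proof (rule bij_betwI[where g = "\<lambda>x. x \<cdot>\<^bsub>C\<^esub> inver C m"])
  note [simp] = homs_def inver_ars dm_inver cd_inver cmp_ars dm_cmp cd_cmp cmp_assoc
    inver_cmp cmp_inver cmp_idn
  show "(\<lambda>x. x \<cdot>\<^bsub>C\<^esub> m) \<in> homs C b c \<rightarrow> homs C a c" "(\<lambda>x. x \<cdot>\<^bsub>C\<^esub> inver C m) \<in> homs C a c \<rightarrow> homs C b c"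
    "\<And>x. x \<in> homs C b c \<Longrightarrow> (x \<cdot>\<^bsub>C\<^esub> m) \<cdot>\<^bsub>C\<^esub> inver C m = x"
    "\<And>x. x \<in> homs C a c \<Longrightarrow> (x \<cdot>\<^bsub>C\<^esub> inver C m) \<cdot>\<^bsub>C\<^esub> m = x"
    using assms by auto
qed

text \<open>Yoneda: surjectivity at \<open>a\<close> gives a retraction \<open>s\<close>, and
  injectivity at \<open>b\<close> makes it a two-sided inverse. The mates below are shown to be
  invertible by this criterion and its dual, without an inverse ever being written down.\<close>

lemma is_iso_if_pre_bij:
  assumes m: "m \<in> homs C a b" and obs: "a \<in> obs C" "b \<in> obs C"
    and bij: "\<And>c. c \<in> obs C \<Longrightarrow> bij_betw (\<lambda>x. x \<cdot>\<^bsub>C\<^esub> m) (homs C b c) (homs C a c)"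
  shows "is_iso C m"
proof -
  have "idn C a \<in> (\<lambda>x. x \<cdot>\<^bsub>C\<^esub> m) ` homs C b a"
    using bij[OF obs(1)] idn_homs[OF obs(1)] by (simp add: bij_betw_def)
  then obtain s where s: "s \<in> homs C b a" "s \<cdot>\<^bsub>C\<^esub> m = idn C a" by auto
  have "(m \<cdot>\<^bsub>C\<^esub> s) \<cdot>\<^bsub>C\<^esub> m = idn C b \<cdot>\<^bsub>C\<^esub> m"
    using m s by (simp add: homs_def cmp_assoc cmp_idn idn_cmp)
  then have "m \<cdot>\<^bsub>C\<^esub> s = idn C b"
    using bij_betw_imp_inj_on[OF bij[OF obs(2)]] cmp_homs[OF s(1) m] idn_homs[OF obs(2)]
    by (auto dest: inj_onD)
  then show ?thesis using m s by (intro is_isoI)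
qed

lemma is_iso_if_post_bij:
  assumes m: "m \<in> homs C a b" and obs: "a \<in> obs C" "b \<in> obs C"
    and bij: "\<And>c. c \<in> obs C \<Longrightarrow> bij_betw (\<lambda>x. m \<cdot>\<^bsub>C\<^esub> x) (homs C c a) (homs C c b)"
  shows "is_iso C m"
proof -
  have "idn C b \<in> (\<lambda>x. m \<cdot>\<^bsub>C\<^esub> x) ` homs C b a"
    using bij[OF obs(2)] idn_homs[OF obs(2)] by (simp add: bij_betw_def)
  then obtain s where s: "s \<in> homs C b a" "m \<cdot>\<^bsub>C\<^esub> s = idn C b" by auto
  have "m \<cdot>\<^bsub>C\<^esub> (s \<cdot>\<^bsub>C\<^esub> m) = m \<cdot>\<^bsub>C\<^esub> idn C a"
    using m s by (simp add: homs_def cmp_assoc[symmetric] cmp_idn idn_cmp)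
  then have "s \<cdot>\<^bsub>C\<^esub> m = idn C a"
    using bij_betw_imp_inj_on[OF bij[OF obs(1)]] cmp_homs[OF m s(1)] idn_homs[OF obs(1)]
    by (auto dest: inj_onD)
  then show ?thesis using m s by (intro is_isoI)
qed

lemma is_iso_cancel_left:
  assumes "is_iso C (g \<cdot>\<^bsub>C\<^esub> f)" "is_iso C g" "f \<in> homs C a b" "g \<in> homs C b c"
  shows "is_iso C f"
proof -
  have "f = inver C g \<cdot>\<^bsub>C\<^esub> (g \<cdot>\<^bsub>C\<^esub> f)"
    using assms(2-4)
    by (auto simp: homs_def cmp_assoc[symmetric] inver_ars cd_inver dm_inver inver_cmp idn_cmp)
  moreover have "is_iso C (inver C g \<cdot>\<^bsub>C\<^esub> (g \<cdot>\<^bsub>C\<^esub> f))"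
    using assms(2-4) by (intro is_iso_cmp[OF assms(1) is_iso_inver[OF assms(2)]])
      (auto simp: homs_def cd_cmp dm_inver)
  ultimately show ?thesis by (rule ssubst)
qed

lemma is_iso_cancel_right:
  assumes "is_iso C (g \<cdot>\<^bsub>C\<^esub> f)" "is_iso C f" "f \<in> homs C a b" "g \<in> homs C b c"
  shows "is_iso C g"
proof -
  have "g = (g \<cdot>\<^bsub>C\<^esub> f) \<cdot>\<^bsub>C\<^esub> inver C f"
    using assms(2-4)
    by (auto simp: homs_def cmp_assoc inver_ars cd_inver dm_inver cmp_inver cmp_idn)
  moreover have "is_iso C ((g \<cdot>\<^bsub>C\<^esub> f) \<cdot>\<^bsub>C\<^esub> inver C f)"
    using assms(2-4) by (intro is_iso_cmp[OF is_iso_inver[OF assms(2)] assms(1)])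
      (auto simp: homs_def dm_cmp cd_inver)
  ultimately show ?thesis by (rule ssubst)
qed

end

section \<open>Functors, natural transformations and whiskering\<close>

abbreviation ftr_id :: "('o, 'm) ftr" where
  "ftr_id \<equiv> \<lparr>onO = \<lambda>a. a, onA = \<lambda>f. f\<rparr>"

text \<open>Both ends are required to be categories, so that this single hypothesis supplies every
  rule about endpoints, identities and composites.\<close>

definition fctr :: "('o, 'm, 'z) cat_scheme \<Rightarrow> ('o, 'm, 'z2) cat_scheme \<Rightarrow> ('o, 'm) ftr \<Rightarrow> bool" where
  "fctr C D F \<longleftrightarrow> category C \<and> category D \<and> is_functor C D (onO F) (onA F)"

lemma fctrD:
  assumes "fctr C D F"
  shows "category C" "category D"
    "\<And>a. a \<in> obs C \<Longrightarrow> onO F a \<in> obs D" "\<And>a. a \<in> obs C \<Longrightarrow> onA F (idn C a) = idn D (onO F a)"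
    "\<And>f. f \<in> ars C \<Longrightarrow> onA F f \<in> ars D" "\<And>f. f \<in> ars C \<Longrightarrow> dm D (onA F f) = onO F (dm C f)"
    "\<And>f. f \<in> ars C \<Longrightarrow> cd D (onA F f) = onO F (cd C f)"
    "\<And>f g. f \<in> ars C \<Longrightarrow> g \<in> ars C \<Longrightarrow> cd C f = dm C g \<Longrightarrow> onA F (g \<cdot>\<^bsub>C\<^esub> f) = onA F g \<cdot>\<^bsub>D\<^esub> onA F f"
  using assms by (auto simp: fctr_def is_functor_def homs_def)

lemma fctr_homs: "fctr C D F \<Longrightarrow> f \<in> homs C a b \<Longrightarrow> onA F f \<in> homs D (onO F a) (onO F b)"
  by (auto simp: homs_def fctrD)

lemma fctr_iso:
  assumes "fctr C D F" "is_iso C f"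
  shows "is_iso D (onA F f)"
proof -
  note C = fctrD(1)[OF assms(1)] and [simp] = fctrD(3-)[OF assms(1)]
  note [simp] = iso_ars[OF C assms(2)] inver_ars[OF C assms(2)] dm_inver[OF C assms(2)]
    cd_inver[OF C assms(2)] dm_obs[OF C] cd_obs[OF C]
  show ?thesis
  proof (rule is_isoI[OF fctrD(2)[OF assms(1)]])
    show "onA F f \<in> homs D (onO F (dm C f)) (onO F (cd C f))"
      "onA F (inver C f) \<in> homs D (onO F (cd C f)) (onO F (dm C f))"
      by (auto simp: homs_def)
    show "onA F (inver C f) \<cdot>\<^bsub>D\<^esub> onA F f = idn D (onO F (dm C f))"
      using fctrD(8)[OF assms(1), of f "inver C f"] inver_cmp[OF C assms(2)] by simp
    show "onA F f \<cdot>\<^bsub>D\<^esub> onA F (inver C f) = idn D (onO F (cd C f))"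
      using fctrD(8)[OF assms(1), of "inver C f" f] cmp_inver[OF C assms(2)] by simp
  qed
qed

lemma fctr_id: "category C \<Longrightarrow> fctr C C ftr_id"
  by (auto simp: fctr_def is_functor_def homs_def)

lemma ftr_comp_simps[simp]: "onO (G \<odot> F) a = onO G (onO F a)" "onA (G \<odot> F) f = onA G (onA F f)"
  by (simp_all add: ftr_comp_def)

lemma fctr_comp: "fctr C D F \<Longrightarrow> fctr D E G \<Longrightarrow> fctr C E (G \<odot> F)"
  by (auto simp: fctr_def is_functor_def homs_def)

lemma ftr_eta: "\<lparr>onO = onO F, onA = onA F\<rparr> = F"
  by (cases F) simp

lemma ftr_comp_id[simp]: "F \<odot> ftr_id = F" "ftr_id \<odot> F = F"
  by (simp_all add: ftr_comp_def comp_def ftr_eta)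

lemma ftr_comp_assoc: "(H \<odot> G) \<odot> F = H \<odot> (G \<odot> F)"
  by (simp add: ftr_comp_def comp_assoc)

lemma nat_transD:
  assumes "nat_trans C D F G t"
  shows "\<And>a. a \<in> obs C \<Longrightarrow> t a \<in> homs D (onO F a) (onO G a)"
    "\<And>a. a \<in> obs C \<Longrightarrow> t a \<in> ars D" "\<And>a. a \<in> obs C \<Longrightarrow> dm D (t a) = onO F a"
    "\<And>a. a \<in> obs C \<Longrightarrow> cd D (t a) = onO G a"
    "\<And>f. f \<in> ars C \<Longrightarrow> t (cd C f) \<cdot>\<^bsub>D\<^esub> onA F f = onA G f \<cdot>\<^bsub>D\<^esub> t (dm C f)"
  using assms by (auto simp: nat_trans_def homs_def)

lemma nat_trans_natural:
  "nat_trans C D F G t \<Longrightarrow> f \<in> homs C a b \<Longrightarrow> t b \<cdot>\<^bsub>D\<^esub> onA F f = onA G f \<cdot>\<^bsub>D\<^esub> t a"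
  using nat_transD(5)[of C D F G t f] by (simp add: homs_def)

lemma nat_trans_vcomp:
  assumes "fctr C D F" "fctr C D G" "fctr C D H" "nat_trans C D F G s" "nat_trans C D G H t"
  shows "nat_trans C D F H (\<lambda>a. t a \<cdot>\<^bsub>D\<^esub> s a)"
proof -
  note C = fctrD(1)[OF assms(1)] and D = fctrD(2)[OF assms(1)]
  note [simp] = fctrD(3-)[OF assms(1)] fctrD(3-)[OF assms(2)] fctrD(3-)[OF assms(3)]
    nat_transD(2-4)[OF assms(4)] nat_transD(2-4)[OF assms(5)] cmp_ars[OF D] dm_cmp[OF D] cd_cmp[OF D]
    dm_obs[OF C] cd_obs[OF C]
  have "(t (cd C f) \<cdot>\<^bsub>D\<^esub> s (cd C f)) \<cdot>\<^bsub>D\<^esub> onA F f = onA H f \<cdot>\<^bsub>D\<^esub> (t (dm C f) \<cdot>\<^bsub>D\<^esub> s (dm C f))"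
    if f: "f \<in> ars C" for f
  proof -
    have "(t (cd C f) \<cdot>\<^bsub>D\<^esub> s (cd C f)) \<cdot>\<^bsub>D\<^esub> onA F f = t (cd C f) \<cdot>\<^bsub>D\<^esub> (onA G f \<cdot>\<^bsub>D\<^esub> s (dm C f))"
      using f by (simp add: cmp_assoc[OF D] nat_transD(5)[OF assms(4)])
    also have "\<dots> = (onA H f \<cdot>\<^bsub>D\<^esub> t (dm C f)) \<cdot>\<^bsub>D\<^esub> s (dm C f)"
      using f by (simp add: cmp_assoc[OF D, symmetric] nat_transD(5)[OF assms(5)])
    finally show ?thesis using f by (simp add: cmp_assoc[OF D])
  qed
  then show ?thesis by (auto simp: nat_trans_def homs_def)
qed

text \<open>The premises of \<open>nat_trans_vcomp\<close> in the order that suits arguments in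
  which the later transformation is constructed before the earlier one.\<close>

lemma nat_trans_vcomp_after:
  "nat_trans C D G H t \<Longrightarrow> nat_trans C D F G s \<Longrightarrow> fctr C D F \<Longrightarrow> fctr C D G \<Longrightarrow> fctr C D H
    \<Longrightarrow> nat_trans C D F H (\<lambda>a. t a \<cdot>\<^bsub>D\<^esub> s a)"
  by (rule nat_trans_vcomp)

lemma nat_trans_whisker_left:
  assumes "fctr D E H" "fctr C D F" "fctr C D G" "nat_trans C D F G t"
  shows "nat_trans C E (H \<odot> F) (H \<odot> G) (\<lambda>a. onA H (t a))"
proof -
  note C = fctrD(1)[OF assms(2)]
  note [simp] = fctrD(3-)[OF assms(1)] fctrD(3-)[OF assms(2)] fctrD(3-)[OF assms(3)]
    nat_transD(2-4)[OF assms(4)] dm_obs[OF C] cd_obs[OF C]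
  have "onA H (t (cd C f)) \<cdot>\<^bsub>E\<^esub> onA H (onA F f) = onA H (onA G f) \<cdot>\<^bsub>E\<^esub> onA H (t (dm C f))"
    if f: "f \<in> ars C" for f
    using f nat_transD(5)[OF assms(4) f]
      fctrD(8)[OF assms(1), of "onA F f" "t (cd C f)"] fctrD(8)[OF assms(1), of "t (dm C f)" "onA G f"]
    by simp
  then show ?thesis by (auto simp: nat_trans_def homs_def)
qed

lemma nat_trans_whisker_right:
  assumes "fctr B C K" "nat_trans C D F G t"
  shows "nat_trans B D (F \<odot> K) (G \<odot> K) (\<lambda>a. t (onO K a))"
proof -
  note [simp] = fctrD(3-)[OF assms(1)] nat_transD(2-4)[OF assms(2)]
  have "t (onO K (cd B f)) \<cdot>\<^bsub>D\<^esub> onA F (onA K f) = onA G (onA K f) \<cdot>\<^bsub>D\<^esub> t (onO K (dm B f))"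
    if f: "f \<in> ars B" for f
    using f nat_transD(5)[OF assms(2), of "onA K f"] by simp
  then show ?thesis by (auto simp: nat_trans_def homs_def)
qed

lemma nat_trans_inver:
  assumes "fctr C D F" "fctr C D G" "nat_trans C D F G t" "\<And>a. a \<in> obs C \<Longrightarrow> is_iso D (t a)"
  shows "nat_trans C D G F (\<lambda>a. inver D (t a))"
proof -
  note C = fctrD(1)[OF assms(1)] and D = fctrD(2)[OF assms(1)]
  note [simp] = fctrD(3-)[OF assms(1)] fctrD(3-)[OF assms(2)]
    nat_transD(2-4)[OF assms(3)] cmp_ars[OF D] dm_cmp[OF D] cd_cmp[OF D]
    dm_obs[OF C] cd_obs[OF C] assms(4) inver_ars[OF D] dm_inver[OF D] cd_inver[OF D]
  have "inver D (t (cd C f)) \<cdot>\<^bsub>D\<^esub> onA G f = onA F f \<cdot>\<^bsub>D\<^esub> inver D (t (dm C f))" if f: "f \<in> ars C" for f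
  proof -
    let ?s = "inver D (t (cd C f))" and ?s' = "inver D (t (dm C f))"
    have "?s \<cdot>\<^bsub>D\<^esub> onA G f = ?s \<cdot>\<^bsub>D\<^esub> (onA G f \<cdot>\<^bsub>D\<^esub> (t (dm C f) \<cdot>\<^bsub>D\<^esub> ?s'))"
      using f by (simp add: cmp_inver[OF D] cmp_idn[OF D])
    also have "\<dots> = ?s \<cdot>\<^bsub>D\<^esub> ((t (cd C f) \<cdot>\<^bsub>D\<^esub> onA F f) \<cdot>\<^bsub>D\<^esub> ?s')"
      using f nat_transD(5)[OF assms(3) f] by (simp add: cmp_assoc[OF D])
    also have "\<dots> = (?s \<cdot>\<^bsub>D\<^esub> t (cd C f)) \<cdot>\<^bsub>D\<^esub> (onA F f \<cdot>\<^bsub>D\<^esub> ?s')"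
      using f by (simp add: cmp_assoc[OF D])
    also have "\<dots> = onA F f \<cdot>\<^bsub>D\<^esub> ?s'"
      using f by (simp add: inver_cmp[OF D] idn_cmp[OF D])
    finally show ?thesis .
  qed
  then show ?thesis by (auto simp: nat_trans_def homs_def)
qed

subsection \<open>Adjunctions\<close>

definition adj ::
  "('o, 'm, 'z) cat_scheme \<Rightarrow> ('o, 'm, 'z2) cat_scheme \<Rightarrow> ('o, 'm) ftr \<Rightarrow> ('o, 'm) ftr
    \<Rightarrow> ('o \<Rightarrow> 'm) \<Rightarrow> ('o \<Rightarrow> 'm) \<Rightarrow> bool" where
  "adj C D L R un co \<longleftrightarrow> category C \<and> category D \<and> adjunction C D L R un co"

lemma adjD:
  assumes "adj C D L R un co"
  shows "category C" "category D" "fctr C D L" "fctr D C R"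
    "nat_trans C C ftr_id (R \<odot> L) un" "nat_trans D D (L \<odot> R) ftr_id co"
    "\<And>a. a \<in> obs C \<Longrightarrow> co (onO L a) \<cdot>\<^bsub>D\<^esub> onA L (un a) = idn D (onO L a)"
    "\<And>b. b \<in> obs D \<Longrightarrow> onA R (co b) \<cdot>\<^bsub>C\<^esub> un (onO R b) = idn C (onO R b)"
  using assms by (auto simp: adj_def adjunction_def fctr_def)

context
  fixes C :: "('o, 'm, 'z) cat_scheme" and D :: "('o, 'm, 'z2) cat_scheme"
    and L R :: "('o, 'm) ftr" and un co :: "'o \<Rightarrow> 'm"
  assumes a: "adj C D L R un co"
begin

private lemmas C = adjD(1)[OF a] and D = adjD(2)[OF a]

private lemmas simps =
  fctrD(3-)[OF adjD(3)[OF a]] fctrD(3-)[OF adjD(4)[OF a]] nat_transD(2-4)[OF adjD(5)[OF a], simplified]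
  nat_transD(2-4)[OF adjD(6)[OF a], simplified] cmp_ars[OF D] dm_cmp[OF D] cd_cmp[OF D]
  cmp_ars[OF C] dm_cmp[OF C] cd_cmp[OF C] dm_obs[OF C] cd_obs[OF C] dm_obs[OF D] cd_obs[OF D]
  idn_cmp[OF C] idn_cmp[OF D] cmp_idn[OF C] cmp_idn[OF D]

private lemma un_nat: "f \<in> ars C \<Longrightarrow> un (cd C f) \<cdot>\<^bsub>C\<^esub> f = onA R (onA L f) \<cdot>\<^bsub>C\<^esub> un (dm C f)"
  using nat_transD(5)[OF adjD(5)[OF a]] by simp

private lemma co_nat: "f \<in> ars D \<Longrightarrow> co (cd D f) \<cdot>\<^bsub>D\<^esub> onA L (onA R f) = f \<cdot>\<^bsub>D\<^esub> co (dm D f)"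
  using nat_transD(5)[OF adjD(6)[OF a]] by simp

lemma adj_left_right:
  assumes "f \<in> homs D (onO L c) d" "c \<in> obs C"
  shows "co d \<cdot>\<^bsub>D\<^esub> onA L (onA R f \<cdot>\<^bsub>C\<^esub> un c) = f"
proof -
  have "co d \<cdot>\<^bsub>D\<^esub> onA L (onA R f \<cdot>\<^bsub>C\<^esub> un c) = (co d \<cdot>\<^bsub>D\<^esub> onA L (onA R f)) \<cdot>\<^bsub>D\<^esub> onA L (un c)"
    using assms by (auto simp: simps homs_def cmp_assoc[OF D])
  also have "\<dots> = f \<cdot>\<^bsub>D\<^esub> (co (onO L c) \<cdot>\<^bsub>D\<^esub> onA L (un c))"
    using assms co_nat[of f] by (auto simp: simps homs_def cmp_assoc[OF D])
  finally show ?thesis using assms by (auto simp: simps homs_def adjD(7)[OF a])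
qed

lemma adj_right_left:
  assumes "f \<in> homs C c (onO R d)" "d \<in> obs D"
  shows "onA R (co d \<cdot>\<^bsub>D\<^esub> onA L f) \<cdot>\<^bsub>C\<^esub> un c = f"
proof -
  have "onA R (co d \<cdot>\<^bsub>D\<^esub> onA L f) \<cdot>\<^bsub>C\<^esub> un c = onA R (co d) \<cdot>\<^bsub>C\<^esub> (onA R (onA L f) \<cdot>\<^bsub>C\<^esub> un c)"
    using assms by (auto simp: simps homs_def cmp_assoc[OF C])
  also have "\<dots> = (onA R (co d) \<cdot>\<^bsub>C\<^esub> un (onO R d)) \<cdot>\<^bsub>C\<^esub> f"
    using assms un_nat[of f] by (auto simp: simps homs_def cmp_assoc[OF C])
  finally show ?thesis using assms by (auto simp: simps homs_def adjD(8)[OF a])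
qed

lemma adj_bij_right:
  assumes "c \<in> obs C" "d \<in> obs D"
  shows "bij_betw (\<lambda>f. onA R f \<cdot>\<^bsub>C\<^esub> un c) (homs D (onO L c) d) (homs C c (onO R d))"
proof (rule bij_betwI[where g = "\<lambda>f. co d \<cdot>\<^bsub>D\<^esub> onA L f"])
  show "(\<lambda>f. onA R f \<cdot>\<^bsub>C\<^esub> un c) \<in> homs D (onO L c) d \<rightarrow> homs C c (onO R d)"
    "(\<lambda>f. co d \<cdot>\<^bsub>D\<^esub> onA L f) \<in> homs C c (onO R d) \<rightarrow> homs D (onO L c) d"
    using assms by (auto simp: homs_def simps)
qed (use assms in \<open>auto simp: adj_left_right adj_right_left\<close>)

lemma adj_bij_left:
  assumes "c \<in> obs C" "d \<in> obs D"
  shows "bij_betw (\<lambda>f. co d \<cdot>\<^bsub>D\<^esub> onA L f) (homs C c (onO R d)) (homs D (onO L c) d)"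
proof (rule bij_betwI[where g = "\<lambda>f. onA R f \<cdot>\<^bsub>C\<^esub> un c"])
  show "(\<lambda>f. onA R f \<cdot>\<^bsub>C\<^esub> un c) \<in> homs D (onO L c) d \<rightarrow> homs C c (onO R d)"
    "(\<lambda>f. co d \<cdot>\<^bsub>D\<^esub> onA L f) \<in> homs C c (onO R d) \<rightarrow> homs D (onO L c) d"
    using assms by (auto simp: homs_def simps)
qed (use assms in \<open>auto simp: adj_left_right adj_right_left\<close>)

end

text \<open>Both maps express bijectivity on \<open>Hom\<close>-sets: precomposition with the unit corresponds, under
  the two adjunctions, to composition with the counit.\<close>

lemma unit_iso_if_counit_iso:
  assumes LM: "adj C D L M un co" and MR: "adj D C M R un' co'"
    and iso: "\<And>b. b \<in> obs C \<Longrightarrow> is_iso C (co' b)" and b: "b \<in> obs C"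
  shows "is_iso C (un b)"
proof -
  note C = adjD(1)[OF LM] and D = adjD(2)[OF LM]
  note simps = fctrD(3-)[OF adjD(3)[OF LM]] fctrD(3-)[OF adjD(4)[OF LM]]
    nat_transD(2-4)[OF adjD(5)[OF LM], simplified] nat_transD(2-4)[OF adjD(6)[OF LM], simplified]
    fctrD(3-)[OF adjD(3)[OF MR]] fctrD(3-)[OF adjD(4)[OF MR]]
    nat_transD(2-4)[OF adjD(5)[OF MR], simplified] nat_transD(2-4)[OF adjD(6)[OF MR], simplified]
    cmp_ars[OF D] dm_cmp[OF D] cd_cmp[OF D] cmp_ars[OF C] dm_cmp[OF C] cd_cmp[OF C]
    dm_obs[OF C] cd_obs[OF C] dm_obs[OF D] cd_obs[OF D]
  let ?Q = "onO M (onO L b)"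
  show ?thesis
  proof (rule is_iso_if_pre_bij[OF C])
    show "un b \<in> homs C b ?Q" "?Q \<in> obs C" using b by (auto simp: simps homs_def)
    fix c assume c: "c \<in> obs C"
    \<comment> \<open>The route Hom(M L b, c) -> Hom(L b, R c) -> Hom(b, M R c) -> Hom(b, c): two
      adjunctions, then composition with the invertible counit. Its value is precomposition with the
      unit of \<open>b\<close>.\<close>
    let ?h = "\<lambda>f. co' c \<cdot>\<^bsub>C\<^esub> (onA M (onA R f \<cdot>\<^bsub>D\<^esub> un' (onO L b)) \<cdot>\<^bsub>C\<^esub> un b)"
    have "bij_betw ((\<lambda>x. co' c \<cdot>\<^bsub>C\<^esub> x) \<circ> ((\<lambda>f. onA M f \<cdot>\<^bsub>C\<^esub> un b) \<circ> (\<lambda>f. onA R f \<cdot>\<^bsub>D\<^esub> un' (onO L b))))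
        (homs C ?Q c) (homs C b c)"
      using b c
      by (intro bij_betw_trans[OF bij_betw_trans[OF adj_bij_right[OF MR] adj_bij_right[OF LM]]]
          iso_post_bij[OF C]) (auto simp: simps homs_def iso)
    moreover have "co' c \<cdot>\<^bsub>C\<^esub> (onA M (onA R f \<cdot>\<^bsub>D\<^esub> un' (onO L b)) \<cdot>\<^bsub>C\<^esub> un b) = f \<cdot>\<^bsub>C\<^esub> un b"
      if "f \<in> homs C ?Q c" for f
      using that b c adj_left_right[OF MR that]
      by (auto simp: simps homs_def cmp_assoc[OF C, symmetric] simp del: fctrD(8)[OF adjD(3)[OF MR]])
    ultimately show "bij_betw (\<lambda>x. x \<cdot>\<^bsub>C\<^esub> un b) (homs C ?Q c) (homs C b c)"
      by (subst bij_betw_cong[of _ _ ?h]) (auto simp: comp_def)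
  qed (use b in auto)
qed

subsection \<open>Exchange morphisms of a square as mates\<close>

text \<open>The formal content of a commutative square p a = q b: \<open>X\<close> belongs to the
  common target, \<open>U\<close> and \<open>V\<close> to the sources of p and q, \<open>W\<close>
  to the remaining corner, and \<open>e\<close> compares the two composite inverse images. Geometry
  does not enter, so each exchange morphism can be studied as a mate of \<open>e\<close>.\<close>

locale square =
  fixes X U V W :: "('o, 'm, 'z) cat_scheme" and Lp La Lq Lb :: "('o, 'm) ftr" and e :: "'o \<Rightarrow> 'm"
  assumes Lp: "fctr X U Lp" and La: "fctr U W La" and Lq: "fctr X V Lq" and Lb: "fctr V W Lb"
    and e: "nat_trans X W (La \<odot> Lp) (Lb \<odot> Lq) e"
begin

lemmas X = fctrD(1)[OF Lp] and U = fctrD(2)[OF Lp] and V = fctrD(2)[OF Lq] and W = fctrD(2)[OF La]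

lemmas fun_simps = fctrD(3-)[OF Lp] fctrD(3-)[OF La] fctrD(3-)[OF Lq] fctrD(3-)[OF Lb]
  nat_transD(2-4)[OF e, simplified]
  cmp_ars[OF X] dm_cmp[OF X] cd_cmp[OF X] cmp_ars[OF U] dm_cmp[OF U] cd_cmp[OF U]
  cmp_ars[OF V] dm_cmp[OF V] cd_cmp[OF V] cmp_ars[OF W] dm_cmp[OF W] cd_cmp[OF W]
  dm_obs[OF X] cd_obs[OF X] dm_obs[OF U] cd_obs[OF U] dm_obs[OF V] cd_obs[OF V]
  dm_obs[OF W] cd_obs[OF W]

lemma e_nat: "f \<in> homs X a b \<Longrightarrow> e b \<cdot>\<^bsub>W\<^esub> onA La (onA Lp f) = onA Lb (onA Lq f) \<cdot>\<^bsub>W\<^esub> e a"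
  using nat_trans_natural[OF e] by simp

text \<open>This and the next three formulas have the bodies of \<open>ex_us\<close>,
  \<open>ex_sh\<close>, \<open>ex_usus\<close> and \<open>ex_shus\<close>, with the adjoints, units
  and counits as parameters, so that the exchange morphisms of a derivator become instances.\<close>

definition us_mate where
  "us_mate Rq Ra coq una B = onA Ra (onA Lb (coq B) \<cdot>\<^bsub>W\<^esub> e (onO Rq B)) \<cdot>\<^bsub>U\<^esub> una (onO Lp (onO Rq B))"

definition sh_mate where
  "sh_mate Pp Pb unp cob B =
     cob (onO Lq (onO Pp B)) \<cdot>\<^bsub>V\<^esub> onA Pb (e (onO Pp B) \<cdot>\<^bsub>W\<^esub> onA La (unp B))"

definition usus_mate where
  "usus_mate Rp Ra Rq Rb unp una coq cob B =
     onA Rp (onA Ra (cob B \<cdot>\<^bsub>W\<^esub> onA Lb (coq (onO Rb B)) \<cdot>\<^bsub>W\<^esub> e (onO Rq (onO Rb B)))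
       \<cdot>\<^bsub>U\<^esub> una (onO Lp (onO Rq (onO Rb B)))) \<cdot>\<^bsub>X\<^esub> unp (onO Rq (onO Rb B))"

definition shus_mate where
  "shus_mate Rq Ra Pp Pb cop coq una unb B =
     cop (onO Rq (onO Pb B)) \<cdot>\<^bsub>X\<^esub>
       onA Pp (inver U (us_mate Rq Ra coq una (onO Pb B)) \<cdot>\<^bsub>U\<^esub> onA Ra (unb B))"

lemma us_mate_nat:
  assumes q: "adj X V Lq Rq unq coq" and a: "adj U W La Ra una coa"
  shows "nat_trans V U (Lp \<odot> Rq) (Ra \<odot> Lb) (us_mate Rq Ra coq una)"
proof -
  note Rq = adjD(4)[OF q] and Ra = adjD(4)[OF a]
  note fctr = fctr_comp Rq Ra Lp La Lq Lb
  have "nat_trans V W (La \<odot> Lp \<odot> Rq) (Lb \<odot> Lq \<odot> Rq) (\<lambda>B. e (onO Rq B))"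
    using nat_trans_whisker_right[OF Rq e] by (simp add: ftr_comp_assoc)
  moreover have "nat_trans V W (Lb \<odot> Lq \<odot> Rq) Lb (\<lambda>B. onA Lb (coq B))"
    using nat_trans_whisker_left[OF Lb fctr_comp[OF Rq Lq] fctr_id[OF V] adjD(6)[OF q]] by simp
  ultimately have "nat_trans V W (La \<odot> Lp \<odot> Rq) Lb (\<lambda>B. onA Lb (coq B) \<cdot>\<^bsub>W\<^esub> e (onO Rq B))"
    by (rule nat_trans_vcomp[rotated 3]) (rule fctr)+
  then have 1: "nat_trans V U (Ra \<odot> La \<odot> Lp \<odot> Rq) (Ra \<odot> Lb)
      (\<lambda>B. onA Ra (onA Lb (coq B) \<cdot>\<^bsub>W\<^esub> e (onO Rq B)))"
    by (rule nat_trans_whisker_left[rotated 3]) (rule fctr)+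
  have "nat_trans V U (Lp \<odot> Rq) (Ra \<odot> La \<odot> Lp \<odot> Rq) (\<lambda>B. una (onO Lp (onO Rq B)))"
    using nat_trans_whisker_right[OF fctr_comp[OF Rq Lp] adjD(5)[OF a]]
    by (simp add: ftr_comp_assoc)
  from this 1 show ?thesis
    unfolding us_mate_def by (rule nat_trans_vcomp[rotated 3]) (rule fctr)+
qed

lemma sh_mate_nat:
  assumes p: "adj U X Pp Lp unp cop" and b: "adj W V Pb Lb unb cob"
  shows "nat_trans U V (Pb \<odot> La) (Lq \<odot> Pp) (sh_mate Pp Pb unp cob)"
proof -
  note Pp = adjD(3)[OF p] and Pb = adjD(3)[OF b]
  note fctr = fctr_comp Pp Pb Lp La Lq Lb
  have "nat_trans U W La (La \<odot> Lp \<odot> Pp) (\<lambda>B. onA La (unp B))"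
    using nat_trans_whisker_left[OF La fctr_id[OF U] fctr_comp[OF Pp Lp] adjD(5)[OF p]] by simp
  moreover have "nat_trans U W (La \<odot> Lp \<odot> Pp) (Lb \<odot> Lq \<odot> Pp) (\<lambda>B. e (onO Pp B))"
    using nat_trans_whisker_right[OF Pp e] by (simp add: ftr_comp_assoc)
  ultimately have "nat_trans U W La (Lb \<odot> Lq \<odot> Pp) (\<lambda>B. e (onO Pp B) \<cdot>\<^bsub>W\<^esub> onA La (unp B))"
    by (rule nat_trans_vcomp[rotated 3]) (rule fctr)+
  then have 1: "nat_trans U V (Pb \<odot> La) (Pb \<odot> Lb \<odot> Lq \<odot> Pp)
      (\<lambda>B. onA Pb (e (onO Pp B) \<cdot>\<^bsub>W\<^esub> onA La (unp B)))"
    by (rule nat_trans_whisker_left[rotated 3]) (rule fctr)+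
  have "nat_trans U V (Pb \<odot> Lb \<odot> Lq \<odot> Pp) (Lq \<odot> Pp) (\<lambda>B. cob (onO Lq (onO Pp B)))"
    using nat_trans_whisker_right[OF fctr_comp[OF Pp Lq] adjD(6)[OF b]]
    by (simp add: ftr_comp_assoc)
  from 1 this show ?thesis
    unfolding sh_mate_def by (rule nat_trans_vcomp[rotated 3]) (rule fctr)+
qed

lemma usus_mate_nat:
  assumes p: "adj X U Lp Rp unp cop" and a: "adj U W La Ra una coa"
    and q: "adj X V Lq Rq unq coq" and b: "adj V W Lb Rb unb cob"
  shows "nat_trans W X (Rq \<odot> Rb) (Rp \<odot> Ra) (usus_mate Rp Ra Rq Rb unp una coq cob)"
proof -
  note R = adjD(4)[OF p] adjD(4)[OF a] adjD(4)[OF q] adjD(4)[OF b]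
  note fctr = fctr_comp R Lp La Lq Lb fctr_id[OF W]
  let ?M = "Rq \<odot> Rb"
  have "nat_trans W W (La \<odot> Lp \<odot> ?M) (Lb \<odot> Lq \<odot> ?M) (\<lambda>B. e (onO Rq (onO Rb B)))"
    using nat_trans_whisker_right[OF fctr_comp[OF R(4,3)] e] by (simp add: ftr_comp_assoc)
  moreover have "nat_trans W W (Lb \<odot> Lq \<odot> ?M) ftr_id (\<lambda>B. cob B \<cdot>\<^bsub>W\<^esub> onA Lb (coq (onO Rb B)))"
  proof (rule nat_trans_vcomp[rotated 3])
    have "nat_trans W V (Lq \<odot> ?M) Rb (\<lambda>B. coq (onO Rb B))"
      using nat_trans_whisker_right[OF R(4) adjD(6)[OF q]] by (simp add: ftr_comp_assoc)
    then show "nat_trans W W (Lb \<odot> Lq \<odot> ?M) (Lb \<odot> Rb) (\<lambda>B. onA Lb (coq (onO Rb B)))"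
      by (rule nat_trans_whisker_left[rotated 3]) (rule fctr)+
    show "nat_trans W W (Lb \<odot> Rb) ftr_id cob" by (rule adjD(6)[OF b])
  qed (rule fctr)+
  ultimately have "nat_trans W W (La \<odot> Lp \<odot> ?M) ftr_id
      (\<lambda>B. cob B \<cdot>\<^bsub>W\<^esub> onA Lb (coq (onO Rb B)) \<cdot>\<^bsub>W\<^esub> e (onO Rq (onO Rb B)))"
    by (rule nat_trans_vcomp[rotated 3]) (rule fctr)+
  then have "nat_trans W U (Ra \<odot> La \<odot> Lp \<odot> ?M) (Ra \<odot> ftr_id)
      (\<lambda>B. onA Ra (cob B \<cdot>\<^bsub>W\<^esub> onA Lb (coq (onO Rb B)) \<cdot>\<^bsub>W\<^esub> e (onO Rq (onO Rb B))))"
    by (rule nat_trans_whisker_left[rotated 3]) (rule fctr)+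
  then have "nat_trans W U (Ra \<odot> La \<odot> Lp \<odot> ?M) Ra
      (\<lambda>B. onA Ra (cob B \<cdot>\<^bsub>W\<^esub> onA Lb (coq (onO Rb B)) \<cdot>\<^bsub>W\<^esub> e (onO Rq (onO Rb B))))"
    by simp
  moreover have "nat_trans W U (Lp \<odot> ?M) (Ra \<odot> La \<odot> Lp \<odot> ?M) (\<lambda>B. una (onO Lp (onO Rq (onO Rb B))))"
    using nat_trans_whisker_right[OF fctr_comp[OF fctr_comp[OF R(4,3)] Lp] adjD(5)[OF a]]
    by (simp add: ftr_comp_assoc)
  ultimately have "nat_trans W U (Lp \<odot> ?M) Ra
      (\<lambda>B. onA Ra (cob B \<cdot>\<^bsub>W\<^esub> onA Lb (coq (onO Rb B)) \<cdot>\<^bsub>W\<^esub> e (onO Rq (onO Rb B)))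
        \<cdot>\<^bsub>U\<^esub> una (onO Lp (onO Rq (onO Rb B))))"
    by (rule nat_trans_vcomp_after) (rule fctr)+
  then have "nat_trans W X (Rp \<odot> Lp \<odot> ?M) (Rp \<odot> Ra)
      (\<lambda>B. onA Rp (onA Ra (cob B \<cdot>\<^bsub>W\<^esub> onA Lb (coq (onO Rb B)) \<cdot>\<^bsub>W\<^esub> e (onO Rq (onO Rb B)))
        \<cdot>\<^bsub>U\<^esub> una (onO Lp (onO Rq (onO Rb B)))))"
    by (rule nat_trans_whisker_left[rotated 3]) (rule fctr)+
  moreover have "nat_trans W X ?M (Rp \<odot> Lp \<odot> ?M) (\<lambda>B. unp (onO Rq (onO Rb B)))"
    using nat_trans_whisker_right[OF fctr_comp[OF R(4,3)] adjD(5)[OF p]]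
    by (simp add: ftr_comp_assoc)
  ultimately show ?thesis unfolding usus_mate_def
    by (rule nat_trans_vcomp_after) (rule fctr)+
qed

text \<open>The two composites of direct images are right adjoint to the two composites of inverse
  images, which \<open>e\<close> identifies. The adjunction bijections and precomposition with
  \<open>e T\<close> give a bijection from Hom(T, Rq Rb B) to Hom(T, Rp Ra B). Naturality of
  \<open>e\<close> and of the units shows that it is composition with the mate.\<close>

lemma usus_mate_iso:
  assumes p: "adj X U Lp Rp unp cop" and a: "adj U W La Ra una coa"
    and q: "adj X V Lq Rq unq coq" and b: "adj V W Lb Rb unb cob"
    and iso: "\<And>A. A \<in> obs X \<Longrightarrow> is_iso W (e A)" and B: "B \<in> obs W"
  shows "is_iso X (usus_mate Rp Ra Rq Rb unp una coq cob B)"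
proof -
  note [simp] = fun_simps fctrD(3-)[OF adjD(4)[OF p]] fctrD(3-)[OF adjD(4)[OF a]]
    fctrD(3-)[OF adjD(4)[OF q]] fctrD(3-)[OF adjD(4)[OF b]]
    nat_transD(2-4)[OF adjD(5)[OF p], simplified] nat_transD(2-4)[OF adjD(5)[OF a], simplified]
    nat_transD(2-4)[OF adjD(6)[OF q], simplified] nat_transD(2-4)[OF adjD(6)[OF b], simplified]
  let ?t = "usus_mate Rp Ra Rq Rb unp una coq cob B"
  let ?N = "onO Rb B"
  let ?M = "onO Rq ?N"
  let ?d = "cob B \<cdot>\<^bsub>W\<^esub> onA Lb (coq ?N)"
  show ?thesis
  proof (rule is_iso_if_post_bij[OF X])
    show "?t \<in> homs X ?M (onO Rp (onO Ra B))"
      using nat_transD(1)[OF usus_mate_nat[OF p a q b] B] by simp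
    fix T assume T: "T \<in> obs X"
    let ?F = "\<lambda>f. onA Rp (onA Ra ((cob B \<cdot>\<^bsub>W\<^esub> onA Lb (coq ?N \<cdot>\<^bsub>V\<^esub> onA Lq f)) \<cdot>\<^bsub>W\<^esub> e T)
        \<cdot>\<^bsub>U\<^esub> una (onO Lp T)) \<cdot>\<^bsub>X\<^esub> unp T"
    have "bij_betw ((\<lambda>f. onA Rp f \<cdot>\<^bsub>X\<^esub> unp T) \<circ> ((\<lambda>f. onA Ra f \<cdot>\<^bsub>U\<^esub> una (onO Lp T)) \<circ>
        ((\<lambda>f. f \<cdot>\<^bsub>W\<^esub> e T) \<circ> ((\<lambda>f. cob B \<cdot>\<^bsub>W\<^esub> onA Lb f) \<circ> (\<lambda>f. coq ?N \<cdot>\<^bsub>V\<^esub> onA Lq f)))))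
        (homs X T ?M) (homs X T (onO Rp (onO Ra B)))"
      using T B
      by (intro bij_betw_trans[OF bij_betw_trans[OF bij_betw_trans[OF
          bij_betw_trans[OF adj_bij_left[OF q] adj_bij_left[OF b]]]
          adj_bij_right[OF a]] adj_bij_right[OF p]] iso_pre_bij[OF W])
        (auto simp: homs_def iso)
    then have F: "bij_betw ?F (homs X T ?M) (homs X T (onO Rp (onO Ra B)))"
      by (simp add: comp_def)
    have "?F f = ?t \<cdot>\<^bsub>X\<^esub> f" if f: "f \<in> homs X T ?M" for f
    proof -
      have [simp]: "f \<in> ars X" "dm X f = T" "cd X f = ?M" using f by (auto simp: homs_def)
      have "(cob B \<cdot>\<^bsub>W\<^esub> onA Lb (coq ?N \<cdot>\<^bsub>V\<^esub> onA Lq f)) \<cdot>\<^bsub>W\<^esub> e T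
          = ?d \<cdot>\<^bsub>W\<^esub> (onA Lb (onA Lq f) \<cdot>\<^bsub>W\<^esub> e T)"
        using T B by (simp add: cmp_assoc[OF W])
      also have "\<dots> = (?d \<cdot>\<^bsub>W\<^esub> e ?M) \<cdot>\<^bsub>W\<^esub> onA La (onA Lp f)"
        using T B e_nat[OF f] by (simp add: cmp_assoc[OF W])
      finally have "onA Ra ((cob B \<cdot>\<^bsub>W\<^esub> onA Lb (coq ?N \<cdot>\<^bsub>V\<^esub> onA Lq f)) \<cdot>\<^bsub>W\<^esub> e T) \<cdot>\<^bsub>U\<^esub> una (onO Lp T)
          = onA Ra (?d \<cdot>\<^bsub>W\<^esub> e ?M) \<cdot>\<^bsub>U\<^esub> (onA Ra (onA La (onA Lp f)) \<cdot>\<^bsub>U\<^esub> una (onO Lp T))"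
        using T B by (simp add: cmp_assoc[OF U] cmp_assoc[OF W])
      also have "\<dots> = (onA Ra (?d \<cdot>\<^bsub>W\<^esub> e ?M) \<cdot>\<^bsub>U\<^esub> una (onO Lp ?M)) \<cdot>\<^bsub>U\<^esub> onA Lp f"
        using T B nat_transD(5)[OF adjD(5)[OF a], of "onA Lp f"]
        by (simp add: cmp_assoc[OF U] cmp_assoc[OF W])
      finally have "?F f = onA Rp (onA Ra (?d \<cdot>\<^bsub>W\<^esub> e ?M) \<cdot>\<^bsub>U\<^esub> una (onO Lp ?M))
          \<cdot>\<^bsub>X\<^esub> (onA Rp (onA Lp f) \<cdot>\<^bsub>X\<^esub> unp T)"
        using T B by (simp add: cmp_assoc[OF X] cmp_assoc[OF U] cmp_assoc[OF W])
      also have "\<dots> = ?t \<cdot>\<^bsub>X\<^esub> f"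
        using T B nat_transD(5)[OF adjD(5)[OF p], of f]
        by (simp add: usus_mate_def cmp_assoc[OF X] cmp_assoc[OF U] cmp_assoc[OF W])
      finally show ?thesis .
    qed
    with F show "bij_betw (\<lambda>x. ?t \<cdot>\<^bsub>X\<^esub> x) (homs X T ?M) (homs X T (onO Rp (onO Ra B)))"
      by (simp cong: bij_betw_cong)
  qed (use B in auto)
qed

lemma shus_mate_nat:
  assumes q: "adj X V Lq Rq unq coq" and a: "adj U W La Ra una coa"
    and p: "adj U X Pp Lp unp cop" and b: "adj W V Pb Lb unb cob"
    and iso: "\<And>B. B \<in> obs V \<Longrightarrow> is_iso U (us_mate Rq Ra coq una B)"
  shows "nat_trans W X (Pp \<odot> Ra) (Rq \<odot> Pb) (shus_mate Rq Ra Pp Pb cop coq una unb)"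
proof -
  note F = adjD(4)[OF q] adjD(4)[OF a] adjD(3)[OF p] adjD(3)[OF b]
  note fctr = fctr_comp F Lp La Lq Lb
  have "nat_trans W U Ra (Ra \<odot> Lb \<odot> Pb) (\<lambda>B. onA Ra (unb B))"
    using nat_trans_whisker_left[OF F(2) fctr_id[OF W] fctr_comp[OF F(4) Lb] adjD(5)[OF b]] by simp
  moreover have "nat_trans W U (Ra \<odot> Lb \<odot> Pb) (Lp \<odot> Rq \<odot> Pb)
      (\<lambda>B. inver U (us_mate Rq Ra coq una (onO Pb B)))"
    using nat_trans_whisker_right[OF F(4) nat_trans_inver[OF fctr_comp[OF F(1) Lp]
      fctr_comp[OF Lb F(2)] us_mate_nat[OF q a] iso]]
    by (simp add: ftr_comp_assoc)
  ultimately have "nat_trans W U Ra (Lp \<odot> Rq \<odot> Pb)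
      (\<lambda>B. inver U (us_mate Rq Ra coq una (onO Pb B)) \<cdot>\<^bsub>U\<^esub> onA Ra (unb B))"
    by (rule nat_trans_vcomp[rotated 3]) (rule fctr)+
  then have 1: "nat_trans W X (Pp \<odot> Ra) (Pp \<odot> Lp \<odot> Rq \<odot> Pb)
      (\<lambda>B. onA Pp (inver U (us_mate Rq Ra coq una (onO Pb B)) \<cdot>\<^bsub>U\<^esub> onA Ra (unb B)))"
    by (rule nat_trans_whisker_left[rotated 3]) (rule fctr)+
  have "nat_trans W X (Pp \<odot> Lp \<odot> Rq \<odot> Pb) (Rq \<odot> Pb) (\<lambda>B. cop (onO Rq (onO Pb B)))"
    using nat_trans_whisker_right[OF fctr_comp[OF F(4,1)] adjD(6)[OF p]]
    by (simp add: ftr_comp_assoc)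
  from 1 this show ?thesis
    unfolding shus_mate_def by (rule nat_trans_vcomp[rotated 3]) (rule fctr)+
qed

text \<open>The two exchange morphisms are conjugate under the composite adjunctions, so that
  precomposition with one corresponds to composition with the other.\<close>

lemma sh_mate_iso:
  assumes q: "adj X V Lq Rq unq coq" and a: "adj U W La Ra una coa"
    and p: "adj U X Pp Lp unp cop" and b: "adj W V Pb Lb unb cob"
    and iso: "\<And>B. B \<in> obs V \<Longrightarrow> is_iso U (us_mate Rq Ra coq una B)" and B: "B \<in> obs U"
  shows "is_iso V (sh_mate Pp Pb unp cob B)"
proof -
  note us = us_mate_nat[OF q a]
  note [simp] = fun_simps fctrD(3-)[OF adjD(3)[OF p]] fctrD(3-)[OF adjD(4)[OF a]]
    fctrD(3-)[OF adjD(4)[OF q]] fctrD(3-)[OF adjD(3)[OF b]]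
    nat_transD(2-4)[OF adjD(5)[OF p], simplified] nat_transD(2-4)[OF adjD(5)[OF a], simplified]
    nat_transD(2-4)[OF adjD(6)[OF q], simplified] nat_transD(2-4)[OF adjD(6)[OF b], simplified]
    nat_transD(2-4)[OF adjD(5)[OF q], simplified] nat_transD(2-4)[OF adjD(6)[OF a], simplified]
    nat_transD(2-4)[OF us, simplified]
  let ?t = "sh_mate Pp Pb unp cob B" and ?u = "us_mate Rq Ra coq una"
  let ?M = "onO Pp B"
  let ?S = "onO Pb (onO La B)"
  show ?thesis
  proof (rule is_iso_if_pre_bij[OF V])
    show "?t \<in> homs V ?S (onO Lq ?M)"
      using nat_transD(1)[OF sh_mate_nat[OF p b] B] by simp
    fix T assume T: "T \<in> obs V"
    \<comment> \<open>The route from Hom(Lq Pp B, T) to Hom(Pb La B, T): two transposes to the right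
      give \<open>?g\<close>, composition with the invertible mate \<open>?u\<close> follows, and
      two transposes lead back to the left.\<close>
    let ?g = "\<lambda>f. onA Lp (onA Rq f \<cdot>\<^bsub>X\<^esub> unq ?M) \<cdot>\<^bsub>U\<^esub> unp B"
    let ?F = "\<lambda>f. cob T \<cdot>\<^bsub>V\<^esub> onA Pb (coa (onO Lb T) \<cdot>\<^bsub>W\<^esub> onA La (?u T \<cdot>\<^bsub>U\<^esub> ?g f))"
    have "bij_betw ((\<lambda>f. cob T \<cdot>\<^bsub>V\<^esub> onA Pb f) \<circ> ((\<lambda>f. coa (onO Lb T) \<cdot>\<^bsub>W\<^esub> onA La f) \<circ>
        ((\<lambda>f. ?u T \<cdot>\<^bsub>U\<^esub> f) \<circ> ((\<lambda>f. onA Lp f \<cdot>\<^bsub>U\<^esub> unp B) \<circ> (\<lambda>f. onA Rq f \<cdot>\<^bsub>X\<^esub> unq ?M)))))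
        (homs V (onO Lq ?M) T) (homs V ?S T)"
      using T B
      by (intro bij_betw_trans[OF bij_betw_trans[OF bij_betw_trans[OF
          bij_betw_trans[OF adj_bij_right[OF q] adj_bij_right[OF p]]]
          adj_bij_left[OF a]] adj_bij_left[OF b]] iso_post_bij[OF U])
        (auto simp: homs_def iso)
    then have F: "bij_betw ?F (homs V (onO Lq ?M) T) (homs V ?S T)"
      by (simp add: comp_def)
    have "?F f = f \<cdot>\<^bsub>V\<^esub> ?t" if f: "f \<in> homs V (onO Lq ?M) T" for f
    proof -
      have [simp]: "f \<in> ars V" "dm V f = onO Lq ?M" "cd V f = T" using f by (auto simp: homs_def)
      let ?Q = "onO Lq ?M"
      \<comment> \<open>For the universal choice of target, the transpose of the mate applied to the
        unit of q. The triangle identity for q collapses it to \<open>e\<close> itself; this is the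
        point where the two mates are compared.\<close>
      let ?h = "coa (onO Lb ?Q) \<cdot>\<^bsub>W\<^esub> onA La (?u ?Q \<cdot>\<^bsub>U\<^esub> onA Lp (unq ?M))"
      have co: "coa (onO Lb ?Q) \<cdot>\<^bsub>W\<^esub> onA La (?u ?Q) = onA Lb (coq ?Q) \<cdot>\<^bsub>W\<^esub> e (onO Rq ?Q)"
        using B by (subst us_mate_def, subst adj_left_right[OF a]) (auto simp: homs_def)
      have "?h = (coa (onO Lb ?Q) \<cdot>\<^bsub>W\<^esub> onA La (?u ?Q)) \<cdot>\<^bsub>W\<^esub> onA La (onA Lp (unq ?M))"
        using B by (simp add: cmp_assoc[OF W])
      also have "\<dots> = onA Lb (coq ?Q) \<cdot>\<^bsub>W\<^esub> (e (onO Rq ?Q) \<cdot>\<^bsub>W\<^esub> onA La (onA Lp (unq ?M)))"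
        unfolding co using B by (simp add: cmp_assoc[OF W])
      also have "e (onO Rq ?Q) \<cdot>\<^bsub>W\<^esub> onA La (onA Lp (unq ?M)) = onA Lb (onA Lq (unq ?M)) \<cdot>\<^bsub>W\<^esub> e ?M"
        using B by (intro e_nat) (simp add: homs_def)
      also have "onA Lb (coq ?Q) \<cdot>\<^bsub>W\<^esub> (onA Lb (onA Lq (unq ?M)) \<cdot>\<^bsub>W\<^esub> e ?M)
          = onA Lb (coq ?Q \<cdot>\<^bsub>V\<^esub> onA Lq (unq ?M)) \<cdot>\<^bsub>W\<^esub> e ?M"
        using B by (simp add: cmp_assoc[OF W])
      also have "coq ?Q \<cdot>\<^bsub>V\<^esub> onA Lq (unq ?M) = idn V ?Q"
        using B by (simp add: adjD(7)[OF q])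
      finally have h: "?h = e ?M" using B by (simp add: idn_cmp[OF W])
      have "?u T \<cdot>\<^bsub>U\<^esub> ?g f = (?u T \<cdot>\<^bsub>U\<^esub> onA Lp (onA Rq f)) \<cdot>\<^bsub>U\<^esub> (onA Lp (unq ?M) \<cdot>\<^bsub>U\<^esub> unp B)"
        using B T by (simp add: cmp_assoc[OF U])
      also have "\<dots> = onA Ra (onA Lb f) \<cdot>\<^bsub>U\<^esub> ((?u ?Q \<cdot>\<^bsub>U\<^esub> onA Lp (unq ?M)) \<cdot>\<^bsub>U\<^esub> unp B)"
        using B T nat_transD(5)[OF us, of f] by (simp add: cmp_assoc[OF U])
      finally have "coa (onO Lb T) \<cdot>\<^bsub>W\<^esub> onA La (?u T \<cdot>\<^bsub>U\<^esub> ?g f)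
          = (coa (onO Lb T) \<cdot>\<^bsub>W\<^esub> onA La (onA Ra (onA Lb f)))
            \<cdot>\<^bsub>W\<^esub> (onA La (?u ?Q \<cdot>\<^bsub>U\<^esub> onA Lp (unq ?M)) \<cdot>\<^bsub>W\<^esub> onA La (unp B))"
        using B T by (simp add: cmp_assoc[OF W] cmp_assoc[OF U])
      also have "\<dots> = onA Lb f \<cdot>\<^bsub>W\<^esub> (?h \<cdot>\<^bsub>W\<^esub> onA La (unp B))"
        using B T nat_transD(5)[OF adjD(6)[OF a], of "onA Lb f"] by (simp add: cmp_assoc[OF W])
      finally have "?F f = (cob T \<cdot>\<^bsub>V\<^esub> onA Pb (onA Lb f)) \<cdot>\<^bsub>V\<^esub> onA Pb (e ?M \<cdot>\<^bsub>W\<^esub> onA La (unp B))"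
        unfolding h using B T by (simp add: cmp_assoc[OF V])
      also have "\<dots> = f \<cdot>\<^bsub>V\<^esub> ?t"
        using B T nat_transD(5)[OF adjD(6)[OF b], of f] by (simp add: sh_mate_def cmp_assoc[OF V])
      finally show ?thesis .
    qed
    with F show "bij_betw (\<lambda>x. x \<cdot>\<^bsub>V\<^esub> ?t) (homs V (onO Lq ?M) T) (homs V ?S T)"
      by (simp cong: bij_betw_cong)
  qed (use B in auto)
qed

end

section \<open>Triangulated categories\<close>

locale triangulated_cat =
  fixes C :: "('o, 'm, 'z) tcat_scheme"
  assumes triangulated: "triangulated C"
begin

lemma additive: "additive_cat C" and cat: "category C"
  and shift_additive: "additive_functor C C (sho C) (sha C)"
  using triangulated by (auto simp: triangulated_def additive_cat_def)

lemma tri_pre: "(f, g, h) \<in> tri C \<Longrightarrow> pre_triangle C f g h"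
  using triangulated by (auto simp: triangulated_def)

lemma tri_iso:
  assumes "(f, g, h) \<in> tri C" "pre_triangle C f' g' h'"
    "x \<in> homs C (dm C f) (dm C f')" "y \<in> homs C (dm C g) (dm C g')" "z \<in> homs C (dm C h) (dm C h')"
    "is_iso C x" "is_iso C y" "is_iso C z"
    "y \<cdot>\<^bsub>C\<^esub> f = f' \<cdot>\<^bsub>C\<^esub> x" "z \<cdot>\<^bsub>C\<^esub> g = g' \<cdot>\<^bsub>C\<^esub> y" "sha C x \<cdot>\<^bsub>C\<^esub> h = h' \<cdot>\<^bsub>C\<^esub> z"
  shows "(f', g', h') \<in> tri C"
proof -
  have *: "\<forall>f g h f' g' h' x y z. (f, g, h) \<in> tri C \<and> pre_triangle C f' g' h' \<and>
        x \<in> homs C (dm C f) (dm C f') \<and> y \<in> homs C (dm C g) (dm C g') \<and> z \<in> homs C (dm C h) (dm C h') \<and>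
        is_iso C x \<and> is_iso C y \<and> is_iso C z \<and>
        y \<cdot>\<^bsub>C\<^esub> f = f' \<cdot>\<^bsub>C\<^esub> x \<and> z \<cdot>\<^bsub>C\<^esub> g = g' \<cdot>\<^bsub>C\<^esub> y \<and> sha C x \<cdot>\<^bsub>C\<^esub> h = h' \<cdot>\<^bsub>C\<^esub> z
        \<longrightarrow> (f', g', h') \<in> tri C"
    using triangulated unfolding triangulated_def by (elim conjE) assumption
  show ?thesis by (rule *[rule_format, of f g h f' g' h' x y z]) (use assms in auto)
qed

lemma tri_idn:
  assumes "a \<in> obs C" "zero_ob C z"
  shows "(idn C a, hzero C a z, hzero C z (sho C a)) \<in> tri C"
proof -
  have *: "\<forall>a\<in>obs C. \<forall>z. zero_ob C z \<longrightarrow> (idn C a, hzero C a z, hzero C z (sho C a)) \<in> tri C"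
    using triangulated unfolding triangulated_def by (elim conjE) assumption
  show ?thesis using * assms by blast
qed

lemma tri_complete: "f \<in> ars C \<Longrightarrow> \<exists>g h. (f, g, h) \<in> tri C"
  using triangulated unfolding triangulated_def by (elim conjE) blast

lemma tri_rotate:
  assumes "pre_triangle C f g h"
  shows "(f, g, h) \<in> tri C \<longleftrightarrow> (g, h, hneg C (sha C f)) \<in> tri C"
proof -
  have *: "\<forall>f g h. pre_triangle C f g h \<longrightarrow>
        ((f, g, h) \<in> tri C \<longleftrightarrow> (g, h, hneg C (sha C f)) \<in> tri C)"
    using triangulated unfolding triangulated_def by (elim conjE) assumption
  show ?thesis by (rule *[rule_format, OF assms])
qed

lemma tri_map:
  assumes "(f, g, h) \<in> tri C" "(f', g', h') \<in> tri C"
    "x \<in> homs C (dm C f) (dm C f')" "y \<in> homs C (dm C g) (dm C g')" "y \<cdot>\<^bsub>C\<^esub> f = f' \<cdot>\<^bsub>C\<^esub> x"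
  obtains z where "z \<in> homs C (dm C h) (dm C h')" "z \<cdot>\<^bsub>C\<^esub> g = g' \<cdot>\<^bsub>C\<^esub> y" "sha C x \<cdot>\<^bsub>C\<^esub> h = h' \<cdot>\<^bsub>C\<^esub> z"
proof -
  have *: "\<forall>f g h f' g' h' x y. (f, g, h) \<in> tri C \<and> (f', g', h') \<in> tri C \<and>
        x \<in> homs C (dm C f) (dm C f') \<and> y \<in> homs C (dm C g) (dm C g') \<and> y \<cdot>\<^bsub>C\<^esub> f = f' \<cdot>\<^bsub>C\<^esub> x \<longrightarrow>
        (\<exists>z\<in>homs C (dm C h) (dm C h'). z \<cdot>\<^bsub>C\<^esub> g = g' \<cdot>\<^bsub>C\<^esub> y \<and> sha C x \<cdot>\<^bsub>C\<^esub> h = h' \<cdot>\<^bsub>C\<^esub> z)"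
    using triangulated unfolding triangulated_def by (elim conjE) assumption
  show ?thesis using *[rule_format, of f g h f' g' h' x y] assms that by blast
qed

lemma triD:
  assumes "(f, g, h) \<in> tri C"
  shows "f \<in> ars C" "g \<in> ars C" "h \<in> ars C" "dm C g = cd C f" "dm C h = cd C g"
    "cd C h = sho C (dm C f)"
  using tri_pre[OF assms] by (auto simp: pre_triangle_def)

lemma shift_fctr: "fctr C C (shift_ftr C)"
  using shift_additive cat by (auto simp: fctr_def additive_functor_def shift_ftr_def)

lemmas shift_simps = fctrD(3-)[OF shift_fctr, unfolded shift_ftr_def, simplified]

lemma grp: "a \<in> obs C \<Longrightarrow> b \<in> obs C \<Longrightarrow> comm_group (hom_grp C a b)"
  using additive by (auto simp: additive_cat_def)

lemma cmp_hadd: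
  assumes "f \<in> homs C a b" "f' \<in> homs C a b" "g \<in> homs C b c" "a \<in> obs C" "b \<in> obs C" "c \<in> obs C"
  shows "g \<cdot>\<^bsub>C\<^esub> hadd C a b f f' = hadd C a c (g \<cdot>\<^bsub>C\<^esub> f) (g \<cdot>\<^bsub>C\<^esub> f')"
  using additive assms unfolding additive_cat_def by blast

lemma hadd_cmp:
  assumes "f \<in> homs C a b" "g \<in> homs C b c" "g' \<in> homs C b c" "a \<in> obs C" "b \<in> obs C" "c \<in> obs C"
  shows "hadd C b c g g' \<cdot>\<^bsub>C\<^esub> f = hadd C a c (g \<cdot>\<^bsub>C\<^esub> f) (g' \<cdot>\<^bsub>C\<^esub> f)"
  using additive assms unfolding additive_cat_def by blast

lemma homs_obs: "f \<in> homs C a b \<Longrightarrow> a \<in> obs C" "f \<in> homs C a b \<Longrightarrow> b \<in> obs C"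
  using dm_obs[OF cat] cd_obs[OF cat] by (auto simp: homs_def)

lemma hadd_homs: "f \<in> homs C a b \<Longrightarrow> g \<in> homs C a b \<Longrightarrow> hadd C a b f g \<in> homs C a b"
  using monoid.m_closed[OF group.is_monoid[OF comm_group.axioms(2)[OF grp]], of a b f g] homs_obs[of f a b]
  by (simp add: hom_grp_def)

lemma hzero_homs: "a \<in> obs C \<Longrightarrow> b \<in> obs C \<Longrightarrow> hzero C a b \<in> homs C a b"
  using monoid.one_closed[OF group.is_monoid[OF comm_group.axioms(2)[OF grp]], of a b]
  by (simp add: hom_grp_def)

lemma hadd_zero: "f \<in> homs C a b \<Longrightarrow> hadd C a b (hzero C a b) f = f"
    "f \<in> homs C a b \<Longrightarrow> hadd C a b f (hzero C a b) = f"
  using monoid.l_one[OF group.is_monoid[OF comm_group.axioms(2)[OF grp]], of a b f]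
    monoid.r_one[OF group.is_monoid[OF comm_group.axioms(2)[OF grp]], of a b f] homs_obs[of f a b]
  by (simp_all add: hom_grp_def)

lemma hadd_cancel:
  assumes "f \<in> homs C a b" "g \<in> homs C a b" "h \<in> homs C a b" "hadd C a b f h = hadd C a b g h"
  shows "f = g"
  using group.right_cancel[OF comm_group.axioms(2)[OF grp], of a b h f g] homs_obs[of f a b] assms
  by (simp add: hom_grp_def)

lemma hadd_cancel_zero:
  assumes "f \<in> homs C a b" "h \<in> homs C a b" "hadd C a b f h = h"
  shows "f = hzero C a b"
  using assms hadd_cancel[of f a b "hzero C a b" h] homs_obs[of f a b]
  by (simp add: hzero_homs hadd_zero)

text \<open>Subtraction, in the only form in which the diagram chases use it: a difference that can
  be added back.\<close>

lemma hsub_ex: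
  assumes "x \<in> homs C a b" "y \<in> homs C a b"
  obtains d where "d \<in> homs C a b" "x = hadd C a b d y"
proof -
  interpret comm_group "hom_grp C a b" using grp homs_obs[OF assms(1)] by simp
  let ?d = "x \<otimes>\<^bsub>hom_grp C a b\<^esub> inv\<^bsub>hom_grp C a b\<^esub> y"
  have c: "x \<in> carrier (hom_grp C a b)" "y \<in> carrier (hom_grp C a b)"
    using assms by (simp_all add: hom_grp_def)
  then have "?d \<in> carrier (hom_grp C a b)" "?d \<otimes>\<^bsub>hom_grp C a b\<^esub> y = x"
    by (simp_all add: m_assoc)
  then show ?thesis using that[of ?d] by (simp add: hom_grp_def)
qed

lemma hneg_homs: "f \<in> homs C a b \<Longrightarrow> hneg C f \<in> homs C a b"
  and hneg_hadd: "f \<in> homs C a b \<Longrightarrow> hadd C a b (hneg C f) f = hzero C a b"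
proof -
  assume f: "f \<in> homs C a b"
  interpret comm_group "hom_grp C a b" using grp homs_obs[OF f] by simp
  have "f \<in> carrier (hom_grp C a b)" using f by (simp add: hom_grp_def)
  then have "inv\<^bsub>hom_grp C a b\<^esub> f \<in> carrier (hom_grp C a b)"
    "inv\<^bsub>hom_grp C a b\<^esub> f \<otimes>\<^bsub>hom_grp C a b\<^esub> f = \<one>\<^bsub>hom_grp C a b\<^esub>" by simp_all
  then show "hneg C f \<in> homs C a b" "hadd C a b (hneg C f) f = hzero C a b"
    using homsD[OF f] by (simp_all add: hneg_def hom_grp_def)
qed

lemma cmp_hzero:
  assumes "f \<in> homs C b c" "a \<in> obs C"
  shows "f \<cdot>\<^bsub>C\<^esub> hzero C a b = hzero C a c"
proof (rule hadd_cancel_zero)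
  note o = homs_obs[OF assms(1)] hzero_homs[OF assms(2) homs_obs(1)[OF assms(1)]]
  show z: "f \<cdot>\<^bsub>C\<^esub> hzero C a b \<in> homs C a c" by (rule cmp_homs[OF cat o(3) assms(1)])
  show "f \<cdot>\<^bsub>C\<^esub> hzero C a b \<in> homs C a c" by (rule z)
  show "hadd C a c (f \<cdot>\<^bsub>C\<^esub> hzero C a b) (f \<cdot>\<^bsub>C\<^esub> hzero C a b) = f \<cdot>\<^bsub>C\<^esub> hzero C a b"
    using cmp_hadd[OF o(3) o(3) assms(1) assms(2) o(1,2)] by (simp add: hadd_zero[OF o(3)])
qed

lemma hzero_cmp:
  assumes "f \<in> homs C a b" "c \<in> obs C"
  shows "hzero C b c \<cdot>\<^bsub>C\<^esub> f = hzero C a c"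
proof (rule hadd_cancel_zero)
  note o = homs_obs[OF assms(1)] hzero_homs[OF homs_obs(2)[OF assms(1)] assms(2)]
  show z: "hzero C b c \<cdot>\<^bsub>C\<^esub> f \<in> homs C a c" by (rule cmp_homs[OF cat assms(1) o(3)])
  show "hzero C b c \<cdot>\<^bsub>C\<^esub> f \<in> homs C a c" by (rule z)
  show "hadd C a c (hzero C b c \<cdot>\<^bsub>C\<^esub> f) (hzero C b c \<cdot>\<^bsub>C\<^esub> f) = hzero C b c \<cdot>\<^bsub>C\<^esub> f"
    using hadd_cmp[OF assms(1) o(3) o(3) o(1,2) assms(2)] by (simp add: hadd_zero[OF o(3)])
qed

lemma cmp_hneg:
  assumes "f \<in> homs C a b" "g \<in> homs C b c"
  shows "g \<cdot>\<^bsub>C\<^esub> hneg C f = hneg C g \<cdot>\<^bsub>C\<^esub> f"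
proof (rule hadd_cancel)
  note o = homs_obs[OF assms(1)] homs_obs(2)[OF assms(2)]
  note h = hneg_homs[OF assms(1)] hneg_homs[OF assms(2)]
  show "g \<cdot>\<^bsub>C\<^esub> hneg C f \<in> homs C a c" "hneg C g \<cdot>\<^bsub>C\<^esub> f \<in> homs C a c" "g \<cdot>\<^bsub>C\<^esub> f \<in> homs C a c"
    using assms h by (auto intro: cmp_homs[OF cat])
  have "hadd C a c (g \<cdot>\<^bsub>C\<^esub> hneg C f) (g \<cdot>\<^bsub>C\<^esub> f) = hzero C a c"
    using cmp_hadd[OF h(1) assms o, symmetric] assms o
    by (simp add: hneg_hadd[OF assms(1)] cmp_hzero[OF assms(2)])
  moreover have "hadd C a c (hneg C g \<cdot>\<^bsub>C\<^esub> f) (g \<cdot>\<^bsub>C\<^esub> f) = hzero C a c"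
    using hadd_cmp[OF assms(1) h(2) assms(2) o, symmetric] assms o
    by (simp add: hneg_hadd[OF assms(2)] hzero_cmp[OF assms(1)])
  ultimately show "hadd C a c (g \<cdot>\<^bsub>C\<^esub> hneg C f) (g \<cdot>\<^bsub>C\<^esub> f) = hadd C a c (hneg C g \<cdot>\<^bsub>C\<^esub> f) (g \<cdot>\<^bsub>C\<^esub> f)"
    by simp
qed

lemma hneg_hzero: "a \<in> obs C \<Longrightarrow> b \<in> obs C \<Longrightarrow> hneg C (hzero C a b) = hzero C a b"
  using hneg_hadd[OF hzero_homs, of a b] hadd_zero(2)[OF hneg_homs[OF hzero_homs], of a b] by simp

lemma zero_ob_unique:
  assumes "zero_ob C z"
  shows "f \<in> homs C z a \<Longrightarrow> f = hzero C z a" "f \<in> homs C a z \<Longrightarrow> f = hzero C a z"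
proof -
  have z: "z \<in> obs C" "idn C z = hzero C z z" using assms by (auto simp: zero_ob_def)
  show "f = hzero C z a" if f: "f \<in> homs C z a"
    using cmp_idn[OF cat homsD(1,2)[OF f]] cmp_hzero[OF f z(1)] z by simp
  show "f = hzero C a z" if f: "f \<in> homs C a z"
    using idn_cmp[OF cat homsD(1,3)[OF f]] hzero_cmp[OF f z(1)] z by simp
qed

lemma zero_ob_if_unique:
  assumes "z \<in> obs C" "\<And>f g. f \<in> homs C z z \<Longrightarrow> g \<in> homs C z z \<Longrightarrow> f = g"
  shows "zero_ob C z"
  using assms(1) assms(2)[OF idn_homs[OF cat assms(1)] hzero_homs[OF assms(1,1)]]
  by (simp add: zero_ob_def)

lemma zero_ob_iso:
  assumes "zero_ob C z" "e \<in> homs C z w" "is_iso C e"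
  shows "zero_ob C w"
proof (rule zero_ob_if_unique)
  show "w \<in> obs C" using homs_obs[OF assms(2)] by simp
  fix f g assume fg: "f \<in> homs C w w" "g \<in> homs C w w"
  have "f \<cdot>\<^bsub>C\<^esub> e = g \<cdot>\<^bsub>C\<^esub> e"
    using zero_ob_unique(1)[OF assms(1)] cmp_homs[OF cat assms(2) fg(1)] cmp_homs[OF cat assms(2) fg(2)]
    by metis
  then show "f = g" by (rule iso_epi[OF cat assms(3,2) fg])
qed

lemma zero_ob_ex: "\<exists>z. zero_ob C z"
  using additive by (auto simp: additive_cat_def)

lemma additive_hzero:
  fixes D :: "('o2, 'm2, 'z2) tcat_scheme"
  assumes "triangulated D" "additive_functor C D F G" "a \<in> obs C" "b \<in> obs C"
  shows "G (hzero C a b) = hzero D (F a) (F b)"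
proof -
  interpret D: triangulated_cat D by unfold_locales (rule assms(1))
  note z = hzero_homs[OF assms(3,4)]
  have h: "G (hzero C a b) \<in> homs D (F a) (F b)"
    using assms(2) z by (auto simp: additive_functor_def is_functor_def homs_def)
  show ?thesis
  proof (rule D.hadd_cancel_zero[OF h h])
    show "hadd D (F a) (F b) (G (hzero C a b)) (G (hzero C a b)) = G (hzero C a b)"
      using assms(2-4) z hadd_zero[OF z] unfolding additive_functor_def by metis
  qed
qed

lemma shift_hzero: "a \<in> obs C \<Longrightarrow> b \<in> obs C \<Longrightarrow> sha C (hzero C a b) = hzero C (sho C a) (sho C b)"
  by (rule additive_hzero[OF triangulated shift_additive])

lemma zero_ob_shift: "zero_ob C z \<Longrightarrow> zero_ob C (sho C z)"
  using shift_hzero[of z z] shift_simps(1,2)[of z] by (simp add: zero_ob_def)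

text \<open>Map the triangle on the identity of the source of \<open>f\<close> to the given one by
  the identity and \<open>f\<close>. The fill-in factors g f through a zero object.\<close>

lemma tri_consecutive:
  assumes "(f, g, h) \<in> tri C"
  shows "g \<cdot>\<^bsub>C\<^esub> f = hzero C (dm C f) (cd C g)"
proof -
  obtain z where z: "zero_ob C z" using zero_ob_ex by blast
  note t = triD[OF assms]
  have o: "dm C f \<in> obs C" "z \<in> obs C" using t z by (auto simp: dm_obs[OF cat] zero_ob_def)
  note h = homsD[OF hzero_homs[OF o]] homsD[OF hzero_homs[OF o(2) shift_simps(1)[OF o(1)]]]
  obtain w where w: "w \<in> homs C z (dm C h)" "w \<cdot>\<^bsub>C\<^esub> hzero C (dm C f) z = g \<cdot>\<^bsub>C\<^esub> f"
    using tri_map[OF tri_idn[OF o(1) z] assms, of "idn C (dm C f)" f] o t h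
    by (auto simp: homs_def dm_idn[OF cat] cd_idn[OF cat] idn_ars[OF cat])
  then show ?thesis using cmp_hzero[OF w(1) o(1)] t by simp
qed

lemma tri_rotated: "(f, g, h) \<in> tri C \<Longrightarrow> (g, h, hneg C (sha C f)) \<in> tri C"
  using tri_rotate tri_pre by blast

text \<open>Exactness of Hom(_, t) at the second object. The triangle is mapped to 0 -> t -> t,
  which is distinguished because its rotation is the triangle on the identity of \<open>t\<close>;
  the sign of the rotation falls on a zero map.\<close>

lemma tri_weak_cokernel:
  assumes "(f, g, h) \<in> tri C" "x \<in> homs C (cd C f) t" "x \<cdot>\<^bsub>C\<^esub> f = hzero C (dm C f) t"
  obtains y where "y \<in> homs C (cd C g) t" "x = y \<cdot>\<^bsub>C\<^esub> g"
proof -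
  obtain z where z: "zero_ob C z" using zero_ob_ex by blast
  note T = triD[OF assms(1)]
  have o: "z \<in> obs C" "t \<in> obs C" "dm C f \<in> obs C" "sho C z \<in> obs C"
    using T z homs_obs[OF assms(2)] by (auto simp: dm_obs[OF cat] zero_ob_def shift_simps)
  note h = homsD[OF hzero_homs[OF o(1,2)]] homsD[OF hzero_homs[OF o(2,4)]]
  have "pre_triangle C (hzero C z t) (idn C t) (hzero C t (sho C z))"
    using h o by (simp add: pre_triangle_def idn_ars[OF cat] dm_idn[OF cat] cd_idn[OF cat])
  moreover have "(idn C t, hzero C t (sho C z), hneg C (sha C (hzero C z t))) \<in> tri C"
    using tri_idn[OF o(2) zero_ob_shift[OF z]] o by (simp add: shift_hzero hneg_hzero shift_simps)
  ultimately have 2: "(hzero C z t, idn C t, hzero C t (sho C z)) \<in> tri C"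
    by (simp add: tri_rotate)
  have e: "x \<cdot>\<^bsub>C\<^esub> f = hzero C z t \<cdot>\<^bsub>C\<^esub> hzero C (dm C f) z"
    using assms(3) hzero_cmp[OF hzero_homs[OF o(3,1)] o(2)] by simp
  obtain y where y: "y \<in> homs C (dm C h) (dm C (hzero C t (sho C z)))" "y \<cdot>\<^bsub>C\<^esub> g = idn C t \<cdot>\<^bsub>C\<^esub> x"
    using tri_map[OF assms(1) 2 _ _ e] hzero_homs[OF o(3,1)] assms(2) T h o
    by (auto simp: dm_idn[OF cat])
  with that[of y] T h idn_cmp[OF cat homsD(1,3)[OF assms(2)]] show ?thesis by simp
qed

lemma tri_weak_cokernel2:
  assumes "(f, g, h) \<in> tri C" "x \<in> homs C (cd C g) t" "x \<cdot>\<^bsub>C\<^esub> g = hzero C (dm C g) t"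
  obtains y where "y \<in> homs C (cd C h) t" "x = y \<cdot>\<^bsub>C\<^esub> h"
  using tri_weak_cokernel[OF tri_rotated[OF assms(1)] assms(2,3)] by blast

text \<open>Rotation replaces \<open>sha C f\<close> by its negative; the sign is moved into the
  factor \<open>y\<close>.\<close>

lemma tri_weak_cokernel3:
  assumes "(f, g, h) \<in> tri C" "x \<in> homs C (cd C h) t" "x \<cdot>\<^bsub>C\<^esub> h = hzero C (dm C h) t"
  obtains y where "y \<in> homs C (sho C (cd C f)) t" "x = y \<cdot>\<^bsub>C\<^esub> sha C f"
proof -
  note T = triD[OF assms(1)]
  have f: "sha C f \<in> homs C (sho C (dm C f)) (sho C (cd C f))"
    using T by (simp add: homs_def shift_simps)
  obtain y where y: "y \<in> homs C (cd C (hneg C (sha C f))) t" "x = y \<cdot>\<^bsub>C\<^esub> hneg C (sha C f)"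
    using tri_weak_cokernel2[OF tri_rotated[OF assms(1)] assms(2,3)] by blast
  then have y': "y \<in> homs C (sho C (cd C f)) t" using homsD[OF hneg_homs[OF f]] by simp
  show ?thesis
    using that[OF hneg_homs[OF y']] y(2) cmp_hneg[OF f y'] by simp
qed

text \<open>Under either hypothesis both maps at the third object vanish. Its identity then kills
  \<open>g\<close>, so it factors through \<open>h\<close>, which is zero.\<close>

lemma tri_third_zero:
  assumes "(f, g, h) \<in> tri C" "is_iso C f \<or> (zero_ob C (dm C f) \<and> zero_ob C (cd C f))"
  shows "zero_ob C (cd C g)"
proof -
  note T = triD[OF assms(1)]
  let ?k = "cd C g"
  have o: "?k \<in> obs C" "dm C g \<in> obs C" "cd C h \<in> obs C" "dm C f \<in> obs C"
    using T by (auto simp: cd_obs[OF cat] dm_obs[OF cat] shift_simps)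
  have g: "g \<in> homs C (dm C g) ?k" and h: "h \<in> homs C ?k (cd C h)" and f: "f \<in> homs C (dm C f) (dm C g)"
    using T by (auto simp: homs_def)
  have g0: "g = hzero C (dm C g) ?k" and h0: "h = hzero C ?k (cd C h)"
  proof -
    show "g = hzero C (dm C g) ?k"
      using assms(2)
    proof
      assume i: "is_iso C f"
      show ?thesis
        by (rule iso_epi[OF cat i f g hzero_homs[OF o(2,1)]])
          (use tri_consecutive[OF assms(1)] hzero_cmp[OF f o(1)] in simp)
    qed (use zero_ob_unique(1)[OF _ g] T in auto)
    show "h = hzero C ?k (cd C h)"
      using assms(2)
    proof
      assume i: "is_iso C f"
      have sf: "sha C f \<in> homs C (cd C h) (sho C (cd C f))" using T by (simp add: homs_def shift_simps)
      have i': "is_iso C (sha C f)" using fctr_iso[OF shift_fctr i] by (simp add: shift_ftr_def)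
      \<comment> \<open>Consecutive maps of the twice rotated triangle. As \<open>sha C f\<close> is
        invertible, this forces \<open>h\<close> to vanish up to sign.\<close>
      have "hneg C (sha C f) \<cdot>\<^bsub>C\<^esub> h = hzero C ?k (cd C (hneg C (sha C f)))"
        using tri_consecutive[OF tri_rotated[OF assms(1)]]
          tri_consecutive[OF tri_rotated[OF tri_rotated[OF assms(1)]]] T by simp
      then have "hneg C (sha C f) \<cdot>\<^bsub>C\<^esub> h = hzero C ?k (sho C (cd C f))"
        using homsD[OF hneg_homs[OF sf]] by simp
      moreover have "hneg C (sha C f) \<cdot>\<^bsub>C\<^esub> h = sha C f \<cdot>\<^bsub>C\<^esub> hneg C h"
        using cmp_hneg[OF h sf] by simp
      ultimately have "hneg C h = hzero C ?k (cd C h)"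
        using iso_mono[OF cat i' sf hneg_homs[OF h] hzero_homs[OF o(1,3)]] cmp_hzero[OF sf o(1)] by simp
      then show ?thesis using hneg_hadd[OF h] hadd_zero(1)[OF h] by simp
    next
      assume "zero_ob C (dm C f) \<and> zero_ob C (cd C f)"
      then show ?thesis using zero_ob_unique(2)[OF _ h] zero_ob_shift T by simp
    qed
  qed
  have "idn C ?k \<cdot>\<^bsub>C\<^esub> g = hzero C (dm C g) ?k"
    using g0 idn_cmp[OF cat T(2)] by simp
  then obtain y where y: "y \<in> homs C (cd C h) ?k" "idn C ?k = y \<cdot>\<^bsub>C\<^esub> h"
    using tri_weak_cokernel2[OF assms(1) idn_homs[OF cat o(1)]] by blast
  then have "idn C ?k = hzero C ?k ?k"
    using cmp_hzero[OF y(1) o(1)] h0 by simp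
  then show ?thesis using o(1) by (simp add: zero_ob_def)
qed

end

section \<open>Triangulated functors and their composites\<close>

lemma triangulated_functorE:
  assumes "triangulated_functor C D F"
  obtains s where "nat_trans C D (F \<odot> shift_ftr C) (shift_ftr D \<odot> F) s" "\<And>a. a \<in> obs C \<Longrightarrow> is_iso D (s a)"
    "\<And>f g h. (f, g, h) \<in> tri C \<Longrightarrow> (onA F f, onA F g, s (dm C f) \<cdot>\<^bsub>D\<^esub> onA F h) \<in> tri D"
proof -
  obtain s where s: "nat_trans C D (F \<odot> shift_ftr C) (shift_ftr D \<odot> F) s" "\<forall>a\<in>obs C. is_iso D (s a)"
     "\<forall>(f, g, h)\<in>tri C. (onA F f, onA F g, s (dm C f) \<cdot>\<^bsub>D\<^esub> onA F h) \<in> tri D"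
    using assms unfolding triangulated_functor_def by blast
  show ?thesis by (rule that[OF s(1)]) (use s(2,3) in auto)
qed

lemma triangulated_category: "triangulated C \<Longrightarrow> category C"
  by (simp add: triangulated_def additive_cat_def)

lemma triangulated_functor_fctr:
  "triangulated C \<Longrightarrow> triangulated D \<Longrightarrow> triangulated_functor C D F \<Longrightarrow> fctr C D F"
  by (auto simp: fctr_def triangulated_functor_def additive_functor_def triangulated_category)

lemma triangulated_functor_comp:
  assumes C: "triangulated C" and D: "triangulated D" and E: "triangulated E"
    and F: "triangulated_functor C D F" and G: "triangulated_functor D E G"
  shows "triangulated_functor C E (G \<odot> F)"
proof -
  interpret C: triangulated_cat C by unfold_locales (rule C)
  interpret D: triangulated_cat D by unfold_locales (rule D)
  interpret E: triangulated_cat E by unfold_locales (rule E)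
  note Ff = triangulated_functor_fctr[OF C D F] and Gf = triangulated_functor_fctr[OF D E G]
  note fctr = Ff Gf C.shift_fctr D.shift_fctr E.shift_fctr fctr_comp
  obtain s where s: "nat_trans C D (F \<odot> shift_ftr C) (shift_ftr D \<odot> F) s"
    "\<And>a. a \<in> obs C \<Longrightarrow> is_iso D (s a)"
    "\<And>f g h. (f, g, h) \<in> tri C \<Longrightarrow> (onA F f, onA F g, s (dm C f) \<cdot>\<^bsub>D\<^esub> onA F h) \<in> tri D"
    using triangulated_functorE[OF F] by metis
  obtain t where t: "nat_trans D E (G \<odot> shift_ftr D) (shift_ftr E \<odot> G) t"
    "\<And>a. a \<in> obs D \<Longrightarrow> is_iso E (t a)"
    "\<And>f g h. (f, g, h) \<in> tri D \<Longrightarrow> (onA G f, onA G g, t (dm D f) \<cdot>\<^bsub>E\<^esub> onA G h) \<in> tri E"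
    using triangulated_functorE[OF G] by metis
  note simps = fctrD(3-)[OF Ff] fctrD(3-)[OF Gf] nat_transD(2-4)[OF s(1)] nat_transD(2-4)[OF t(1)]
    dm_obs[OF C.cat] cd_obs[OF C.cat] shift_ftr_def
  \<comment> \<open>The shift isomorphism of the composite, G F [1] -> G [1] F -> [1] G F.\<close>
  let ?r = "\<lambda>a. t (onO F a) \<cdot>\<^bsub>E\<^esub> onA G (s a)"
  have "additive_functor C E (onO (G \<odot> F)) (onA (G \<odot> F))"
    unfolding additive_functor_def
  proof (intro conjI ballI)
    show "is_functor C E (onO (G \<odot> F)) (onA (G \<odot> F))"
      using fctr_comp[OF Ff Gf] by (simp add: fctr_def)
    fix a b f g assume *: "a \<in> obs C" "b \<in> obs C" "f \<in> homs C a b" "g \<in> homs C a b"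
    have "onA F (hadd C a b f g) = hadd D (onO F a) (onO F b) (onA F f) (onA F g)"
      using F * by (simp add: triangulated_functor_def additive_functor_def)
    moreover have "onA G (hadd D (onO F a) (onO F b) (onA F f) (onA F g))
      = hadd E (onO G (onO F a)) (onO G (onO F b)) (onA G (onA F f)) (onA G (onA F g))"
      using G * fctr_homs[OF Ff] fctrD(3)[OF Ff]
      by (simp add: triangulated_functor_def additive_functor_def)
    ultimately show "onA (G \<odot> F) (hadd C a b f g) =
        hadd E (onO (G \<odot> F) a) (onO (G \<odot> F) b) (onA (G \<odot> F) f) (onA (G \<odot> F) g)" by simp
  qed
  moreover have "nat_trans C E ((G \<odot> F) \<odot> shift_ftr C) (shift_ftr E \<odot> (G \<odot> F)) ?r"
  proof (rule nat_trans_vcomp)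
    show "nat_trans C E ((G \<odot> F) \<odot> shift_ftr C) (G \<odot> shift_ftr D \<odot> F) (\<lambda>a. onA G (s a))"
      unfolding ftr_comp_assoc by (rule nat_trans_whisker_left[OF _ _ _ s(1)]) (rule fctr)+
    show "nat_trans C E (G \<odot> shift_ftr D \<odot> F) (shift_ftr E \<odot> (G \<odot> F)) (\<lambda>a. t (onO F a))"
      using nat_trans_whisker_right[OF Ff t(1)] by (simp add: ftr_comp_assoc)
  qed (rule fctr)+
  moreover have "is_iso E (?r a)" if "a \<in> obs C" for a
    using that s(2) t(2) fctr_iso[OF Gf] by (intro is_iso_cmp[OF E.cat]) (auto simp: simps)
  moreover have "(onA (G \<odot> F) f, onA (G \<odot> F) g, ?r (dm C f) \<cdot>\<^bsub>E\<^esub> onA (G \<odot> F) h) \<in> tri E"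
    if T: "(f, g, h) \<in> tri C" for f g h
  proof -
    have "(onA G (onA F f), onA G (onA F g),
        t (onO F (dm C f)) \<cdot>\<^bsub>E\<^esub> onA G (s (dm C f) \<cdot>\<^bsub>D\<^esub> onA F h)) \<in> tri E"
      using t(3)[OF s(3)[OF T]] C.triD[OF T] by (simp add: simps)
    moreover have "t (onO F (dm C f)) \<cdot>\<^bsub>E\<^esub> onA G (s (dm C f) \<cdot>\<^bsub>D\<^esub> onA F h) = ?r (dm C f) \<cdot>\<^bsub>E\<^esub> onA G (onA F h)"
      using C.triD[OF T] by (simp add: simps cmp_assoc[OF E.cat])
    ultimately show ?thesis by simp
  qed
  ultimately show ?thesis unfolding triangulated_functor_def by (auto intro!: exI[of _ ?r])
qed

subsection \<open>The functorial cone of the counit of a fully faithful left adjoint\<close>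

text \<open>The cone of the counit \<open>L R M \<longrightarrow> M\<close> is the universal morphism from \<open>M\<close> to an object
  killed by \<open>R\<close>; this makes it a functor, which is triangulated.\<close>

locale coreflection =
  C: triangulated_cat C + E: triangulated_cat E
  for C :: "('o, 'm) tcat" and E :: "('o, 'm) tcat" +
  fixes L R :: "('o, 'm) ftr" and un co :: "'o \<Rightarrow> 'm"
  assumes adjunction: "adjunction C E L R un co"
    and L: "triangulated_functor C E L" and R: "triangulated_functor E C R"
    and unit_iso: "a \<in> obs C \<Longrightarrow> is_iso C (un a)"
begin

lemma adj: "adj C E L R un co"
  using adjunction C.cat E.cat by (simp add: adj_def)

lemmas L_fctr = adjD(3)[OF adj] and R_fctr = adjD(4)[OF adj]

lemmas simps = fctrD(3-)[OF L_fctr] fctrD(3-)[OF R_fctr] E.shift_simps C.shift_simps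
  nat_transD(2-4)[OF adjD(5)[OF adj], simplified] nat_transD(2-4)[OF adjD(6)[OF adj], simplified]
  dm_obs[OF E.cat] cd_obs[OF E.cat] dm_obs[OF C.cat] cd_obs[OF C.cat]

text \<open>By adjunction, the right orthogonal of the image of \<open>L\<close>.\<close>

definition loc :: "'o set" where
  "loc = {w \<in> obs E. zero_ob C (onO R w)}"

lemma loc_obs: "w \<in> loc \<Longrightarrow> w \<in> obs E"
  by (simp add: loc_def)

text \<open>Orthogonality as equality of any two maps instead of vanishing. In this form it passes
  through isomorphisms of the source by cancellation, which gives the two shifted versions.\<close>

lemma loc_orth:
  assumes "w \<in> loc" "x \<in> obs C" "f \<in> homs E (onO L x) w" "g \<in> homs E (onO L x) w"
  shows "f = g"
proof -
  have b: "bij_betw (\<lambda>f. onA R f \<cdot>\<^bsub>C\<^esub> un x) (homs E (onO L x) w) (homs C x (onO R w))"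
    using assms(2) loc_obs[OF assms(1)] by (rule adj_bij_right[OF adj])
  then have "onA R f \<cdot>\<^bsub>C\<^esub> un x \<in> homs C x (onO R w)" "onA R g \<cdot>\<^bsub>C\<^esub> un x \<in> homs C x (onO R w)"
    using assms(3,4) by (auto simp: bij_betw_def)
  then have "onA R f \<cdot>\<^bsub>C\<^esub> un x = onA R g \<cdot>\<^bsub>C\<^esub> un x"
    using C.zero_ob_unique(2) assms(1) unfolding loc_def by (metis (mono_tags, lifting) mem_Collect_eq)
  then show ?thesis using bij_betw_imp_inj_on[OF b] assms(3,4) by (auto dest: inj_onD)
qed

lemma loc_orth_shift:
  assumes "w \<in> loc" "x \<in> obs C" "f \<in> homs E (sho E (onO L x)) w" "g \<in> homs E (sho E (onO L x)) w"
  shows "f = g"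
proof -
  obtain s where s: "nat_trans C E (L \<odot> shift_ftr C) (shift_ftr E \<odot> L) s" "\<And>a. a \<in> obs C \<Longrightarrow> is_iso E (s a)"
    using triangulated_functorE[OF L] by metis
  have h: "s x \<in> homs E (onO L (sho C x)) (sho E (onO L x))"
    using nat_transD(1)[OF s(1) assms(2)] by (simp add: shift_ftr_def)
  have "f \<cdot>\<^bsub>E\<^esub> s x = g \<cdot>\<^bsub>E\<^esub> s x"
    by (rule loc_orth[OF assms(1) C.shift_simps(1)[OF assms(2)]]) (auto intro: cmp_homs[OF E.cat h] assms)
  then show ?thesis by (rule iso_epi[OF E.cat s(2)[OF assms(2)] h assms(3,4)])
qed

text \<open>The second shift is needed because \<open>shift_cone_in_reflection\<close> runs the
  exactness argument for a triangle whose first object is already shifted once.\<close>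

lemma loc_orth_shift2:
  assumes "w \<in> loc" "x \<in> obs C" "f \<in> homs E (sho E (sho E (onO L x))) w"
    "g \<in> homs E (sho E (sho E (onO L x))) w"
  shows "f = g"
proof -
  obtain s where s: "nat_trans C E (L \<odot> shift_ftr C) (shift_ftr E \<odot> L) s" "\<And>a. a \<in> obs C \<Longrightarrow> is_iso E (s a)"
    using triangulated_functorE[OF L] by metis
  have "s x \<in> homs E (onO L (sho C x)) (sho E (onO L x))"
    using nat_transD(1)[OF s(1) assms(2)] by (simp add: shift_ftr_def)
  then have h: "sha E (s x) \<in> homs E (sho E (onO L (sho C x))) (sho E (sho E (onO L x)))"
    by (auto simp: homs_def simps)
  have i: "is_iso E (sha E (s x))"
    using fctr_iso[OF E.shift_fctr s(2)[OF assms(2)]] by (simp add: shift_ftr_def)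
  have "f \<cdot>\<^bsub>E\<^esub> sha E (s x) = g \<cdot>\<^bsub>E\<^esub> sha E (s x)"
    by (rule loc_orth_shift[OF assms(1) C.shift_simps(1)[OF assms(2)]])
      (auto intro: cmp_homs[OF E.cat h] assms)
  then show ?thesis by (rule iso_epi[OF E.cat i h assms(3,4)])
qed

lemma loc_shift:
  assumes "w \<in> loc"
  shows "sho E w \<in> loc"
proof -
  obtain s where s: "nat_trans E C (R \<odot> shift_ftr E) (shift_ftr C \<odot> R) s" "\<And>a. a \<in> obs E \<Longrightarrow> is_iso C (s a)"
    using triangulated_functorE[OF R] by metis
  note w = loc_obs[OF assms]
  have h: "s w \<in> homs C (onO R (sho E w)) (sho C (onO R w))"
    using nat_transD(1)[OF s(1) w] by (simp add: shift_ftr_def)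
  have "zero_ob C (onO R (sho E w))"
    by (rule C.zero_ob_iso[OF _ inver_homs[OF C.cat s(2)[OF w] h] is_iso_inver[OF C.cat s(2)[OF w]]])
      (use assms C.zero_ob_shift in \<open>simp add: loc_def\<close>)
  then show ?thesis using w by (simp add: loc_def simps)
qed

lemma R_tri:
  assumes "(f, g, h) \<in> tri E"
  obtains h' where "(onA R f, onA R g, h') \<in> tri C"
  using triangulated_functorE[OF R] assms by metis

text \<open>\<open>R\<close> carries the triangle to one whose first two objects are zero, so the
  third is zero as well.\<close>

lemma loc_cone:
  assumes "(f, g, h) \<in> tri E" "dm E f \<in> loc" "cd E f \<in> loc"
  shows "cd E g \<in> loc"
proof -
  note T = E.triD[OF assms(1)]
  obtain h' where "(onA R f, onA R g, h') \<in> tri C" using R_tri[OF assms(1)] .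
  from C.tri_third_zero[OF this] have "zero_ob C (onO R (cd E g))"
    using assms(2,3) T by (simp add: simps loc_def)
  then show ?thesis using T by (simp add: loc_def simps)
qed

text \<open>By a triangle identity it is a left inverse of a unit, and the unit is
  invertible.\<close>

lemma R_co_iso:
  assumes "M \<in> obs E"
  shows "is_iso C (onA R (co M))"
proof (rule is_iso_cancel_right[OF C.cat])
  have "onO R M \<in> obs C" using assms by (simp add: simps)
  then show "is_iso C (onA R (co M) \<cdot>\<^bsub>C\<^esub> un (onO R M))" "is_iso C (un (onO R M))"
    by (simp_all add: adjD(8)[OF adj assms] is_iso_idn[OF C.cat] unit_iso)
  show "un (onO R M) \<in> homs C (onO R M) (onO R (onO L (onO R M)))"
    "onA R (co M) \<in> homs C (onO R (onO L (onO R M))) (onO R M)"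
    using assms by (auto simp: homs_def simps)
qed

lemma loc_cone_counit:
  assumes "(co M, g, h) \<in> tri E" "M \<in> obs E"
  shows "cd E g \<in> loc"
proof -
  note T = E.triD[OF assms(1)]
  obtain h' where "(onA R (co M), onA R g, h') \<in> tri C" using R_tri[OF assms(1)] .
  from C.tri_third_zero[OF this] have "zero_ob C (onO R (cd E g))"
    using R_co_iso[OF assms(2)] T by (simp add: simps)
  then show ?thesis using T by (simp add: loc_def simps)
qed

text \<open>The arrow \<open>b\<close> is universal from its source into \<open>loc\<close>.\<close>

definition reflection :: "'m \<Rightarrow> bool" where
  "reflection b \<longleftrightarrow> b \<in> ars E \<and> cd E b \<in> loc \<and>
     (\<forall>w\<in>loc. bij_betw (\<lambda>x. x \<cdot>\<^bsub>E\<^esub> b) (homs E (cd E b) w) (homs E (dm E b) w))"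

lemma reflection_ex:
  assumes "reflection b" "w \<in> loc" "x \<in> homs E (dm E b) w"
  obtains y where "y \<in> homs E (cd E b) w" "y \<cdot>\<^bsub>E\<^esub> b = x"
proof -
  have "x \<in> (\<lambda>x. x \<cdot>\<^bsub>E\<^esub> b) ` homs E (cd E b) w"
    using assms by (simp add: reflection_def bij_betw_def)
  then show ?thesis using that by auto
qed

lemma reflection_unique:
  assumes "reflection b" "w \<in> loc" "x \<in> homs E (cd E b) w" "y \<in> homs E (cd E b) w" "x \<cdot>\<^bsub>E\<^esub> b = y \<cdot>\<^bsub>E\<^esub> b"
  shows "x = y"
  using assms unfolding reflection_def bij_betw_def by (metis inj_onD)

text \<open>By additivity, injectivity has to be tested against the zero map only. The two remaining
  conditions are those that weak cokernels deliver.\<close>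

lemma reflectionI:
  assumes b: "b \<in> ars E" "cd E b \<in> loc"
    and ex: "\<And>w x. w \<in> loc \<Longrightarrow> x \<in> homs E (dm E b) w \<Longrightarrow> \<exists>y\<in>homs E (cd E b) w. y \<cdot>\<^bsub>E\<^esub> b = x"
    and un: "\<And>w x. w \<in> loc \<Longrightarrow> x \<in> homs E (cd E b) w \<Longrightarrow> x \<cdot>\<^bsub>E\<^esub> b = hzero E (dm E b) w \<Longrightarrow> x = hzero E (cd E b) w"
  shows "reflection b"
  unfolding reflection_def
proof (intro conjI ballI b)
  fix w assume w: "w \<in> loc"
  have bh: "b \<in> homs E (dm E b) (cd E b)" using b by (simp add: homs_def)
  have o: "dm E b \<in> obs E" "cd E b \<in> obs E" "w \<in> obs E" using b w by (auto simp: simps loc_obs)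
  show "bij_betw (\<lambda>x. x \<cdot>\<^bsub>E\<^esub> b) (homs E (cd E b) w) (homs E (dm E b) w)"
    unfolding bij_betw_def
  proof (intro conjI inj_onI)
    fix x y assume xy: "x \<in> homs E (cd E b) w" "y \<in> homs E (cd E b) w" "x \<cdot>\<^bsub>E\<^esub> b = y \<cdot>\<^bsub>E\<^esub> b"
    obtain d where d: "d \<in> homs E (cd E b) w" "x = hadd E (cd E b) w d y"
      using E.hsub_ex[OF xy(1,2)] .
    have "hadd E (dm E b) w (d \<cdot>\<^bsub>E\<^esub> b) (y \<cdot>\<^bsub>E\<^esub> b) = y \<cdot>\<^bsub>E\<^esub> b"
      using E.hadd_cmp[OF bh d(1) xy(2) o] d(2) xy(3) by simp
    then have "d \<cdot>\<^bsub>E\<^esub> b = hzero E (dm E b) w"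
      by (rule E.hadd_cancel_zero[OF cmp_homs[OF E.cat bh d(1)] cmp_homs[OF E.cat bh xy(2)]])
    then show "x = y" using un[OF w d(1)] d(2) E.hadd_zero(1)[OF xy(2)] by simp
  next
    show "(\<lambda>x. x \<cdot>\<^bsub>E\<^esub> b) ` homs E (cd E b) w = homs E (dm E b) w"
      using ex[OF w] cmp_homs[OF E.cat bh] by (fastforce simp: image_iff)
  qed
qed

text \<open>Two pieces of the exact sequence of Hom(_, w). A map out of the second object kills
  \<open>f\<close> by orthogonality to the first object, so it extends along \<open>g\<close>. A map
  killed by \<open>g\<close> factors through the shift of the first object, so it is zero.\<close>

lemma reflection_cone:
  assumes T: "(f, g, h) \<in> tri E" and g: "cd E g \<in> loc"
    and orth: "\<And>w x y. w \<in> loc \<Longrightarrow> x \<in> homs E (dm E f) w \<Longrightarrow> y \<in> homs E (dm E f) w \<Longrightarrow> x = y"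
    and orth': "\<And>w x y. w \<in> loc \<Longrightarrow> x \<in> homs E (sho E (dm E f)) w \<Longrightarrow> y \<in> homs E (sho E (dm E f)) w \<Longrightarrow> x = y"
  shows "reflection g"
proof (rule reflectionI[OF _ g])
  note t = E.triD[OF T]
  show "g \<in> ars E" by (rule t)
  have fh: "f \<in> homs E (dm E f) (dm E g)" and hh: "h \<in> homs E (cd E g) (sho E (dm E f))"
    using t by (auto simp: homs_def)
  note o = E.homs_obs[OF fh] E.homs_obs[OF hh]
  fix w assume w: "w \<in> loc"
  note z = E.hzero_homs[OF o(1) loc_obs[OF w]] E.hzero_homs[OF o(4) loc_obs[OF w]]
  show "\<exists>y\<in>homs E (cd E g) w. y \<cdot>\<^bsub>E\<^esub> g = x" if x: "x \<in> homs E (dm E g) w" for x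
  proof -
    have "x \<cdot>\<^bsub>E\<^esub> f = hzero E (dm E f) w" by (rule orth[OF w cmp_homs[OF E.cat fh x] z(1)])
    then obtain y where "y \<in> homs E (cd E g) w" "x = y \<cdot>\<^bsub>E\<^esub> g"
      using E.tri_weak_cokernel[OF T] x t by metis
    then show ?thesis by blast
  qed
  show "x = hzero E (cd E g) w"
    if x: "x \<in> homs E (cd E g) w" "x \<cdot>\<^bsub>E\<^esub> g = hzero E (dm E g) w" for x
  proof -
    obtain y where y: "y \<in> homs E (cd E h) w" "x = y \<cdot>\<^bsub>E\<^esub> h"
      using E.tri_weak_cokernel2[OF T x] .
    then have "y = hzero E (sho E (dm E f)) w" using orth'[OF w _ z(2)] t by simp
    then show ?thesis using y E.hzero_cmp[OF hh loc_obs[OF w]] by simp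
  qed
qed

definition cone :: "'o \<Rightarrow> 'm \<times> 'm" where
  "cone M = (SOME p. (co M, fst p, snd p) \<in> tri E)"

definition cone_in :: "'o \<Rightarrow> 'm" where "cone_in M = fst (cone M)"
definition cone_out :: "'o \<Rightarrow> 'm" where "cone_out M = snd (cone M)"

lemma cone_tri:
  assumes "M \<in> obs E"
  shows "(co M, cone_in M, cone_out M) \<in> tri E"
proof -
  have "\<exists>p. (co M, fst p, snd p) \<in> tri E"
    using E.tri_complete[of "co M"] assms by (auto simp: simps)
  then show ?thesis unfolding cone_in_def cone_out_def cone_def by (rule someI_ex)
qed

definition coneO :: "'o \<Rightarrow> 'o" where "coneO M = cd E (cone_in M)"

lemma
  assumes "M \<in> obs E"
  shows cone_in_homs: "cone_in M \<in> homs E M (coneO M)"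
    and cone_out_homs: "cone_out M \<in> homs E (coneO M) (sho E (onO L (onO R M)))"
    and coneO_loc: "coneO M \<in> loc"
    and cone_in_reflection: "reflection (cone_in M)"
proof -
  note t = E.triD[OF cone_tri[OF assms]]
  show "cone_in M \<in> homs E M (coneO M)" "cone_out M \<in> homs E (coneO M) (sho E (onO L (onO R M)))"
    using t assms by (auto simp: homs_def coneO_def simps)
  show l: "coneO M \<in> loc" unfolding coneO_def by (rule loc_cone_counit[OF cone_tri[OF assms] assms])
  have o: "onO R M \<in> obs C" using assms by (simp add: simps)
  show "reflection (cone_in M)"
    by (rule reflection_cone[OF cone_tri[OF assms]])
      (use l loc_orth[OF _ o] loc_orth_shift[OF _ o] assms in \<open>auto simp: coneO_def simps\<close>)
qed

text \<open>Three rotations turn the cone triangle into the triangle of the negated shifted maps, to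
  which \<open>reflection_cone\<close> applies; afterwards the sign is removed. This universality is
  what makes the comparison \<open>cone_shift\<close> invertible.\<close>

lemma shift_cone_in_reflection:
  assumes "M \<in> obs E"
  shows "reflection (sha E (cone_in M))"
proof -
  have o: "onO R M \<in> obs C" using assms by (simp add: simps)
  note t = E.triD[OF cone_tri[OF assms]] and h = homsD[OF cone_in_homs[OF assms]]
  let ?f = "sha E (co M)" and ?g = "sha E (cone_in M)"
  have fh: "?f \<in> homs E (sho E (onO L (onO R M))) (sho E M)" using assms by (auto simp: homs_def simps)
  have gh: "?g \<in> homs E (sho E M) (sho E (coneO M))" using h by (auto simp: homs_def simps)
  have T: "(hneg E ?f, hneg E ?g, hneg E (sha E (cone_out M))) \<in> tri E"
    using E.tri_rotated[OF E.tri_rotated[OF E.tri_rotated[OF cone_tri[OF assms]]]] .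
  have refl: "reflection (hneg E ?g)"
    by (rule reflection_cone[OF T])
      (use homsD[OF E.hneg_homs[OF fh]] homsD[OF E.hneg_homs[OF gh]] loc_shift[OF coneO_loc[OF assms]]
        loc_orth_shift[OF _ o] loc_orth_shift2[OF _ o] in auto)
  note nh = E.hneg_homs[OF gh] and d = homsD[OF gh] homsD[OF E.hneg_homs[OF gh]]
  have neg: "\<exists>y'\<in>homs E (sho E (coneO M)) w. y' \<cdot>\<^bsub>E\<^esub> ?g = y \<cdot>\<^bsub>E\<^esub> hneg E ?g"
    if "y \<in> homs E (sho E (coneO M)) w" for y w
    using E.cmp_hneg[OF gh that] E.hneg_homs[OF that] by metis
  show ?thesis
  proof (rule reflectionI)
    show "?g \<in> ars E" "cd E ?g \<in> loc" using d loc_shift[OF coneO_loc[OF assms]] by auto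
    fix w assume w: "w \<in> loc"
    show "\<exists>y\<in>homs E (cd E ?g) w. y \<cdot>\<^bsub>E\<^esub> ?g = x" if x: "x \<in> homs E (dm E ?g) w" for x
    proof -
      obtain y where "y \<in> homs E (sho E (coneO M)) w" "y \<cdot>\<^bsub>E\<^esub> hneg E ?g = x"
        using reflection_ex[OF refl w, of x] x d by metis
      then show ?thesis using neg[of y w] d by auto
    qed
    show "x = hzero E (cd E ?g) w"
      if x: "x \<in> homs E (cd E ?g) w" "x \<cdot>\<^bsub>E\<^esub> ?g = hzero E (dm E ?g) w" for x
    proof -
      have xh: "x \<in> homs E (sho E (coneO M)) w" using x d by simp
      \<comment> \<open>The sign is carried twice: if x g = 0, then also (-x)(-g) = 0, and the
        universality of -g yields -x = 0.\<close>
      have "hneg E x \<cdot>\<^bsub>E\<^esub> hneg E ?g = hzero E (sho E M) w \<cdot>\<^bsub>E\<^esub> idn E (sho E M)"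
      proof -
        have "x \<cdot>\<^bsub>E\<^esub> hneg E ?g = hneg E (x \<cdot>\<^bsub>E\<^esub> ?g)" if "x \<in> homs E (sho E (coneO M)) w" for x
        proof (rule E.hadd_cancel)
          note o' = E.homs_obs[OF gh] E.homs_obs(2)[OF that]
          have xg: "x \<cdot>\<^bsub>E\<^esub> ?g \<in> homs E (sho E M) w" by (rule cmp_homs[OF E.cat gh that])
          show "x \<cdot>\<^bsub>E\<^esub> hneg E ?g \<in> homs E (sho E M) w" "hneg E (x \<cdot>\<^bsub>E\<^esub> ?g) \<in> homs E (sho E M) w"
            "x \<cdot>\<^bsub>E\<^esub> ?g \<in> homs E (sho E M) w"
            using cmp_homs[OF E.cat nh that] xg E.hneg_homs by auto
          show "hadd E (sho E M) w (x \<cdot>\<^bsub>E\<^esub> hneg E ?g) (x \<cdot>\<^bsub>E\<^esub> ?g) =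
              hadd E (sho E M) w (hneg E (x \<cdot>\<^bsub>E\<^esub> ?g)) (x \<cdot>\<^bsub>E\<^esub> ?g)"
            using E.cmp_hadd[OF nh gh that o', symmetric] E.cmp_hzero[OF that o'(1)]
            by (simp add: E.hneg_hadd[OF gh] E.hneg_hadd[OF xg])
        qed
        note 1 = this
        have o': "sho E M \<in> obs E" "w \<in> obs E" "sho E (coneO M) \<in> obs E"
          using E.homs_obs[OF gh] loc_obs[OF w] by auto
        have "hneg E x \<cdot>\<^bsub>E\<^esub> ?g = x \<cdot>\<^bsub>E\<^esub> hneg E ?g" using E.cmp_hneg[OF gh xh] by simp
        then have "hneg E x \<cdot>\<^bsub>E\<^esub> ?g = hzero E (sho E M) w"
          using 1[OF xh] x(2) d E.hneg_hzero[OF o'(1,2)] by simp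
        then have "hneg E x \<cdot>\<^bsub>E\<^esub> hneg E ?g = hzero E (sho E M) w"
          using 1[OF E.hneg_homs[OF xh]] E.hneg_hzero[OF o'(1,2)] by simp
        then show ?thesis using cmp_idn[OF E.cat homsD(1,2)[OF E.hzero_homs[OF o'(1,2)]]] by simp
      qed
      moreover have "\<dots> = hzero E (sho E (coneO M)) w \<cdot>\<^bsub>E\<^esub> hneg E ?g"
        using E.hzero_cmp[OF nh loc_obs[OF w]] E.homs_obs[OF gh]
          E.cmp_hzero[OF idn_homs[OF E.cat E.homs_obs(1)[OF gh]]]
          cmp_idn[OF E.cat homsD(1,2)[OF E.hzero_homs[OF E.homs_obs(1)[OF gh] loc_obs[OF w]]]] by simp
      ultimately have "hneg E x = hzero E (sho E (coneO M)) w"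
        using reflection_unique[OF refl w] E.hneg_homs[OF xh] E.hzero_homs[OF E.homs_obs(2)[OF gh] loc_obs[OF w]] d
        by simp
      then show ?thesis using E.hneg_hadd[OF xh] E.hadd_zero(1)[OF xh] d by simp
    qed
  qed
qed

text \<open>The choice is forced: \<open>coneO_unique\<close> leaves only one such map, and all
  equations between values of \<open>coneA\<close> rest on this.\<close>

definition coneA :: "'m \<Rightarrow> 'm" where
  "coneA m = (SOME x. x \<in> homs E (coneO (dm E m)) (coneO (cd E m)) \<and>
      x \<cdot>\<^bsub>E\<^esub> cone_in (dm E m) = cone_in (cd E m) \<cdot>\<^bsub>E\<^esub> m)"

lemma coneA:
  assumes "m \<in> homs E M N"
  shows "coneA m \<in> homs E (coneO M) (coneO N)" "coneA m \<cdot>\<^bsub>E\<^esub> cone_in M = cone_in N \<cdot>\<^bsub>E\<^esub> m"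
proof -
  note o = E.homs_obs[OF assms]
  have "\<exists>x. x \<in> homs E (coneO M) (coneO N) \<and> x \<cdot>\<^bsub>E\<^esub> cone_in M = cone_in N \<cdot>\<^bsub>E\<^esub> m"
    using reflection_ex[OF cone_in_reflection[OF o(1)] coneO_loc[OF o(2)],
        of "cone_in N \<cdot>\<^bsub>E\<^esub> m"] cmp_homs[OF E.cat assms cone_in_homs[OF o(2)]]
      homsD[OF cone_in_homs[OF o(1)]] by metis
  from someI_ex[OF this] show "coneA m \<in> homs E (coneO M) (coneO N)" "coneA m \<cdot>\<^bsub>E\<^esub> cone_in M = cone_in N \<cdot>\<^bsub>E\<^esub> m"
    unfolding coneA_def using homsD[OF assms] by auto
qed

lemma coneO_unique:
  assumes "M \<in> obs E" "w \<in> loc" "x \<in> homs E (coneO M) w" "y \<in> homs E (coneO M) w"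
    "x \<cdot>\<^bsub>E\<^esub> cone_in M = y \<cdot>\<^bsub>E\<^esub> cone_in M"
  shows "x = y"
  using reflection_unique[OF cone_in_reflection[OF assms(1)] assms(2)] assms(3-)
    homsD[OF cone_in_homs[OF assms(1)]] by simp

definition cone_ftr :: "('o, 'm) ftr" where
  "cone_ftr = \<lparr>onO = coneO, onA = coneA\<rparr>"

lemma cone_fctr: "fctr E E cone_ftr"
  unfolding fctr_def is_functor_def cone_ftr_def
proof (simp add: E.cat, intro conjI ballI impI)
  fix M assume M: "M \<in> obs E"
  note h = cone_in_homs[OF M] and i = idn_homs[OF E.cat M]
  show c: "coneO M \<in> obs E" using coneO_loc[OF M] by (rule loc_obs)
  show "coneA (idn E M) = idn E (coneO M)"
    by (rule coneO_unique[OF M coneO_loc[OF M]])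
      (use coneA[OF i] idn_homs[OF E.cat c] homsD[OF h] in \<open>simp_all add: cmp_idn[OF E.cat] idn_cmp[OF E.cat]\<close>)
next
  fix f assume f: "f \<in> ars E"
  show "coneA f \<in> homs E (coneO (dm E f)) (coneO (cd E f))"
    by (rule coneA) (use f in \<open>simp add: homs_def\<close>)
next
  fix f g assume fg: "f \<in> ars E" "g \<in> ars E" "cd E f = dm E g"
  let ?a = "dm E f" and ?b = "dm E g" and ?c = "cd E g"
  have f: "f \<in> homs E ?a ?b" and g: "g \<in> homs E ?b ?c" using fg by (auto simp: homs_def)
  note gf = cmp_homs[OF E.cat f g]
  have o: "?a \<in> obs E" "?b \<in> obs E" "?c \<in> obs E" using fg by (auto simp: simps)
  note A = coneA[OF f] coneA[OF g] coneA[OF gf]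
  note h = cone_in_homs[OF o(1)] cone_in_homs[OF o(2)] cone_in_homs[OF o(3)]
  show "coneA (g \<cdot>\<^bsub>E\<^esub> f) = coneA g \<cdot>\<^bsub>E\<^esub> coneA f"
  proof (rule coneO_unique[OF o(1) coneO_loc[OF o(3)] A(5) cmp_homs[OF E.cat A(1,3)]])
    have "(coneA g \<cdot>\<^bsub>E\<^esub> coneA f) \<cdot>\<^bsub>E\<^esub> cone_in ?a = coneA g \<cdot>\<^bsub>E\<^esub> (cone_in ?b \<cdot>\<^bsub>E\<^esub> f)"
      using cmp_assoc_homs[OF E.cat h(1) A(1,3)] A(2) by simp
    also have "\<dots> = (cone_in ?c \<cdot>\<^bsub>E\<^esub> g) \<cdot>\<^bsub>E\<^esub> f"
      using cmp_assoc_homs[OF E.cat f h(2) A(3)] A(4) by simp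
    also have "\<dots> = cone_in ?c \<cdot>\<^bsub>E\<^esub> (g \<cdot>\<^bsub>E\<^esub> f)" by (rule cmp_assoc_homs[OF E.cat f g h(3)])
    finally show "coneA (g \<cdot>\<^bsub>E\<^esub> f) \<cdot>\<^bsub>E\<^esub> cone_in ?a = (coneA g \<cdot>\<^bsub>E\<^esub> coneA f) \<cdot>\<^bsub>E\<^esub> cone_in ?a"
      using A(6) by simp
  qed
qed

lemma cone_in_nat: "nat_trans E E ftr_id cone_ftr cone_in"
  unfolding nat_trans_def cone_ftr_def
  using cone_in_homs coneA(2) by (auto simp: homs_def)

text \<open>The axiom on maps of triangles provides a fill-in compatible with both
  \<open>cone_in\<close> and \<open>cone_out\<close>. Compatibility with \<open>cone_in\<close>
  identifies it with \<open>coneA f\<close>, which thereby inherits the second square.\<close>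

lemma cone_out_nat: "nat_trans E E cone_ftr (shift_ftr E \<odot> (L \<odot> R)) cone_out"
  unfolding nat_trans_def
proof (intro conjI ballI)
  fix M assume "M \<in> obs E"
  then show "cone_out M \<in> homs E (onO cone_ftr M) (onO (shift_ftr E \<odot> (L \<odot> R)) M)"
    using cone_out_homs by (simp add: cone_ftr_def shift_ftr_def)
next
  fix f assume f: "f \<in> ars E"
  let ?a = "dm E f" and ?b = "cd E f"
  have fh: "f \<in> homs E ?a ?b" and o: "?a \<in> obs E" "?b \<in> obs E" using f by (auto simp: homs_def simps)
  note t = E.triD[OF cone_tri[OF o(1)]] E.triD[OF cone_tri[OF o(2)]]
  let ?x = "onA L (onA R f)"
  have xh: "?x \<in> homs E (dm E (co ?a)) (dm E (co ?b))" using f by (auto simp: homs_def simps)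
  have yh: "f \<in> homs E (dm E (cone_in ?a)) (dm E (cone_in ?b))"
    using fh homsD[OF cone_in_homs[OF o(1)]] homsD[OF cone_in_homs[OF o(2)]] by simp
  have e: "f \<cdot>\<^bsub>E\<^esub> co ?a = co ?b \<cdot>\<^bsub>E\<^esub> ?x"
    using nat_transD(5)[OF adjD(6)[OF adj] f] by simp
  obtain z where z: "z \<in> homs E (dm E (cone_out ?a)) (dm E (cone_out ?b))"
    "z \<cdot>\<^bsub>E\<^esub> cone_in ?a = cone_in ?b \<cdot>\<^bsub>E\<^esub> f" "sha E ?x \<cdot>\<^bsub>E\<^esub> cone_out ?a = cone_out ?b \<cdot>\<^bsub>E\<^esub> z"
    using E.tri_map[OF cone_tri[OF o(1)] cone_tri[OF o(2)] xh yh e] .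
  have "z = coneA f"
    by (rule coneO_unique[OF o(1) coneO_loc[OF o(2)]])
      (use z coneA[OF fh] homsD[OF cone_out_homs[OF o(1)]] homsD[OF cone_out_homs[OF o(2)]] in auto)
  then show "cone_out ?b \<cdot>\<^bsub>E\<^esub> onA cone_ftr f = onA (shift_ftr E \<odot> (L \<odot> R)) f \<cdot>\<^bsub>E\<^esub> cone_out ?a"
    using z(3) by (simp add: cone_ftr_def shift_ftr_def)
qed

lemma cone_additive: "additive_functor E E coneO coneA"
  unfolding additive_functor_def
proof (intro conjI ballI)
  show "is_functor E E coneO coneA" using cone_fctr by (simp add: fctr_def cone_ftr_def)
  fix a b f g assume *: "a \<in> obs E" "b \<in> obs E" "f \<in> homs E a b" "g \<in> homs E a b"
  note s = E.hadd_homs[OF *(3,4)] and h = cone_in_homs[OF *(1)] cone_in_homs[OF *(2)]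
  note c = loc_obs[OF coneO_loc[OF *(1)]] loc_obs[OF coneO_loc[OF *(2)]]
  note A = coneA[OF *(3)] coneA[OF *(4)] coneA[OF s]
  show "coneA (hadd E a b f g) = hadd E (coneO a) (coneO b) (coneA f) (coneA g)"
    by (rule coneO_unique[OF *(1) coneO_loc[OF *(2)] A(5) E.hadd_homs[OF A(1,3)]])
      (simp add: A E.hadd_cmp[OF h(1) A(1,3) *(1) c] E.cmp_hadd[OF *(3,4) h(2) *(1,2) c(2)])
qed

text \<open>Uniqueness of universal arrows; it will compare the chosen cones with objects produced
  by other triangles.\<close>

lemma reflection_iso:
  assumes "reflection b" "reflection b'" "dm E b = dm E b'" "e \<in> homs E (cd E b) (cd E b')" "e \<cdot>\<^bsub>E\<^esub> b = b'"
  shows "is_iso E e"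
proof -
  have l: "cd E b \<in> loc" "cd E b' \<in> loc" and bh: "b \<in> homs E (dm E b) (cd E b)" "b' \<in> homs E (dm E b) (cd E b')"
    using assms(1-3) by (auto simp: reflection_def homs_def)
  obtain e' where e': "e' \<in> homs E (cd E b') (cd E b)" "e' \<cdot>\<^bsub>E\<^esub> b' = b"
    using reflection_ex[OF assms(2) l(1), of b] assms(3) bh by auto
  show ?thesis
  proof (rule is_isoI[OF E.cat assms(4) e'(1)])
    show "e' \<cdot>\<^bsub>E\<^esub> e = idn E (cd E b)"
      by (rule reflection_unique[OF assms(1) l(1) cmp_homs[OF E.cat assms(4) e'(1)] idn_homs[OF E.cat loc_obs[OF l(1)]]])
        (use cmp_assoc_homs[OF E.cat bh(1) assms(4) e'(1)] assms(5) e' bh in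
          \<open>simp add: idn_cmp[OF E.cat] homs_def\<close>)
    show "e \<cdot>\<^bsub>E\<^esub> e' = idn E (cd E b')"
      by (rule reflection_unique[OF assms(2) l(2) cmp_homs[OF E.cat e'(1) assms(4)] idn_homs[OF E.cat loc_obs[OF l(2)]]])
        (use cmp_assoc_homs[OF E.cat bh(2) e'(1) assms(4)] assms(5) e' bh in
          \<open>simp add: idn_cmp[OF E.cat] homs_def\<close>)
  qed
qed

definition cone_shift :: "'o \<Rightarrow> 'm" where
  "cone_shift M = (SOME x. x \<in> homs E (coneO (sho E M)) (sho E (coneO M)) \<and>
      x \<cdot>\<^bsub>E\<^esub> cone_in (sho E M) = sha E (cone_in M))"

lemma cone_shift:
  assumes "M \<in> obs E"
  shows "cone_shift M \<in> homs E (coneO (sho E M)) (sho E (coneO M))"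
    "cone_shift M \<cdot>\<^bsub>E\<^esub> cone_in (sho E M) = sha E (cone_in M)"
proof -
  have o: "sho E M \<in> obs E" using assms by (simp add: simps)
  have "\<exists>x. x \<in> homs E (coneO (sho E M)) (sho E (coneO M)) \<and> x \<cdot>\<^bsub>E\<^esub> cone_in (sho E M) = sha E (cone_in M)"
    using reflection_ex[OF cone_in_reflection[OF o] loc_shift[OF coneO_loc[OF assms]], of "sha E (cone_in M)"]
      cone_in_homs[OF assms] homsD[OF cone_in_homs[OF o]] by (auto simp: homs_def simps)
  from someI_ex[OF this] show "cone_shift M \<in> homs E (coneO (sho E M)) (sho E (coneO M))"
    "cone_shift M \<cdot>\<^bsub>E\<^esub> cone_in (sho E M) = sha E (cone_in M)"
    unfolding cone_shift_def by auto
qed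

lemma cone_shift_iso: "M \<in> obs E \<Longrightarrow> is_iso E (cone_shift M)"
  using cone_shift[of M] homsD[OF cone_in_homs[of M]] homsD[OF cone_in_homs[of "sho E M"]]
  by (intro reflection_iso[OF cone_in_reflection shift_cone_in_reflection]) (auto simp: simps)

lemma cone_shift_nat: "nat_trans E E (cone_ftr \<odot> shift_ftr E) (shift_ftr E \<odot> cone_ftr) cone_shift"
  unfolding nat_trans_def
proof (intro conjI ballI)
  fix M assume "M \<in> obs E"
  then show "cone_shift M \<in> homs E (onO (cone_ftr \<odot> shift_ftr E) M) (onO (shift_ftr E \<odot> cone_ftr) M)"
    using cone_shift by (simp add: cone_ftr_def shift_ftr_def)
next
  fix f assume f: "f \<in> ars E"
  let ?a = "dm E f" and ?b = "cd E f"
  have fh: "f \<in> homs E ?a ?b" and o: "?a \<in> obs E" "?b \<in> obs E" using f by (auto simp: homs_def simps)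
  have sf: "sha E f \<in> homs E (sho E ?a) (sho E ?b)" using f by (simp add: homs_def simps)
  note so = E.homs_obs[OF sf]
  note A = coneA[OF fh] coneA[OF sf] and S = cone_shift[OF o(1)] cone_shift[OF o(2)]
  note h = cone_in_homs[OF o(1)] cone_in_homs[OF o(2)] cone_in_homs[OF so(1)] cone_in_homs[OF so(2)]
  have sA: "sha E (coneA f) \<in> homs E (sho E (coneO ?a)) (sho E (coneO ?b))"
    using A(1) by (auto simp: homs_def simps)
  have "cone_shift ?b \<cdot>\<^bsub>E\<^esub> coneA (sha E f) = sha E (coneA f) \<cdot>\<^bsub>E\<^esub> cone_shift ?a"
  proof (rule coneO_unique[OF so(1) loc_shift[OF coneO_loc[OF o(2)]] cmp_homs[OF E.cat A(3) S(3)]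
        cmp_homs[OF E.cat S(1) sA]])
    have "(cone_shift ?b \<cdot>\<^bsub>E\<^esub> coneA (sha E f)) \<cdot>\<^bsub>E\<^esub> cone_in (sho E ?a) = sha E (cone_in ?b) \<cdot>\<^bsub>E\<^esub> sha E f"
      using cmp_assoc_homs[OF E.cat h(3) A(3) S(3)] A(4) cmp_assoc_homs[OF E.cat sf h(4) S(3)] S(4) by simp
    also have "\<dots> = sha E (coneA f) \<cdot>\<^bsub>E\<^esub> sha E (cone_in ?a)"
      using E.shift_simps(6)[of f "cone_in ?b"] E.shift_simps(6)[of "cone_in ?a" "coneA f"] A(1,2) h f
      by (simp add: homs_def)
    also have "\<dots> = (sha E (coneA f) \<cdot>\<^bsub>E\<^esub> cone_shift ?a) \<cdot>\<^bsub>E\<^esub> cone_in (sho E ?a)"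
      using cmp_assoc_homs[OF E.cat h(3) S(1) sA] S(2) by simp
    finally show "(cone_shift ?b \<cdot>\<^bsub>E\<^esub> coneA (sha E f)) \<cdot>\<^bsub>E\<^esub> cone_in (sho E ?a) =
      (sha E (coneA f) \<cdot>\<^bsub>E\<^esub> cone_shift ?a) \<cdot>\<^bsub>E\<^esub> cone_in (sho E ?a)" .
  qed
  then show "cone_shift ?b \<cdot>\<^bsub>E\<^esub> onA (cone_ftr \<odot> shift_ftr E) f =
      onA (shift_ftr E \<odot> cone_ftr) f \<cdot>\<^bsub>E\<^esub> cone_shift ?a"
    by (simp add: cone_ftr_def shift_ftr_def)
qed

text \<open>The five lemma for Hom(_, w), written out. The vertical maps at the first two objects
  and at their shifts are reflections, so they induce bijections on maps to local objects; the
  vertical map \<open>z\<close> at the third object inherits this.\<close>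

lemma cone_map_reflection:
  assumes T: "(f, g, h) \<in> tri E" and T': "(coneA f, k, l) \<in> tri E"
    and z: "z \<in> homs E (cd E g) (cd E k)" "z \<cdot>\<^bsub>E\<^esub> g = k \<cdot>\<^bsub>E\<^esub> cone_in (cd E f)"
      "sha E (cone_in (dm E f)) \<cdot>\<^bsub>E\<^esub> h = l \<cdot>\<^bsub>E\<^esub> z"
  shows "reflection z"
proof -
  let ?M = "dm E f" and ?N = "cd E f" and ?P = "cd E g" and ?K = "cd E k"
  note t = E.triD[OF T] and t' = E.triD[OF T']
  have f: "f \<in> homs E ?M ?N" and g: "g \<in> homs E ?N ?P" and h: "h \<in> homs E ?P (sho E ?M)"
    using t by (auto simp: homs_def)
  note o = E.homs_obs[OF f] E.homs_obs[OF g] E.homs_obs[OF h]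
  note A = coneA[OF f]
  have k: "k \<in> homs E (coneO ?N) ?K" and l: "l \<in> homs E ?K (sho E (coneO ?M))"
    using t' homsD[OF A(1)] by (auto simp: homs_def)
  have K: "?K \<in> loc" using loc_cone[OF T'] homsD[OF A(1)] coneO_loc o by simp
  let ?b = "cone_in ?M" and ?c = "cone_in ?N"
  note b = cone_in_homs[OF o(1)] and c = cone_in_homs[OF o(2)]
  have sb: "sha E ?b \<in> homs E (sho E ?M) (sho E (coneO ?M))"
    and sc: "sha E ?c \<in> homs E (sho E ?N) (sho E (coneO ?N))"
    and sf: "sha E f \<in> homs E (sho E ?M) (sho E ?N)"
    and sA: "sha E (coneA f) \<in> homs E (sho E (coneO ?M)) (sho E (coneO ?N))"
    using b c f A(1) by (auto simp: homs_def simps)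
  note R = cone_in_reflection[OF o(1)] cone_in_reflection[OF o(2)]
    shift_cone_in_reflection[OF o(1)] shift_cone_in_reflection[OF o(2)]
  have zM: "x = hzero E (coneO ?M) w"
    if "w \<in> loc" "x \<in> homs E (coneO ?M) w" "x \<cdot>\<^bsub>E\<^esub> ?b = hzero E ?M w" for x w
    using coneO_unique[OF o(1) that(1,2) E.hzero_homs] E.homs_obs[OF b] loc_obs[OF that(1)]
      E.hzero_cmp[OF b loc_obs[OF that(1)]] that(3) by simp
  have zN: "x = hzero E (coneO ?N) w"
    if "w \<in> loc" "x \<in> homs E (coneO ?N) w" "x \<cdot>\<^bsub>E\<^esub> ?c = hzero E ?N w" for x w
    using coneO_unique[OF o(2) that(1,2) E.hzero_homs] E.homs_obs[OF c] loc_obs[OF that(1)]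
      E.hzero_cmp[OF c loc_obs[OF that(1)]] that(3) by simp
  show ?thesis
  proof (rule reflectionI)
    show "z \<in> ars E" "cd E z \<in> loc" using homsD[OF z(1)] K by auto
    fix w assume w: "w \<in> loc"
    note wo = loc_obs[OF w]
    show "\<exists>y\<in>homs E (cd E z) w. y \<cdot>\<^bsub>E\<^esub> z = x" if "x \<in> homs E (dm E z) w" for x
    proof -
      have x: "x \<in> homs E ?P w" using that homsD[OF z(1)] by simp
      note xg = cmp_homs[OF E.cat g x]
      obtain t1 where t1: "t1 \<in> homs E (coneO ?N) w" "t1 \<cdot>\<^bsub>E\<^esub> ?c = x \<cdot>\<^bsub>E\<^esub> g"
        using reflection_ex[OF R(2) w, of "x \<cdot>\<^bsub>E\<^esub> g"] xg homsD[OF c] by auto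
      have "(t1 \<cdot>\<^bsub>E\<^esub> coneA f) \<cdot>\<^bsub>E\<^esub> ?b = (x \<cdot>\<^bsub>E\<^esub> g) \<cdot>\<^bsub>E\<^esub> f"
        using cmp_assoc_homs[OF E.cat b A(1) t1(1)] A(2) cmp_assoc_homs[OF E.cat f c t1(1)] t1(2) by simp
      also have "\<dots> = hzero E ?M w"
        using cmp_assoc_homs[OF E.cat f g x] E.tri_consecutive[OF T] E.cmp_hzero[OF x o(1)] by simp
      finally have "t1 \<cdot>\<^bsub>E\<^esub> coneA f = hzero E (coneO ?M) w"
        by (rule zM[OF w cmp_homs[OF E.cat A(1) t1(1)]])
      then obtain t2 where t2: "t2 \<in> homs E ?K w" "t1 = t2 \<cdot>\<^bsub>E\<^esub> k"
        using E.tri_weak_cokernel[OF T', of t1 w] t1 homsD[OF A(1)] by auto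
      have t2z: "t2 \<cdot>\<^bsub>E\<^esub> z \<in> homs E ?P w" by (rule cmp_homs[OF E.cat z(1) t2(1)])
      have e: "(t2 \<cdot>\<^bsub>E\<^esub> z) \<cdot>\<^bsub>E\<^esub> g = x \<cdot>\<^bsub>E\<^esub> g"
        using cmp_assoc_homs[OF E.cat g z(1) t2(1)] z(2) cmp_assoc_homs[OF E.cat c k t2(1)] t2(2) t1(2)
        by simp
      \<comment> \<open>The candidate \<open>t2\<close> is right only after composition with
        \<open>g\<close>. The error \<open>d\<close> vanishes on \<open>g\<close>, hence factors
        through \<open>h\<close>, and the reflection of the shifted first object rewrites it as a
        correction t4 l of \<open>t2\<close>.\<close>
      obtain d where d: "d \<in> homs E ?P w" "x = hadd E ?P w d (t2 \<cdot>\<^bsub>E\<^esub> z)"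
        using E.hsub_ex[OF x t2z] .
      have "hadd E ?N w (d \<cdot>\<^bsub>E\<^esub> g) (x \<cdot>\<^bsub>E\<^esub> g) = x \<cdot>\<^bsub>E\<^esub> g"
        using E.hadd_cmp[OF g d(1) t2z o(3,4) wo] d(2) e by simp
      then have "d \<cdot>\<^bsub>E\<^esub> g = hzero E ?N w"
        by (rule E.hadd_cancel_zero[OF cmp_homs[OF E.cat g d(1)] xg])
      then obtain t3 where t3: "t3 \<in> homs E (sho E ?M) w" "d = t3 \<cdot>\<^bsub>E\<^esub> h"
        using E.tri_weak_cokernel2[OF T, of d w] d(1) t by auto
      obtain t4 where t4: "t4 \<in> homs E (sho E (coneO ?M)) w" "t4 \<cdot>\<^bsub>E\<^esub> sha E ?b = t3"
        using reflection_ex[OF R(3) w, of t3] t3(1) homsD[OF sb] by auto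
      have "d = (t4 \<cdot>\<^bsub>E\<^esub> l) \<cdot>\<^bsub>E\<^esub> z"
        using t3(2) t4(2) cmp_assoc_homs[OF E.cat h sb t4(1)] z(3)
          cmp_assoc_homs[OF E.cat z(1) l t4(1)] by simp
      then have "x = hadd E ?K w (t4 \<cdot>\<^bsub>E\<^esub> l) t2 \<cdot>\<^bsub>E\<^esub> z"
        using d(2) E.hadd_cmp[OF z(1) cmp_homs[OF E.cat l t4(1)] t2(1) E.homs_obs[OF z(1)] wo] by simp
      then show ?thesis
        using E.hadd_homs[OF cmp_homs[OF E.cat l t4(1)] t2(1)] homsD[OF z(1)] by auto
    qed
    show "x = hzero E (cd E z) w"
      if "x \<in> homs E (cd E z) w" "x \<cdot>\<^bsub>E\<^esub> z = hzero E (dm E z) w" for x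
    proof -
      have x: "x \<in> homs E ?K w" "x \<cdot>\<^bsub>E\<^esub> z = hzero E ?P w" using that homsD[OF z(1)] by auto
      have "(x \<cdot>\<^bsub>E\<^esub> k) \<cdot>\<^bsub>E\<^esub> ?c = (x \<cdot>\<^bsub>E\<^esub> z) \<cdot>\<^bsub>E\<^esub> g"
        using cmp_assoc_homs[OF E.cat c k x(1)] cmp_assoc_homs[OF E.cat g z(1) x(1)] z(2) by simp
      then have "x \<cdot>\<^bsub>E\<^esub> k = hzero E (coneO ?N) w"
        using zN[OF w cmp_homs[OF E.cat k x(1)]] x(2) E.hzero_cmp[OF g wo] by simp
      then obtain t5 where t5: "t5 \<in> homs E (sho E (coneO ?M)) w" "x = t5 \<cdot>\<^bsub>E\<^esub> l"
        using E.tri_weak_cokernel2[OF T', of x w] x(1) t' homsD[OF A(1)] by auto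
      have "(t5 \<cdot>\<^bsub>E\<^esub> sha E ?b) \<cdot>\<^bsub>E\<^esub> h = hzero E ?P w"
        using cmp_assoc_homs[OF E.cat h sb t5(1)] z(3) cmp_assoc_homs[OF E.cat z(1) l t5(1)] t5(2) x(2)
        by simp
      then obtain t6 where t6: "t6 \<in> homs E (sho E ?N) w" "t5 \<cdot>\<^bsub>E\<^esub> sha E ?b = t6 \<cdot>\<^bsub>E\<^esub> sha E f"
        using E.tri_weak_cokernel3[OF T, of "t5 \<cdot>\<^bsub>E\<^esub> sha E ?b" w] cmp_homs[OF E.cat sb t5(1)] t by auto
      obtain t7 where t7: "t7 \<in> homs E (sho E (coneO ?N)) w" "t7 \<cdot>\<^bsub>E\<^esub> sha E ?c = t6"
        using reflection_ex[OF R(4) w, of t6] t6(1) homsD[OF sc] by auto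
      have "sha E ?c \<cdot>\<^bsub>E\<^esub> sha E f = sha E (coneA f) \<cdot>\<^bsub>E\<^esub> sha E ?b"
        using E.shift_simps(6)[of f ?c] E.shift_simps(6)[of ?b "coneA f"] homsD[OF f] homsD[OF c]
          homsD[OF b] homsD[OF A(1)] A(2) by simp
      then have "t5 \<cdot>\<^bsub>E\<^esub> sha E ?b = (t7 \<cdot>\<^bsub>E\<^esub> sha E (coneA f)) \<cdot>\<^bsub>E\<^esub> sha E ?b"
        using t6(2) t7(2) cmp_assoc_homs[OF E.cat sf sc t7(1)] cmp_assoc_homs[OF E.cat sb sA t7(1)] by simp
      then have "t5 = t7 \<cdot>\<^bsub>E\<^esub> sha E (coneA f)"
        using reflection_unique[OF R(3) w, of t5 "t7 \<cdot>\<^bsub>E\<^esub> sha E (coneA f)"] t5(1)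
          cmp_homs[OF E.cat sA t7(1)] homsD[OF sb] by simp
      then have "x = t7 \<cdot>\<^bsub>E\<^esub> (sha E (coneA f) \<cdot>\<^bsub>E\<^esub> l)"
        using t5(2) cmp_assoc_homs[OF E.cat l sA t7(1)] by simp
      \<comment> \<open>Two signs are inserted because the rotated triangle contains the negative of
        the shifted map, and consecutive maps vanish in that form.\<close>
      also have "\<dots> = hneg E t7 \<cdot>\<^bsub>E\<^esub> (hneg E (sha E (coneA f)) \<cdot>\<^bsub>E\<^esub> l)"
      proof -
        note n = E.hneg_homs[OF sA] E.hneg_homs[OF t7(1)]
        have "hneg E t7 \<cdot>\<^bsub>E\<^esub> hneg E (sha E (coneA f)) = t7 \<cdot>\<^bsub>E\<^esub> hneg E (hneg E (sha E (coneA f)))"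
          using E.cmp_hneg[OF n(1) t7(1)] by simp
        moreover have "hneg E (hneg E (sha E (coneA f))) = sha E (coneA f)"
        proof (rule E.hadd_cancel)
          show "hneg E (hneg E (sha E (coneA f))) \<in> homs E (sho E (coneO ?M)) (sho E (coneO ?N))"
            "sha E (coneA f) \<in> homs E (sho E (coneO ?M)) (sho E (coneO ?N))"
            "hneg E (sha E (coneA f)) \<in> homs E (sho E (coneO ?M)) (sho E (coneO ?N))"
            using sA n(1) E.hneg_homs by auto
          interpret G: comm_group "hom_grp E (sho E (coneO ?M)) (sho E (coneO ?N))"
            by (rule E.grp[OF E.homs_obs[OF sA]])
          show "hadd E (sho E (coneO ?M)) (sho E (coneO ?N)) (hneg E (hneg E (sha E (coneA f)))) (hneg E (sha E (coneA f)))
            = hadd E (sho E (coneO ?M)) (sho E (coneO ?N)) (sha E (coneA f)) (hneg E (sha E (coneA f)))"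
            using E.hneg_hadd[OF n(1)] E.hneg_hadd[OF sA]
              G.m_comm[of "sha E (coneA f)" "hneg E (sha E (coneA f))"] sA n(1)
            by (simp add: hom_grp_def)
        qed
        ultimately show ?thesis
          using cmp_assoc_homs[OF E.cat l n] cmp_assoc_homs[OF E.cat l sA t7(1)] by simp
      qed
      also have "hneg E (sha E (coneA f)) \<cdot>\<^bsub>E\<^esub> l = hzero E ?K (sho E (coneO ?N))"
        using E.tri_consecutive[OF E.tri_rotated[OF T']] t'(4)
          E.tri_consecutive[OF E.tri_rotated[OF E.tri_rotated[OF T']]] homsD[OF l] homsD[OF k]
          homsD[OF E.hneg_homs[OF sA]] by simp
      finally show ?thesis
        using E.cmp_hzero[OF E.hneg_homs[OF t7(1)]] E.homs_obs[OF l] homsD[OF z(1)] by simp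
    qed
  qed
qed

text \<open>Complete \<open>coneA f\<close> to any triangle, with third object \<open>?K\<close>. By
  the preceding lemma \<open>?K\<close> is also a reflection of the third object of the original
  triangle, so a unique isomorphism \<open>i\<close> identifies it with the chosen cone. Uniqueness
  matches the remaining two maps, and the triangle is transported along \<open>i\<close>.\<close>

lemma cone_triangle:
  assumes T: "(f, g, h) \<in> tri E"
  shows "(coneA f, coneA g, cone_shift (dm E f) \<cdot>\<^bsub>E\<^esub> coneA h) \<in> tri E"
proof -
  let ?M = "dm E f" and ?N = "cd E f" and ?P = "cd E g"
  note t = E.triD[OF T]
  have f: "f \<in> homs E ?M ?N" and g: "g \<in> homs E ?N ?P" and h: "h \<in> homs E ?P (sho E ?M)"
    using t by (auto simp: homs_def)
  note o = E.homs_obs[OF f] E.homs_obs[OF g] E.homs_obs[OF h]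
  note A = coneA[OF f] coneA[OF g] coneA[OF h] and S = cone_shift[OF o(1)]
  obtain k l where T': "(coneA f, k, l) \<in> tri E"
    using E.tri_complete[OF homsD(1)[OF A(1)]] by blast
  note t' = E.triD[OF T']
  let ?K = "cd E k"
  have k: "k \<in> homs E (coneO ?N) ?K" and l: "l \<in> homs E ?K (sho E (coneO ?M))"
    using t' homsD[OF A(1)] by (auto simp: homs_def)
  note b = cone_in_homs[OF o(1)] and c = cone_in_homs[OF o(2)] and d = cone_in_homs[OF o(4)]
    and e = cone_in_homs[OF o(6)]
  obtain z where z: "z \<in> homs E ?P ?K" "z \<cdot>\<^bsub>E\<^esub> g = k \<cdot>\<^bsub>E\<^esub> cone_in ?N"
      "sha E (cone_in ?M) \<cdot>\<^bsub>E\<^esub> h = l \<cdot>\<^bsub>E\<^esub> z"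
    using E.tri_map[OF T T', of "cone_in ?M" "cone_in ?N"] A b c t t' homsD[OF k] homsD[OF A(1)] by auto
  have zr: "reflection z" by (rule cone_map_reflection[OF T T' z])
  have K: "?K \<in> loc" using zr homsD[OF z(1)] by (simp add: reflection_def)
  obtain i where i: "i \<in> homs E (coneO ?P) ?K" "i \<cdot>\<^bsub>E\<^esub> cone_in ?P = z"
    using reflection_ex[OF cone_in_reflection[OF o(4)] K, of z] z(1) homsD[OF d] by auto
  have ii: "is_iso E i"
    by (rule reflection_iso[OF cone_in_reflection[OF o(4)] zr]) (use homsD[OF d] homsD[OF z(1)] i in auto)
  have 1: "i \<cdot>\<^bsub>E\<^esub> coneA g = k"
    by (rule coneO_unique[OF o(2) K cmp_homs[OF E.cat A(3) i(1)] k])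
      (use cmp_assoc_homs[OF E.cat c A(3) i(1)] A(4) cmp_assoc_homs[OF E.cat g d i(1)] i(2) z(2) in simp)
  have 2: "l \<cdot>\<^bsub>E\<^esub> i = cone_shift ?M \<cdot>\<^bsub>E\<^esub> coneA h"
    by (rule coneO_unique[OF o(4) loc_shift[OF coneO_loc[OF o(1)]] cmp_homs[OF E.cat i(1) l]
          cmp_homs[OF E.cat A(5) S(1)]])
      (use cmp_assoc_homs[OF E.cat d i(1) l] i(2) z(3) S(2) A(6) cmp_assoc_homs[OF E.cat h e S(1)]
        cmp_assoc_homs[OF E.cat d A(5) S(1)] in simp)
  have oc: "coneO ?M \<in> obs E" "coneO ?N \<in> obs E" using E.homs_obs[OF A(1)] by auto
  note dA = homsD[OF A(1)] homsD[OF A(3)] homsD[OF cmp_homs[OF E.cat A(5) S(1)]] homsD[OF k] homsD[OF l]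
  show ?thesis
  proof (rule E.tri_iso[OF T'])
    show "pre_triangle E (coneA f) (coneA g) (cone_shift ?M \<cdot>\<^bsub>E\<^esub> coneA h)"
      using dA by (simp add: pre_triangle_def)
    show "idn E (coneO ?M) \<in> homs E (dm E (coneA f)) (dm E (coneA f))"
      "idn E (coneO ?N) \<in> homs E (dm E k) (dm E (coneA g))"
      "inver E i \<in> homs E (dm E l) (dm E (cone_shift ?M \<cdot>\<^bsub>E\<^esub> coneA h))"
      using dA idn_homs[OF E.cat oc(1)] idn_homs[OF E.cat oc(2)] inver_homs[OF E.cat ii i(1)] by auto
    show "is_iso E (idn E (coneO ?M))" "is_iso E (idn E (coneO ?N))" "is_iso E (inver E i)"
      using oc ii by (auto intro: is_iso_idn[OF E.cat] is_iso_inver[OF E.cat])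
    show "idn E (coneO ?N) \<cdot>\<^bsub>E\<^esub> coneA f = coneA f \<cdot>\<^bsub>E\<^esub> idn E (coneO ?M)"
      using dA by (simp add: cmp_idn[OF E.cat] idn_cmp[OF E.cat])
    note v = inver_homs[OF E.cat ii i(1)]
    show "inver E i \<cdot>\<^bsub>E\<^esub> k = coneA g \<cdot>\<^bsub>E\<^esub> idn E (coneO ?N)"
      unfolding 1[symmetric] using cmp_assoc_homs[OF E.cat A(3) i(1) v] inver_cmp[OF E.cat ii] homsD[OF i(1)] dA
      by (simp add: cmp_idn[OF E.cat] idn_cmp[OF E.cat])
    show "sha E (idn E (coneO ?M)) \<cdot>\<^bsub>E\<^esub> l = (cone_shift ?M \<cdot>\<^bsub>E\<^esub> coneA h) \<cdot>\<^bsub>E\<^esub> inver E i"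
      unfolding 2[symmetric] using cmp_assoc_homs[OF E.cat v i(1) l] cmp_inver[OF E.cat ii] homsD[OF i(1)] dA oc
      by (simp add: cmp_idn[OF E.cat] idn_cmp[OF E.cat] simps)
  qed
qed

lemma cone_triangulated: "triangulated_functor E E cone_ftr"
  unfolding triangulated_functor_def
  using cone_additive cone_shift_nat cone_shift_iso cone_triangle
  by (auto simp: cone_ftr_def intro!: exI[of _ cone_shift])

end

section \<open>Open subspaces and open immersions\<close>

lemma
  assumes "lrs X"
  shows lrs_local: "x \<in> pts X \<Longrightarrow> local_ring (stalk X x)"
    and lrs_sec_PiE: "openin (ktop X) U \<Longrightarrow> s \<in> secs X U \<Longrightarrow> s \<in> (\<Pi>\<^sub>E x\<in>U. carrier (stalk X x))"
    and lrs_sec_ring: "openin (ktop X) U \<Longrightarrow> cring (sec_ring X U)"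
    and lrs_restrict: "openin (ktop X) U \<Longrightarrow> openin (ktop X) V \<Longrightarrow> V \<subseteq> U \<Longrightarrow> s \<in> secs X U \<Longrightarrow>
       restrict s V \<in> secs X V"
    and lrs_glue: "openin (ktop X) U \<Longrightarrow> s \<in> (\<Pi>\<^sub>E x\<in>U. carrier (stalk X x)) \<Longrightarrow>
       \<forall>x\<in>U. \<exists>V. openin (ktop X) V \<and> x \<in> V \<and> V \<subseteq> U \<and> restrict s V \<in> secs X V \<Longrightarrow> s \<in> secs X U"
proof -
  have *: "\<forall>x\<in>pts X. local_ring (stalk X x)"
    "\<forall>U. openin (ktop X) U \<longrightarrow>
        secs X U \<subseteq> (\<Pi>\<^sub>E x\<in>U. carrier (stalk X x)) \<and> cring (sec_ring X U) \<and>
        (\<forall>V s. openin (ktop X) V \<and> V \<subseteq> U \<and> s \<in> secs X U \<longrightarrow> restrict s V \<in> secs X V) \<and>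
        (\<forall>s\<in>(\<Pi>\<^sub>E x\<in>U. carrier (stalk X x)).
           (\<forall>x\<in>U. \<exists>V. openin (ktop X) V \<and> x \<in> V \<and> V \<subseteq> U \<and> restrict s V \<in> secs X V)
           \<longrightarrow> s \<in> secs X U)"
    using assms unfolding lrs_def by - (elim conjE, assumption)+
  show "x \<in> pts X \<Longrightarrow> local_ring (stalk X x)" using *(1) by simp
  show "openin (ktop X) U \<Longrightarrow> s \<in> secs X U \<Longrightarrow> s \<in> (\<Pi>\<^sub>E x\<in>U. carrier (stalk X x))"
    "openin (ktop X) U \<Longrightarrow> cring (sec_ring X U)"
    "openin (ktop X) U \<Longrightarrow> openin (ktop X) V \<Longrightarrow> V \<subseteq> U \<Longrightarrow> s \<in> secs X U \<Longrightarrow> restrict s V \<in> secs X V"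
    "openin (ktop X) U \<Longrightarrow> s \<in> (\<Pi>\<^sub>E x\<in>U. carrier (stalk X x)) \<Longrightarrow>
       \<forall>x\<in>U. \<exists>V. openin (ktop X) V \<and> x \<in> V \<and> V \<subseteq> U \<and> restrict s V \<in> secs X V \<Longrightarrow> s \<in> secs X U"
    using *(2)[rule_format, of U] by auto
qed

lemma
  assumes "lrs X"
  shows lrs_germ: "x \<in> pts X \<Longrightarrow> r \<in> carrier (stalk X x) \<Longrightarrow>
       \<exists>U s. openin (ktop X) U \<and> x \<in> U \<and> s \<in> secs X U \<and> s x = r"
    and lrs_germ_eq: "openin (ktop X) U \<Longrightarrow> openin (ktop X) V \<Longrightarrow> s \<in> secs X U \<Longrightarrow> t \<in> secs X V \<Longrightarrow>
       x \<in> U \<inter> V \<Longrightarrow> s x = t x \<Longrightarrow> \<exists>W. openin (ktop X) W \<and> x \<in> W \<and> W \<subseteq> U \<inter> V \<and> (\<forall>y\<in>W. s y = t y)"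
    and lrs_scal_hom: "x \<in> pts X \<Longrightarrow> scal X x \<in> ring_hom field_ring (stalk X x)"
    and lrs_scal_sec: "(\<lambda>x\<in>pts X. scal X x c) \<in> secs X (pts X)"
proof -
  have *: "\<forall>x\<in>pts X. \<forall>r\<in>carrier (stalk X x). \<exists>U s. openin (ktop X) U \<and> x \<in> U \<and> s \<in> secs X U \<and> s x = r"
    "\<forall>U V s t x. openin (ktop X) U \<and> openin (ktop X) V \<and> s \<in> secs X U \<and> t \<in> secs X V \<and>
        x \<in> U \<inter> V \<and> s x = t x \<longrightarrow>
        (\<exists>W. openin (ktop X) W \<and> x \<in> W \<and> W \<subseteq> U \<inter> V \<and> (\<forall>y\<in>W. s y = t y))"
    "\<forall>x\<in>pts X. scal X x \<in> ring_hom field_ring (stalk X x)"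
    "\<forall>c. (\<lambda>x\<in>pts X. scal X x c) \<in> secs X (pts X)"
    using assms unfolding lrs_def by - (elim conjE, assumption)+
  show "x \<in> pts X \<Longrightarrow> r \<in> carrier (stalk X x) \<Longrightarrow>
       \<exists>U s. openin (ktop X) U \<and> x \<in> U \<and> s \<in> secs X U \<and> s x = r" using *(1) by blast
  show "openin (ktop X) U \<Longrightarrow> openin (ktop X) V \<Longrightarrow> s \<in> secs X U \<Longrightarrow> t \<in> secs X V \<Longrightarrow>
       x \<in> U \<inter> V \<Longrightarrow> s x = t x \<Longrightarrow> \<exists>W. openin (ktop X) W \<and> x \<in> W \<and> W \<subseteq> U \<inter> V \<and> (\<forall>y\<in>W. s y = t y)"
    using *(2)[rule_format, of U V s t x] by blast
  show "x \<in> pts X \<Longrightarrow> scal X x \<in> ring_hom field_ring (stalk X x)"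
    "(\<lambda>x\<in>pts X. scal X x c) \<in> secs X (pts X)" using *(3,4) by auto
qed

lemma lrs_sec_carrier:
  "lrs X \<Longrightarrow> openin (ktop X) U \<Longrightarrow> s \<in> secs X U \<Longrightarrow> x \<in> U \<Longrightarrow> s x \<in> carrier (stalk X x)"
  using lrs_sec_PiE by blast

lemma lrs_sec_restrict: "lrs X \<Longrightarrow> openin (ktop X) U \<Longrightarrow> s \<in> secs X U \<Longrightarrow> restrict s U = s"
  using lrs_sec_PiE[of X U s] by (simp add: PiE_def extensional_restrict)

lemma openin_pts: "openin (ktop X) U \<Longrightarrow> x \<in> U \<Longrightarrow> x \<in> pts X"
  using openin_subset by blast

lemma lrs_stalk_cring: "lrs X \<Longrightarrow> x \<in> pts X \<Longrightarrow> cring (stalk X x)"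
  using lrs_local[of X x] by (simp add: local_ring_def)

lemma lrs_scal_carrier: "lrs X \<Longrightarrow> x \<in> pts X \<Longrightarrow> scal X x c \<in> carrier (stalk X x)"
  using ring_hom_closed[OF lrs_scal_hom, of X x c] by (simp add: field_ring_def)

text \<open>Gluing in its most convenient form: local agreement with sections already puts the
  values into the stalks, so only extensionality remains to be supplied.\<close>

lemma lrs_glue_eq:
  assumes X: "lrs X" and U: "openin (ktop X) U" and s: "s \<in> extensional U"
    and loc: "\<And>x. x \<in> U \<Longrightarrow> \<exists>V t. openin (ktop X) V \<and> x \<in> V \<and> t \<in> secs X V \<and> (\<forall>y\<in>V \<inter> U. s y = t y)"
  shows "s \<in> secs X U"
proof (rule lrs_glue[OF X U _ ballI])
  show "s \<in> (\<Pi>\<^sub>E x\<in>U. carrier (stalk X x))"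
  proof (rule PiE_I)
    fix x assume x: "x \<in> U"
    obtain V t where V: "openin (ktop X) V" "x \<in> V" "t \<in> secs X V" "\<forall>y\<in>V \<inter> U. s y = t y"
      using loc[OF x] by blast
    then show "s x \<in> carrier (stalk X x)" using lrs_sec_carrier[OF X V(1,3,2)] x by simp
  qed (use s in \<open>simp add: extensional_def\<close>)
  fix x assume x: "x \<in> U"
  obtain V t where V: "openin (ktop X) V" "x \<in> V" "t \<in> secs X V" "\<forall>y\<in>V \<inter> U. s y = t y"
    using loc[OF x] by blast
  have o: "openin (ktop X) (V \<inter> U)" using V U by blast
  have "restrict s (V \<inter> U) = restrict t (V \<inter> U)" using V(4) by (auto simp: restrict_def fun_eq_iff)
  then have "restrict s (V \<inter> U) \<in> secs X (V \<inter> U)" using lrs_restrict[OF X V(1) o _ V(3)] by simp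
  then show "\<exists>V. openin (ktop X) V \<and> x \<in> V \<and> V \<subseteq> U \<and> restrict s V \<in> secs X V"
    using o x V(2) by blast
qed

lemma sec_ring_simps:
  "carrier (sec_ring X U) = secs X U"
  "x \<in> U \<Longrightarrow> (s \<otimes>\<^bsub>sec_ring X U\<^esub> t) x = s x \<otimes>\<^bsub>stalk X x\<^esub> t x"
  "x \<in> U \<Longrightarrow> (s \<oplus>\<^bsub>sec_ring X U\<^esub> t) x = s x \<oplus>\<^bsub>stalk X x\<^esub> t x"
  "x \<in> U \<Longrightarrow> \<one>\<^bsub>sec_ring X U\<^esub> x = \<one>\<^bsub>stalk X x\<^esub>"
  "x \<in> U \<Longrightarrow> \<zero>\<^bsub>sec_ring X U\<^esub> x = \<zero>\<^bsub>stalk X x\<^esub>"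
  by (simp_all add: sec_ring_def)

lemma sec_eqI:
  "lrs X \<Longrightarrow> openin (ktop X) U \<Longrightarrow> s \<in> secs X U \<Longrightarrow> t \<in> secs X U \<Longrightarrow> (\<And>x. x \<in> U \<Longrightarrow> s x = t x) \<Longrightarrow> s = t"
  using lrs_sec_restrict[of X U s] lrs_sec_restrict[of X U t] by (metis restrict_ext)

lemma sec_ring_pow:
  assumes "lrs X" "openin (ktop X) U" "s \<in> secs X U" "x \<in> U"
  shows "(s [^]\<^bsub>sec_ring X U\<^esub> (n::nat)) x = s x [^]\<^bsub>stalk X x\<^esub> n"
  by (induction n) (use assms in \<open>simp_all add: sec_ring_simps nat_pow_def sec_ring_def\<close>)

lemma restrict_hom:
  assumes X: "lrs X" and U: "openin (ktop X) U" and V: "openin (ktop X) V" "V \<subseteq> U"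
  shows "(\<lambda>s. restrict s V) \<in> ring_hom (sec_ring X U) (sec_ring X V)"
  using V(2) lrs_restrict[OF X U V]
  by (intro ring_hom_memI) (auto simp: sec_ring_def restrict_def fun_eq_iff)

section \<open>Morphisms of spaces and the categories they form\<close>

lemma is_kmorD:
  assumes "is_kmor f"
  shows "continuous_map (ktop (src f)) (ktop (tgt f)) (bas f)"
    "bas f \<in> extensional (pts (src f))" "shf f \<in> extensional (pts (src f))"
    "\<And>y. y \<in> pts (src f) \<Longrightarrow> shf f y \<in> ring_hom (stalk (tgt f) (bas f y)) (stalk (src f) y)"
    "\<And>y. y \<in> pts (src f) \<Longrightarrow> shf f y \<in> extensional (carrier (stalk (tgt f) (bas f y)))"
    "\<And>y a. y \<in> pts (src f) \<Longrightarrow> a \<in> carrier (stalk (tgt f) (bas f y)) \<Longrightarrow>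
        shf f y a \<in> Units (stalk (src f) y) \<Longrightarrow> a \<in> Units (stalk (tgt f) (bas f y))"
    "\<And>y c. y \<in> pts (src f) \<Longrightarrow> shf f y (scal (tgt f) (bas f y) c) = scal (src f) y c"
    "\<And>U s. openin (ktop (tgt f)) U \<Longrightarrow> s \<in> secs (tgt f) U \<Longrightarrow> pullsec f (preim f U) s \<in> secs (src f) (preim f U)"
    "\<And>y. y \<in> pts (src f) \<Longrightarrow> bas f y \<in> pts (tgt f)"
    "\<And>y a. y \<in> pts (src f) \<Longrightarrow> a \<in> carrier (stalk (tgt f) (bas f y)) \<Longrightarrow> shf f y a \<in> carrier (stalk (src f) y)"
  using assms unfolding is_kmor_def by (auto simp: ring_hom_closed dest: continuous_map_image_subset_topspace)

lemma kmor_eqI: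
  assumes "is_kmor f" "is_kmor g" "src f = src g" "tgt f = tgt g"
    "\<And>x. x \<in> pts (src f) \<Longrightarrow> bas f x = bas g x"
    "\<And>x r. x \<in> pts (src f) \<Longrightarrow> r \<in> carrier (stalk (tgt f) (bas f x)) \<Longrightarrow> shf f x r = shf g x r"
  shows "f = g"
proof -
  have "bas f = bas g"
    using is_kmorD(2)[OF assms(1)] is_kmorD(2)[OF assms(2)] assms(3,5) by (auto intro: extensionalityI)
  moreover have "shf f = shf g"
  proof (rule extensionalityI[OF is_kmorD(3)[OF assms(1)]])
    show "shf g \<in> extensional (pts (src f))" using is_kmorD(3)[OF assms(2)] assms(3) by simp
    fix x assume x: "x \<in> pts (src f)"
    show "shf f x = shf g x"
      by (rule extensionalityI[OF is_kmorD(5)[OF assms(1) x]])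
        (use is_kmorD(5)[OF assms(2), of x] x assms in auto)
  qed
  ultimately show ?thesis using assms(3,4) by (cases f, cases g) simp
qed

lemma preim_open: "is_kmor f \<Longrightarrow> openin (ktop (tgt f)) U \<Longrightarrow> openin (ktop (src f)) (preim f U)"
  using openin_continuous_map_preimage[OF is_kmorD(1)] by (auto simp: preim_def)

lemma is_kmor_kid: 
  assumes X: "lrs X"
  shows "is_kmor (kid X)"
proof -
  have "pullsec (kid X) (preim (kid X) U) s = s" if "openin (ktop X) U" "s \<in> secs X U" for U s
  proof -
    have "preim (kid X) U = U" using openin_pts[OF that(1)] by (auto simp: preim_def kid_def)
    moreover have "pullsec (kid X) U s = restrict s U"
      using openin_pts[OF that(1)] lrs_sec_carrier[OF X that]
      by (auto simp: pullsec_def kid_def restrict_def fun_eq_iff)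
    ultimately show ?thesis using lrs_sec_restrict[OF X that] by simp
  qed
  moreover have "preim (kid X) U = U" if "openin (ktop X) U" for U
    using openin_pts[OF that(1)] by (auto simp: preim_def kid_def)
  moreover have "continuous_map (ktop X) (ktop X) (\<lambda>x\<in>pts X. x)"
    by (rule continuous_map_eq[OF continuous_map_id]) simp
  moreover have "(\<lambda>r\<in>carrier (stalk X x). r) \<in> ring_hom (stalk X x) (stalk X x)" if "x \<in> pts X" for x
  proof -
    interpret cring "stalk X x" by (rule lrs_stalk_cring[OF X that])
    show ?thesis by (intro ring_hom_memI) auto
  qed
  ultimately show ?thesis
    using lrs_scal_carrier[OF X] by (auto simp: is_kmor_def kid_def)
qed

lemma is_kmor_kcomp:
  assumes f: "is_kmor f" and g: "is_kmor g" and fg: "tgt f = src g" and Z: "lrs (tgt g)"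
  shows "is_kmor (kcomp g f)"
  unfolding is_kmor_def
proof (intro conjI ballI allI impI)
  note F = is_kmorD[OF f, unfolded fg] and G = is_kmorD[OF g]
  show "continuous_map (ktop (src (kcomp g f))) (ktop (tgt (kcomp g f))) (bas (kcomp g f))"
    using continuous_map_compose[OF F(1) G(1)]
    by (auto simp: kcomp_def intro: continuous_map_eq)
  show "bas (kcomp g f) \<in> extensional (pts (src (kcomp g f)))"
    "shf (kcomp g f) \<in> extensional (pts (src (kcomp g f)))" by (simp_all add: kcomp_def)
  fix y assume "y \<in> pts (src (kcomp g f))"
  then have y: "y \<in> pts (src f)" "bas f y \<in> pts (src g)" using F(9) by (auto simp: kcomp_def)
  let ?S = "stalk (tgt g) (bas g (bas f y))"
  have h: "shf f y \<circ> shf g (bas f y) \<in> ring_hom ?S (stalk (src f) y)"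
    using ring_hom_trans[OF G(4)[OF y(2)] F(4)[OF y(1)]] .
  have r: "cring ?S" using lrs_stalk_cring[OF Z G(9)[OF y(2)]] .
  interpret S: cring ?S by (rule r)
  show "shf (kcomp g f) y \<in> ring_hom (stalk (tgt (kcomp g f)) (bas (kcomp g f) y)) (stalk (src (kcomp g f)) y)"
    using h y by (auto simp: kcomp_def ring_hom_def)
  show "shf (kcomp g f) y \<in> extensional (carrier (stalk (tgt (kcomp g f)) (bas (kcomp g f) y)))"
    using y by (simp add: kcomp_def)
  show "shf (kcomp g f) y (scal (tgt (kcomp g f)) (bas (kcomp g f) y) c) = scal (src (kcomp g f)) y c" for c
    using y F(7)[of y c] G(7)[of "bas f y" c] lrs_scal_carrier[OF Z G(9)[OF y(2)], of c]
    by (simp add: kcomp_def)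
  fix a assume "a \<in> carrier (stalk (tgt (kcomp g f)) (bas (kcomp g f) y))"
    "shf (kcomp g f) y a \<in> Units (stalk (src (kcomp g f)) y)"
  then show "a \<in> Units (stalk (tgt (kcomp g f)) (bas (kcomp g f) y))"
    using y F(6)[of y "shf g (bas f y) a"] G(6)[of "bas f y" a] G(10)[of "bas f y" a]
    by (simp add: kcomp_def)
next
  note F = is_kmorD[OF f, unfolded fg] and G = is_kmorD[OF g]
  fix U s assume "openin (ktop (tgt (kcomp g f))) U" "s \<in> secs (tgt (kcomp g f)) U"
  then have U: "openin (ktop (tgt g)) U" "s \<in> secs (tgt g) U" by (auto simp: kcomp_def)
  have p: "preim (kcomp g f) U = preim f (preim g U)" using F(9) by (auto simp: preim_def kcomp_def)
  have "pullsec (kcomp g f) (preim (kcomp g f) U) s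
      = pullsec f (preim f (preim g U)) (pullsec g (preim g U) s)"
    unfolding p using lrs_sec_carrier[OF Z U]
    by (auto simp: pullsec_def preim_def kcomp_def fun_eq_iff)
  then show "pullsec (kcomp g f) (preim (kcomp g f) U) s \<in> secs (src (kcomp g f)) (preim (kcomp g f) U)"
    unfolding p using F(8)[OF _ G(8)[OF U]] preim_open[OF g U(1)] by (simp add: kcomp_def)
qed

lemma ring_hom_Units:
  assumes "h \<in> ring_hom R S" "a \<in> Units R"
  shows "h a \<in> Units S"
proof -
  obtain b where b: "a \<in> carrier R" "b \<in> carrier R" "b \<otimes>\<^bsub>R\<^esub> a = \<one>\<^bsub>R\<^esub>" "a \<otimes>\<^bsub>R\<^esub> b = \<one>\<^bsub>R\<^esub>"
    using assms(2) by (auto simp: Units_def)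
  then have "h b \<otimes>\<^bsub>S\<^esub> h a = \<one>\<^bsub>S\<^esub>" "h a \<otimes>\<^bsub>S\<^esub> h b = \<one>\<^bsub>S\<^esub>" "h a \<in> carrier S" "h b \<in> carrier S"
    using ring_hom_mult[OF assms(1)] ring_hom_one[OF assms(1)] ring_hom_closed[OF assms(1)] by metis+
  then show ?thesis by (auto simp: Units_def)
qed

lemma spaces_cat_simps:
  "obs (spaces_cat P) = {X. P X}" "ars (spaces_cat P) = {f. is_kmor f \<and> P (src f) \<and> P (tgt f)}"
  "dm (spaces_cat P) = src" "cd (spaces_cat P) = tgt" "idn (spaces_cat P) = kid"
  "g \<cdot>\<^bsub>spaces_cat P\<^esub> f = kcomp g f"
  by (simp_all add: spaces_cat_def)

lemma kcomp_simps: "src (kcomp g f) = src f" "tgt (kcomp g f) = tgt g"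
  and kid_simps: "src (kid X) = X" "tgt (kid X) = X"
  by (simp_all add: kcomp_def kid_def)

lemma kcomp_bas: "y \<in> pts (src f) \<Longrightarrow> bas (kcomp g f) y = bas g (bas f y)"
  and kcomp_shf: "y \<in> pts (src f) \<Longrightarrow> r \<in> carrier (stalk (tgt g) (bas g (bas f y))) \<Longrightarrow>
    shf (kcomp g f) y r = shf f y (shf g (bas f y) r)"
  by (simp_all add: kcomp_def)

lemma kid_bas: "y \<in> pts X \<Longrightarrow> bas (kid X) y = y"
  and kid_shf: "y \<in> pts X \<Longrightarrow> r \<in> carrier (stalk X y) \<Longrightarrow> shf (kid X) y r = r"
  by (simp_all add: kid_def)

lemma spaces_category:
  assumes "\<And>X. P X \<Longrightarrow> lrs X"
  shows "category (spaces_cat P)"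
proof -
  have 1: "kid X \<in> homs (spaces_cat P) X X" if "P X" for X
    using is_kmor_kid[OF assms[OF that]] that by (simp add: homs_def spaces_cat_simps kid_simps)
  have 2: "kcomp g f \<in> homs (spaces_cat P) (src f) (tgt g)"
    if "f \<in> ars (spaces_cat P)" "g \<in> ars (spaces_cat P)" "tgt f = src g" for f g
    using that assms is_kmor_kcomp[of f g] by (simp add: homs_def spaces_cat_simps kcomp_simps)
  have 3: "kcomp f (kid (src f)) = f" if "f \<in> ars (spaces_cat P)" for f
  proof -
    have f: "is_kmor f" "lrs (src f)" "lrs (tgt f)" using that assms by (auto simp: spaces_cat_simps)
    show ?thesis
      by (rule kmor_eqI[OF is_kmor_kcomp[OF is_kmor_kid[OF f(2)] f(1) _ f(3)] f(1)])
        (simp_all add: kcomp_simps kid_simps kcomp_bas kid_bas kcomp_shf kid_shf is_kmorD(10)[OF f(1)])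
  qed
  have 4: "kcomp (kid (tgt f)) f = f" if "f \<in> ars (spaces_cat P)" for f
  proof -
    have f: "is_kmor f" "lrs (src f)" "lrs (tgt f)" using that assms by (auto simp: spaces_cat_simps)
    show ?thesis
      by (rule kmor_eqI[OF is_kmor_kcomp[OF f(1) is_kmor_kid[OF f(3)]] f(1)])
        (simp_all add: f kcomp_simps kid_simps kcomp_bas kid_bas kcomp_shf kid_shf is_kmorD(9)[OF f(1)])
  qed
  have 5: "kcomp (kcomp h g) f = kcomp h (kcomp g f)"
    if "f \<in> ars (spaces_cat P)" "g \<in> ars (spaces_cat P)" "h \<in> ars (spaces_cat P)"
      "tgt f = src g" "tgt g = src h" for f g h
  proof -
    have k: "is_kmor f" "is_kmor g" "is_kmor h" "lrs (src h)" "lrs (tgt h)"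
      using that assms by (auto simp: spaces_cat_simps)
    show ?thesis
    proof (rule kmor_eqI)
      show "is_kmor (kcomp (kcomp h g) f)" "is_kmor (kcomp h (kcomp g f))"
        using that k by (auto intro!: is_kmor_kcomp simp: kcomp_simps)
    qed (use is_kmorD(9)[OF k(1)] is_kmorD(9)[OF k(2)] is_kmorD(10)[OF k(3)] that(4,5) in
      \<open>simp_all add: kcomp_simps kcomp_bas kcomp_shf\<close>)
  qed
  from 1 2 3 4 5 show ?thesis
    unfolding category_def by (auto simp: spaces_cat_simps)
qed

lemma kcomp_assoc:
  assumes "is_kmor f" "is_kmor g" "is_kmor h" "tgt f = src g" "tgt g = src h"
    "lrs (src f)" "lrs (src g)" "lrs (src h)" "lrs (tgt h)"
  shows "kcomp (kcomp h g) f = kcomp h (kcomp g f)"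
  using cmp_assoc[OF spaces_category[of lrs], of f g h] assms by (simp add: spaces_cat_simps)

lemma openin_open_sub:
  "openin (ktop X) U \<Longrightarrow> openin (ktop (open_sub X U)) V \<longleftrightarrow> openin (ktop X) V \<and> V \<subseteq> U"
  by (simp add: open_sub_def openin_open_subtopology)

lemma open_sub_simps:
  "stalk (open_sub X U) = stalk X" "secs (open_sub X U) = secs X" "scal (open_sub X U) = scal X"
  "sec_ring (open_sub X U) = sec_ring X"
  "ktop (open_sub X U) = subtopology (ktop X) U"
  by (simp_all add: open_sub_def sec_ring_def fun_eq_iff)

lemma pts_open_sub: "openin (ktop X) U \<Longrightarrow> pts (open_sub X U) = U"
  using openin_subset by (fastforce simp: open_sub_def)

lemma open_sub_open_sub: "V \<subseteq> U \<Longrightarrow> open_sub (open_sub X U) V = open_sub X V"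
  by (simp add: open_sub_def subtopology_subtopology Int_absorb1)

lemma lrs_open_sub:
  assumes X: "lrs X" and U: "openin (ktop X) U"
  shows "lrs (open_sub X U)"
proof -
  note o = openin_open_sub[OF U] and p = pts_open_sub[OF U]
  have 1: "local_ring (stalk X x)" if "x \<in> U" for x
    using lrs_local[OF X openin_pts[OF U that]] .
  have 2: "s \<in> secs X V"
    if "openin (ktop X) V" "V \<subseteq> U" "s \<in> (\<Pi>\<^sub>E x\<in>V. carrier (stalk X x))"
      "\<forall>x\<in>V. \<exists>W. (openin (ktop X) W \<and> W \<subseteq> U) \<and> x \<in> W \<and> W \<subseteq> V \<and> restrict s W \<in> secs X W" for V s
    using lrs_glue[OF X that(1,3)] that(4) by blast
  have 3: "\<exists>V s. (openin (ktop X) V \<and> V \<subseteq> U) \<and> x \<in> V \<and> s \<in> secs X V \<and> s x = r"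
    if x: "x \<in> U" and r: "r \<in> carrier (stalk X x)" for x r
  proof -
    obtain V s where V: "openin (ktop X) V" "x \<in> V" "s \<in> secs X V" "s x = r"
      using lrs_germ[OF X openin_pts[OF U x] r] by blast
    then have "openin (ktop X) (V \<inter> U) \<and> V \<inter> U \<subseteq> U" "x \<in> V \<inter> U" "restrict s (V \<inter> U) x = r"
      "restrict s (V \<inter> U) \<in> secs X (V \<inter> U)"
      using U x lrs_restrict[OF X V(1) _ _ V(3)] by auto
    then show ?thesis by blast
  qed
  have 4: "\<exists>W. (openin (ktop X) W \<and> W \<subseteq> U) \<and> x \<in> W \<and> W \<subseteq> V \<inter> V' \<and> (\<forall>y\<in>W. s y = t y)"
    if "openin (ktop X) V \<and> V \<subseteq> U" "openin (ktop X) V' \<and> V' \<subseteq> U" "s \<in> secs X V" "t \<in> secs X V'"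
      "x \<in> V \<inter> V'" "s x = t x" for V V' s t x
    using lrs_germ_eq[OF X _ _ that(3,4,5,6)] that(1,2) by blast
  have 5: "scal X x \<in> ring_hom field_ring (stalk X x)" if "x \<in> U" for x
    using lrs_scal_hom[OF X openin_pts[OF U that]] .
  have 6: "(\<lambda>x\<in>U. scal X x c) \<in> secs X U" for c
  proof -
    have "restrict (\<lambda>x\<in>pts X. scal X x c) U = (\<lambda>x\<in>U. scal X x c)"
      using openin_pts[OF U] by (auto simp: restrict_def fun_eq_iff)
    then show ?thesis using lrs_restrict[OF X _ U _ lrs_scal_sec[OF X, of c]] openin_subset[OF U] by simp
  qed
  have 7: "secs X V \<subseteq> (\<Pi>\<^sub>E x\<in>V. carrier (stalk X x))" "cring (sec_ring X V)"
    "openin (ktop X) W \<Longrightarrow> W \<subseteq> V \<Longrightarrow> s \<in> secs X V \<Longrightarrow> restrict s W \<in> secs X W"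
    if "openin (ktop X) V" for V W s
    using lrs_sec_PiE[OF X that] lrs_sec_ring[OF X that] lrs_restrict[OF X that] by auto
  show ?thesis
    unfolding lrs_def o p unfolding open_sub_simps
  proof (intro conjI)
    show "\<forall>V. openin (ktop X) V \<and> V \<subseteq> U \<longrightarrow>
        secs X V \<subseteq> (\<Pi>\<^sub>E x\<in>V. carrier (stalk X x)) \<and> cring (sec_ring X V) \<and>
        (\<forall>W s. (openin (ktop X) W \<and> W \<subseteq> U) \<and> W \<subseteq> V \<and> s \<in> secs X V \<longrightarrow> restrict s W \<in> secs X W) \<and>
        (\<forall>s\<in>(\<Pi>\<^sub>E x\<in>V. carrier (stalk X x)).
           (\<forall>x\<in>V. \<exists>W. (openin (ktop X) W \<and> W \<subseteq> U) \<and> x \<in> W \<and> W \<subseteq> V \<and> restrict s W \<in> secs X W)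
           \<longrightarrow> s \<in> secs X V)"
    proof (intro allI impI conjI ballI; elim conjE)
      fix V W s
      assume "openin (ktop X) V" "openin (ktop X) W" "W \<subseteq> V" "s \<in> secs X V"
      then show "restrict s W \<in> secs X W" by (rule 7(3))
    qed (simp_all add: 7(1,2) 2)
    show "\<forall>V W s t x. (openin (ktop X) V \<and> V \<subseteq> U) \<and> (openin (ktop X) W \<and> W \<subseteq> U) \<and> s \<in> secs X V \<and>
        t \<in> secs X W \<and> x \<in> V \<inter> W \<and> s x = t x \<longrightarrow>
        (\<exists>Z. (openin (ktop X) Z \<and> Z \<subseteq> U) \<and> x \<in> Z \<and> Z \<subseteq> V \<inter> W \<and> (\<forall>y\<in>Z. s y = t y))"
      using 4 by simp
  qed (use 1 3 5 6 in simp_all)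
qed

section \<open>Open immersions: sections, liftings, cancellation\<close>

definition incl :: "('p, 'r, 'k) kspace \<Rightarrow> 'p set \<Rightarrow> ('p, 'r, 'k) kmor" where
  "incl X U = \<lparr>src = open_sub X U, tgt = X, bas = (\<lambda>x\<in>U. x), shf = (\<lambda>x\<in>U. \<lambda>r\<in>carrier (stalk X x). r)\<rparr>"

lemma incl_simps:
  "src (incl X U) = open_sub X U" "tgt (incl X U) = X" "x \<in> U \<Longrightarrow> bas (incl X U) x = x"
  "x \<in> U \<Longrightarrow> r \<in> carrier (stalk X x) \<Longrightarrow> shf (incl X U) x r = r"
  by (simp_all add: incl_def)

lemma is_kmor_incl:
  assumes X: "lrs X" and U: "openin (ktop X) U"
  shows "is_kmor (incl X U)"
proof -
  note p = pts_open_sub[OF U]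
  have pr: "preim (incl X U) V = V \<inter> U" for V
    using p by (auto simp: preim_def incl_def)
  have "pullsec (incl X U) (preim (incl X U) V) s \<in> secs X (preim (incl X U) V)"
    if V: "openin (ktop X) V" "s \<in> secs X V" for V s
  proof -
    have "pullsec (incl X U) (V \<inter> U) s = restrict s (V \<inter> U)"
      using lrs_sec_carrier[OF X V] by (auto simp: pullsec_def incl_simps restrict_def fun_eq_iff)
    moreover have "restrict s (V \<inter> U) \<in> secs X (V \<inter> U)" using lrs_restrict[OF X V(1) _ _ V(2)] U V(1) by blast
    ultimately show ?thesis by (simp add: pr)
  qed
  moreover have "continuous_map (ktop (open_sub X U)) (ktop X) (\<lambda>x\<in>U. x)"
    by (rule continuous_map_eq[of _ _ "\<lambda>x. x"])
      (use p in \<open>auto simp: open_sub_simps intro: continuous_map_from_subtopology\<close>)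
  moreover have "(\<lambda>r\<in>carrier (stalk X x). r) \<in> ring_hom (stalk X x) (stalk X x)" if "x \<in> U" for x
  proof -
    interpret cring "stalk X x" by (rule lrs_stalk_cring[OF X openin_pts[OF U that]])
    show ?thesis by (intro ring_hom_memI) auto
  qed
  ultimately show ?thesis
    using lrs_scal_carrier[OF X] openin_pts[OF U]
    unfolding is_kmor_def by (auto simp: p incl_def open_sub_simps)
qed

lemma open_immersionD:
  assumes "open_immersion u"
  shows "is_kmor u" "inj_on (bas u) (pts (src u))"
    "\<And>U. openin (ktop (src u)) U \<Longrightarrow> openin (ktop (tgt u)) (bas u ` U)"
    "\<And>y. y \<in> pts (src u) \<Longrightarrow>
      bij_betw (shf u y) (carrier (stalk (tgt u) (bas u y))) (carrier (stalk (src u) y))"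
proof -
  have h: "homeomorphic_map (ktop (src u)) (subtopology (ktop (tgt u)) (bas u ` pts (src u))) (bas u)"
    and o: "openin (ktop (tgt u)) (bas u ` pts (src u))"
    using assms by (auto simp: open_immersion_def embedding_map_def)
  show "inj_on (bas u) (pts (src u))" by (rule homeomorphic_imp_injective_map[OF h])
  show "openin (ktop (tgt u)) (bas u ` U)" if "openin (ktop (src u)) U" for U
    using homeomorphic_imp_open_map[OF h] that o
    by (auto simp: open_map_def intro: openin_trans_full)
qed (use assms in \<open>auto simp: open_immersion_def\<close>)

lemma open_immersionI:
  assumes "is_kmor u" "inj_on (bas u) (pts (src u))"
    "\<And>U. openin (ktop (src u)) U \<Longrightarrow> openin (ktop (tgt u)) (bas u ` U)"
    "\<And>y. y \<in> pts (src u) \<Longrightarrow>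
      bij_betw (shf u y) (carrier (stalk (tgt u) (bas u y))) (carrier (stalk (src u) y))"
  shows "open_immersion u"
  using assms is_kmorD(1)[OF assms(1)]
  by (auto simp: open_immersion_def open_map_def intro!: injective_open_imp_embedding_map)

lemma open_immersion_incl:
  assumes X: "lrs X" and U: "openin (ktop X) U"
  shows "open_immersion (incl X U)"
proof (rule open_immersionI[OF is_kmor_incl[OF X U]])
  note p = pts_open_sub[OF U]
  show "inj_on (bas (incl X U)) (pts (src (incl X U)))"
    by (auto simp: inj_on_def incl_def p)
  show "openin (ktop (tgt (incl X U))) (bas (incl X U) ` V)" if "openin (ktop (src (incl X U))) V" for V
  proof -
    have V: "openin (ktop X) V" "V \<subseteq> U" using that openin_open_sub[OF U] by (auto simp: incl_simps)
    then have "bas (incl X U) ` V = V" by (force simp: incl_simps)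
    then show ?thesis using V by (simp add: incl_simps)
  qed
  show "bij_betw (shf (incl X U) y) (carrier (stalk (tgt (incl X U)) (bas (incl X U) y)))
      (carrier (stalk (src (incl X U)) y))" if "y \<in> pts (src (incl X U))" for y
  proof -
    have "y \<in> U" using that by (simp add: incl_simps p)
    then have "bij_betw (\<lambda>x. x) (carrier (stalk X y)) (carrier (stalk X y)) \<Longrightarrow> ?thesis"
      by (subst bij_betw_cong[of _ _ "\<lambda>x. x"]) (simp_all add: incl_simps open_sub_simps)
    then show ?thesis by (simp add: bij_betw_def)
  qed
qed

text \<open>Bijectivity on stalks forces the values of \<open>t\<close>. That they form a section is
  local: a section \<open>r\<close> with the right germ at a point pulls back to one that agrees
  with \<open>s\<close> on a neighbourhood \<open>W\<close>, so \<open>t\<close> and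
  \<open>r\<close> agree on the image of \<open>W\<close>, which is open.\<close>

lemma open_immersion_section:
  assumes u: "open_immersion u" and Y: "lrs (src u)" and Z: "lrs (tgt u)"
    and U: "openin (ktop (src u)) U" and s: "s \<in> secs (src u) U"
  obtains t where "t \<in> secs (tgt u) (bas u ` U)" "\<And>y. y \<in> U \<Longrightarrow> shf u y (t (bas u y)) = s y"
proof -
  note O = open_immersionD[OF u]
  define iv where "iv z = inv_into U (bas u) z" for z
  have injU: "inj_on (bas u) U" using inj_on_subset[OF O(2) openin_subset[OF U]] .
  have iv: "iv (bas u y) = y" if "y \<in> U" for y unfolding iv_def by (rule inv_into_f_f[OF injU that])
  define t where "t = (\<lambda>z\<in>bas u ` U. inv_into (carrier (stalk (tgt u) z)) (shf u (iv z)) (s (iv z)))"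
  have t: "t (bas u y) \<in> carrier (stalk (tgt u) (bas u y))" "shf u y (t (bas u y)) = s y" if y: "y \<in> U" for y
  proof -
    have "s y \<in> shf u y ` carrier (stalk (tgt u) (bas u y))"
      using O(4)[OF openin_pts[OF U y]] lrs_sec_carrier[OF Y U s y] by (simp add: bij_betw_def)
    from inv_into_into[OF this] f_inv_into_f[OF this] show "t (bas u y) \<in> carrier (stalk (tgt u) (bas u y))"
      "shf u y (t (bas u y)) = s y"
      using y by (simp_all add: t_def iv)
  qed
  have "t \<in> secs (tgt u) (bas u ` U)"
  proof (rule lrs_glue_eq[OF Z O(3)[OF U]])
    show "t \<in> extensional (bas u ` U)" by (simp add: t_def)
    fix z assume "z \<in> bas u ` U"
    then obtain y where y: "y \<in> U" "z = bas u y" by blast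
    note yp = openin_pts[OF U y(1)]
    obtain V r where V: "openin (ktop (tgt u)) V" "z \<in> V" "r \<in> secs (tgt u) V" "r z = t z"
      using lrs_germ[OF Z is_kmorD(9)[OF O(1) yp] t(1)[OF y(1)]] y(2) by blast
    note P = preim_open[OF O(1) V(1)] is_kmorD(8)[OF O(1) V(1,3)]
    have yV: "y \<in> preim u V" using yp V(2) y(2) by (simp add: preim_def)
    have "pullsec u (preim u V) r y = s y" using yV V(4) t(2)[OF y(1)] y(2) by (simp add: pullsec_def)
    then obtain W where W: "openin (ktop (src u)) W" "y \<in> W" "W \<subseteq> preim u V \<inter> U"
      "\<forall>x\<in>W. pullsec u (preim u V) r x = s x"
      using lrs_germ_eq[OF Y P(1) U P(2) s, of y] yV y(1) by blast
    have "t x = r x" if x: "x \<in> bas u ` W" for x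
    proof -
      obtain w where w: "w \<in> W" "x = bas u w" using x by blast
      have wU: "w \<in> U" "w \<in> preim u V" using w W(3) by auto
      have "shf u w (r x) = shf u w (t x)"
        using W(4) w wU t(2)[OF wU(1)] by (auto simp: pullsec_def)
      moreover have "r x \<in> carrier (stalk (tgt u) x)"
        using lrs_sec_carrier[OF Z V(1,3)] wU(2) w(2) by (simp add: preim_def)
      ultimately show ?thesis
        using t(1)[OF wU(1)] O(4)[OF openin_pts[OF U wU(1)]] w(2) by (auto simp: bij_betw_def dest: inj_onD)
    qed
    moreover have "openin (ktop (tgt u)) (bas u ` W \<inter> V)" using O(3)[OF W(1)] V(1) by blast
    moreover have "restrict r (bas u ` W \<inter> V) \<in> secs (tgt u) (bas u ` W \<inter> V)"
      using lrs_restrict[OF Z V(1) _ _ V(3)] calculation(2) by blast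
    ultimately show "\<exists>V t'. openin (ktop (tgt u)) V \<and> z \<in> V \<and> t' \<in> secs (tgt u) V \<and> (\<forall>y\<in>V \<inter> bas u ` U. t y = t' y)"
      using y(2) W(2) V(2) by (intro exI[of _ "bas u ` W \<inter> V"] exI[of _ "restrict r (bas u ` W \<inter> V)"]) auto
  qed
  then show ?thesis using that t(2) by blast
qed

text \<open>The factorization of \<open>h\<close> through the open immersion \<open>u\<close>. Both
  inverses are taken by \<open>inv_into\<close>, so it is meaningful only if the image of
  \<open>h\<close> lies in that of \<open>u\<close>.\<close>

definition oi_lift :: "('p, 'r, 'k) kmor \<Rightarrow> ('p, 'r, 'k) kmor \<Rightarrow> ('p, 'r, 'k) kmor" where
  "oi_lift u h = (let i = (\<lambda>x. inv_into (pts (src u)) (bas u) (bas h x)) in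
     \<lparr>src = src h, tgt = src u, bas = (\<lambda>x\<in>pts (src h). i x),
      shf = (\<lambda>x\<in>pts (src h). \<lambda>r\<in>carrier (stalk (src u) (i x)).
        shf h x (inv_into (carrier (stalk (tgt u) (bas h x))) (shf u (i x)) r))\<rparr>)"

lemma
  assumes u: "open_immersion u" and Y: "lrs (src u)" and Z: "lrs (tgt u)"
    and h: "is_kmor h" and hu: "tgt h = tgt u" and im: "bas h ` pts (src h) \<subseteq> bas u ` pts (src u)"
  shows is_kmor_oi_lift: "is_kmor (oi_lift u h)" and kcomp_oi_lift: "kcomp u (oi_lift u h) = h"
    and src_oi_lift: "src (oi_lift u h) = src h" and tgt_oi_lift: "tgt (oi_lift u h) = src u"
proof -
  note O = open_immersionD[OF u] and H = is_kmorD[OF h]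
  note uD = is_kmorD[OF O(1)]
  define l where "l = oi_lift u h"
  define i where "i x = inv_into (pts (src u)) (bas u) (bas h x)" for x
  have i: "i x \<in> pts (src u)" "bas u (i x) = bas h x" if "x \<in> pts (src h)" for x
    using im that inv_into_into[of "bas h x" "bas u" "pts (src u)"] f_inv_into_f[of "bas h x" "bas u" "pts (src u)"]
    by (auto simp: i_def)
  show s: "src (oi_lift u h) = src h" "tgt (oi_lift u h) = src u" by (simp_all add: oi_lift_def)
  have bas: "bas l x = i x" if "x \<in> pts (src h)" for x using that by (simp add: l_def oi_lift_def i_def)
  have shf: "shf l x (shf u (i x) a) = shf h x a"
    if x: "x \<in> pts (src h)" and a: "a \<in> carrier (stalk (tgt u) (bas h x))" for x a
  proof -
    note b = O(4)[OF i(1)[OF x], unfolded i(2)[OF x]]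
    have "shf u (i x) a \<in> carrier (stalk (src u) (i x))" using bij_betwE[OF b] a by blast
    then have "shf l x (shf u (i x) a) =
        shf h x (inv_into (carrier (stalk (tgt u) (bas h x))) (shf u (i x)) (shf u (i x) a))"
      using x by (simp add: l_def oi_lift_def i_def)
    then show ?thesis using inv_into_f_f[OF bij_betw_imp_inj_on[OF b] a] by simp
  qed
  have surj: "\<exists>a\<in>carrier (stalk (tgt u) (bas h x)). r = shf u (i x) a"
    if x: "x \<in> pts (src h)" and r: "r \<in> carrier (stalk (src u) (i x))" for x r
    using O(4)[OF i(1)[OF x], unfolded i(2)[OF x]] r by (auto simp: bij_betw_def)
  \<comment> \<open>Opens of the source of \<open>u\<close> are traded for their open images, which
    reduces continuity of the lift to continuity of \<open>h\<close>.\<close>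
  have pre: "preim l U = preim h (bas u ` U)" if U: "openin (ktop (src u)) U" for U
  proof -
    have "i x \<in> U \<longleftrightarrow> bas h x \<in> bas u ` U" if x: "x \<in> pts (src h)" for x
      using i[OF x] O(2) openin_pts[OF U] by (metis (no_types, lifting) image_iff inj_onD)
    then show ?thesis using bas s by (auto simp: preim_def l_def)
  qed
  have k: "is_kmor l" unfolding is_kmor_def
  proof (intro conjI ballI allI impI)
    show "continuous_map (ktop (src l)) (ktop (tgt l)) (bas l)"
      unfolding continuous_map_def
    proof (intro conjI allI impI)
      show "bas l \<in> pts (src l) \<rightarrow> pts (tgt l)" using i bas s by (auto simp: l_def)
      fix U assume "openin (ktop (tgt l)) U"
      then have U: "openin (ktop (src u)) U" using s by (simp add: l_def)
      have "openin (ktop (src h)) (preim h (bas u ` U))"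
        using preim_open[OF h] O(3)[OF U] hu by simp
      then show "openin (ktop (src l)) {x \<in> pts (src l). bas l x \<in> U}"
        using pre[OF U] s by (simp add: l_def preim_def)
    qed
    show "bas l \<in> extensional (pts (src l))" "shf l \<in> extensional (pts (src l))"
      by (simp_all add: l_def oi_lift_def)
    fix y assume "y \<in> pts (src l)"
    then have y: "y \<in> pts (src h)" using s by (simp add: l_def)
    note iy = i[OF y]
    note uh = uD(4)[OF iy(1), unfolded iy(2)] and hh = H(4)[OF y, unfolded hu]
    note sj = surj[OF y]
    have un: "\<one>\<^bsub>stalk (src u) (i y)\<^esub> = shf u (i y) \<one>\<^bsub>stalk (tgt u) (bas h y)\<^esub>" using ring_hom_one[OF uh] by simp
    have zc: "cring (stalk (tgt u) (bas h y))" using lrs_stalk_cring[OF Z] H(9)[OF y] hu by simp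
    interpret S: cring "stalk (tgt u) (bas h y)" by (rule zc)
    show "shf l y \<in> ring_hom (stalk (tgt l) (bas l y)) (stalk (src l) y)"
    proof (rule ring_hom_memI)
      fix a b assume "a \<in> carrier (stalk (tgt l) (bas l y))"
      then obtain a' where a: "a' \<in> carrier (stalk (tgt u) (bas h y))" "a = shf u (i y) a'"
        using sj bas[OF y] s by (auto simp: l_def)
      show "shf l y a \<in> carrier (stalk (src l) y)" using shf[OF y a(1)] a ring_hom_closed[OF hh a(1)] s by (simp add: l_def)
      assume "b \<in> carrier (stalk (tgt l) (bas l y))"
      then obtain b' where b: "b' \<in> carrier (stalk (tgt u) (bas h y))" "b = shf u (i y) b'"
        using sj bas[OF y] s by (auto simp: l_def)
      have "a \<otimes>\<^bsub>stalk (src u) (i y)\<^esub> b = shf u (i y) (a' \<otimes>\<^bsub>stalk (tgt u) (bas h y)\<^esub> b')"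
        "a \<oplus>\<^bsub>stalk (src u) (i y)\<^esub> b = shf u (i y) (a' \<oplus>\<^bsub>stalk (tgt u) (bas h y)\<^esub> b')"
        using ring_hom_mult[OF uh a(1) b(1)] ring_hom_add[OF uh a(1) b(1)] a b by simp_all
      then show "shf l y (a \<otimes>\<^bsub>stalk (tgt l) (bas l y)\<^esub> b) = shf l y a \<otimes>\<^bsub>stalk (src l) y\<^esub> shf l y b"
        "shf l y (a \<oplus>\<^bsub>stalk (tgt l) (bas l y)\<^esub> b) = shf l y a \<oplus>\<^bsub>stalk (src l) y\<^esub> shf l y b"
        using bas[OF y] s a b shf[OF y a(1)] shf[OF y b(1)] shf[OF y S.m_closed[OF a(1) b(1)]]
          shf[OF y S.a_closed[OF a(1) b(1)]] ring_hom_mult[OF hh a(1) b(1)] ring_hom_add[OF hh a(1) b(1)]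
        by (simp_all add: l_def)
    next
      show "shf l y \<one>\<^bsub>stalk (tgt l) (bas l y)\<^esub> = \<one>\<^bsub>stalk (src l) y\<^esub>"
        using bas[OF y] s un shf[OF y S.one_closed] ring_hom_one[OF hh] by (simp add: l_def)
    qed
    show "shf l y \<in> extensional (carrier (stalk (tgt l) (bas l y)))"
      using y by (simp add: l_def oi_lift_def)
    show "shf l y (scal (tgt l) (bas l y) c) = scal (src l) y c" for c
      using bas[OF y] s shf[OF y lrs_scal_carrier[OF Z], of c] H(9)[OF y] uD(7)[OF iy(1), of c] iy(2) H(7)[OF y, of c] hu
      by (simp add: l_def)
    fix a assume "a \<in> carrier (stalk (tgt l) (bas l y))" "shf l y a \<in> Units (stalk (src l) y)"
    then obtain a' where a: "a' \<in> carrier (stalk (tgt u) (bas h y))" "a = shf u (i y) a'"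
        "shf h y a' \<in> Units (stalk (src h) y)"
        using sj[of a] bas[OF y] s shf[OF y] by (auto simp: l_def)
    then have "a' \<in> Units (stalk (tgt u) (bas h y))" using H(6)[OF y] hu by simp
    then have "shf u (i y) a' \<in> Units (stalk (src u) (i y))"
      using ring_hom_Units[OF uh] by simp
    then show "a \<in> Units (stalk (tgt l) (bas l y))" using a(2) bas[OF y] s by (simp add: l_def)
  next
    fix U r assume "openin (ktop (tgt l)) U" "r \<in> secs (tgt l) U"
    then have U: "openin (ktop (src u)) U" "r \<in> secs (src u) U" using s by (auto simp: l_def)
    \<comment> \<open>The section \<open>r\<close> comes from a section \<open>t\<close> on the open
      image of \<open>U\<close>, so its pullback along the lift is the pullback of \<open>t\<close>
      along \<open>h\<close>.\<close>
    obtain t where t: "t \<in> secs (tgt u) (bas u ` U)" "\<And>y. y \<in> U \<Longrightarrow> shf u y (t (bas u y)) = r y"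
      using open_immersion_section[OF u Y Z U] by blast
    have "pullsec l (preim l U) r = pullsec h (preim h (bas u ` U)) t"
      unfolding pre[OF U(1)]
    proof (unfold pullsec_def, rule restrict_ext)
      fix x assume x: "x \<in> preim h (bas u ` U)"
      then have xp: "x \<in> pts (src h)" by (simp add: preim_def)
      have "x \<in> preim l U" using x pre[OF U(1)] by simp
      then have iU: "i x \<in> U" using bas[OF xp] by (simp add: preim_def)
      have tc: "t (bas h x) \<in> carrier (stalk (tgt u) (bas h x))"
        using lrs_sec_carrier[OF Z O(3)[OF U(1)] t(1)] x by (simp add: preim_def)
      show "shf l x (r (bas l x)) = shf h x (t (bas h x))"
        using shf[OF xp tc] t(2)[OF iU] i(2)[OF xp] bas[OF xp] by simp
    qed
    then show "pullsec l (preim l U) r \<in> secs (src l) (preim l U)"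
      using H(8)[of "bas u ` U" t] O(3)[OF U(1)] t(1) hu pre[OF U(1)] s by (simp add: l_def)
  qed
  then show "is_kmor (oi_lift u h)" by (simp add: l_def)
  have "kcomp u l = h"
  proof (rule kmor_eqI[OF is_kmor_kcomp[OF k O(1) _ Z] h])
    fix x assume "x \<in> pts (src (kcomp u l))"
    then have x: "x \<in> pts (src l)" "x \<in> pts (src h)" using s by (auto simp: kcomp_simps l_def)
    show "bas (kcomp u l) x = bas h x" using x bas i by (simp add: kcomp_bas)
    fix r assume "r \<in> carrier (stalk (tgt (kcomp u l)) (bas (kcomp u l) x))"
    then have "r \<in> carrier (stalk (tgt u) (bas h x))" using x bas i by (simp add: kcomp_simps kcomp_bas)
    then show "shf (kcomp u l) x r = shf h x r" using x bas i shf by (simp add: kcomp_shf)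
  qed (use s hu in \<open>auto simp: l_def kcomp_simps\<close>)
  then show "kcomp u (oi_lift u h) = h" by (simp add: l_def)
qed

text \<open>Injectivity of \<open>u\<close> on points determines the map of points, and surjectivity
  of its stalk maps then determines the stalk maps.\<close>

lemma open_immersion_mono:
  assumes u: "open_immersion u" and x: "is_kmor x" "tgt x = src u" and y: "is_kmor y" "tgt y = src u"
    and s: "src x = src y" and e: "kcomp u x = kcomp u y"
  shows "x = y"
proof (rule kmor_eqI[OF x(1) y(1) s])
  note O = open_immersionD[OF u]
  show "tgt x = tgt y" using x(2) y(2) by simp
  fix p assume p: "p \<in> pts (src x)"
  have bx: "bas x p \<in> pts (src u)" "bas y p \<in> pts (src u)"
    using is_kmorD(9)[OF x(1) p] is_kmorD(9)[OF y(1), of p] p s x(2) y(2) by auto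
  have "bas u (bas x p) = bas u (bas y p)"
    using e kcomp_bas[of p x u] kcomp_bas[of p y u] p s by simp
  then show b: "bas x p = bas y p" using O(2) bx by (auto dest: inj_onD)
  fix r assume "r \<in> carrier (stalk (tgt x) (bas x p))"
  then obtain a where a: "a \<in> carrier (stalk (tgt u) (bas u (bas x p)))" "r = shf u (bas x p) a"
    using O(4)[OF bx(1)] x(2) by (auto simp: bij_betw_def)
  then show "shf x p r = shf y p r"
    using e kcomp_shf[of p x a u] kcomp_shf[of p y a u] p s b by simp
qed

section \<open>Affine spaces and their basic open subsets\<close>

lemma (in cring) ideal_criterion:
  assumes "I \<subseteq> carrier R" "\<zero> \<in> I" "\<And>a b. a \<in> I \<Longrightarrow> b \<in> I \<Longrightarrow> a \<oplus> b \<in> I"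
    "\<And>a x. a \<in> I \<Longrightarrow> x \<in> carrier R \<Longrightarrow> x \<otimes> a \<in> I"
  shows "ideal I R"
proof (rule idealI[OF ring_axioms])
  show "subgroup I (add_monoid R)"
  proof (rule add.subgroupI)
    fix a assume a: "a \<in> I"
    then have "\<ominus> \<one> \<otimes> a \<in> I" using assms(4) by simp
    moreover have "\<ominus> \<one> \<otimes> a = \<ominus> a" using a assms(1) l_minus[of \<one> a] by auto
    ultimately show "\<ominus> a \<in> I" by simp
  qed (use assms in auto)
  fix a x assume "a \<in> I" "x \<in> carrier R"
  then show "x \<otimes> a \<in> I" "a \<otimes> x \<in> I" using assms(1,4) m_comm[of a x] by auto
qed

text \<open>Zorn's lemma provides an ideal maximal among those that contain \<open>J\<close> and
  miss every power of \<open>f\<close>; maximality makes it prime. The power 0 keeps it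
  proper.\<close>

lemma (in cring) prime_avoiding_powers:
  assumes J: "ideal J R" and f: "f \<in> carrier R" and Jf: "\<And>n::nat. f [^] n \<notin> J"
  obtains P where "primeideal P R" "J \<subseteq> P" "f \<notin> P"
proof -
  let ?A = "{I. ideal I R \<and> J \<subseteq> I \<and> (\<forall>n::nat. f [^] n \<notin> I)}"
  have "\<exists>M\<in>?A. \<forall>I\<in>?A. M \<subseteq> I \<longrightarrow> I = M"
  proof (rule subset_Zorn_nonempty)
    show "?A \<noteq> {}" using J Jf by auto
    fix C assume C: "C \<noteq> {}" "subset.chain ?A C"
    then have "subset.chain {I. ideal I R} C" by (auto simp: subset_chain_def)
    from chain_Union_is_ideal[OF this] have "ideal (\<Union>C) R" using C by simp
    moreover have "C \<subseteq> ?A" using C(2) by (simp add: subset_chain_def)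
    then have *: "\<And>I. I \<in> C \<Longrightarrow> J \<subseteq> I" "\<And>I n. I \<in> C \<Longrightarrow> f [^] (n::nat) \<notin> I" by auto
    have "J \<subseteq> \<Union>C" using C(1) *(1) by (metis Sup_upper2 ex_in_conv)
    moreover have "f [^] n \<notin> \<Union>C" for n :: nat
    proof
      assume "f [^] n \<in> \<Union>C"
      then obtain I where "I \<in> C" "f [^] n \<in> I" by (rule UnionE)
      then show False using *(2) by blast
    qed
    ultimately show "\<Union>C \<in> ?A" by simp
  qed
  then obtain M where MA: "M \<in> ?A" and "\<forall>I\<in>?A. M \<subseteq> I \<longrightarrow> I = M" by (rule bexE)
  then have max: "\<And>I. ideal I R \<Longrightarrow> J \<subseteq> I \<Longrightarrow> \<forall>n::nat. f [^] n \<notin> I \<Longrightarrow> M \<subseteq> I \<Longrightarrow> I = M" by simp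
  have M: "ideal M R" "J \<subseteq> M" "\<forall>n::nat. f [^] n \<notin> M" using MA by auto
  interpret M: ideal M R by (rule M)
  \<comment> \<open>If adding \<open>a\<close> to \<open>M\<close> reached no power of
    \<open>f\<close>, the larger ideal would contradict maximality. For a product in
    \<open>M\<close>, multiplying two such representations puts a power of \<open>f\<close> into
    \<open>M\<close>.\<close>
  have *: "\<exists>n::nat. \<exists>p\<in>M. \<exists>r\<in>carrier R. f [^] n = p \<oplus> r \<otimes> a" if a: "a \<in> carrier R" "a \<notin> M" for a
  proof (rule ccontr)
    assume no: "\<not> ?thesis"
    let ?I = "set_add R M (PIdl a)"
    have I: "ideal ?I R" by (rule add_ideals[OF M(1) cgenideal_ideal[OF a(1)]])
    have el: "x \<in> ?I \<longleftrightarrow> (\<exists>p\<in>M. \<exists>r\<in>carrier R. x = p \<oplus> r \<otimes> a)" for x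
      by (auto simp: set_add_def' cgenideal_def)
    have MI: "M \<subseteq> ?I"
    proof
      fix p assume "p \<in> M"
      then show "p \<in> ?I"
        unfolding el by (intro bexI[of _ p] bexI[of _ \<zero>]) (use a M.Icarr in simp_all)
    qed
    have "a \<in> ?I"
      unfolding el by (rule bexI[of _ \<zero>], rule bexI[of _ \<one>]) (use a M.zero_closed in simp_all)
    then have "?I \<noteq> M" using a(2) by auto
    then have "\<exists>n::nat. f [^] n \<in> ?I" using max[OF I _ _ MI] M(2) MI by blast
    then show False using no unfolding el by blast
  qed
  have "primeideal M R"
  proof (rule primeidealI[OF M(1) is_cring])
    show "carrier R \<noteq> M" using M(3)[rule_format, of 0] by auto
    fix a b assume ab: "a \<in> carrier R" "b \<in> carrier R" "a \<otimes> b \<in> M"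
    show "a \<in> M \<or> b \<in> M"
    proof (rule ccontr)
      assume "\<not> ?thesis"
      then have n: "a \<notin> M" "b \<notin> M" by auto
      obtain n :: nat and p r where 1: "p \<in> M" "r \<in> carrier R" "f [^] n = p \<oplus> r \<otimes> a"
        using *[OF ab(1) n(1)] by blast
      obtain m :: nat and q s where 2: "q \<in> M" "s \<in> carrier R" "f [^] m = q \<oplus> s \<otimes> b"
        using *[OF ab(2) n(2)] by blast
      note c = M.Icarr[OF 1(1)] M.Icarr[OF 2(1)] 1(2) 2(2) ab(1,2)
      have "f [^] (n + m) = (p \<oplus> r \<otimes> a) \<otimes> (q \<oplus> s \<otimes> b)"
        using 1(3) 2(3) f by (simp add: nat_pow_mult[symmetric])
      also have "\<dots> = (q \<oplus> s \<otimes> b) \<otimes> p \<oplus> ((r \<otimes> a) \<otimes> q \<oplus> (r \<otimes> s) \<otimes> (a \<otimes> b))"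
        using c by algebra
      also have "\<dots> \<in> M"
      proof -
        have "(q \<oplus> s \<otimes> b) \<otimes> p \<in> M" by (rule M.I_l_closed[OF 1(1)]) (use c in simp)
        moreover have "(r \<otimes> a) \<otimes> q \<in> M" by (rule M.I_l_closed[OF 2(1)]) (use c in simp)
        moreover have "(r \<otimes> s) \<otimes> (a \<otimes> b) \<in> M" by (rule M.I_l_closed[OF ab(3)]) (use c in simp)
        ultimately show ?thesis by (intro M.a_closed)
      qed
      finally show False using M(3) by blast
    qed
  qed
  moreover have "f \<notin> M" using M(3)[rule_format, of 1] f by simp
  ultimately show ?thesis using that M(2) by blast
qed

lemma lrs_eval_hom:
  assumes "lrs X" "openin (ktop X) U" "x \<in> U"
  shows "(\<lambda>s. s x) \<in> ring_hom (sec_ring X U) (stalk X x)"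
  using assms lrs_sec_carrier[OF assms(1,2)] by (intro ring_hom_memI) (auto simp: sec_ring_simps)

text \<open>An inverse of the germ extends to a section, and the equation s t = 1 at one point
  spreads to a neighbourhood.\<close>

lemma lrs_unit_open:
  assumes X: "lrs X" and U: "openin (ktop X) U" and s: "s \<in> secs X U"
  shows "openin (ktop X) {x \<in> U. s x \<in> Units (stalk X x)}"
proof (subst openin_subopen, safe)
  fix x assume x: "x \<in> U" "s x \<in> Units (stalk X x)"
  obtain r where r: "r \<in> carrier (stalk X x)" "s x \<otimes>\<^bsub>stalk X x\<^esub> r = \<one>\<^bsub>stalk X x\<^esub>"
    using x(2) by (auto simp: Units_def)
  obtain V t where V: "openin (ktop X) V" "x \<in> V" "t \<in> secs X V" "t x = r"
    using lrs_germ[OF X openin_pts[OF U x(1)] r(1)] by blast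
  let ?W = "U \<inter> V"
  have W: "openin (ktop X) ?W" using U V(1) by blast
  interpret B: cring "sec_ring X ?W" by (rule lrs_sec_ring[OF X W])
  let ?s = "restrict s ?W" and ?t = "restrict t ?W"
  have st: "?s \<in> secs X ?W" "?t \<in> secs X ?W"
    using lrs_restrict[OF X U W _ s] lrs_restrict[OF X V(1) W _ V(3)] by auto
  have p: "?s \<otimes>\<^bsub>sec_ring X ?W\<^esub> ?t \<in> secs X ?W" "\<one>\<^bsub>sec_ring X ?W\<^esub> \<in> secs X ?W"
    using B.m_closed B.one_closed st by (simp_all add: sec_ring_simps(1))
  obtain W' where W': "openin (ktop X) W'" "x \<in> W'" "W' \<subseteq> ?W \<inter> ?W"
    "\<forall>y\<in>W'. (?s \<otimes>\<^bsub>sec_ring X ?W\<^esub> ?t) y = \<one>\<^bsub>sec_ring X ?W\<^esub> y"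
    using lrs_germ_eq[OF X W W p, of x] x(1) V(2,4) r(2) by (auto simp: sec_ring_simps)
  have "s y \<in> Units (stalk X y)" if y: "y \<in> W'" for y
  proof -
    have yW: "y \<in> U" "y \<in> V" using y W'(3) by auto
    interpret R: cring "stalk X y" by (rule lrs_stalk_cring[OF X openin_pts[OF U yW(1)]])
    have c: "s y \<in> carrier (stalk X y)" "t y \<in> carrier (stalk X y)"
      using lrs_sec_carrier[OF X U s yW(1)] lrs_sec_carrier[OF X V(1,3) yW(2)] by auto
    have "s y \<otimes>\<^bsub>stalk X y\<^esub> t y = \<one>\<^bsub>stalk X y\<^esub>" using W'(4) y yW by (auto simp: sec_ring_simps)
    then show ?thesis using c R.m_comm[OF c] by (auto simp: Units_def)
  qed
  then show "\<exists>T. openin (ktop X) T \<and> x \<in> T \<and> T \<subseteq> {x \<in> U. s x \<in> Units (stalk X x)}"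
    using W'(1-3) by (intro exI[of _ W']) auto
qed

text \<open>The inverses in the stalks are unique, so a local section representing one of them
  agrees with all the others nearby, and the inverses glue.\<close>

lemma lrs_sec_inverse:
  assumes X: "lrs X" and U: "openin (ktop X) U" and s: "s \<in> secs X U"
    and un: "\<And>x. x \<in> U \<Longrightarrow> s x \<in> Units (stalk X x)"
  obtains t where "t \<in> secs X U" "\<And>x. x \<in> U \<Longrightarrow> s x \<otimes>\<^bsub>stalk X x\<^esub> t x = \<one>\<^bsub>stalk X x\<^esub>"
proof -
  define t where "t = (\<lambda>x\<in>U. inv\<^bsub>stalk X x\<^esub> s x)"
  have t: "t x \<in> carrier (stalk X x)" "s x \<otimes>\<^bsub>stalk X x\<^esub> t x = \<one>\<^bsub>stalk X x\<^esub>" if x: "x \<in> U" for x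
  proof -
    interpret R: cring "stalk X x" by (rule lrs_stalk_cring[OF X openin_pts[OF U x]])
    show "t x \<in> carrier (stalk X x)" "s x \<otimes>\<^bsub>stalk X x\<^esub> t x = \<one>\<^bsub>stalk X x\<^esub>"
      using un[OF x] x by (simp_all add: t_def)
  qed
  have "t \<in> secs X U"
  proof (rule lrs_glue_eq[OF X U])
    show "t \<in> extensional U" by (simp add: t_def)
    fix x assume x: "x \<in> U"
    obtain V r where V: "openin (ktop X) V" "x \<in> V" "r \<in> secs X V" "r x = t x"
      using lrs_germ[OF X openin_pts[OF U x] t(1)[OF x]] by blast
    let ?W = "U \<inter> V"
    have W: "openin (ktop X) ?W" using U V(1) by blast
    interpret B: cring "sec_ring X ?W" by (rule lrs_sec_ring[OF X W])
    let ?s = "restrict s ?W" and ?r = "restrict r ?W"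
    have st: "?s \<in> secs X ?W" "?r \<in> secs X ?W"
      using lrs_restrict[OF X U W _ s] lrs_restrict[OF X V(1) W _ V(3)] by auto
    have p: "?s \<otimes>\<^bsub>sec_ring X ?W\<^esub> ?r \<in> secs X ?W" "\<one>\<^bsub>sec_ring X ?W\<^esub> \<in> secs X ?W"
      using B.m_closed B.one_closed st by (simp_all add: sec_ring_simps(1))
    obtain W' where W': "openin (ktop X) W'" "x \<in> W'" "W' \<subseteq> ?W \<inter> ?W"
      "\<forall>y\<in>W'. (?s \<otimes>\<^bsub>sec_ring X ?W\<^esub> ?r) y = \<one>\<^bsub>sec_ring X ?W\<^esub> y"
      using lrs_germ_eq[OF X W W p, of x] x V(2,4) t(2) by (auto simp: sec_ring_simps)
    have "t y = restrict r W' y" if y: "y \<in> W'" for y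
    proof -
      have yW: "y \<in> U" "y \<in> V" using y W'(3) by auto
      interpret R: cring "stalk X y" by (rule lrs_stalk_cring[OF X openin_pts[OF U yW(1)]])
      have "s y \<otimes>\<^bsub>stalk X y\<^esub> r y = \<one>\<^bsub>stalk X y\<^esub>" using W'(4) y yW by (auto simp: sec_ring_simps)
      then have "s y \<otimes>\<^bsub>stalk X y\<^esub> r y = s y \<otimes>\<^bsub>stalk X y\<^esub> t y" using t(2)[OF yW(1)] by simp
      then have "r y = t y"
        using R.Units_l_cancel[OF un[OF yW(1)] lrs_sec_carrier[OF X V(1,3) yW(2)] t(1)[OF yW(1)]] by simp
      then show ?thesis using y by simp
    qed
    moreover have "restrict r W' \<in> secs X W'" using lrs_restrict[OF X V(1) W'(1) _ V(3)] W'(3) by auto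
    ultimately show "\<exists>V t'. openin (ktop X) V \<and> x \<in> V \<and> t' \<in> secs X V \<and> (\<forall>y\<in>V \<inter> U. t y = t' y)"
      using W'(1,2) by (intro exI[of _ W'] exI[of _ "restrict r W'"]) auto
  qed
  then show ?thesis using that t(2) by blast
qed

text \<open>The preimage, under evaluation at \<open>x\<close>, of the maximal ideal of a local
  ring.\<close>

lemma lrs_nonunits_prime:
  assumes X: "lrs X" and U: "openin (ktop X) U" and x: "x \<in> U"
  shows "primeideal {a \<in> secs X U. a x \<notin> Units (stalk X x)} (sec_ring X U)"
proof -
  interpret B: cring "sec_ring X U" by (rule lrs_sec_ring[OF X U])
  have lr: "local_ring (stalk X x)" by (rule lrs_local[OF X openin_pts[OF U x]])
  interpret R: cring "stalk X x" using lr by (simp add: local_ring_def)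
  note c = lrs_sec_carrier[OF X U _ x] and bc = B.m_closed B.a_closed B.zero_closed B.one_closed
  have z: "\<zero>\<^bsub>stalk X x\<^esub> \<notin> Units (stalk X x)"
    using lr R.Units_l_cancel[of "\<zero>\<^bsub>stalk X x\<^esub>" "\<one>\<^bsub>stalk X x\<^esub>" "\<zero>\<^bsub>stalk X x\<^esub>"] by (auto simp: local_ring_def)
  show ?thesis
  proof (rule primeidealI[OF B.ideal_criterion B.is_cring])
    let ?I = "{a \<in> secs X U. a x \<notin> Units (stalk X x)}"
    show "?I \<subseteq> carrier (sec_ring X U)" by (auto simp: sec_ring_simps(1))
    show "\<zero>\<^bsub>sec_ring X U\<^esub> \<in> ?I" using bc(3) z x by (simp add: sec_ring_simps)
    show "a \<oplus>\<^bsub>sec_ring X U\<^esub> b \<in> ?I" if "a \<in> ?I" "b \<in> ?I" for a b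
      using that bc(2)[of a b] lr c x by (auto simp: sec_ring_simps local_ring_def)
    show "y \<otimes>\<^bsub>sec_ring X U\<^esub> a \<in> ?I" if "a \<in> ?I" "y \<in> carrier (sec_ring X U)" for a y
      using that bc(1)[of y a] c x R.unit_factor[of "a x" "y x"] R.m_comm[of "a x" "y x"]
      by (auto simp: sec_ring_simps)
    have "\<one>\<^bsub>sec_ring X U\<^esub> \<notin> ?I" using x by (simp add: sec_ring_simps)
    then show "carrier (sec_ring X U) \<noteq> ?I" using bc(4) by metis
    show "a \<in> ?I \<or> b \<in> ?I"
      if "a \<in> carrier (sec_ring X U)" "b \<in> carrier (sec_ring X U)" "a \<otimes>\<^bsub>sec_ring X U\<^esub> b \<in> ?I" for a b
      using that x by (auto simp: sec_ring_simps)
  qed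
qed

text \<open>An element of a local ring is a unit exactly if it is nonzero in the residue field, so
  this is the basic open subset of \<open>U\<close> defined by \<open>a\<close>.\<close>

definition nonvanishing :: "('p, 'r, 'k) kspace \<Rightarrow> 'p set \<Rightarrow> ('p \<Rightarrow> 'r) \<Rightarrow> 'p set" where
  "nonvanishing X U a = {x \<in> U. a x \<in> Units (stalk X x)}"

locale affine_space =
  fixes X :: "('p, 'r, 'k::field) kspace"
  assumes aff: "affine X"
begin

abbreviation "A \<equiv> sec_ring X (pts X)"
abbreviation "D \<equiv> nonvanishing X (pts X)"

lemma lrs: "lrs X"
  using aff by (simp add: affine_def)

lemma open_pts: "openin (ktop X) (pts X)"
  by simp

sublocale A: cring A
  by (rule lrs_sec_ring[OF lrs open_pts])

lemma A_carrier: "carrier A = secs X (pts X)"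
  by (simp add: sec_ring_simps)

lemma prime_bij:
  "bij_betw (\<lambda>x. {a \<in> carrier A. a x \<notin> Units (stalk X x)}) (pts X) {P. primeideal P A}"
  using aff unfolding affine_def Let_def by (elim conjE) assumption

lemma open_basis:
  assumes "openin (ktop X) U" "x \<in> U"
  obtains a where "a \<in> carrier A" "x \<in> D a" "D a \<subseteq> U"
proof -
  have "\<forall>U. openin (ktop X) U \<longleftrightarrow> U \<subseteq> pts X \<and>
        (\<forall>x\<in>U. \<exists>a\<in>carrier A. a x \<in> Units (stalk X x) \<and> {y \<in> pts X. a y \<in> Units (stalk X y)} \<subseteq> U)"
    using aff unfolding affine_def Let_def by (elim conjE) assumption
  then show ?thesis using assms that unfolding nonvanishing_def by blast
qed

lemma stalk_fractions:
  assumes "x \<in> pts X"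
  shows "r \<in> carrier (stalk X x) \<Longrightarrow> \<exists>a\<in>carrier A. \<exists>b\<in>carrier A. x \<in> D b \<and> r \<otimes>\<^bsub>stalk X x\<^esub> b x = a x"
    "a \<in> carrier A \<Longrightarrow> a x = \<zero>\<^bsub>stalk X x\<^esub> \<Longrightarrow> \<exists>b\<in>carrier A. x \<in> D b \<and> b \<otimes>\<^bsub>A\<^esub> a = \<zero>\<^bsub>A\<^esub>"
proof -
  have *: "\<forall>x\<in>pts X.
        (\<forall>r\<in>carrier (stalk X x). \<exists>a\<in>carrier A. \<exists>b\<in>carrier A.
           b x \<in> Units (stalk X x) \<and> r \<otimes>\<^bsub>stalk X x\<^esub> b x = a x) \<and>
        (\<forall>a\<in>carrier A. a x = \<zero>\<^bsub>stalk X x\<^esub> \<longrightarrow>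
           (\<exists>b\<in>carrier A. b x \<in> Units (stalk X x) \<and> b \<otimes>\<^bsub>A\<^esub> a = \<zero>\<^bsub>A\<^esub>))"
    using aff unfolding affine_def Let_def by (elim conjE) assumption
  show "r \<in> carrier (stalk X x) \<Longrightarrow> \<exists>a\<in>carrier A. \<exists>b\<in>carrier A. x \<in> D b \<and> r \<otimes>\<^bsub>stalk X x\<^esub> b x = a x"
    "a \<in> carrier A \<Longrightarrow> a x = \<zero>\<^bsub>stalk X x\<^esub> \<Longrightarrow> \<exists>b\<in>carrier A. x \<in> D b \<and> b \<otimes>\<^bsub>A\<^esub> a = \<zero>\<^bsub>A\<^esub>"
    using *[rule_format, OF assms] assms unfolding nonvanishing_def by simp_all
qed

lemma D_open: "a \<in> carrier A \<Longrightarrow> openin (ktop X) (D a)"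
  unfolding nonvanishing_def A_carrier by (rule lrs_unit_open[OF lrs open_pts])

lemma D_pts: "x \<in> D a \<Longrightarrow> x \<in> pts X" and D_unit: "x \<in> D a \<Longrightarrow> a x \<in> Units (stalk X x)"
  by (simp_all add: nonvanishing_def)

lemma cring_stalk: "x \<in> pts X \<Longrightarrow> cring (stalk X x)"
  by (rule lrs_stalk_cring[OF lrs])

lemma A_val: "a \<in> carrier A \<Longrightarrow> x \<in> pts X \<Longrightarrow> a x \<in> carrier (stalk X x)"
  unfolding A_carrier by (rule lrs_sec_carrier[OF lrs open_pts])

lemma A_pow: "a \<in> carrier A \<Longrightarrow> x \<in> pts X \<Longrightarrow> (a [^]\<^bsub>A\<^esub> (n::nat)) x = a x [^]\<^bsub>stalk X x\<^esub> n"
  unfolding A_carrier by (rule sec_ring_pow[OF lrs open_pts])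

lemma D_mult:
  assumes "a \<in> carrier A" "b \<in> carrier A"
  shows "D (a \<otimes>\<^bsub>A\<^esub> b) = D a \<inter> D b"
proof -
  have "a x \<otimes>\<^bsub>stalk X x\<^esub> b x \<in> Units (stalk X x) \<longleftrightarrow> a x \<in> Units (stalk X x) \<and> b x \<in> Units (stalk X x)"
    if x: "x \<in> pts X" for x
  proof -
    interpret R: cring "stalk X x" by (rule cring_stalk[OF x])
    show ?thesis using A_val[OF assms(1) x] A_val[OF assms(2) x]
        R.unit_factor[of "a x" "b x"] R.unit_factor[of "b x" "a x"] R.m_comm[of "a x" "b x"] by auto
  qed
  then show ?thesis by (auto simp: nonvanishing_def sec_ring_simps)
qed

text \<open>Locality of the stalks: if a sum is a unit, one of its summands is.\<close>

lemma D_add: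
  assumes "a \<in> carrier A" "b \<in> carrier A"
  shows "D (a \<oplus>\<^bsub>A\<^esub> b) \<subseteq> D a \<union> D b"
proof
  fix x assume "x \<in> D (a \<oplus>\<^bsub>A\<^esub> b)"
  then have x: "x \<in> pts X" "a x \<oplus>\<^bsub>stalk X x\<^esub> b x \<in> Units (stalk X x)"
    by (auto simp: nonvanishing_def sec_ring_simps)
  then have "a x \<in> Units (stalk X x) \<or> b x \<in> Units (stalk X x)"
    using lrs_local[OF lrs x(1)] A_val[OF assms(1) x(1)] A_val[OF assms(2) x(1)]
    by (simp add: local_ring_def)
  then show "x \<in> D a \<union> D b" using x(1) by (auto simp: nonvanishing_def)
qed

lemma D_zero: "D \<zero>\<^bsub>A\<^esub> = {}"
proof -
  have "\<zero>\<^bsub>stalk X x\<^esub> \<notin> Units (stalk X x)" if x: "x \<in> pts X" for x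
  proof -
    have lr: "local_ring (stalk X x)" by (rule lrs_local[OF lrs x])
    interpret R: cring "stalk X x" by (rule cring_stalk[OF x])
    show ?thesis
      using lr R.Units_l_cancel[of "\<zero>\<^bsub>stalk X x\<^esub>" "\<one>\<^bsub>stalk X x\<^esub>" "\<zero>\<^bsub>stalk X x\<^esub>"] by (auto simp: local_ring_def)
  qed
  then show ?thesis by (auto simp: nonvanishing_def sec_ring_simps)
qed

lemma D_pow:
  assumes "a \<in> carrier A"
  shows "D a \<subseteq> D (a [^]\<^bsub>A\<^esub> (n::nat))"
proof
  fix x assume x: "x \<in> D a"
  interpret R: cring "stalk X x" by (rule cring_stalk[OF D_pts[OF x]])
  show "x \<in> D (a [^]\<^bsub>A\<^esub> n)"
    using x R.Units_pow_closed[OF D_unit[OF x], of n] A_pow[OF assms D_pts[OF x]] by (simp add: nonvanishing_def)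
qed

text \<open>Otherwise some prime contains \<open>J\<close> and avoids \<open>f\<close>. It is the
  prime of a point of \<open>D f\<close>, at which some element of \<open>J\<close> would have to be
  a unit. This statement replaces finite subcovers: to make something uniform on \<open>D f\<close>,
  it suffices to arrange the good functions in an ideal.\<close>

lemma power_in_ideal:
  assumes J: "ideal J A" and f: "f \<in> carrier A" and cover: "\<And>x. x \<in> D f \<Longrightarrow> \<exists>a\<in>J. x \<in> D a"
  shows "\<exists>n::nat. f [^]\<^bsub>A\<^esub> n \<in> J"
proof (rule ccontr)
  assume "\<not> ?thesis"
  then obtain P where P: "primeideal P A" "J \<subseteq> P" "f \<notin> P"
    using A.prime_avoiding_powers[OF J f] by blast
  have "P \<in> (\<lambda>x. {a \<in> carrier A. a x \<notin> Units (stalk X x)}) ` pts X"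
    using P(1) prime_bij unfolding bij_betw_def by simp
  then obtain x where x: "x \<in> pts X" "P = {a \<in> carrier A. a x \<notin> Units (stalk X x)}" by blast
  then have "x \<in> D f" using P(3) f by (simp add: nonvanishing_def)
  then obtain a where "a \<in> J" "x \<in> D a" using cover by blast
  then show False using P(2) x(2) by (auto simp: nonvanishing_def)
qed

text \<open>The functions \<open>a\<close> for which the property holds on \<open>D a \<inter> D f\<close> form an ideal: this is
  the quasi-compactness of \<open>D f\<close>.\<close>

lemma compact_induct:
  assumes f: "f \<in> carrier A" and empty: "Q {}"
    and mono: "\<And>U V. Q V \<Longrightarrow> U \<subseteq> V \<Longrightarrow> Q U" and union: "\<And>U V. Q U \<Longrightarrow> Q V \<Longrightarrow> Q (U \<union> V)"
    and loc: "\<And>x. x \<in> D f \<Longrightarrow> \<exists>U. openin (ktop X) U \<and> x \<in> U \<and> Q U"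
  shows "Q (D f)"
proof -
  let ?J = "{a \<in> carrier A. Q (D a \<inter> D f)}"
  have "ideal ?J A"
  proof (rule A.ideal_criterion)
    show "\<zero>\<^bsub>A\<^esub> \<in> ?J" using D_zero empty by simp
    show "a \<oplus>\<^bsub>A\<^esub> b \<in> ?J" if "a \<in> ?J" "b \<in> ?J" for a b
      using mono[OF union, of "D a \<inter> D f" "D b \<inter> D f" "D (a \<oplus>\<^bsub>A\<^esub> b) \<inter> D f"] D_add[of a b] that by auto
    show "x \<otimes>\<^bsub>A\<^esub> a \<in> ?J" if "a \<in> ?J" "x \<in> carrier A" for a x
      using mono[of "D a \<inter> D f" "D (x \<otimes>\<^bsub>A\<^esub> a) \<inter> D f"] D_mult[of x a] that by auto
  qed auto
  then obtain n :: nat where "f [^]\<^bsub>A\<^esub> n \<in> ?J"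
  proof (rule power_in_ideal[OF _ f, THEN exE])
    fix x assume "x \<in> D f"
    then obtain U where U: "openin (ktop X) U" "x \<in> U" "Q U" using loc by blast
    obtain a where a: "a \<in> carrier A" "x \<in> D a" "D a \<subseteq> U" using open_basis[OF U(1,2)] .
    then have "Q (D a \<inter> D f)" using mono[OF U(3)] by blast
    then show "\<exists>a\<in>?J. x \<in> D a" using a by blast
  qed
  then show ?thesis using mono D_pow[OF f, of n] by auto
qed

text \<open>The annihilator of \<open>p\<close> is an ideal, and the description of the stalks as
  localizations provides an annihilator that is a unit at any given point of
  \<open>D k\<close>.\<close>

lemma vanishing_power:
  assumes p: "p \<in> carrier A" and k: "k \<in> carrier A" and z: "\<And>x. x \<in> D k \<Longrightarrow> p x = \<zero>\<^bsub>stalk X x\<^esub>"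
  shows "\<exists>m::nat. k [^]\<^bsub>A\<^esub> m \<otimes>\<^bsub>A\<^esub> p = \<zero>\<^bsub>A\<^esub>"
proof -
  let ?J = "{a \<in> carrier A. a \<otimes>\<^bsub>A\<^esub> p = \<zero>\<^bsub>A\<^esub>}"
  have "ideal ?J A"
    by (rule A.ideal_criterion) (use p in \<open>auto simp: A.l_distr A.m_assoc\<close>)
  then have "\<exists>n::nat. k [^]\<^bsub>A\<^esub> n \<in> ?J"
  proof (rule power_in_ideal[OF _ k])
    fix x assume x: "x \<in> D k"
    show "\<exists>a\<in>?J. x \<in> D a" using stalk_fractions(2)[OF D_pts[OF x] p z[OF x]] by blast
  qed
  then show ?thesis by blast
qed

lemma sec_val: "f \<in> carrier A \<Longrightarrow> s \<in> secs X (D f) \<Longrightarrow> x \<in> D f \<Longrightarrow> s x \<in> carrier (stalk X x)"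
  using lrs_sec_carrier[OF lrs D_open] by blast

lemma A_restrict: "f \<in> carrier A \<Longrightarrow> a \<in> carrier A \<Longrightarrow> restrict a (D f) \<in> secs X (D f)"
  using lrs_restrict[OF lrs open_pts D_open] D_pts unfolding A_carrier by blast

text \<open>A germ is a fraction p/q, and the equality q s = p at the point spreads to a basic open
  neighbourhood. The denominator \<open>q\<close> is a unit at \<open>x\<close>, but not necessarily
  on all of \<open>D h\<close>.\<close>

lemma local_fraction:
  assumes f: "f \<in> carrier A" and s: "s \<in> secs X (D f)" and x: "x \<in> D f"
  obtains p q h where "p \<in> carrier A" "q \<in> carrier A" "h \<in> carrier A" "x \<in> D q" "x \<in> D h"
    "D h \<subseteq> D f" "\<And>y. y \<in> D h \<Longrightarrow> q y \<otimes>\<^bsub>stalk X y\<^esub> s y = p y"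
proof -
  let ?B = "sec_ring X (D f)"
  interpret B: cring ?B by (rule lrs_sec_ring[OF lrs D_open[OF f]])
  obtain p q where pq: "p \<in> carrier A" "q \<in> carrier A" "x \<in> D q" "s x \<otimes>\<^bsub>stalk X x\<^esub> q x = p x"
    using stalk_fractions(1)[OF D_pts[OF x] sec_val[OF f s x]] by blast
  have c: "restrict q (D f) \<otimes>\<^bsub>?B\<^esub> s \<in> secs X (D f)"
    using B.m_closed[of "restrict q (D f)" s] A_restrict[OF f pq(2)] s by (simp add: sec_ring_simps(1))
  interpret R: cring "stalk X x" by (rule cring_stalk[OF D_pts[OF x]])
  have "(restrict q (D f) \<otimes>\<^bsub>?B\<^esub> s) x = restrict p (D f) x"
    using pq(4) x R.m_comm[OF sec_val[OF f s x] A_val[OF pq(2) D_pts[OF x]]] by (simp add: sec_ring_simps)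
  then obtain W where W: "openin (ktop X) W" "x \<in> W" "W \<subseteq> D f \<inter> D f"
    "\<forall>y\<in>W. (restrict q (D f) \<otimes>\<^bsub>?B\<^esub> s) y = restrict p (D f) y"
    using lrs_germ_eq[OF lrs D_open[OF f] D_open[OF f] c A_restrict[OF f pq(1)], of x] x by blast
  obtain h where h: "h \<in> carrier A" "x \<in> D h" "D h \<subseteq> W" using open_basis[OF W(1,2)] .
  have "q y \<otimes>\<^bsub>stalk X y\<^esub> s y = p y" if "y \<in> D h" for y
  proof -
    have "y \<in> W" "y \<in> D f" using that h(3) W(3) by auto
    then show ?thesis using W(4) by (auto simp: sec_ring_simps)
  qed
  moreover have "D h \<subseteq> D f" using h(3) W(3) by blast
  ultimately show ?thesis using that pq h by blast
qed

text \<open>The analogue for a section given on \<open>D f\<close> only. Near a point, q e = p with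
  \<open>p\<close> global, and \<open>p\<close> vanishes on D(gh); so a power of gh kills
  \<open>p\<close>. Where \<open>h\<close> and \<open>q\<close> are units they cancel, leaving a
  power of \<open>g\<close> that kills \<open>e\<close>. Compactness of \<open>D f\<close> makes the
  exponent uniform.\<close>

lemma vanishing_power_section:
  assumes f: "f \<in> carrier A" and e: "e \<in> secs X (D f)" and g: "g \<in> carrier A" and gf: "D g \<subseteq> D f"
    and z: "\<And>x. x \<in> D g \<Longrightarrow> e x = \<zero>\<^bsub>stalk X x\<^esub>"
  shows "\<exists>m::nat. \<forall>y\<in>D f. g y [^]\<^bsub>stalk X y\<^esub> m \<otimes>\<^bsub>stalk X y\<^esub> e y = \<zero>\<^bsub>stalk X y\<^esub>"
proof -
  let ?z = "\<lambda>m y. g y [^]\<^bsub>stalk X y\<^esub> m \<otimes>\<^bsub>stalk X y\<^esub> e y = \<zero>\<^bsub>stalk X y\<^esub>"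
  \<comment> \<open>Exponents may be raised, so two opens with different exponents can be
    united.\<close>
  have step: "\<forall>(m::nat) (n::nat) y. ?z m y \<longrightarrow> y \<in> D f \<longrightarrow> ?z (m + n) y"
  proof (intro allI impI)
    fix m n :: nat and y assume that: "?z m y" "y \<in> D f"
    interpret R: cring "stalk X y" by (rule cring_stalk[OF D_pts[OF that(2)]])
    have c: "g y \<in> carrier (stalk X y)" "e y \<in> carrier (stalk X y)"
      using A_val[OF g D_pts[OF that(2)]] sec_val[OF f e that(2)] by auto
    have "g y [^]\<^bsub>stalk X y\<^esub> (m + n) \<otimes>\<^bsub>stalk X y\<^esub> e y
        = g y [^]\<^bsub>stalk X y\<^esub> n \<otimes>\<^bsub>stalk X y\<^esub> (g y [^]\<^bsub>stalk X y\<^esub> m \<otimes>\<^bsub>stalk X y\<^esub> e y)"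
      using c by (simp add: R.nat_pow_mult[symmetric] R.m_ac)
    then show "?z (m + n) y" using that(1) c by simp
  qed
  let ?Q = "\<lambda>U. \<exists>m::nat. \<forall>y\<in>U \<inter> D f. ?z m y"
  have "?Q (D f)"
  proof (rule compact_induct[OF f, of ?Q])
    show "?Q {}" by simp
    show "?Q U" if "?Q V" "U \<subseteq> V" for U V using that by blast
    show "?Q (U \<union> V)" if U: "?Q U" and V: "?Q V" for U V
    proof -
      obtain m n :: nat where mn: "\<forall>y\<in>U \<inter> D f. ?z m y" "\<forall>y\<in>V \<inter> D f. ?z n y" using U V by blast
      have "?z (m + n) y" if "y \<in> (U \<union> V) \<inter> D f" for y
        using that mn spec[OF spec[OF spec[OF step, of m], of n], of y] spec[OF spec[OF spec[OF step, of n], of m], of y] by (auto simp: add.commute)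
      then show ?thesis by blast
    qed
    fix x assume x: "x \<in> D f"
    obtain p q h where *: "p \<in> carrier A" "q \<in> carrier A" "h \<in> carrier A" "x \<in> D q" "x \<in> D h"
      "D h \<subseteq> D f" "\<And>y. y \<in> D h \<Longrightarrow> q y \<otimes>\<^bsub>stalk X y\<^esub> e y = p y"
      using local_fraction[OF f e x] by blast
    have gh: "g \<otimes>\<^bsub>A\<^esub> h \<in> carrier A" using g *(3) by simp
    have "p y = \<zero>\<^bsub>stalk X y\<^esub>" if "y \<in> D (g \<otimes>\<^bsub>A\<^esub> h)" for y
    proof -
      have y: "y \<in> D g" "y \<in> D h" using that D_mult[OF g *(3)] by auto
      interpret R: cring "stalk X y" by (rule cring_stalk[OF D_pts[OF y(1)]])
      show ?thesis using *(7)[OF y(2)] z[OF y(1)] A_val[OF *(2) D_pts[OF y(1)]] by simp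
    qed
    then obtain m :: nat where m: "(g \<otimes>\<^bsub>A\<^esub> h) [^]\<^bsub>A\<^esub> m \<otimes>\<^bsub>A\<^esub> p = \<zero>\<^bsub>A\<^esub>"
      using vanishing_power[OF *(1) gh] by blast
    have "?z m y" if y: "y \<in> D h" "y \<in> D q" for y
    proof -
      note yp = D_pts[OF y(1)]
      interpret R: cring "stalk X y" by (rule cring_stalk[OF yp])
      have yf: "y \<in> D f" using y(1) *(6) by blast
      note c = A_val[OF g yp] A_val[OF *(3) yp] A_val[OF *(2) yp] sec_val[OF f e yf]
      have "((g \<otimes>\<^bsub>A\<^esub> h) [^]\<^bsub>A\<^esub> m \<otimes>\<^bsub>A\<^esub> p) y = \<zero>\<^bsub>stalk X y\<^esub>"
        using m yp by (simp add: sec_ring_simps)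
      then have "(g y \<otimes>\<^bsub>stalk X y\<^esub> h y) [^]\<^bsub>stalk X y\<^esub> m \<otimes>\<^bsub>stalk X y\<^esub> (q y \<otimes>\<^bsub>stalk X y\<^esub> e y) = \<zero>\<^bsub>stalk X y\<^esub>"
        using yp gh A_pow[OF gh yp] *(7)[OF y(1)] by (simp add: sec_ring_simps)
      then have "(h y [^]\<^bsub>stalk X y\<^esub> m \<otimes>\<^bsub>stalk X y\<^esub> q y) \<otimes>\<^bsub>stalk X y\<^esub> (g y [^]\<^bsub>stalk X y\<^esub> m \<otimes>\<^bsub>stalk X y\<^esub> e y)
          = (h y [^]\<^bsub>stalk X y\<^esub> m \<otimes>\<^bsub>stalk X y\<^esub> q y) \<otimes>\<^bsub>stalk X y\<^esub> \<zero>\<^bsub>stalk X y\<^esub>"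
        using c by (simp add: R.nat_pow_distrib R.m_ac)
      moreover have "h y [^]\<^bsub>stalk X y\<^esub> m \<otimes>\<^bsub>stalk X y\<^esub> q y \<in> Units (stalk X y)"
        using R.Units_pow_closed[OF D_unit[OF y(1)]] D_unit[OF y(2)] by simp
      moreover have "g y [^]\<^bsub>stalk X y\<^esub> m \<otimes>\<^bsub>stalk X y\<^esub> e y \<in> carrier (stalk X y)" using c by simp
      ultimately show ?thesis using R.Units_l_cancel[OF _ _ R.zero_closed] by blast
    qed
    then have "?Q (D h \<inter> D q)" by blast
    moreover have "openin (ktop X) (D h \<inter> D q)" using D_open[OF *(2)] D_open[OF *(3)] by blast
    ultimately show "\<exists>U. openin (ktop X) U \<and> x \<in> U \<and> ?Q U" using *(4,5) by blast
  qed
  then show ?thesis by simp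
qed

text \<open>Sections over \<open>D f\<close> are fractions with a power of \<open>f\<close> as denominator, because the
  global denominators of a section form an ideal.\<close>

lemma section_fraction:
  assumes f: "f \<in> carrier A" and a: "a \<in> secs X (D f)"
  shows "\<exists>n::nat. \<exists>c\<in>carrier A. \<forall>y\<in>D f. f y [^]\<^bsub>stalk X y\<^esub> n \<otimes>\<^bsub>stalk X y\<^esub> a y = c y"
proof -
  let ?B = "sec_ring X (D f)"
  interpret B: cring ?B by (rule lrs_sec_ring[OF lrs D_open[OF f]])
  let ?J = "{b \<in> carrier A. \<exists>c\<in>carrier A. \<forall>y\<in>D f. b y \<otimes>\<^bsub>stalk X y\<^esub> a y = c y}"
  have av: "\<And>y. y \<in> D f \<Longrightarrow> a y \<in> carrier (stalk X y)" using sec_val[OF f a] .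
  have "ideal ?J A"
  proof (rule A.ideal_criterion)
    have "\<zero>\<^bsub>A\<^esub> y \<otimes>\<^bsub>stalk X y\<^esub> a y = \<zero>\<^bsub>A\<^esub> y" if "y \<in> D f" for y
    proof -
      interpret R: cring "stalk X y" by (rule cring_stalk[OF D_pts[OF that]])
      show ?thesis using av[OF that] D_pts[OF that] by (simp add: sec_ring_simps)
    qed
    then show "\<zero>\<^bsub>A\<^esub> \<in> ?J" by (intro CollectI conjI bexI[of _ "\<zero>\<^bsub>A\<^esub>"]) auto
  next
    fix b b' assume "b \<in> ?J" "b' \<in> ?J"
    then obtain c c' where *: "b \<in> carrier A" "b' \<in> carrier A" "c \<in> carrier A" "c' \<in> carrier A"
      "\<forall>y\<in>D f. b y \<otimes>\<^bsub>stalk X y\<^esub> a y = c y" "\<forall>y\<in>D f. b' y \<otimes>\<^bsub>stalk X y\<^esub> a y = c' y" by blast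
    have "(b \<oplus>\<^bsub>A\<^esub> b') y \<otimes>\<^bsub>stalk X y\<^esub> a y = (c \<oplus>\<^bsub>A\<^esub> c') y" if "y \<in> D f" for y
    proof -
      interpret R: cring "stalk X y" by (rule cring_stalk[OF D_pts[OF that]])
      show ?thesis using av[OF that] D_pts[OF that] * that A_val[OF *(1)] A_val[OF *(2)]
        by (auto simp: sec_ring_simps R.l_distr)
    qed
    then show "b \<oplus>\<^bsub>A\<^esub> b' \<in> ?J" using * by (intro CollectI conjI bexI[of _ "c \<oplus>\<^bsub>A\<^esub> c'"]) auto
  next
    fix b x assume "b \<in> ?J" and x: "x \<in> carrier A"
    then obtain c where *: "b \<in> carrier A" "c \<in> carrier A" "\<forall>y\<in>D f. b y \<otimes>\<^bsub>stalk X y\<^esub> a y = c y" by blast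
    have "(x \<otimes>\<^bsub>A\<^esub> b) y \<otimes>\<^bsub>stalk X y\<^esub> a y = (x \<otimes>\<^bsub>A\<^esub> c) y" if "y \<in> D f" for y
    proof -
      interpret R: cring "stalk X y" by (rule cring_stalk[OF D_pts[OF that]])
      show ?thesis using av[OF that] D_pts[OF that] * that A_val[OF *(1)] A_val[OF x]
        by (auto simp: sec_ring_simps R.m_assoc)
    qed
    then show "x \<otimes>\<^bsub>A\<^esub> b \<in> ?J" using * x by (intro CollectI conjI bexI[of _ "x \<otimes>\<^bsub>A\<^esub> c"]) auto
  qed auto
  then have "\<exists>n::nat. f [^]\<^bsub>A\<^esub> n \<in> ?J"
  proof (rule power_in_ideal[OF _ f])
    fix x assume x: "x \<in> D f"
    obtain c b g where *: "c \<in> carrier A" "b \<in> carrier A" "g \<in> carrier A" "x \<in> D b" "x \<in> D g"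
      "D g \<subseteq> D f" "\<And>y. y \<in> D g \<Longrightarrow> b y \<otimes>\<^bsub>stalk X y\<^esub> a y = c y"
      using local_fraction[OF f a x] by blast
    let ?b = "restrict b (D f)" and ?c = "restrict c (D f)"
    have bc: "?b \<in> carrier ?B" "?c \<in> carrier ?B" "a \<in> carrier ?B"
      using A_restrict[OF f *(2)] A_restrict[OF f *(1)] a by (auto simp: sec_ring_simps(1))
    \<comment> \<open>The failure of the local equation b a = c outside \<open>D g\<close>. It
      vanishes on \<open>D g\<close>, so a power of \<open>g\<close> kills it on all of
      \<open>D f\<close>, and that power times \<open>b\<close> is a global denominator of
      \<open>a\<close>.\<close>
    define e where "e = ?b \<otimes>\<^bsub>?B\<^esub> a \<ominus>\<^bsub>?B\<^esub> ?c"
    have e: "e \<in> secs X (D f)" using bc by (simp add: e_def sec_ring_simps(1)[symmetric])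
    have ev: "e y = b y \<otimes>\<^bsub>stalk X y\<^esub> a y \<ominus>\<^bsub>stalk X y\<^esub> c y" if y: "y \<in> D f" for y
    proof -
      interpret h: ring_hom_cring ?B "stalk X y" "\<lambda>s. s y"
        using lrs_eval_hom[OF lrs D_open[OF f] y] cring_stalk[OF D_pts[OF y]] B.is_cring
        by (intro ring_hom_cringI) (auto intro: ring_hom_ringI2 cring.axioms)
      have "e y = (?b \<otimes>\<^bsub>?B\<^esub> a) y \<oplus>\<^bsub>stalk X y\<^esub> (\<ominus>\<^bsub>stalk X y\<^esub> ?c y)"
        unfolding e_def a_minus_def using bc by (simp add: h.hom_add[simplified] h.hom_a_inv[simplified])
      then show ?thesis using y by (simp add: sec_ring_simps a_minus_def)
    qed
    have "e y = \<zero>\<^bsub>stalk X y\<^esub>" if y: "y \<in> D g" for y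
    proof -
      have yf: "y \<in> D f" using y *(6) by blast
      interpret R: cring "stalk X y" by (rule cring_stalk[OF D_pts[OF y]])
      show ?thesis using ev[OF yf] *(7)[OF y] A_val[OF *(1) D_pts[OF y]] by (simp add: R.r_neg a_minus_def)
    qed
    then obtain m :: nat where m: "\<forall>y\<in>D f. g y [^]\<^bsub>stalk X y\<^esub> m \<otimes>\<^bsub>stalk X y\<^esub> e y = \<zero>\<^bsub>stalk X y\<^esub>"
      using vanishing_power_section[OF f e *(3,6)] by blast
    let ?gm = "g [^]\<^bsub>A\<^esub> m"
    have gm: "?gm \<in> carrier A" using *(3) by simp
    have "(?gm \<otimes>\<^bsub>A\<^esub> b) y \<otimes>\<^bsub>stalk X y\<^esub> a y = (?gm \<otimes>\<^bsub>A\<^esub> c) y" if y: "y \<in> D f" for y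
    proof -
      note yp = D_pts[OF y]
      interpret R: cring "stalk X y" by (rule cring_stalk[OF yp])
      note v = A_val[OF gm yp] A_val[OF *(1) yp] A_val[OF *(2) yp] av[OF y]
      have "?gm y \<otimes>\<^bsub>stalk X y\<^esub> (b y \<otimes>\<^bsub>stalk X y\<^esub> a y \<ominus>\<^bsub>stalk X y\<^esub> c y) = \<zero>\<^bsub>stalk X y\<^esub>"
        using bspec[OF m y] ev[OF y] A_pow[OF *(3) yp] by simp
      then have "?gm y \<otimes>\<^bsub>stalk X y\<^esub> (b y \<otimes>\<^bsub>stalk X y\<^esub> a y) \<ominus>\<^bsub>stalk X y\<^esub> ?gm y \<otimes>\<^bsub>stalk X y\<^esub> c y = \<zero>\<^bsub>stalk X y\<^esub>"
        using v by (simp add: a_minus_def R.r_distr R.r_minus)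
      then have "?gm y \<otimes>\<^bsub>stalk X y\<^esub> (b y \<otimes>\<^bsub>stalk X y\<^esub> a y) = ?gm y \<otimes>\<^bsub>stalk X y\<^esub> c y"
        using v by (simp add: R.r_right_minus_eq)
      then show ?thesis using v yp by (simp add: sec_ring_simps R.m_assoc)
    qed
    then have "?gm \<otimes>\<^bsub>A\<^esub> b \<in> ?J"
      using *(1,2) gm by (intro CollectI conjI bexI[of _ "?gm \<otimes>\<^bsub>A\<^esub> c"]) auto
    moreover have "x \<in> D (?gm \<otimes>\<^bsub>A\<^esub> b)"
      unfolding D_mult[OF gm *(2)] using D_pow[OF *(3), of m] *(4,5) by auto
    ultimately show "\<exists>b\<in>?J. x \<in> D b" by blast
  qed
  then obtain n :: nat where n: "f [^]\<^bsub>A\<^esub> n \<in> ?J" by blast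
  then obtain c where "c \<in> carrier A" "\<forall>y\<in>D f. (f [^]\<^bsub>A\<^esub> n) y \<otimes>\<^bsub>stalk X y\<^esub> a y = c y" by blast
  then show ?thesis using A_pow[OF f D_pts] by (intro exI[of _ n] bexI[of _ c]) auto
qed

end

text \<open>Every clause is transferred from the global ring by \<open>section_fraction\<close>: a
  section over \<open>D f\<close> becomes the restriction of a global function after multiplication
  by a power of \<open>f\<close>, which is a unit on \<open>D f\<close>. The points of
  \<open>D f\<close> thereby correspond to the primes that avoid \<open>f\<close>.\<close>

lemma (in affine_space) affine_open_sub_D:
  assumes f: "f \<in> carrier A"
  shows "affine (open_sub X (D f))"
proof -
  let ?B = "sec_ring X (D f)"
  note Do = D_open[OF f]
  note p = pts_open_sub[OF Do] and o = openin_open_sub[OF Do]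
  interpret B: cring ?B by (rule lrs_sec_ring[OF lrs Do])
  have Bc: "carrier ?B = secs X (D f)" by (simp add: sec_ring_simps)
  have res: "restrict a (D f) \<in> carrier ?B" if "a \<in> carrier A" for a
    using A_restrict[OF f that] Bc by simp
  have "D f \<subseteq> pts X" using D_pts by blast
  then have rh: "ring_hom_ring A ?B (\<lambda>s. restrict s (D f))"
    by (intro ring_hom_ringI2 A.ring_axioms B.ring_axioms restrict_hom[OF lrs open_pts Do])
  have unit_r: "restrict f (D f) \<in> Units ?B"
  proof -
    obtain t where t: "t \<in> secs X (D f)"
      "\<And>x. x \<in> D f \<Longrightarrow> restrict f (D f) x \<otimes>\<^bsub>stalk X x\<^esub> t x = \<one>\<^bsub>stalk X x\<^esub>"
      using lrs_sec_inverse[OF lrs Do A_restrict[OF f f]] D_unit by auto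
    have "restrict f (D f) \<otimes>\<^bsub>?B\<^esub> t = \<one>\<^bsub>?B\<^esub>"
      by (rule sec_eqI[OF lrs Do]) (use t res[OF f] Bc B.m_closed[of "restrict f (D f)" t] B.one_closed in
        \<open>simp_all add: sec_ring_simps\<close>)
    then show ?thesis using t(1) res[OF f] Bc B.m_comm[of "restrict f (D f)" t] by (auto simp: Units_def)
  qed
  have pr: "primeideal {a \<in> secs X (D f). a x \<notin> Units (stalk X x)} ?B" if "x \<in> D f" for x
    by (rule lrs_nonunits_prime[OF lrs Do that])
  have "bij_betw (\<lambda>x. {a \<in> carrier ?B. a x \<notin> Units (stalk X x)}) (D f) {P. primeideal P ?B}"
    unfolding bij_betw_def
  proof
    show "inj_on (\<lambda>x. {a \<in> carrier ?B. a x \<notin> Units (stalk X x)}) (D f)"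
    proof (rule inj_onI)
      fix x y assume xy: "x \<in> D f" "y \<in> D f"
        "{a \<in> carrier ?B. a x \<notin> Units (stalk X x)} = {a \<in> carrier ?B. a y \<notin> Units (stalk X y)}"
      \<comment> \<open>The restrictions of global functions already separate the points.\<close>
      have "{a \<in> carrier A. a x \<notin> Units (stalk X x)} = {a \<in> carrier A. a y \<notin> Units (stalk X y)}"
      proof -
        have "a x \<in> Units (stalk X x) \<longleftrightarrow> a y \<in> Units (stalk X y)" if a: "a \<in> carrier A" for a
        proof -
          have "restrict a (D f) \<in> {a \<in> carrier ?B. a x \<notin> Units (stalk X x)} \<longleftrightarrow>
              restrict a (D f) \<in> {a \<in> carrier ?B. a y \<notin> Units (stalk X y)}" using xy(3) by simp
          then show ?thesis using res[OF a] xy(1,2) by simp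
        qed
        then show ?thesis by blast
      qed
      then show "x = y" using bij_betw_imp_inj_on[OF prime_bij] D_pts[OF xy(1)] D_pts[OF xy(2)]
        by (auto dest: inj_onD)
    qed
    show "(\<lambda>x. {a \<in> carrier ?B. a x \<notin> Units (stalk X x)}) ` D f = {P. primeideal P ?B}"
    proof
      show "(\<lambda>x. {a \<in> carrier ?B. a x \<notin> Units (stalk X x)}) ` D f \<subseteq> {P. primeideal P ?B}"
        using pr Bc by auto
      show "{P. primeideal P ?B} \<subseteq> (\<lambda>x. {a \<in> carrier ?B. a x \<notin> Units (stalk X x)}) ` D f"
      proof
        fix P assume "P \<in> {P. primeideal P ?B}"
        then have P: "primeideal P ?B" by simp
        interpret P: primeideal P ?B by (rule P)
        \<comment> \<open>The contraction of \<open>P\<close> to the global ring is the prime of a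
          point \<open>x\<close>. As \<open>f\<close> becomes invertible on \<open>D f\<close>, it
          is not in \<open>P\<close>, so \<open>x\<close> lies in \<open>D f\<close>.\<close>
        let ?P = "{a \<in> carrier A. restrict a (D f) \<in> P}"
        have "primeideal ?P A" by (rule ring_hom_ring.primeideal_vimage[OF rh A.is_cring P])
        then have "?P \<in> (\<lambda>x. {a \<in> carrier A. a x \<notin> Units (stalk X x)}) ` pts X"
          using prime_bij unfolding bij_betw_def by simp
        then obtain x where x: "x \<in> pts X" "?P = {a \<in> carrier A. a x \<notin> Units (stalk X x)}" by blast
        have mem: "restrict a (D f) \<in> P \<longleftrightarrow> a x \<notin> Units (stalk X x)" if "a \<in> carrier A" for a
          using x(2) that by blast
        have fP: "restrict f (D f) \<notin> P"
        proof
          assume "restrict f (D f) \<in> P"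
          moreover obtain t where "t \<in> carrier ?B" "t \<otimes>\<^bsub>?B\<^esub> restrict f (D f) = \<one>\<^bsub>?B\<^esub>"
            using unit_r by (auto simp: Units_def)
          ultimately have "\<one>\<^bsub>?B\<^esub> \<in> P" using P.I_l_closed by metis
          then show False using P.I_notcarr P.one_imp_carrier by simp
        qed
        then have xf: "x \<in> D f" using mem[OF f] x(1) by (simp add: nonvanishing_def)
        interpret R: cring "stalk X x" by (rule cring_stalk[OF x(1)])
        \<comment> \<open>Multiplication by a power of \<open>f\<close> changes neither membership
          in \<open>P\<close> nor invertibility at \<open>x\<close>, and for a suitable power the
          product is global, where the two conditions are known to match.\<close>
        have "a \<in> P \<longleftrightarrow> a x \<notin> Units (stalk X x)" if a: "a \<in> carrier ?B" for a
        proof -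
          have as: "a \<in> secs X (D f)" using a Bc by simp
          obtain n :: nat and c where c: "c \<in> carrier A"
            "\<forall>y\<in>D f. f y [^]\<^bsub>stalk X y\<^esub> n \<otimes>\<^bsub>stalk X y\<^esub> a y = c y" using section_fraction[OF f as] by blast
          let ?r = "restrict f (D f)"
          have rn: "?r [^]\<^bsub>?B\<^esub> n \<in> carrier ?B" using res[OF f] by simp
          have "?r [^]\<^bsub>?B\<^esub> n \<otimes>\<^bsub>?B\<^esub> a = restrict c (D f)"
            by (rule sec_eqI[OF lrs Do]) (use B.m_closed[OF rn a] Bc A_restrict[OF f c(1)] c(2)
              sec_ring_pow[OF lrs Do A_restrict[OF f f]] in \<open>simp_all add: sec_ring_simps\<close>)
          moreover have "a \<in> P \<longleftrightarrow> ?r [^]\<^bsub>?B\<^esub> n \<otimes>\<^bsub>?B\<^esub> a \<in> P"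
          proof -
            have "?r [^]\<^bsub>?B\<^esub> n \<notin> P"
            proof (induction n)
              case 0
              show ?case using P.I_notcarr P.one_imp_carrier by auto
            next
              case (Suc n)
              show ?case
              proof
                assume "?r [^]\<^bsub>?B\<^esub> Suc n \<in> P"
                then have "?r [^]\<^bsub>?B\<^esub> n \<otimes>\<^bsub>?B\<^esub> ?r \<in> P" by (simp only: B.nat_pow_Suc)
                then show False
                  using P.I_prime[OF B.nat_pow_closed[OF res[OF f]] res[OF f]] fP Suc by blast
              qed
            qed
            then show ?thesis using P.I_prime[OF rn a] P.I_l_closed[OF _ rn] by blast
          qed
          ultimately have 1: "a \<in> P \<longleftrightarrow> c x \<notin> Units (stalk X x)" using mem[OF c(1)] by simp
          have un: "f x [^]\<^bsub>stalk X x\<^esub> n \<in> Units (stalk X x)" using R.Units_pow_closed[OF D_unit[OF xf]] .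
          have av: "a x \<in> carrier (stalk X x)" using sec_val[OF f as xf] .
          have "c x \<in> Units (stalk X x) \<longleftrightarrow> a x \<in> Units (stalk X x)"
            using bspec[OF c(2) xf] un av R.Units_m_closed[OF un, of "a x"]
              R.unit_factor[of "a x" "f x [^]\<^bsub>stalk X x\<^esub> n"] R.m_comm[of "a x" "f x [^]\<^bsub>stalk X x\<^esub> n"]
            by (metis R.Units_closed)
          then show ?thesis using 1 by simp
        qed
        then have "P = {a \<in> carrier ?B. a x \<notin> Units (stalk X x)}" using P.a_subset by blast
        then show "P \<in> (\<lambda>x. {a \<in> carrier ?B. a x \<notin> Units (stalk X x)}) ` D f" using xf by blast
      qed
    qed
  qed
  moreover have "(openin (ktop X) U \<and> U \<subseteq> D f) \<longleftrightarrow> U \<subseteq> D f \<and>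
      (\<forall>x\<in>U. \<exists>a\<in>carrier ?B. a x \<in> Units (stalk X x) \<and> {y \<in> D f. a y \<in> Units (stalk X y)} \<subseteq> U)" for U
  proof (intro iffI conjI ballI)
    fix x assume U: "openin (ktop X) U \<and> U \<subseteq> D f" and x: "x \<in> U"
    obtain a where a: "a \<in> carrier A" "x \<in> D a" "D a \<subseteq> U" using open_basis[OF conjunct1[OF U] x] .
    have "{y \<in> D f. restrict a (D f) y \<in> Units (stalk X y)} \<subseteq> U"
      using a(3) by (auto simp: nonvanishing_def)
    then show "\<exists>a\<in>carrier ?B. a x \<in> Units (stalk X x) \<and> {y \<in> D f. a y \<in> Units (stalk X y)} \<subseteq> U"
      using res[OF a(1)] U x D_unit[OF a(2)] by (intro bexI[of _ "restrict a (D f)"]) auto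
  next
    assume U: "U \<subseteq> D f \<and>
      (\<forall>x\<in>U. \<exists>a\<in>carrier ?B. a x \<in> Units (stalk X x) \<and> {y \<in> D f. a y \<in> Units (stalk X y)} \<subseteq> U)"
    show "openin (ktop X) U"
    proof (subst openin_subopen, rule ballI)
      fix x assume x: "x \<in> U"
      then obtain a where a: "a \<in> carrier ?B" "a x \<in> Units (stalk X x)" "{y \<in> D f. a y \<in> Units (stalk X y)} \<subseteq> U"
        using bspec[OF conjunct2[OF U], of x] by auto
      show "\<exists>T. openin (ktop X) T \<and> x \<in> T \<and> T \<subseteq> U"
        using lrs_unit_open[OF lrs Do, of a] a x U Bc by (intro exI[of _ "{y \<in> D f. a y \<in> Units (stalk X y)}"]) auto
    qed
  qed auto
  moreover have "\<exists>a\<in>carrier ?B. \<exists>b\<in>carrier ?B. b x \<in> Units (stalk X x) \<and> r \<otimes>\<^bsub>stalk X x\<^esub> b x = a x"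
    if x: "x \<in> D f" and r: "r \<in> carrier (stalk X x)" for x r
  proof -
    obtain a b where "a \<in> carrier A" "b \<in> carrier A" "x \<in> D b" "r \<otimes>\<^bsub>stalk X x\<^esub> b x = a x"
      using stalk_fractions(1)[OF D_pts[OF x] r] by blast
    then show ?thesis using res x D_unit
      by (intro bexI[of _ "restrict a (D f)"] bexI[of _ "restrict b (D f)"]) auto
  qed
  moreover have "\<exists>b\<in>carrier ?B. b x \<in> Units (stalk X x) \<and> b \<otimes>\<^bsub>?B\<^esub> a = \<zero>\<^bsub>?B\<^esub>"
    if x: "x \<in> D f" and a: "a \<in> carrier ?B" "a x = \<zero>\<^bsub>stalk X x\<^esub>" for x a
  proof -
    have as: "a \<in> secs X (D f)" using a Bc by simp
    obtain n :: nat and c where c: "c \<in> carrier A"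
      "\<forall>y\<in>D f. f y [^]\<^bsub>stalk X y\<^esub> n \<otimes>\<^bsub>stalk X y\<^esub> a y = c y" using section_fraction[OF f as] by blast
    interpret R: cring "stalk X x" by (rule cring_stalk[OF D_pts[OF x]])
    have "c x = \<zero>\<^bsub>stalk X x\<^esub>" using bspec[OF c(2) x] a(2) A_val[OF f D_pts[OF x]] by simp
    then obtain b where b: "b \<in> carrier A" "x \<in> D b" "b \<otimes>\<^bsub>A\<^esub> c = \<zero>\<^bsub>A\<^esub>"
      using stalk_fractions(2)[OF D_pts[OF x] c(1)] by blast
    \<comment> \<open>The numerator \<open>c\<close> vanishes at \<open>x\<close>, so a global
      \<open>b\<close> that is a unit at \<open>x\<close> annihilates it. Since \<open>c\<close> is
      f^n times \<open>a\<close> on \<open>D f\<close>, the product of \<open>b\<close> and f^n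
      annihilates \<open>a\<close>.\<close>
    let ?b = "restrict (b \<otimes>\<^bsub>A\<^esub> (f [^]\<^bsub>A\<^esub> n)) (D f)"
    have bf: "b \<otimes>\<^bsub>A\<^esub> (f [^]\<^bsub>A\<^esub> n) \<in> carrier A" using b(1) f by simp
    have "?b \<otimes>\<^bsub>?B\<^esub> a = \<zero>\<^bsub>?B\<^esub>"
    proof (rule sec_eqI[OF lrs Do])
      show "?b \<otimes>\<^bsub>?B\<^esub> a \<in> secs X (D f)" "\<zero>\<^bsub>?B\<^esub> \<in> secs X (D f)"
        using B.m_closed[OF res[OF bf] a(1)] B.zero_closed Bc by auto
      fix y assume y: "y \<in> D f"
      note yp = D_pts[OF y]
      interpret Ry: cring "stalk X y" by (rule cring_stalk[OF yp])
      have "(b \<otimes>\<^bsub>A\<^esub> c) y = \<zero>\<^bsub>stalk X y\<^esub>" using b(3) yp by (simp add: sec_ring_simps)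
      then have "b y \<otimes>\<^bsub>stalk X y\<^esub> (f y [^]\<^bsub>stalk X y\<^esub> n \<otimes>\<^bsub>stalk X y\<^esub> a y) = \<zero>\<^bsub>stalk X y\<^esub>"
        using bspec[OF c(2) y] yp by (simp add: sec_ring_simps)
      then show "(?b \<otimes>\<^bsub>?B\<^esub> a) y = \<zero>\<^bsub>?B\<^esub> y"
        using y yp A_val[OF b(1) yp] A_val[OF f yp] sec_val[OF f as y] A_pow[OF f yp]
        by (simp add: sec_ring_simps Ry.m_assoc)
    qed
    moreover have "?b x \<in> Units (stalk X x)"
      using D_unit[of x "b \<otimes>\<^bsub>A\<^esub> (f [^]\<^bsub>A\<^esub> n)"] D_mult[OF b(1), of "f [^]\<^bsub>A\<^esub> n"] f b(2) x D_pow[OF f, of n] by auto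
    ultimately show ?thesis using res[OF bf] by blast
  qed
  ultimately show ?thesis
    unfolding affine_def Let_def p o unfolding open_sub_simps(1-4)
    using lrs_open_sub[OF lrs Do] by simp
qed


section \<open>Open subspaces of schemes and of varieties\<close>

lemma affine_open_sub_iff:
  "openin (ktop X) U \<Longrightarrow> V \<subseteq> U \<Longrightarrow> affine_open (open_sub X U) V \<longleftrightarrow> affine_open X V"
  by (simp add: affine_open_def openin_open_sub open_sub_open_sub)

text \<open>Basic open subsets of one affine chart are affine again and can be chosen inside any
  neighbourhood.\<close>

lemma kscheme_affine_basis:
  assumes X: "kscheme X" and U: "openin (ktop X) U" and x: "x \<in> U"
  obtains V where "affine_open X V" "x \<in> V" "V \<subseteq> U"
proof -
  obtain W where W: "x \<in> W" "affine_open X W"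
    using X openin_pts[OF U x] by (auto simp: kscheme_def)
  have Wo: "openin (ktop X) W" and "affine (open_sub X W)" using W(2) by (auto simp: affine_open_def)
  interpret affine_space "open_sub X W" by unfold_locales fact
  have "openin (ktop (open_sub X W)) (U \<inter> W)" using U Wo by (auto simp: openin_open_sub[OF Wo])
  then obtain a where a: "a \<in> carrier A" "x \<in> D a" "D a \<subseteq> U \<inter> W" using open_basis x W(1) by blast
  have "affine (open_sub X (D a))"
    using affine_open_sub_D[OF a(1)] open_sub_open_sub[of "D a" W X] a(3) by simp
  moreover have "openin (ktop X) (D a)" using D_open[OF a(1)] openin_open_sub[OF Wo] by simp
  ultimately show ?thesis using that[of "D a"] a by (auto simp: affine_open_def)
qed

lemma kscheme_open_sub:
  assumes X: "kscheme X" and U: "openin (ktop X) U"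
  shows "kscheme (open_sub X U)"
  unfolding kscheme_def pts_open_sub[OF U]
proof (intro conjI ballI)
  show "lrs (open_sub X U)" using X U by (simp add: lrs_open_sub kscheme_def)
  fix x assume "x \<in> U"
  then obtain V where "affine_open X V" "x \<in> V" "V \<subseteq> U" using kscheme_affine_basis[OF X U] by blast
  then show "\<exists>V. x \<in> V \<and> affine_open (open_sub X U) V" using affine_open_sub_iff[OF U] by blast
qed

text \<open>The product of the open subspace with itself is the open part \<open>Q\<close> of the
  given product on which both projections land in \<open>U\<close>. Projections, mediating morphisms
  and the diagonal are all obtained by lifting along open immersions, and their equations are
  checked after composing with these monomorphisms.\<close>

lemma separated_open_sub:
  assumes X: "kscheme X" and sep: "separated X" and U: "openin (ktop X) U"
  shows "separated (open_sub X U)"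
proof -
  have Xl: "lrs X" using X by (simp add: kscheme_def)
  have kl: "lrs Z" if "kscheme Z" for Z :: "('a, 'b, 'c) kspace" using that by (simp add: kscheme_def)
  let ?C = "spaces_cat kscheme"
  obtain P q d where prod: "is_product ?C {0, 1} P q (\<lambda>_. X)" and d: "d \<in> homs ?C X P"
    and qd: "kcomp (q 0) d = kid X" "kcomp (q 1) d = kid X" and dc: "closed_immersion d"
    using sep by (auto simp: separated_def)
  have P: "kscheme P" and q: "\<And>j. j \<in> {0, 1} \<Longrightarrow> q j \<in> homs ?C P X"
    and univ: "\<And>T h. kscheme T \<Longrightarrow> (\<forall>j\<in>{0,1}. h j \<in> homs ?C T X) \<Longrightarrow>
        \<exists>!m. m \<in> homs ?C T P \<and> (\<forall>j\<in>{0,1}. kcomp (q j) m = h j)"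
    using prod by (auto simp: is_product_def spaces_cat_simps)
  note Pl = kl[OF P]
  have qk: "is_kmor (q j)" "src (q j) = P" "tgt (q j) = X" if "j \<in> {0, 1}" for j
    using q[OF that] by (auto simp: homs_def spaces_cat_simps)
  have dk: "is_kmor d" "src d = X" "tgt d = P" using d by (auto simp: homs_def spaces_cat_simps)
  define Q where "Q = preim (q 0) U \<inter> preim (q 1) U"
  have Oo: "openin (ktop P) Q"
    using preim_open[OF qk(1), of 0 U] preim_open[OF qk(1), of 1 U] qk[of 0] qk[of 1] U
    unfolding Q_def by auto
  have Q1: "bas (q j) x \<in> U" if "j \<in> {0, 1}" "x \<in> Q" for j x
    using that by (auto simp: Q_def preim_def)
  have Q2: "x \<in> Q" if "x \<in> pts P" "\<And>j. j \<in> {0, 1} \<Longrightarrow> bas (q j) x \<in> U" for x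
    using that(1) that(2)[of 0] that(2)[of 1] qk(2)[of 0] qk(2)[of 1] by (simp add: Q_def preim_def)
  let ?U = "open_sub X U" and ?P = "open_sub P Q"
  let ?i = "incl X U" and ?k = "incl P Q"
  note i = open_immersion_incl[OF Xl U] is_kmor_incl[OF Xl U] incl_simps(1,2)[of X U]
  note k = open_immersion_incl[OF Pl Oo] is_kmor_incl[OF Pl Oo] incl_simps(1,2)[of P Q]
  note kU = kscheme_open_sub[OF X U] and kP = kscheme_open_sub[OF P Oo]
  note lU = kl[OF kU] and lP = kl[OF kP]
  note pU = pts_open_sub[OF U] and pP = pts_open_sub[OF Oo]
  let ?q = "\<lambda>j. oi_lift ?i (kcomp (q j) ?k)"
  have qkk: "is_kmor (kcomp (q j) ?k)" "bas (kcomp (q j) ?k) ` pts ?P \<subseteq> U" if j: "j \<in> {0, 1}" for j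
  proof -
    show "is_kmor (kcomp (q j) ?k)" using qk[OF j] k Xl by (intro is_kmor_kcomp) auto
    show "bas (kcomp (q j) ?k) ` pts ?P \<subseteq> U"
    proof (rule image_subsetI)
      fix x assume "x \<in> pts ?P"
      then have x: "x \<in> Q" using pP by simp
      then have "bas (kcomp (q j) ?k) x = bas (q j) x" using k pP by (simp add: kcomp_bas incl_simps(3))
      then show "bas (kcomp (q j) ?k) x \<in> U" using Q1[OF j x] by simp
    qed
  qed
  have q': "is_kmor (?q j)" "kcomp ?i (?q j) = kcomp (q j) ?k" "src (?q j) = ?P" "tgt (?q j) = ?U"
    if j: "j \<in> {0, 1}" for j
  proof -
    have im: "bas (kcomp (q j) ?k) ` pts (src (kcomp (q j) ?k)) \<subseteq> bas ?i ` pts (src ?i)"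
    proof -
      have "bas ?i ` U = U" by (force simp: incl_simps)
      then show ?thesis using qkk(2)[OF j] by (simp add: kcomp_simps incl_simps pU)
    qed
    note lift = is_kmor_oi_lift kcomp_oi_lift src_oi_lift tgt_oi_lift
    note L = lift[OF i(1) _ _ qkk(1)[OF j] _ im]
    show "is_kmor (?q j)" "kcomp ?i (?q j) = kcomp (q j) ?k" "src (?q j) = ?P" "tgt (?q j) = ?U"
      using L lU Xl qk[OF j] by (simp_all add: kcomp_simps incl_simps)
  qed
  have "is_product ?C {0, 1} ?P ?q (\<lambda>_. ?U)"
    unfolding is_product_def spaces_cat_simps
  proof (intro conjI ballI allI impI)
    show "?P \<in> {X. kscheme X}" using kP by simp
    show "?q j \<in> homs ?C ?P ?U" if "j \<in> {0, 1}" for j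
      using q'[OF that] kP kU by (simp add: homs_def spaces_cat_simps)
    fix T and h :: "nat \<Rightarrow> ('a, 'b, 'c) kmor"
    assume "T \<in> {X. kscheme X}" and h: "\<forall>j\<in>{0,1}. h j \<in> homs ?C T ?U"
    then have T: "kscheme T" by simp
    have hk: "is_kmor (h j)" "src (h j) = T" "tgt (h j) = ?U" if "j \<in> {0, 1}" for j
      using h that by (auto simp: homs_def spaces_cat_simps)
    have ih: "is_kmor (kcomp ?i (h j))" if "j \<in> {0, 1}" for j
      using hk[OF that] i Xl by (intro is_kmor_kcomp) auto
    have "\<forall>j\<in>{0,1}. kcomp ?i (h j) \<in> homs ?C T X"
      using ih hk T X i by (auto simp: homs_def spaces_cat_simps kcomp_simps)
    then have "\<exists>!m. m \<in> homs ?C T P \<and> (\<forall>j\<in>{0,1}. kcomp (q j) m = kcomp ?i (h j))"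
      using univ[of T "\<lambda>j. kcomp ?i (h j)"] T by blast
    then obtain m where m: "m \<in> homs ?C T P" "\<forall>j\<in>{0,1}. kcomp (q j) m = kcomp ?i (h j)"
      and mu: "\<And>m'. m' \<in> homs ?C T P \<Longrightarrow> \<forall>j\<in>{0,1}. kcomp (q j) m' = kcomp ?i (h j) \<Longrightarrow> m' = m" by blast
    have mk: "is_kmor m" "src m = T" "tgt m = P" using m(1) by (auto simp: homs_def spaces_cat_simps)
    have "bas m x \<in> Q" if x: "x \<in> pts T" for x
    proof -
      have "bas (q j) (bas m x) \<in> U" if j: "j \<in> {0, 1}" for j
      proof -
        have hx: "bas (h j) x \<in> U" using is_kmorD(9)[OF hk(1)[OF j]] hk[OF j] x pU by simp
        have "bas (kcomp (q j) m) x = bas (kcomp ?i (h j)) x" using bspec[OF m(2) j] by simp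
        then show ?thesis using x hx mk hk[OF j] by (simp add: kcomp_bas incl_simps)
      qed
      then show ?thesis using Q2 is_kmorD(9)[OF mk(1)] x mk by simp
    qed
    moreover have "bas ?k ` Q = Q" by (force simp: incl_simps)
    ultimately have im: "bas m ` pts (src m) \<subseteq> bas ?k ` pts (src ?k)"
      using mk by (auto simp: incl_simps pP)
    note L = is_kmor_oi_lift[OF k(1) _ _ mk(1) _ im] kcomp_oi_lift[OF k(1) _ _ mk(1) _ im]
      src_oi_lift[OF k(1) _ _ mk(1) _ im] tgt_oi_lift[OF k(1) _ _ mk(1) _ im]
    let ?m = "oi_lift ?k m"
    have L: "is_kmor ?m" "kcomp ?k ?m = m" "src ?m = T" "tgt ?m = ?P"
      using L lP Pl mk by (simp_all add: incl_simps)
    have lT: "lrs T" using kl[OF T] .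
    \<comment> \<open>Translates a condition on maps into the open part \<open>Q\<close> into one on
      maps into the whole product, where the universal property is available.\<close>
    have comp: "kcomp (q j) (kcomp ?k n) = kcomp ?i (kcomp (?q j) n)"
      if j: "j \<in> {0, 1}" and n: "is_kmor n" "src n = T" "tgt n = ?P" for j n
    proof -
      have "kcomp (q j) (kcomp ?k n) = kcomp (kcomp (q j) ?k) n"
        using qk[OF j] k n lT lP Pl Xl by (intro kcomp_assoc[symmetric]) auto
      also have "\<dots> = kcomp (kcomp ?i (?q j)) n" using q'(2)[OF j] by simp
      also have "\<dots> = kcomp ?i (kcomp (?q j) n)"
        using q'[OF j] i n lT lP lU Xl by (intro kcomp_assoc) auto
      finally show ?thesis .
    qed
    show "\<exists>!m. m \<in> homs ?C T ?P \<and> (\<forall>j\<in>{0,1}. kcomp (?q j) m = h j)"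
    proof (rule ex1I[of _ ?m])
      have "kcomp (?q j) ?m = h j" if j: "j \<in> {0, 1}" for j
      proof (rule open_immersion_mono[OF i(1)])
        show "is_kmor (kcomp (?q j) ?m)" using q'[OF j] L lU by (intro is_kmor_kcomp) auto
        show "kcomp ?i (kcomp (?q j) ?m) = kcomp ?i (h j)"
          using comp[OF j L(1,3,4)] L(2) bspec[OF m(2) j] by simp
      qed (use hk[OF j] q'[OF j] L in \<open>auto simp: incl_simps kcomp_simps\<close>)
      then show "?m \<in> homs ?C T ?P \<and> (\<forall>j\<in>{0,1}. kcomp (?q j) ?m = h j)"
        using L T kP by (simp add: homs_def spaces_cat_simps)
    next
      fix n assume *: "n \<in> homs ?C T ?P \<and> (\<forall>j\<in>{0,1}. kcomp (?q j) n = h j)"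
      then have n: "is_kmor n" "src n = T" "tgt n = ?P" by (auto simp: homs_def spaces_cat_simps)
      have nk: "is_kmor (kcomp ?k n)" using n k Pl by (intro is_kmor_kcomp) auto
      have "kcomp ?k n = m"
      proof (rule mu)
        show "kcomp ?k n \<in> homs ?C T P" using nk n k T P by (simp add: homs_def spaces_cat_simps kcomp_simps)
        show "\<forall>j\<in>{0,1}. kcomp (q j) (kcomp ?k n) = kcomp ?i (h j)"
        proof
          fix j :: nat assume j: "j \<in> {0, 1}"
          show "kcomp (q j) (kcomp ?k n) = kcomp ?i (h j)"
            using comp[OF j n] bspec[OF conjunct2[OF *] j] by simp
        qed
      qed
      then show "n = ?m"
        using open_immersion_mono[OF k(1) n(1) _ L(1)] n L by (simp add: incl_simps)
    qed
  qed
  moreover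
  have di: "is_kmor (kcomp d ?i)" using dk i Pl by (intro is_kmor_kcomp) auto
  have qdx: "bas (q j) (bas d x) = x" if "j \<in> {0, 1}" "x \<in> pts X" for j x
  proof -
    have "bas (kcomp (q j) d) x = x" using qd that kid_bas[of x X] by auto
    then show ?thesis using that dk by (simp add: kcomp_bas)
  qed
  \<comment> \<open>The diagonal meets \<open>Q\<close> exactly over \<open>U\<close>. So the image
    of the restricted diagonal is the trace on \<open>Q\<close> of a closed set, hence closed
    there.\<close>
  have dO: "bas d x \<in> Q \<longleftrightarrow> x \<in> U" if "x \<in> pts X" for x
    using qdx[OF _ that] Q1[of 0 "bas d x"] Q2[of "bas d x"] is_kmorD(9)[OF dk(1), of x] that dk
    by (metis insertI1)
  have im: "bas (kcomp d ?i) ` pts (src (kcomp d ?i)) \<subseteq> bas ?k ` pts (src ?k)"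
  proof -
    have "bas ?k ` Q = Q" by (force simp: incl_simps)
    moreover have "bas (kcomp d ?i) x \<in> Q" if x: "x \<in> U" for x
      using dO[OF openin_pts[OF U x]] x by (simp add: kcomp_bas incl_simps pU)
    ultimately show ?thesis by (auto simp: incl_simps pP pU kcomp_simps)
  qed
  let ?d = "oi_lift ?k (kcomp d ?i)"
  have d': "is_kmor ?d" "kcomp ?k ?d = kcomp d ?i" "src ?d = ?U" "tgt ?d = ?P"
    using is_kmor_oi_lift[OF k(1) _ _ di _ im] kcomp_oi_lift[OF k(1) _ _ di _ im]
      src_oi_lift[OF k(1) _ _ di _ im] tgt_oi_lift[OF k(1) _ _ di _ im] lP Pl dk
    by (simp_all add: incl_simps kcomp_simps)
  have dx: "bas ?d x = bas d x" "bas d x \<in> Q" if x: "x \<in> U" for x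
  proof -
    show O: "bas d x \<in> Q" using dO[OF openin_pts[OF U x]] x by simp
    have "bas ?d x \<in> Q" using is_kmorD(9)[OF d'(1)] d' pU pP x by simp
    then have "bas (kcomp ?k ?d) x = bas ?d x" using x d'(3) pU by (simp add: kcomp_bas incl_simps)
    moreover have "bas (kcomp d ?i) x = bas d x" using x pU by (simp add: kcomp_bas incl_simps)
    ultimately show "bas ?d x = bas d x" using d'(2) by simp
  qed
  have sx: "shf ?d x r = shf d x r" if x: "x \<in> U" and r: "r \<in> carrier (stalk P (bas d x))" for x r
  proof -
    have r': "shf d x r \<in> carrier (stalk X x)" using is_kmorD(10)[OF dk(1), of x r] dk openin_pts[OF U x] r by simp
    have "shf (kcomp ?k ?d) x r = shf ?d x r"
      using x r d'(3) pU dx[OF x] by (simp add: kcomp_shf incl_simps)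
    moreover have "shf (kcomp d ?i) x r = shf d x r"
      using x r r' dk(3) pU by (simp add: kcomp_shf incl_simps)
    ultimately show ?thesis using d'(2) by simp
  qed
  \<comment> \<open>Both sides become the inclusion of \<open>U\<close> after composition with that
    inclusion, which is a monomorphism.\<close>
  have dq: "kcomp (?q j) ?d = kid ?U" if j: "j \<in> {0, 1}" for j
  proof (rule open_immersion_mono[OF i(1)])
    show "is_kmor (kcomp (?q j) ?d)" using q'[OF j] d' lU by (intro is_kmor_kcomp) auto
    show "is_kmor (kid ?U)" by (rule is_kmor_kid[OF lU])
    have "kcomp ?i (kcomp (?q j) ?d) = kcomp (kcomp ?i (?q j)) ?d"
      using q'[OF j] i d' lP lU Xl by (intro kcomp_assoc[symmetric]) auto
    also have "\<dots> = kcomp (kcomp (q j) ?k) ?d" using q'(2)[OF j] by simp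
    also have "\<dots> = kcomp (q j) (kcomp ?k ?d)"
      using qk[OF j] k d' lU lP Pl Xl by (intro kcomp_assoc) auto
    also have "\<dots> = kcomp (kcomp (q j) d) ?i"
      unfolding d'(2) using qk[OF j] dk i lU Pl Xl by (intro kcomp_assoc[symmetric]) auto
    also have "\<dots> = kcomp (kid X) ?i" using qd j by auto
    also have "\<dots> = ?i"
      using idn_cmp[OF spaces_category[of lrs], of ?i X] i lU Xl by (simp add: spaces_cat_simps)
    also have "\<dots> = kcomp ?i (kid ?U)"
      using cmp_idn[OF spaces_category[of lrs], of ?i ?U] i lU Xl by (simp add: spaces_cat_simps)
    finally show "kcomp ?i (kcomp (?q j) ?d) = kcomp ?i (kid ?U)" .
  qed (use q'[OF j] d' in \<open>auto simp: kcomp_simps kid_simps incl_simps\<close>)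
  have "closed_immersion ?d"
    unfolding closed_immersion_def d'(3,4) pU
  proof (intro conjI ballI)
    have emb: "embedding_map (ktop X) (ktop P) (bas d)" and clo: "closedin (ktop P) (bas d ` pts X)"
      and sur: "\<And>y. y \<in> pts X \<Longrightarrow> shf d y ` carrier (stalk P (bas d y)) = carrier (stalk X y)"
      using dc dk by (auto simp: closed_immersion_def)
    show "is_kmor ?d" by (rule d')
    have "embedding_map (ktop ?U) (ktop X) (bas ?i)"
      using i(1) by (simp add: open_immersion_def incl_simps)
    from embedding_map_compose[OF this emb] have "embedding_map (ktop ?U) (ktop P) (bas d \<circ> bas ?i)" .
    then have e: "embedding_map (ktop ?U) (ktop P) (bas ?d)"
      by (rule embedding_map_eq) (use pU dx in \<open>auto simp: incl_simps\<close>)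
    then show "embedding_map (ktop ?U) (ktop ?P) (bas ?d)"
      unfolding open_sub_simps(5)[of P] embedding_map_in_subtopology
      using is_kmorD(9)[OF d'(1)] d' pP by auto
    have "bas ?d ` U = Q \<inter> bas d ` pts X"
    proof
      show "bas ?d ` U \<subseteq> Q \<inter> bas d ` pts X" using dx openin_pts[OF U] by auto
      show "Q \<inter> bas d ` pts X \<subseteq> bas ?d ` U" using dO dx by (auto simp: image_iff)
    qed
    then show "closedin (ktop ?P) (bas ?d ` U)"
      using closedin_subtopology_Int_closed[OF clo, of Q] by (simp add: open_sub_simps(5))
    fix y assume y: "y \<in> U"
    show "shf ?d y ` carrier (stalk ?P (bas ?d y)) = carrier (stalk ?U y)"
      using sur[OF openin_pts[OF U y]] sx[OF y] dx(1)[OF y] by (simp add: open_sub_simps(1))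
  qed
  moreover have "?d \<in> homs ?C ?U ?P" using d' kU kP by (simp add: homs_def spaces_cat_simps)
  ultimately show ?thesis
    unfolding separated_def using dq[of 0] dq[of 1]
    by (intro exI[of _ ?P] exI[of _ ?q] exI[of _ ?d]) simp
qed

lemma kscheme_lrs: "kscheme X \<Longrightarrow> lrs X"
  and kvariety_kscheme: "kvariety X \<Longrightarrow> kscheme X"
  and kvariety_lrs: "kvariety X \<Longrightarrow> lrs X"
  by (auto simp: kscheme_def kvariety_def)

text \<open>The inverse \<open>t\<close> of \<open>a\<close> is added to the restricted generators:
  by \<open>section_fraction\<close> every section over the basic open subset is a power of
  \<open>t\<close> times a restricted section.\<close>

lemma finite_type_nonvanishing:
  assumes X: "kscheme X" and U: "affine_open X U" and S: "finite S" "S \<subseteq> secs X U"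
    and gen: "generate_ring (sec_ring X U) (S \<union> range (\<lambda>c. \<lambda>x\<in>U. scal X x c)) = secs X U"
    and a: "a \<in> secs X U"
  shows "finite_type (open_sub X (nonvanishing X U a))"
proof -
  have Uo: "openin (ktop X) U" and "affine (open_sub X U)" using U by (auto simp: affine_open_def)
  interpret aff: affine_space "open_sub X U" by unfold_locales fact
  note Xl = kscheme_lrs[OF X]
  let ?D = "nonvanishing X U a"
  have DU: "?D \<subseteq> U" by (auto simp: nonvanishing_def)
  have aA: "a \<in> carrier (sec_ring X U)" using a by (simp add: sec_ring_simps(1))
  note p = pts_open_sub[OF Uo]
  have D: "nonvanishing (open_sub X U) (pts (open_sub X U)) a = ?D"
    unfolding p by (simp add: nonvanishing_def open_sub_simps(1))
  have Do: "openin (ktop X) ?D" unfolding nonvanishing_def by (rule lrs_unit_open[OF Xl Uo a])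
  have daff: "affine (open_sub X ?D)"
    using aff.affine_open_sub_D[of a] aA open_sub_open_sub[OF DU, of X] unfolding D
    unfolding p open_sub_simps(4) by simp
  have frac: "\<exists>n::nat. \<exists>c\<in>secs X U. \<forall>y\<in>?D. a y [^]\<^bsub>stalk X y\<^esub> n \<otimes>\<^bsub>stalk X y\<^esub> s y = c y"
    if "s \<in> secs X ?D" for s
    using aff.section_fraction[of a s] that aA unfolding D unfolding p open_sub_simps(1-4)
    by (simp add: sec_ring_simps(1))
  let ?B = "sec_ring X ?D"
  interpret B: cring ?B by (rule lrs_sec_ring[OF Xl Do])
  interpret A: cring "sec_ring X U" by (rule lrs_sec_ring[OF Xl Uo])
  have Bc: "carrier ?B = secs X ?D" and Ac: "carrier (sec_ring X U) = secs X U" by (simp_all add: sec_ring_simps(1))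
  let ?res = "\<lambda>s. restrict s ?D"
  have rh: "?res \<in> ring_hom (sec_ring X U) ?B" by (rule restrict_hom[OF Xl Uo Do DU])
  interpret rh: ring_hom_cring "sec_ring X U" ?B ?res
    using rh A.is_cring B.is_cring by (intro ring_hom_cringI) auto
  have res: "?res s \<in> secs X ?D" if "s \<in> secs X U" for s using lrs_restrict[OF Xl Uo Do DU that] .
  obtain t where t: "t \<in> secs X ?D" "\<And>x. x \<in> ?D \<Longrightarrow> a x \<otimes>\<^bsub>stalk X x\<^esub> t x = \<one>\<^bsub>stalk X x\<^esub>"
    using lrs_sec_inverse[OF Xl Do res[OF a]] by (auto simp: nonvanishing_def)
  let ?k = "range (\<lambda>c. \<lambda>x\<in>?D. scal X x c)"
  let ?S = "insert t (?res ` S)"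
  have kD: "?k \<subseteq> secs X ?D"
    using lrs_scal_sec[OF lrs_open_sub[OF Xl Do]] pts_open_sub[OF Do] by (auto simp: open_sub_simps)
  have Ssub: "?S \<union> ?k \<subseteq> carrier ?B" using kD t(1) res S(2) Bc by auto
  let ?G = "generate_ring ?B (?S \<union> ?k)"
  \<comment> \<open>Induction on the generation of the big ring; scalars restrict to scalars and
    generators to generators.\<close>
  have cG: "?res c \<in> ?G" if "c \<in> secs X U" for c
  proof -
    have "c \<in> generate_ring (sec_ring X U) (S \<union> range (\<lambda>c. \<lambda>x\<in>U. scal X x c))" using gen that by simp
    then show ?thesis
    proof induction
      case one
      then show ?case using rh.hom_one generate_ring.one[of ?B] by simp
    next
      case (incl h)
      show ?case
      proof (cases "h \<in> S")
        case True then show ?thesis by (intro generate_ring.incl) auto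
      next
        case False
        then obtain c where "h = (\<lambda>x\<in>U. scal X x c)" using incl by auto
        then have "?res h = (\<lambda>x\<in>?D. scal X x c)" using DU by (auto simp: restrict_def fun_eq_iff)
        then show ?thesis by (intro generate_ring.incl) auto
      qed
    next
      case (a_inv h)
      then have "h \<in> carrier (sec_ring X U)" using gen Ac by simp
      then have "?res (\<ominus>\<^bsub>sec_ring X U\<^esub> h) = \<ominus>\<^bsub>?B\<^esub> ?res h" by (rule rh.hom_a_inv)
      then show ?case by (simp only: generate_ring.a_inv[OF a_inv.IH])
    next
      case (eng_add h1 h2)
      then have "h1 \<in> carrier (sec_ring X U)" "h2 \<in> carrier (sec_ring X U)" using gen Ac by auto
      then have "?res (h1 \<oplus>\<^bsub>sec_ring X U\<^esub> h2) = ?res h1 \<oplus>\<^bsub>?B\<^esub> ?res h2" by (rule rh.hom_add)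
      then show ?case by (simp only: generate_ring.eng_add[OF eng_add.IH])
    next
      case (eng_mult h1 h2)
      then have "h1 \<in> carrier (sec_ring X U)" "h2 \<in> carrier (sec_ring X U)" using gen Ac by auto
      then have "?res (h1 \<otimes>\<^bsub>sec_ring X U\<^esub> h2) = ?res h1 \<otimes>\<^bsub>?B\<^esub> ?res h2" by (rule rh.hom_mult)
      then show ?case by (simp only: generate_ring.eng_mult[OF eng_mult.IH])
    qed
  qed
  have tn: "t [^]\<^bsub>?B\<^esub> n \<in> ?G" for n :: nat
  proof (induction n)
    case 0 then show ?case using generate_ring.one[of ?B] by simp
  next
    case (Suc n)
    have "t \<in> ?G" by (rule generate_ring.incl) simp
    then show ?case unfolding B.nat_pow_Suc by (rule generate_ring.eng_mult[OF Suc])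
  qed
  have "secs X ?D \<subseteq> ?G"
  proof
    fix s assume s: "s \<in> secs X ?D"
    obtain n :: nat and c where c: "c \<in> secs X U" "\<forall>y\<in>?D. a y [^]\<^bsub>stalk X y\<^esub> n \<otimes>\<^bsub>stalk X y\<^esub> s y = c y"
      using frac[OF s] by blast
    have "s = t [^]\<^bsub>?B\<^esub> n \<otimes>\<^bsub>?B\<^esub> ?res c"
    proof (rule sec_eqI[OF Xl Do s])
      show "t [^]\<^bsub>?B\<^esub> n \<otimes>\<^bsub>?B\<^esub> ?res c \<in> secs X ?D"
        using B.m_closed[OF B.nat_pow_closed, of t "?res c" n] t(1) res[OF c(1)] Bc by simp
      fix y assume y: "y \<in> ?D"
      interpret R: cring "stalk X y" by (rule lrs_stalk_cring[OF Xl openin_pts[OF Do y]])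
      have v: "a y \<in> carrier (stalk X y)" "t y \<in> carrier (stalk X y)" "s y \<in> carrier (stalk X y)"
        using lrs_sec_carrier[OF Xl Uo a] lrs_sec_carrier[OF Xl Do] t(1) s y DU by auto
      have "(t [^]\<^bsub>?B\<^esub> n \<otimes>\<^bsub>?B\<^esub> ?res c) y = t y [^]\<^bsub>stalk X y\<^esub> n \<otimes>\<^bsub>stalk X y\<^esub> c y"
        using y sec_ring_pow[OF Xl Do t(1) y] by (simp add: sec_ring_simps)
      also have "\<dots> = (a y \<otimes>\<^bsub>stalk X y\<^esub> t y) [^]\<^bsub>stalk X y\<^esub> n \<otimes>\<^bsub>stalk X y\<^esub> s y"
        unfolding bspec[OF c(2) y, symmetric] using v by (simp add: R.nat_pow_distrib R.m_ac)
      also have "\<dots> = s y" using t(2)[OF y] v by simp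
      finally show "s y = (t [^]\<^bsub>?B\<^esub> n \<otimes>\<^bsub>?B\<^esub> ?res c) y" by simp
    qed
    then show "s \<in> ?G" by (simp only: generate_ring.eng_mult[OF tn cG[OF c(1)]])
  qed
  moreover have "?G \<subseteq> secs X ?D" using B.generate_ring_incl[OF Ssub] Bc by simp
  ultimately have G: "?G = secs X ?D" by blast
  note pD = pts_open_sub[OF Do]
  have "affine_open (open_sub X ?D) ?D"
    unfolding affine_open_sub_iff[OF Do order.refl] using daff Do by (simp add: affine_open_def)
  moreover have "finite ?S" "?S \<subseteq> secs (open_sub X ?D) ?D"
    using S(1) Ssub Bc unfolding open_sub_simps by auto
  moreover have "generate_ring (sec_ring (open_sub X ?D) ?D)
      (?S \<union> range (\<lambda>c. \<lambda>x\<in>?D. scal (open_sub X ?D) x c)) = secs (open_sub X ?D) ?D"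
    unfolding open_sub_simps(2-4) by (rule G)
  ultimately show ?thesis
    unfolding finite_type_def pD by (intro exI[of _ "{?D}"]) blast
qed

text \<open>The universal property of a fibre square in \<open>Var\<close> can be tested on
  varieties only, so the neighbourhoods used as test objects must be of finite type as well.
  Choosing them as basic open subsets of the given finitely generated charts ensures this.\<close>

lemma kvariety_affine_basis:
  assumes X: "kvariety X" and U: "openin (ktop X) U" and x: "x \<in> U"
  obtains V where "affine_open X V" "x \<in> V" "V \<subseteq> U" "kvariety (open_sub X V)"
proof -
  note Xk = kvariety_kscheme[OF X]
  obtain UU where UU: "\<Union>UU = pts X" "\<forall>W\<in>UU. affine_open X W \<and>
        (\<exists>S. finite S \<and> S \<subseteq> secs X W \<and>
           generate_ring (sec_ring X W) (S \<union> range (\<lambda>c. \<lambda>x\<in>W. scal X x c)) = secs X W)"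
    using X by (auto simp: kvariety_def finite_type_def)
  obtain W where W: "W \<in> UU" "x \<in> W" using UU(1) openin_pts[OF U x] by blast
  obtain S where S: "affine_open X W" "finite S" "S \<subseteq> secs X W"
      "generate_ring (sec_ring X W) (S \<union> range (\<lambda>c. \<lambda>x\<in>W. scal X x c)) = secs X W"
    using bspec[OF UU(2) W(1)] by blast
  have Wo: "openin (ktop X) W" and "affine (open_sub X W)" using S(1) by (auto simp: affine_open_def)
  interpret aff: affine_space "open_sub X W" by unfold_locales fact
  have "openin (ktop (open_sub X W)) (U \<inter> W)" using U Wo by (auto simp: openin_open_sub[OF Wo])
  then obtain a where a: "a \<in> carrier aff.A" "x \<in> aff.D a" "aff.D a \<subseteq> U \<inter> W"
    using aff.open_basis[of "U \<inter> W" x] x W(2) by blast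
  have D: "aff.D a = nonvanishing X W a"
    unfolding pts_open_sub[OF Wo] by (simp add: nonvanishing_def open_sub_simps(1))
  have as: "a \<in> secs X W"
    using a(1) unfolding pts_open_sub[OF Wo] open_sub_simps(4) by (simp add: sec_ring_simps(1))
  have Do: "openin (ktop X) (aff.D a)" using aff.D_open[OF a(1)] openin_open_sub[OF Wo] by simp
  have "affine (open_sub X (aff.D a))"
    using aff.affine_open_sub_D[OF a(1)] open_sub_open_sub[of "aff.D a" W X] a(3) by simp
  then have "affine_open X (aff.D a)" using Do by (simp add: affine_open_def)
  moreover have "kvariety (open_sub X (aff.D a))"
    unfolding kvariety_def
    using kscheme_open_sub[OF Xk Do] separated_open_sub[OF Xk _ Do] X
      finite_type_nonvanishing[OF Xk S as] D by (simp add: kvariety_def)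
  ultimately show ?thesis using that a by blast
qed

section \<open>Open immersions are smooth\<close>

lemma formally_smooth_iso:
  assumes "\<phi> \<in> ring_iso A B" and A: "ring A"
  shows "formally_smooth A B \<phi>"
  unfolding formally_smooth_def
proof (intro allI impI)
  fix C I h g
  assume *: "cring C \<and> ideal I C \<and> (\<forall>a\<in>I. \<forall>b\<in>I. a \<otimes>\<^bsub>C\<^esub> b = \<zero>\<^bsub>C\<^esub>) \<and>
        h \<in> ring_hom A C \<and> g \<in> ring_hom B (C Quot I) \<and> (\<forall>a\<in>carrier A. g (\<phi> a) = I +>\<^bsub>C\<^esub> h a)"
  interpret A: ring A by (rule A)
  let ?i = "inv_into (carrier A) \<phi>"
  have bij: "bij_betw \<phi> (carrier A) (carrier B)" using assms(1) by (auto simp: ring_iso_def)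
  have i: "?i \<in> ring_hom B A" using ring_iso_set_sym[OF A assms(1)] by (simp add: ring_iso_def)
  have "h \<circ> ?i \<in> ring_hom B C" using ring_hom_trans[OF i] * by blast
  moreover have "\<forall>a\<in>carrier A. (h \<circ> ?i) (\<phi> a) = h a"
    using bij by (simp add: bij_betw_def)
  moreover have "\<forall>b\<in>carrier B. I +>\<^bsub>C\<^esub> (h \<circ> ?i) b = g b"
  proof
    fix b assume b: "b \<in> carrier B"
    have "?i b \<in> carrier A" "\<phi> (?i b) = b"
      using b bij by (auto simp: bij_betw_def inv_into_into f_inv_into_f)
    then show "I +>\<^bsub>C\<^esub> (h \<circ> ?i) b = g b" using * by (metis comp_apply)
  qed
  ultimately show "\<exists>g'\<in>ring_hom B C. (\<forall>a\<in>carrier A. g' (\<phi> a) = h a) \<and> (\<forall>b\<in>carrier B. I +>\<^bsub>C\<^esub> g' b = g b)"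
    by blast
qed

text \<open>Injectivity comes from the stalk maps, surjectivity from
  \<open>open_immersion_section\<close>.\<close>

lemma open_immersion_sec_iso:
  assumes u: "open_immersion u" and Y: "lrs (src u)" and Z: "lrs (tgt u)" and V: "openin (ktop (src u)) V"
  shows "pullsec u V \<in> ring_iso (sec_ring (tgt u) (bas u ` V)) (sec_ring (src u) V)"
proof -
  note O = open_immersionD[OF u] and K = is_kmorD[OF open_immersionD(1)[OF u]]
  let ?U = "bas u ` V"
  note Uo = O(3)[OF V]
  have pre: "preim u ?U = V"
    using O(2) openin_pts[OF V] by (auto simp: preim_def dest: inj_onD)
  have ps: "pullsec u V s \<in> secs (src u) V" if "s \<in> secs (tgt u) ?U" for s
    using K(8)[OF Uo that] pre by simp
  have val: "s (bas u y) \<in> carrier (stalk (tgt u) (bas u y))" if "s \<in> secs (tgt u) ?U" "y \<in> V" for s y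
    using lrs_sec_carrier[OF Z Uo that(1)] that(2) by simp
  have h: "pullsec u V \<in> ring_hom (sec_ring (tgt u) ?U) (sec_ring (src u) V)"
  proof (rule ring_hom_memI)
    fix s assume "s \<in> carrier (sec_ring (tgt u) ?U)"
    then show "pullsec u V s \<in> carrier (sec_ring (src u) V)" using ps by (simp add: sec_ring_simps(1))
  next
    fix s t assume "s \<in> carrier (sec_ring (tgt u) ?U)" "t \<in> carrier (sec_ring (tgt u) ?U)"
    then have st: "s \<in> secs (tgt u) ?U" "t \<in> secs (tgt u) ?U" by (simp_all add: sec_ring_simps(1))
    show "pullsec u V (s \<otimes>\<^bsub>sec_ring (tgt u) ?U\<^esub> t) = pullsec u V s \<otimes>\<^bsub>sec_ring (src u) V\<^esub> pullsec u V t"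
      using ring_hom_mult[OF K(4)] val[OF st(1)] val[OF st(2)] openin_pts[OF V]
      by (auto simp: pullsec_def sec_ring_def restrict_def fun_eq_iff)
    show "pullsec u V (s \<oplus>\<^bsub>sec_ring (tgt u) ?U\<^esub> t) = pullsec u V s \<oplus>\<^bsub>sec_ring (src u) V\<^esub> pullsec u V t"
      using ring_hom_add[OF K(4)] val[OF st(1)] val[OF st(2)] openin_pts[OF V]
      by (auto simp: pullsec_def sec_ring_def restrict_def fun_eq_iff)
  next
    show "pullsec u V \<one>\<^bsub>sec_ring (tgt u) ?U\<^esub> = \<one>\<^bsub>sec_ring (src u) V\<^esub>"
      using ring_hom_one[OF K(4)] openin_pts[OF V]
      by (auto simp: pullsec_def sec_ring_def restrict_def fun_eq_iff)
  qed
  have "bij_betw (pullsec u V) (secs (tgt u) ?U) (secs (src u) V)"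
    unfolding bij_betw_def
  proof
    show "inj_on (pullsec u V) (secs (tgt u) ?U)"
    proof (rule inj_onI)
      fix s t assume st: "s \<in> secs (tgt u) ?U" "t \<in> secs (tgt u) ?U" "pullsec u V s = pullsec u V t"
      show "s = t"
      proof (rule sec_eqI[OF Z Uo st(1,2)])
        fix z assume "z \<in> ?U"
        then obtain y where y: "y \<in> V" "z = bas u y" by blast
        have "shf u y (s z) = shf u y (t z)"
          using fun_cong[OF st(3), of y] y by (simp add: pullsec_def)
        then show "s z = t z"
          using bij_betw_imp_inj_on[OF O(4)[OF openin_pts[OF V y(1)]]] val[OF st(1) y(1)] val[OF st(2) y(1)] y(2)
          by (auto dest: inj_onD)
      qed
    qed
    show "pullsec u V ` secs (tgt u) ?U = secs (src u) V"
    proof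
      show "pullsec u V ` secs (tgt u) ?U \<subseteq> secs (src u) V" using ps by blast
      show "secs (src u) V \<subseteq> pullsec u V ` secs (tgt u) ?U"
      proof
        fix s assume s: "s \<in> secs (src u) V"
        obtain t where t: "t \<in> secs (tgt u) ?U" "\<And>y. y \<in> V \<Longrightarrow> shf u y (t (bas u y)) = s y"
          using open_immersion_section[OF u Y Z V s] by blast
        have "pullsec u V t = s"
          by (rule sec_eqI[OF Y V ps[OF t(1)] s]) (use t(2) in \<open>simp add: pullsec_def\<close>)
        then show "s \<in> pullsec u V ` secs (tgt u) ?U" using t(1) by blast
      qed
    qed
  qed
  with h show ?thesis by (simp add: ring_iso_def sec_ring_simps(1))
qed

text \<open>All clauses of affineness are transported along the bijection of points and the
  isomorphism \<open>g\<close> of section rings. The bridge is \<open>un\<close>: a section is a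
  unit at the image of \<open>y\<close> exactly if its pullback is a unit at \<open>y\<close>,
  because the stalk maps are local.\<close>

lemma open_immersion_affine:
  assumes u: "open_immersion u" and Y: "lrs (src u)" and Z: "lrs (tgt u)" and V: "affine_open (src u) V"
  shows "affine_open (tgt u) (bas u ` V)"
proof -
  have Vo: "openin (ktop (src u)) V" and "affine (open_sub (src u) V)" using V by (auto simp: affine_open_def)
  interpret aff: affine_space "open_sub (src u) V" by unfold_locales fact
  note O = open_immersionD[OF u] and K = is_kmorD[OF open_immersionD(1)[OF u]]
  let ?U = "bas u ` V" and ?Y = "src u" and ?Z = "tgt u"
  note Uo = O(3)[OF Vo]
  let ?A = "sec_ring ?Y V" and ?B = "sec_ring ?Z ?U"
  have A: "aff.A = ?A" by (simp add: pts_open_sub[OF Vo] open_sub_simps(4))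
  have AD: "aff.D a = nonvanishing ?Y V a" for a
    unfolding pts_open_sub[OF Vo] by (simp add: nonvanishing_def open_sub_simps(1))
  have Dm: "y \<in> aff.D a \<longleftrightarrow> y \<in> V \<and> a y \<in> Units (stalk ?Y y)" for y a
    unfolding AD by (simp add: nonvanishing_def)
  note pV = pts_open_sub[OF Vo]
  have Vp: "y \<in> pts ?Y" if "y \<in> V" for y using openin_pts[OF Vo that] .
  interpret A: cring ?A by (rule lrs_sec_ring[OF Y Vo])
  interpret B: cring ?B by (rule lrs_sec_ring[OF Z Uo])
  let ?f = "pullsec u V"
  have iso: "?f \<in> ring_iso ?B ?A" by (rule open_immersion_sec_iso[OF u Y Z Vo])
  define g where "g = inv_into (carrier ?B) ?f"
  have gi: "g \<in> ring_iso ?A ?B" unfolding g_def by (rule ring_iso_set_sym[OF B.ring_axioms iso])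
  have bij: "bij_betw ?f (carrier ?B) (carrier ?A)" using iso by (simp add: ring_iso_def)
  have g: "g a \<in> carrier ?B" "?f (g a) = a" if "a \<in> carrier ?A" for a
    using that bij unfolding g_def by (auto simp: bij_betw_def inv_into_into f_inv_into_f)
  have f: "?f b \<in> carrier ?A" "g (?f b) = b" if "b \<in> carrier ?B" for b
    using that bij unfolding g_def by (auto simp: bij_betw_def)
  have gh: "ring_hom_ring ?A ?B g"
    using gi by (intro ring_hom_ringI2) (auto simp: ring_iso_def A.ring_axioms B.ring_axioms)
  have ev: "?f b y = shf u y (b (bas u y))" if "y \<in> V" for b y using that by (simp add: pullsec_def)
  have val: "b (bas u y) \<in> carrier (stalk ?Z (bas u y))" if "b \<in> carrier ?B" "y \<in> V" for b y
    using lrs_sec_carrier[OF Z Uo, of b "bas u y"] that by (simp add: sec_ring_simps(1))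
  have un: "b (bas u y) \<in> Units (stalk ?Z (bas u y)) \<longleftrightarrow> ?f b y \<in> Units (stalk ?Y y)"
    if "b \<in> carrier ?B" "y \<in> V" for b y
    using K(6)[OF Vp[OF that(2)] val[OF that]] ring_hom_Units[OF K(4)[OF Vp[OF that(2)]]] ev[OF that(2)]
    by auto
  have gun: "g a (bas u y) \<in> Units (stalk ?Z (bas u y)) \<longleftrightarrow> a y \<in> Units (stalk ?Y y)"
    if "a \<in> carrier ?A" "y \<in> V" for a y
    using un[OF g(1)[OF that(1)] that(2)] g(2)[OF that(1)] by simp
  have injV: "bas u y = bas u y' \<longleftrightarrow> y = y'" if "y \<in> V" "y' \<in> V" for y y'
    using O(2) Vp that by (auto dest: inj_onD)
  have shinj: "r = r'" if "shf u y r = shf u y r'" "y \<in> V" "r \<in> carrier (stalk ?Z (bas u y))"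
    "r' \<in> carrier (stalk ?Z (bas u y))" for y r r'
    using bij_betw_imp_inj_on[OF O(4)[OF Vp[OF that(2)]]] that by (auto dest: inj_onD)
  have pb: "bij_betw (\<lambda>x. {a \<in> carrier ?A. a x \<notin> Units (stalk ?Y x)}) V {P. primeideal P ?A}"
    using aff.prime_bij unfolding pV open_sub_simps(1,4) .
  have "bij_betw (\<lambda>x. {a \<in> carrier ?B. a x \<notin> Units (stalk ?Z x)}) ?U {P. primeideal P ?B}"
    unfolding bij_betw_def
  proof
    show "inj_on (\<lambda>x. {a \<in> carrier ?B. a x \<notin> Units (stalk ?Z x)}) ?U"
    proof (rule inj_onI)
      fix z z' assume "z \<in> ?U" "z' \<in> ?U"
        and e: "{a \<in> carrier ?B. a z \<notin> Units (stalk ?Z z)} = {a \<in> carrier ?B. a z' \<notin> Units (stalk ?Z z')}"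
      then obtain y y' where y: "y \<in> V" "z = bas u y" "y' \<in> V" "z' = bas u y'" by blast
      have "a y \<in> Units (stalk ?Y y) \<longleftrightarrow> a y' \<in> Units (stalk ?Y y')" if a: "a \<in> carrier ?A" for a
      proof -
        have "g a z \<in> Units (stalk ?Z z) \<longleftrightarrow> g a z' \<in> Units (stalk ?Z z')"
          using e g(1)[OF a] by blast
        then show ?thesis using gun[OF a] y by simp
      qed
      then have "{a \<in> carrier ?A. a y \<notin> Units (stalk ?Y y)} = {a \<in> carrier ?A. a y' \<notin> Units (stalk ?Y y')}"
        by blast
      then show "z = z'" using bij_betw_imp_inj_on[OF pb] y by (auto dest: inj_onD)
    qed
    show "(\<lambda>x. {a \<in> carrier ?B. a x \<notin> Units (stalk ?Z x)}) ` ?U = {P. primeideal P ?B}"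
    proof
      show "(\<lambda>x. {a \<in> carrier ?B. a x \<notin> Units (stalk ?Z x)}) ` ?U \<subseteq> {P. primeideal P ?B}"
        using lrs_nonunits_prime[OF Z Uo] by (auto simp: sec_ring_simps(1))
      show "{P. primeideal P ?B} \<subseteq> (\<lambda>x. {a \<in> carrier ?B. a x \<notin> Units (stalk ?Z x)}) ` ?U"
      proof
        fix P assume "P \<in> {P. primeideal P ?B}"
        then have P: "primeideal P ?B" by simp
        interpret P: primeideal P ?B by (rule P)
        have "primeideal {a \<in> carrier ?A. g a \<in> P} ?A"
          by (rule ring_hom_ring.primeideal_vimage[OF gh A.is_cring P])
        then have "{a \<in> carrier ?A. g a \<in> P} \<in> (\<lambda>x. {a \<in> carrier ?A. a x \<notin> Units (stalk ?Y x)}) ` V"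
          using pb unfolding bij_betw_def by simp
        then obtain y where y: "y \<in> V" "{a \<in> carrier ?A. g a \<in> P} = {a \<in> carrier ?A. a y \<notin> Units (stalk ?Y y)}"
          by blast
        have "b \<in> P \<longleftrightarrow> b (bas u y) \<notin> Units (stalk ?Z (bas u y))" if b: "b \<in> carrier ?B" for b
        proof -
          have "g (?f b) \<in> P \<longleftrightarrow> ?f b y \<notin> Units (stalk ?Y y)" using y(2) f(1)[OF b] by blast
          then show ?thesis using f(2)[OF b] un[OF b y(1)] by simp
        qed
        then have "P = {b \<in> carrier ?B. b (bas u y) \<notin> Units (stalk ?Z (bas u y))}" using P.a_subset by blast
        then show "P \<in> (\<lambda>x. {a \<in> carrier ?B. a x \<notin> Units (stalk ?Z x)}) ` ?U" using y(1) by blast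
      qed
    qed
  qed
  moreover have "(openin (ktop ?Z) W \<and> W \<subseteq> ?U) \<longleftrightarrow> W \<subseteq> ?U \<and>
      (\<forall>x\<in>W. \<exists>a\<in>carrier ?B. a x \<in> Units (stalk ?Z x) \<and> {y \<in> ?U. a y \<in> Units (stalk ?Z y)} \<subseteq> W)" for W
  proof (intro iffI conjI ballI)
    fix z assume W: "openin (ktop ?Z) W \<and> W \<subseteq> ?U" and z: "z \<in> W"
    obtain y where y: "y \<in> V" "z = bas u y" using W z by blast
    have "openin (ktop ?Y) (preim u W \<inter> V)" using preim_open[OF O(1)] W Vo by blast
    then have o: "openin (ktop (open_sub ?Y V)) (preim u W \<inter> V)" by (simp add: openin_open_sub[OF Vo])
    have yW: "y \<in> preim u W \<inter> V" using y z Vp by (simp add: preim_def)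
    obtain a where a: "a \<in> carrier ?A" "y \<in> aff.D a" "aff.D a \<subseteq> preim u W \<inter> V"
      using aff.open_basis[OF o yW] unfolding A by blast
    have "{z \<in> ?U. g a z \<in> Units (stalk ?Z z)} \<subseteq> W"
    proof
      fix z' assume z': "z' \<in> {z \<in> ?U. g a z \<in> Units (stalk ?Z z)}"
      then obtain y' where y': "y' \<in> V" "z' = bas u y'" by blast
      then have "y' \<in> aff.D a" using z' gun[OF a(1)] Dm by simp
      then show "z' \<in> W" using a(3) y'(2) by (auto simp: preim_def)
    qed
    moreover have "g a z \<in> Units (stalk ?Z z)" using gun[OF a(1) y(1)] a(2) Dm y(2) by simp
    ultimately show "\<exists>a\<in>carrier ?B. a z \<in> Units (stalk ?Z z) \<and> {y \<in> ?U. a y \<in> Units (stalk ?Z y)} \<subseteq> W"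
      using g(1)[OF a(1)] by blast
  next
    assume W: "W \<subseteq> ?U \<and>
      (\<forall>x\<in>W. \<exists>a\<in>carrier ?B. a x \<in> Units (stalk ?Z x) \<and> {y \<in> ?U. a y \<in> Units (stalk ?Z y)} \<subseteq> W)"
    show "openin (ktop ?Z) W"
    proof (subst openin_subopen, rule ballI)
      fix x assume x: "x \<in> W"
      then obtain a where a: "a \<in> carrier ?B" "a x \<in> Units (stalk ?Z x)" "{y \<in> ?U. a y \<in> Units (stalk ?Z y)} \<subseteq> W"
        using bspec[OF conjunct2[OF W], of x] by auto
      have "openin (ktop ?Z) {y \<in> ?U. a y \<in> Units (stalk ?Z y)}"
        using lrs_unit_open[OF Z Uo, of a] a(1) by (simp add: sec_ring_simps(1))
      moreover have "x \<in> ?U" using x W by blast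
      ultimately show "\<exists>T. openin (ktop ?Z) T \<and> x \<in> T \<and> T \<subseteq> W" using a(2,3) by blast
    qed
  qed auto
  moreover have "\<exists>a\<in>carrier ?B. \<exists>b\<in>carrier ?B. b z \<in> Units (stalk ?Z z) \<and> r \<otimes>\<^bsub>stalk ?Z z\<^esub> b z = a z"
    if z: "z \<in> ?U" and r: "r \<in> carrier (stalk ?Z z)" for z r
  proof -
    obtain y where y: "y \<in> V" "z = bas u y" using z by blast
    have yp: "y \<in> pts (open_sub ?Y V)" using y(1) pV by simp
    have r': "shf u y r \<in> carrier (stalk ?Y y)" using K(10)[OF Vp[OF y(1)]] r y(2) by simp
    obtain a b where ab: "a \<in> carrier ?A" "b \<in> carrier ?A" "y \<in> aff.D b" "shf u y r \<otimes>\<^bsub>stalk ?Y y\<^esub> b y = a y"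
      using aff.stalk_fractions(1)[OF yp, of "shf u y r"] r' unfolding A open_sub_simps(1) by blast
    interpret R: cring "stalk ?Z z" using lrs_stalk_cring[OF Z] openin_pts[OF Uo z] .
    note G = g[OF ab(1)] g[OF ab(2)]
    have "shf u y (r \<otimes>\<^bsub>stalk ?Z z\<^esub> g b z) = shf u y (g a z)"
      using ring_hom_mult[OF K(4)[OF Vp[OF y(1)]], of r "g b z"] r val[OF G(3) y(1)] y(2) ab(4)
        ev[OF y(1), of "g b"] ev[OF y(1), of "g a"] G by simp
    then have "r \<otimes>\<^bsub>stalk ?Z z\<^esub> g b z = g a z"
      using shinj[OF _ y(1)] R.m_closed[of r "g b z"] r val[OF G(3) y(1)] val[OF G(1) y(1)] y(2) by simp
    moreover have "g b z \<in> Units (stalk ?Z z)" using gun[OF ab(2) y(1)] ab(3) Dm y(2) by simp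
    ultimately show ?thesis using G by blast
  qed
  moreover have "\<exists>b\<in>carrier ?B. b z \<in> Units (stalk ?Z z) \<and> b \<otimes>\<^bsub>?B\<^esub> a = \<zero>\<^bsub>?B\<^esub>"
    if z: "z \<in> ?U" and a: "a \<in> carrier ?B" "a z = \<zero>\<^bsub>stalk ?Z z\<^esub>" for z a
  proof -
    obtain y where y: "y \<in> V" "z = bas u y" using z by blast
    have yp: "y \<in> pts (open_sub ?Y V)" using y(1) pV by simp
    interpret R: cring "stalk ?Z z" using lrs_stalk_cring[OF Z] openin_pts[OF Uo z] .
    interpret S: cring "stalk ?Y y" using lrs_stalk_cring[OF Y Vp[OF y(1)]] .
    have "?f a y = \<zero>\<^bsub>stalk ?Y y\<^esub>"
      using ev[OF y(1), of a] a(2) y(2) ring_hom_zero[OF K(4)[OF Vp[OF y(1)]]] R.ring_axioms S.ring_axioms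
      by simp
    then obtain b where b: "b \<in> carrier ?A" "y \<in> aff.D b" "b \<otimes>\<^bsub>?A\<^esub> ?f a = \<zero>\<^bsub>?A\<^esub>"
      using aff.stalk_fractions(2)[OF yp, of "?f a"] f(1)[OF a(1)] unfolding A open_sub_simps(1) by blast
    have "g (b \<otimes>\<^bsub>?A\<^esub> ?f a) = g b \<otimes>\<^bsub>?B\<^esub> a"
      using gi f[OF a(1)] b(1) by (simp add: ring_iso_def ring_hom_def)
    moreover have "g \<zero>\<^bsub>?A\<^esub> = \<zero>\<^bsub>?B\<^esub>"
      using ring_hom_zero[of g ?A ?B] gi A.ring_axioms B.ring_axioms by (simp add: ring_iso_def)
    ultimately have "g b \<otimes>\<^bsub>?B\<^esub> a = \<zero>\<^bsub>?B\<^esub>" using b(3) by simp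
    moreover have "g b z \<in> Units (stalk ?Z z)" using gun[OF b(1) y(1)] b(2) Dm y(2) by simp
    ultimately show ?thesis using g(1)[OF b(1)] by blast
  qed
  ultimately have "affine (open_sub ?Z ?U)"
    unfolding affine_def Let_def pts_open_sub[OF Uo] openin_open_sub[OF Uo] unfolding open_sub_simps(1-4)
    using lrs_open_sub[OF Z Uo] by simp
  then show ?thesis using Uo by (simp add: affine_open_def)
qed

lemma Var_simps:
  "obs Var = {X. kvariety X}" "ars Var = {f. is_kmor f \<and> kvariety (src f) \<and> kvariety (tgt f)}"
  "dm Var = src" "cd Var = tgt" "idn Var = kid" "g \<cdot>\<^bsub>Var\<^esub> f = kcomp g f"
  by (simp_all add: Var_def spaces_cat_simps)

lemma Var_category: "category Var"
  unfolding Var_def by (rule spaces_category) (rule kvariety_lrs)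

text \<open>An affine open of the source maps onto an affine open of the target with the same
  sections, so the ring map to be tested is an isomorphism.\<close>

lemma smooth_open_immersion:
  assumes f: "f \<in> ars Var" and oi: "open_immersion f"
  shows "smooth f"
  unfolding smooth_def
proof (intro conjI ballI f)
  have l: "lrs (src f)" "lrs (tgt f)" and k: "kscheme (src f)"
    using f kvariety_lrs kvariety_kscheme by (auto simp: Var_simps)
  fix y assume "y \<in> pts (src f)"
  then obtain V where V: "y \<in> V" "affine_open (src f) V" using k by (auto simp: kscheme_def)
  then have Vo: "openin (ktop (src f)) V" by (simp add: affine_open_def)
  let ?U = "bas f ` V"
  have "ring (sec_ring (tgt f) ?U)"
    using lrs_sec_ring[OF l(2) open_immersionD(3)[OF oi Vo]] by (rule cring.axioms)
  then have "formally_smooth (sec_ring (tgt f) ?U) (sec_ring (src f) V) (pullsec f V)"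
    by (rule formally_smooth_iso[OF open_immersion_sec_iso[OF oi l Vo]])
  moreover have "V \<subseteq> preim f ?U" using openin_pts[OF Vo] by (auto simp: preim_def)
  ultimately show "\<exists>V U. y \<in> V \<and> affine_open (src f) V \<and> affine_open (tgt f) U \<and> V \<subseteq> preim f U \<and>
      formally_smooth (sec_ring (tgt f) U) (sec_ring (src f) V) (pullsec f V)"
    using V open_immersion_affine[OF oi l V(2)] by blast
qed

lemma open_immersion_kid:
  assumes X: "lrs X"
  shows "open_immersion (kid X)"
proof (rule open_immersionI[OF is_kmor_kid[OF X]])
  show "inj_on (bas (kid X)) (pts (src (kid X)))" by (auto simp: inj_on_def kid_simps kid_bas)
  show "openin (ktop (tgt (kid X))) (bas (kid X) ` U)" if "openin (ktop (src (kid X))) U" for U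
  proof -
    have "bas (kid X) ` U = U" using openin_pts[OF that] by (force simp: kid_simps kid_bas)
    then show ?thesis using that by (simp add: kid_simps)
  qed
  show "bij_betw (shf (kid X) y) (carrier (stalk (tgt (kid X)) (bas (kid X) y))) (carrier (stalk (src (kid X)) y))"
    if "y \<in> pts (src (kid X))" for y
  proof -
    have y: "y \<in> pts X" using that by (simp add: kid_simps)
    show ?thesis
      using y by (subst bij_betw_cong[of _ _ "\<lambda>r. r"]) (simp_all add: kid_simps kid_bas kid_shf bij_betw_def)
  qed
qed

lemma smooth_kid: "X \<in> obs Var \<Longrightarrow> smooth (kid X)"
  using idn_ars[OF Var_category, of X] kvariety_lrs
  by (intro smooth_open_immersion open_immersion_kid) (auto simp: Var_simps)

section \<open>Fibre squares: base change of open immersions and of proper morphisms\<close>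

lemma is_pullbackD:
  assumes "is_pullback C p q a b"
  shows "p \<in> ars C" "q \<in> ars C" "a \<in> ars C" "b \<in> ars C" "cd C p = cd C q" "dm C a = dm C b"
    "cd C a = dm C p" "cd C b = dm C q" "p \<cdot>\<^bsub>C\<^esub> a = q \<cdot>\<^bsub>C\<^esub> b"
  using assms by (auto simp: is_pullback_def)

lemma is_pullback_lift:
  assumes "is_pullback C p q a b" "x \<in> ars C" "y \<in> ars C" "dm C x = dm C y" "cd C x = dm C p"
    "cd C y = dm C q" "p \<cdot>\<^bsub>C\<^esub> x = q \<cdot>\<^bsub>C\<^esub> y"
  shows "\<exists>!m. m \<in> homs C (dm C x) (dm C a) \<and> a \<cdot>\<^bsub>C\<^esub> m = x \<and> b \<cdot>\<^bsub>C\<^esub> m = y"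
proof -
  have "\<forall>x\<in>ars C. \<forall>y\<in>ars C.
        dm C x = dm C y \<and> cd C x = dm C p \<and> cd C y = dm C q \<and> p \<cdot>\<^bsub>C\<^esub> x = q \<cdot>\<^bsub>C\<^esub> y \<longrightarrow>
        (\<exists>!m. m \<in> homs C (dm C x) (dm C a) \<and> a \<cdot>\<^bsub>C\<^esub> m = x \<and> b \<cdot>\<^bsub>C\<^esub> m = y)"
    using assms(1) unfolding is_pullback_def by (elim conjE) assumption
  then show ?thesis using assms(2-) by blast
qed

lemma pb_lift:
  assumes "is_pullback C p q a b" "x \<in> ars C" "y \<in> ars C" "dm C x = dm C y" "cd C x = dm C p"
    "cd C y = dm C q" "p \<cdot>\<^bsub>C\<^esub> x = q \<cdot>\<^bsub>C\<^esub> y"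
  shows "pb_lift C a b x y \<in> homs C (dm C x) (dm C a)" "a \<cdot>\<^bsub>C\<^esub> pb_lift C a b x y = x"
    "b \<cdot>\<^bsub>C\<^esub> pb_lift C a b x y = y"
  using theI'[OF is_pullback_lift[OF assms]] unfolding pb_lift_def by auto

lemma is_pullback_jointly_mono:
  assumes C: "category C" and pb: "is_pullback C p q a b"
    and x: "x \<in> homs C t (dm C a)" and y: "y \<in> homs C t (dm C a)"
    and e: "a \<cdot>\<^bsub>C\<^esub> x = a \<cdot>\<^bsub>C\<^esub> y" "b \<cdot>\<^bsub>C\<^esub> x = b \<cdot>\<^bsub>C\<^esub> y"
  shows "x = y"
proof -
  note d = is_pullbackD[OF pb] and x' = homsD[OF x]
  have ax: "a \<cdot>\<^bsub>C\<^esub> x \<in> ars C" "b \<cdot>\<^bsub>C\<^esub> x \<in> ars C" "dm C (a \<cdot>\<^bsub>C\<^esub> x) = t" "dm C (b \<cdot>\<^bsub>C\<^esub> x) = t"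
    "cd C (a \<cdot>\<^bsub>C\<^esub> x) = dm C p" "cd C (b \<cdot>\<^bsub>C\<^esub> x) = dm C q"
    using d x' by (simp_all add: cmp_ars[OF C] dm_cmp[OF C] cd_cmp[OF C])
  have "p \<cdot>\<^bsub>C\<^esub> (a \<cdot>\<^bsub>C\<^esub> x) = q \<cdot>\<^bsub>C\<^esub> (b \<cdot>\<^bsub>C\<^esub> x)"
    using d x' by (simp add: cmp_assoc[OF C, symmetric])
  then have "\<exists>!m. m \<in> homs C t (dm C a) \<and> a \<cdot>\<^bsub>C\<^esub> m = a \<cdot>\<^bsub>C\<^esub> x \<and> b \<cdot>\<^bsub>C\<^esub> m = b \<cdot>\<^bsub>C\<^esub> x"
    using is_pullback_lift[OF pb ax(1,2)] ax by simp
  then show ?thesis using x y e by auto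
qed

text \<open>The morphism \<open>a\<close> is a monomorphism, and it has a section over a neighbourhood of each point
  of its image; the two facts together show that it is locally an isomorphism.\<close>

lemma open_immersion_base_change:
  assumes pb: "is_pullback Var p u a b" and u: "open_immersion u"
  shows "open_immersion a"
proof -
  note d = is_pullbackD[OF pb, unfolded Var_simps]
  have K: "is_kmor p" "is_kmor u" "is_kmor a" "is_kmor b" and v: "kvariety (src a)" "kvariety (src p)"
      "kvariety (src u)" "kvariety (tgt u)"
    using d by auto
  have l: "lrs (src a)" "lrs (src p)" "lrs (src u)" "lrs (tgt u)" using v kvariety_lrs by auto
  note ta = d(7)
  \<comment> \<open>If a x = a y, then u b x = p a x = p a y = u b y, so b x = b y because
    \<open>u\<close> is a monomorphism; the two projections of a fibre square are jointly
    monic.\<close>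
  have mono: "x = y"
    if x: "x \<in> ars Var" "y \<in> ars Var" "src x = src y" "tgt x = src a" "tgt y = src a" "kcomp a x = kcomp a y"
    for x y
  proof (rule is_pullback_jointly_mono[OF Var_category pb])
    show "x \<in> homs Var (src x) (dm Var a)" "y \<in> homs Var (src x) (dm Var a)"
      using x by (auto simp: homs_def Var_simps)
    show "a \<cdot>\<^bsub>Var\<^esub> x = a \<cdot>\<^bsub>Var\<^esub> y" using x by (simp add: Var_simps)
    have k: "is_kmor x" "is_kmor y" "lrs (src x)" "lrs (src y)" using x kvariety_lrs by (auto simp: Var_simps)
    have bx: "kcomp u (kcomp b x) = kcomp p (kcomp a x)" if "is_kmor x" "lrs (src x)" "tgt x = src a" for x
      using that K d l kcomp_assoc[of x b u] kcomp_assoc[of x a p] by simp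
    have "kcomp b x = kcomp b y"
    proof (rule open_immersion_mono[OF u])
      show "kcomp u (kcomp b x) = kcomp u (kcomp b y)"
        using bx[OF k(1,3) x(4)] bx[OF k(2,4) x(5)] x(6) by simp
      show "is_kmor (kcomp b x)" "is_kmor (kcomp b y)"
        using k K d l x by (auto intro!: is_kmor_kcomp)
    qed (use d x in \<open>auto simp: kcomp_simps\<close>)
    then show "b \<cdot>\<^bsub>Var\<^esub> x = b \<cdot>\<^bsub>Var\<^esub> y" by (simp add: Var_simps)
  qed
  \<comment> \<open>On an open variety \<open>W\<close> that \<open>p\<close> maps into the image of
    \<open>u\<close>, the inclusion of \<open>W\<close> and the lift of its composite with
    \<open>p\<close> satisfy the equation of the square. They induce the local section
    \<open>s\<close>.\<close>
  have sect: "\<exists>W s. openin (ktop (src p)) W \<and> bas a x \<in> W \<and> s \<in> ars Var \<and> src s = open_sub (src p) W \<and>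
      tgt s = src a \<and> kcomp a s = incl (src p) W" if x: "x \<in> pts (src a)" for x
  proof -
    let ?W0 = "preim p (bas u ` pts (src u))"
    have W0: "openin (ktop (src p)) ?W0"
      using preim_open[OF K(1)] open_immersionD(3)[OF u, of "pts (src u)"] d by simp
    have "bas a x \<in> ?W0"
    proof -
      have "bas p (bas a x) = bas u (bas b x)" using d x by (metis kcomp_bas)
      then show ?thesis using is_kmorD(9)[OF K(3) x] is_kmorD(9)[OF K(4), of x] x d by (auto simp: preim_def)
    qed
    then obtain W where W: "affine_open (src p) W" "bas a x \<in> W" "W \<subseteq> ?W0" "kvariety (open_sub (src p) W)"
      using kvariety_affine_basis[OF v(2) W0] by blast
    have Wo: "openin (ktop (src p)) W" using W(1) by (simp add: affine_open_def)
    let ?i = "incl (src p) W"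
    have i: "is_kmor ?i" "src ?i = open_sub (src p) W" "tgt ?i = src p"
      using is_kmor_incl[OF l(2) Wo] by (simp_all add: incl_simps)
    have pi: "is_kmor (kcomp p ?i)" using i K d l by (intro is_kmor_kcomp) auto
    have im: "bas (kcomp p ?i) ` pts (src (kcomp p ?i)) \<subseteq> bas u ` pts (src u)"
      using W(3) pts_open_sub[OF Wo] i by (auto simp: kcomp_simps kcomp_bas incl_simps preim_def)
    let ?l = "oi_lift u (kcomp p ?i)"
    have L: "is_kmor ?l" "kcomp u ?l = kcomp p ?i" "src ?l = open_sub (src p) W" "tgt ?l = src u"
      using is_kmor_oi_lift[OF u l(3,4) pi _ im] kcomp_oi_lift[OF u l(3,4) pi _ im]
        src_oi_lift[OF u l(3,4) pi _ im] tgt_oi_lift[OF u l(3,4) pi _ im] d i by (simp_all add: kcomp_simps)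
    have "\<exists>!m. m \<in> homs Var (dm Var ?i) (dm Var a) \<and> a \<cdot>\<^bsub>Var\<^esub> m = ?i \<and> b \<cdot>\<^bsub>Var\<^esub> m = ?l"
      by (rule is_pullback_lift[OF pb]) (use i L W(4) v d in \<open>simp_all add: Var_simps\<close>)
    then obtain s where "s \<in> homs Var (dm Var ?i) (dm Var a)" "a \<cdot>\<^bsub>Var\<^esub> s = ?i" by blast
    then show ?thesis using W(2) Wo i by (intro exI[of _ W] exI[of _ s]) (auto simp: Var_simps homs_def)
  qed
  \<comment> \<open>The other composite, s after a, is the identity near \<open>y\<close>.
    Restricted to an open variety \<open>V\<close>, both agree after composition with the
    monomorphism \<open>a\<close>; points and germs are then read off.\<close>
  have inv: "bas s (bas a y) = y"
      "\<And>r. r \<in> carrier (stalk (src a) y) \<Longrightarrow> shf a y (shf s (bas a y) r) = r"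
    if W: "openin (ktop (src p)) W" and s: "s \<in> ars Var" "src s = open_sub (src p) W" "tgt s = src a"
      "kcomp a s = incl (src p) W" and y: "y \<in> pts (src a)" "bas a y \<in> W" for W s y
  proof -
    have sk: "is_kmor s" "kvariety (open_sub (src p) W)" using s by (auto simp: Var_simps)
    have "openin (ktop (src a)) (preim a W)" using preim_open[OF K(3)] W ta by simp
    moreover have "y \<in> preim a W" using y by (simp add: preim_def)
    ultimately obtain V where V: "affine_open (src a) V" "y \<in> V" "V \<subseteq> preim a W" "kvariety (open_sub (src a) V)"
      using kvariety_affine_basis[OF v(1)] by blast
    have Vo: "openin (ktop (src a)) V" using V(1) by (simp add: affine_open_def)
    note pV = pts_open_sub[OF Vo] and pW = pts_open_sub[OF W]
    let ?k = "incl (src a) V" and ?i = "incl (src p) W"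
    have k: "is_kmor ?k" "src ?k = open_sub (src a) V" "tgt ?k = src a"
      using is_kmor_incl[OF l(1) Vo] by (simp_all add: incl_simps)
    have i: "open_immersion ?i" "is_kmor ?i" "src ?i = open_sub (src p) W" "tgt ?i = src p"
      using open_immersion_incl[OF l(2) W] is_kmor_incl[OF l(2) W] by (simp_all add: incl_simps)
    have ak: "is_kmor (kcomp a ?k)" using k K ta l by (intro is_kmor_kcomp) auto
    have im: "bas (kcomp a ?k) ` pts (src (kcomp a ?k)) \<subseteq> bas ?i ` pts (src ?i)"
    proof -
      have "bas ?i ` W = W" by (force simp: incl_simps)
      then show ?thesis using V(3) i pW pV k
        by (auto simp: kcomp_simps kcomp_bas incl_simps preim_def)
    qed
    have lW: "lrs (src ?i)" using sk(2) kvariety_lrs i by simp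
    have lV: "lrs (src ?k)" using V(4) kvariety_lrs k by simp
    let ?m = "oi_lift ?i (kcomp a ?k)"
    have m: "is_kmor ?m" "kcomp ?i ?m = kcomp a ?k" "src ?m = open_sub (src a) V" "tgt ?m = open_sub (src p) W"
      using is_kmor_oi_lift[OF i(1) lW _ ak _ im] kcomp_oi_lift[OF i(1) lW _ ak _ im]
        src_oi_lift[OF i(1) lW _ ak _ im] tgt_oi_lift[OF i(1) lW _ ak _ im] i k l ta
      by (simp_all add: kcomp_simps)
    have sm: "kcomp s ?m = ?k"
    proof (rule mono)
      show "kcomp s ?m \<in> ars Var" "?k \<in> ars Var"
        using s m k V(4) v kvariety_lrs by (auto simp: Var_simps kcomp_simps intro!: is_kmor_kcomp)
      have "kcomp a (kcomp s ?m) = kcomp (kcomp a s) ?m"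
        using s sk m K l lW lV k i ta by (intro kcomp_assoc[symmetric]) auto
      then show "kcomp a (kcomp s ?m) = kcomp a ?k" using s(4) m(2) by simp
    qed (use s m k in \<open>auto simp: kcomp_simps\<close>)
    have my: "bas ?m y = bas a y"
    proof -
      have "bas ?m y \<in> W" using is_kmorD(9)[OF m(1), of y] m V(2) pV pW by simp
      then have "bas (kcomp ?i ?m) y = bas ?m y" using V(2) m(3) pV by (simp add: kcomp_bas incl_simps)
      moreover have "bas (kcomp a ?k) y = bas a y" using V(2) k pV by (simp add: kcomp_bas incl_simps)
      ultimately show ?thesis using m(2) by simp
    qed
    have ms: "shf ?m y t = shf a y t" if t: "t \<in> carrier (stalk (src p) (bas a y))" for t
    proof -
      have at: "shf a y t \<in> carrier (stalk (src a) y)" using is_kmorD(10)[OF K(3) y(1)] t ta by simp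
      have "shf (kcomp ?i ?m) y t = shf ?m y t"
        using t V(2) m(3) pV my y(2) by (simp add: kcomp_shf incl_simps)
      moreover have "shf (kcomp a ?k) y t = shf a y t"
        using t at V(2) k pV ta by (simp add: kcomp_shf incl_simps)
      ultimately show ?thesis using m(2) by simp
    qed
    have "bas (kcomp s ?m) y = bas s (bas a y)" using V(2) m(3) pV my by (simp add: kcomp_bas)
    then show b: "bas s (bas a y) = y" using sm V(2) by (simp add: incl_simps)
    fix r assume r: "r \<in> carrier (stalk (src a) y)"
    have "shf s (bas a y) r \<in> carrier (stalk (src p) (bas a y))"
      using is_kmorD(10)[OF sk(1), of "bas a y" r] r y(2) s pW b by (simp add: open_sub_simps(1))
    then have "shf (kcomp s ?m) y r = shf a y (shf s (bas a y) r)"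
      using r V(2) m(3) pV my ms b s(3) by (simp add: kcomp_shf)
    then show "shf a y (shf s (bas a y) r) = r" using sm V(2) r by (simp add: incl_simps)
  qed
  have sec: "bas s z \<in> pts (src a)" "bas a (bas s z) = z"
      "\<And>t. t \<in> carrier (stalk (src p) z) \<Longrightarrow> shf s z (shf a (bas s z) t) = t"
    if W: "openin (ktop (src p)) W" and s: "s \<in> ars Var" "src s = open_sub (src p) W" "tgt s = src a"
      "kcomp a s = incl (src p) W" and z: "z \<in> W" for W s z
  proof -
    have sk: "is_kmor s" using s by (auto simp: Var_simps)
    have zs: "z \<in> pts (src s)" using s z pts_open_sub[OF W] by simp
    show "bas s z \<in> pts (src a)" using is_kmorD(9)[OF sk zs] s by simp
    have "bas (kcomp a s) z = z" using s(4) z by (simp add: incl_simps)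
    then show b: "bas a (bas s z) = z" using zs by (simp add: kcomp_bas)
    fix t assume t: "t \<in> carrier (stalk (src p) z)"
    have "shf (kcomp a s) z t = t" using s(4) z t by (simp add: incl_simps)
    then show "shf s z (shf a (bas s z) t) = t" using zs t b ta by (simp add: kcomp_shf)
  qed
  show ?thesis
  proof (rule open_immersionI[OF K(3)])
    show "inj_on (bas a) (pts (src a))"
    proof (rule inj_onI)
      fix x x' assume x: "x \<in> pts (src a)" "x' \<in> pts (src a)" "bas a x = bas a x'"
      obtain W s where "openin (ktop (src p)) W \<and> bas a x \<in> W \<and> s \<in> ars Var \<and> src s = open_sub (src p) W \<and>
        tgt s = src a \<and> kcomp a s = incl (src p) W" using sect[OF x(1)] by (elim exE) 
      then have W: "openin (ktop (src p)) W" "bas a x \<in> W" "s \<in> ars Var" "src s = open_sub (src p) W"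
        "tgt s = src a" "kcomp a s = incl (src p) W" by auto
      show "x = x'"
        using inv(1)[OF W(1,3-6) x(1) W(2)] inv(1)[OF W(1,3-6) x(2)] W(2) x(3) by simp
    qed
    show "openin (ktop (tgt a)) (bas a ` U)" if U: "openin (ktop (src a)) U" for U
    proof (subst openin_subopen, rule ballI)
      fix z assume "z \<in> bas a ` U"
      then obtain x where x: "x \<in> U" "z = bas a x" by blast
      note xp = openin_pts[OF U x(1)]
      obtain W s where "openin (ktop (src p)) W \<and> bas a x \<in> W \<and> s \<in> ars Var \<and> src s = open_sub (src p) W \<and>
        tgt s = src a \<and> kcomp a s = incl (src p) W" using sect[OF xp] by (elim exE) 
      then have W: "openin (ktop (src p)) W" "bas a x \<in> W" "s \<in> ars Var" "src s = open_sub (src p) W"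
        "tgt s = src a" "kcomp a s = incl (src p) W" by auto
      have "openin (ktop (src s)) (preim s U)" using preim_open[of s U] W U by (simp add: Var_simps)
      then have "openin (ktop (tgt a)) (preim s U)" using W(4) openin_open_sub[OF W(1)] ta by simp
      moreover have "z \<in> preim s U"
        using inv(1)[OF W(1,3-6) xp W(2)] x W(2,4) pts_open_sub[OF W(1)] by (simp add: preim_def)
      moreover have "preim s U \<subseteq> bas a ` U"
      proof
        fix z' assume "z' \<in> preim s U"
        then have "z' \<in> W" "bas s z' \<in> U" using W(4) pts_open_sub[OF W(1)] by (auto simp: preim_def)
        then show "z' \<in> bas a ` U" using sec(2)[OF W(1,3-6)] by (intro image_eqI[of _ _ "bas s z'"]) auto
      qed
      ultimately show "\<exists>T. openin (ktop (tgt a)) T \<and> z \<in> T \<and> T \<subseteq> bas a ` U" by blast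
    qed
    fix x assume x: "x \<in> pts (src a)"
    obtain W s where "openin (ktop (src p)) W \<and> bas a x \<in> W \<and> s \<in> ars Var \<and> src s = open_sub (src p) W \<and>
        tgt s = src a \<and> kcomp a s = incl (src p) W" using sect[OF x] by (elim exE) 
    then have W: "openin (ktop (src p)) W" "bas a x \<in> W" "s \<in> ars Var" "src s = open_sub (src p) W"
        "tgt s = src a" "kcomp a s = incl (src p) W" by auto
    note b = inv[OF W(1,3-6) x W(2)]
    show "bij_betw (shf a x) (carrier (stalk (tgt a) (bas a x))) (carrier (stalk (src a) x))"
    proof (rule bij_betwI[where g = "shf s (bas a x)"])
      show "shf a x \<in> carrier (stalk (tgt a) (bas a x)) \<rightarrow> carrier (stalk (src a) x)"
        using is_kmorD(10)[OF K(3) x] by blast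
      show "shf s (bas a x) \<in> carrier (stalk (src a) x) \<rightarrow> carrier (stalk (tgt a) (bas a x))"
        using is_kmorD(10)[of s "bas a x"] W b(1) pts_open_sub[OF W(1)] ta
        by (auto simp: Var_simps open_sub_simps(1))
      show "shf s (bas a x) (shf a x r) = r" if "r \<in> carrier (stalk (tgt a) (bas a x))" for r
        using sec(3)[OF W(1,3-6) W(2), of r] that b(1) ta by simp
      show "shf a x (shf s (bas a x) r) = r" if "r \<in> carrier (stalk (src a) x)" for r
        by (rule b(2)[OF that])
    qed
  qed
qed

lemma is_pullback_sym: "is_pullback C p q a b \<Longrightarrow> is_pullback C q p b a"
proof -
  assume pb: "is_pullback C p q a b"
  note d = is_pullbackD[OF pb]
  have "\<exists>!m. m \<in> homs C (dm C x) (dm C b) \<and> b \<cdot>\<^bsub>C\<^esub> m = x \<and> a \<cdot>\<^bsub>C\<^esub> m = y"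
    if "x \<in> ars C" "y \<in> ars C" "dm C x = dm C y" "cd C x = dm C q" "cd C y = dm C p" "q \<cdot>\<^bsub>C\<^esub> x = p \<cdot>\<^bsub>C\<^esub> y" for x y
    using is_pullback_lift[OF pb that(2,1)] that d by (simp add: conj_commute conj_left_commute)
  then show ?thesis unfolding is_pullback_def using d by simp
qed

text \<open>Existence and uniqueness are separated, and uniqueness is replaced by joint monicity of
  the two projections, in which no equation with \<open>p\<close> and \<open>q\<close> has to be
  carried along.\<close>

lemma is_pullbackI:
  assumes "p \<in> ars C" "q \<in> ars C" "a \<in> ars C" "b \<in> ars C" "cd C p = cd C q" "dm C a = dm C b"
    "cd C a = dm C p" "cd C b = dm C q" "p \<cdot>\<^bsub>C\<^esub> a = q \<cdot>\<^bsub>C\<^esub> b"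
    and "\<And>x y. x \<in> ars C \<Longrightarrow> y \<in> ars C \<Longrightarrow> dm C x = dm C y \<Longrightarrow> cd C x = dm C p \<Longrightarrow> cd C y = dm C q \<Longrightarrow>
      p \<cdot>\<^bsub>C\<^esub> x = q \<cdot>\<^bsub>C\<^esub> y \<Longrightarrow> \<exists>m. m \<in> homs C (dm C x) (dm C a) \<and> a \<cdot>\<^bsub>C\<^esub> m = x \<and> b \<cdot>\<^bsub>C\<^esub> m = y"
    and "\<And>t m m'. m \<in> homs C t (dm C a) \<Longrightarrow> m' \<in> homs C t (dm C a) \<Longrightarrow> a \<cdot>\<^bsub>C\<^esub> m = a \<cdot>\<^bsub>C\<^esub> m' \<Longrightarrow>
      b \<cdot>\<^bsub>C\<^esub> m = b \<cdot>\<^bsub>C\<^esub> m' \<Longrightarrow> m = m'"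
  shows "is_pullback C p q a b"
proof -
  have "\<exists>!m. m \<in> homs C (dm C x) (dm C a) \<and> a \<cdot>\<^bsub>C\<^esub> m = x \<and> b \<cdot>\<^bsub>C\<^esub> m = y"
    if h: "x \<in> ars C" "y \<in> ars C" "dm C x = dm C y" "cd C x = dm C p" "cd C y = dm C q" "p \<cdot>\<^bsub>C\<^esub> x = q \<cdot>\<^bsub>C\<^esub> y" for x y
  proof -
    obtain m where "m \<in> homs C (dm C x) (dm C a) \<and> a \<cdot>\<^bsub>C\<^esub> m = x \<and> b \<cdot>\<^bsub>C\<^esub> m = y"
      using assms(10)[OF h] by (elim exE)
    then show ?thesis using assms(11) by (intro ex1I[of _ m]) auto
  qed
  then show ?thesis unfolding is_pullback_def using assms(1-9) by simp
qed

text \<open>The cancellation half of the pasting law: if the square over \<open>f\<close> and the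
  outer square over the composite are cartesian, so is the square over \<open>g\<close>. It shows
  that the morphisms between generic fibres and between special fibres are base changes of
  \<open>g\<close>.\<close>

lemma is_pullback_induced:
  assumes C: "category C" and pb: "is_pullback C f j i e" and pb': "is_pullback C (f \<cdot>\<^bsub>C\<^esub> g) j i' e'"
    and g: "g \<in> ars C" "cd C g = dm C f"
  defines "h \<equiv> pb_lift C i e (g \<cdot>\<^bsub>C\<^esub> i') e'"
  shows "h \<in> homs C (dm C i') (dm C i)" "e \<cdot>\<^bsub>C\<^esub> h = e'" "is_pullback C g i i' h"
proof -
  note d = is_pullbackD[OF pb] and d' = is_pullbackD[OF pb']
  note [simp] = cmp_ars[OF C] dm_cmp[OF C] cd_cmp[OF C]
  have *: "i' \<in> ars C" "e' \<in> ars C" "dm C i' = dm C e'" "cd C i' = dm C g" "cd C e' = dm C j"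
    using d' g d by simp_all
  have fg: "f \<cdot>\<^bsub>C\<^esub> (g \<cdot>\<^bsub>C\<^esub> i') = j \<cdot>\<^bsub>C\<^esub> e'" using d'(9) d g * by (simp add: cmp_assoc[OF C])
  note L = pb_lift[OF pb, of "g \<cdot>\<^bsub>C\<^esub> i'" e', folded h_def]
  have h: "h \<in> homs C (dm C i') (dm C i)" "i \<cdot>\<^bsub>C\<^esub> h = g \<cdot>\<^bsub>C\<^esub> i'" "e \<cdot>\<^bsub>C\<^esub> h = e'"
    using L d g * fg by simp_all
  show "h \<in> homs C (dm C i') (dm C i)" "e \<cdot>\<^bsub>C\<^esub> h = e'" by (rule h)+
  note hd = homsD[OF h(1)]
  show "is_pullback C g i i' h"
  proof (rule is_pullbackI)
    fix x y assume x: "x \<in> ars C" "y \<in> ars C" "dm C x = dm C y" "cd C x = dm C g" "cd C y = dm C i"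
      "g \<cdot>\<^bsub>C\<^esub> x = i \<cdot>\<^bsub>C\<^esub> y"
    have "(f \<cdot>\<^bsub>C\<^esub> g) \<cdot>\<^bsub>C\<^esub> x = f \<cdot>\<^bsub>C\<^esub> (i \<cdot>\<^bsub>C\<^esub> y)" using x g d by (simp add: cmp_assoc[OF C])
    also have "\<dots> = j \<cdot>\<^bsub>C\<^esub> (e \<cdot>\<^bsub>C\<^esub> y)" using x d by (simp add: cmp_assoc[OF C, symmetric])
    finally have "\<exists>!m. m \<in> homs C (dm C x) (dm C i') \<and> i' \<cdot>\<^bsub>C\<^esub> m = x \<and> e' \<cdot>\<^bsub>C\<^esub> m = e \<cdot>\<^bsub>C\<^esub> y"
      using x d g by (intro is_pullback_lift[OF pb']) simp_all
    then obtain m where m: "m \<in> homs C (dm C x) (dm C i')" "i' \<cdot>\<^bsub>C\<^esub> m = x" "e' \<cdot>\<^bsub>C\<^esub> m = e \<cdot>\<^bsub>C\<^esub> y" by blast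
    note md = homsD[OF m(1)]
    have "h \<cdot>\<^bsub>C\<^esub> m = y"
    proof (rule is_pullback_jointly_mono[OF C pb])
      show "h \<cdot>\<^bsub>C\<^esub> m \<in> homs C (dm C x) (dm C i)" by (rule cmp_homs[OF C m(1) h(1)])
      show "y \<in> homs C (dm C x) (dm C i)" using x by (simp add: homs_def)
      have "i \<cdot>\<^bsub>C\<^esub> (h \<cdot>\<^bsub>C\<^esub> m) = (g \<cdot>\<^bsub>C\<^esub> i') \<cdot>\<^bsub>C\<^esub> m" using h(2) hd md d by (simp add: cmp_assoc[OF C, symmetric])
      also have "\<dots> = g \<cdot>\<^bsub>C\<^esub> x" using m(2) md * g by (simp add: cmp_assoc[OF C])
      finally show "i \<cdot>\<^bsub>C\<^esub> (h \<cdot>\<^bsub>C\<^esub> m) = i \<cdot>\<^bsub>C\<^esub> y" using x(6) by simp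
      show "e \<cdot>\<^bsub>C\<^esub> (h \<cdot>\<^bsub>C\<^esub> m) = e \<cdot>\<^bsub>C\<^esub> y" using h(3) m(3) hd md d by (simp add: cmp_assoc[OF C, symmetric])
    qed
    then show "\<exists>m. m \<in> homs C (dm C x) (dm C i') \<and> i' \<cdot>\<^bsub>C\<^esub> m = x \<and> h \<cdot>\<^bsub>C\<^esub> m = y" using m by blast
  next
    fix t m m' assume m: "m \<in> homs C t (dm C i')" "m' \<in> homs C t (dm C i')" "i' \<cdot>\<^bsub>C\<^esub> m = i' \<cdot>\<^bsub>C\<^esub> m'"
      "h \<cdot>\<^bsub>C\<^esub> m = h \<cdot>\<^bsub>C\<^esub> m'"
    have "e' \<cdot>\<^bsub>C\<^esub> m = e \<cdot>\<^bsub>C\<^esub> (h \<cdot>\<^bsub>C\<^esub> m)" if "m \<in> homs C t (dm C i')" for m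
      using h(3) hd homsD[OF that] d by (simp add: cmp_assoc[OF C, symmetric])
    then have "e' \<cdot>\<^bsub>C\<^esub> m = e' \<cdot>\<^bsub>C\<^esub> m'" using m by simp
    then show "m = m'" by (rule is_pullback_jointly_mono[OF C pb' m(1-3)])
  qed (use h hd * g d in simp_all)
qed

lemma is_pullback_paste:
  assumes C: "category C" and pb: "is_pullback C p q a b" and pb': "is_pullback C b r c d"
  shows "is_pullback C p (q \<cdot>\<^bsub>C\<^esub> r) (a \<cdot>\<^bsub>C\<^esub> c) d"
proof -
  note D = is_pullbackD[OF pb] and D' = is_pullbackD[OF pb']
  note [simp] = cmp_ars[OF C] dm_cmp[OF C] cd_cmp[OF C]
  show ?thesis
  proof (rule is_pullbackI)
    have "p \<cdot>\<^bsub>C\<^esub> (a \<cdot>\<^bsub>C\<^esub> c) = (q \<cdot>\<^bsub>C\<^esub> b) \<cdot>\<^bsub>C\<^esub> c" using D D' by (simp add: cmp_assoc[OF C, symmetric])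
    also have "\<dots> = (q \<cdot>\<^bsub>C\<^esub> r) \<cdot>\<^bsub>C\<^esub> d" using D D' by (simp add: cmp_assoc[OF C])
    finally show "p \<cdot>\<^bsub>C\<^esub> (a \<cdot>\<^bsub>C\<^esub> c) = (q \<cdot>\<^bsub>C\<^esub> r) \<cdot>\<^bsub>C\<^esub> d" .
    fix x y assume x: "x \<in> ars C" "y \<in> ars C" "dm C x = dm C y" "cd C x = dm C p" "cd C y = dm C (q \<cdot>\<^bsub>C\<^esub> r)"
      "p \<cdot>\<^bsub>C\<^esub> x = (q \<cdot>\<^bsub>C\<^esub> r) \<cdot>\<^bsub>C\<^esub> y"
    have y: "cd C y = dm C r" using x(5) D D' by simp
    have rq: "cd C r = dm C q" using D D' by simp
    have "p \<cdot>\<^bsub>C\<^esub> x = q \<cdot>\<^bsub>C\<^esub> (r \<cdot>\<^bsub>C\<^esub> y)"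
      unfolding x(6) by (rule cmp_assoc[OF C x(2) D'(2) D(2) y rq])
    then have "\<exists>!m. m \<in> homs C (dm C x) (dm C a) \<and> a \<cdot>\<^bsub>C\<^esub> m = x \<and> b \<cdot>\<^bsub>C\<^esub> m = r \<cdot>\<^bsub>C\<^esub> y"
      using x(1-4) y rq D(1,2) D'(2) by (intro is_pullback_lift[OF pb]) simp_all
    then obtain m where m: "m \<in> homs C (dm C x) (dm C a)" "a \<cdot>\<^bsub>C\<^esub> m = x" "b \<cdot>\<^bsub>C\<^esub> m = r \<cdot>\<^bsub>C\<^esub> y" by blast
    have "\<exists>!n. n \<in> homs C (dm C m) (dm C c) \<and> c \<cdot>\<^bsub>C\<^esub> n = m \<and> d \<cdot>\<^bsub>C\<^esub> n = y"
      using homsD[OF m(1)] m(3) x(2,3) y D(6) by (intro is_pullback_lift[OF pb']) simp_all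
    then obtain n where n: "n \<in> homs C (dm C m) (dm C c)" "c \<cdot>\<^bsub>C\<^esub> n = m" "d \<cdot>\<^bsub>C\<^esub> n = y" by blast
    then show "\<exists>n. n \<in> homs C (dm C x) (dm C (a \<cdot>\<^bsub>C\<^esub> c)) \<and> (a \<cdot>\<^bsub>C\<^esub> c) \<cdot>\<^bsub>C\<^esub> n = x \<and> d \<cdot>\<^bsub>C\<^esub> n = y"
      using homsD[OF m(1)] m(2) homsD[OF n(1)] D D' by (intro exI[of _ n]) (simp add: cmp_assoc[OF C])
  next
    fix t m m' assume m: "m \<in> homs C t (dm C (a \<cdot>\<^bsub>C\<^esub> c))" "m' \<in> homs C t (dm C (a \<cdot>\<^bsub>C\<^esub> c))"
      "(a \<cdot>\<^bsub>C\<^esub> c) \<cdot>\<^bsub>C\<^esub> m = (a \<cdot>\<^bsub>C\<^esub> c) \<cdot>\<^bsub>C\<^esub> m'" "d \<cdot>\<^bsub>C\<^esub> m = d \<cdot>\<^bsub>C\<^esub> m'"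
    have mh: "m \<in> homs C t (dm C c)" "m' \<in> homs C t (dm C c)" using m(1,2) D D' by simp_all
    have c: "c \<in> homs C (dm C c) (dm C a)" using D D' by (simp add: homs_def)
    have "c \<cdot>\<^bsub>C\<^esub> m = c \<cdot>\<^bsub>C\<^esub> m'"
    proof (rule is_pullback_jointly_mono[OF C pb cmp_homs[OF C mh(1) c] cmp_homs[OF C mh(2) c]])
      show "a \<cdot>\<^bsub>C\<^esub> (c \<cdot>\<^bsub>C\<^esub> m) = a \<cdot>\<^bsub>C\<^esub> (c \<cdot>\<^bsub>C\<^esub> m')"
        using m(3) homsD[OF mh(1)] homsD[OF mh(2)] D D' by (simp add: cmp_assoc[OF C])
      have "b \<cdot>\<^bsub>C\<^esub> (c \<cdot>\<^bsub>C\<^esub> m) = r \<cdot>\<^bsub>C\<^esub> (d \<cdot>\<^bsub>C\<^esub> m)" if "m \<in> homs C t (dm C c)" for m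
        using homsD[OF that] D D' by (simp add: cmp_assoc[OF C, symmetric])
      then show "b \<cdot>\<^bsub>C\<^esub> (c \<cdot>\<^bsub>C\<^esub> m) = b \<cdot>\<^bsub>C\<^esub> (c \<cdot>\<^bsub>C\<^esub> m')" using mh m(4) by simp
    qed
    then show "m = m'" by (rule is_pullback_jointly_mono[OF C pb' mh _ m(4)])
  qed (use D D' in simp_all)
qed

text \<open>Properness is quantified over all base changes already, so pasting a further square
  suffices.\<close>

lemma proper_base_change:
  assumes pb: "is_pullback Var p q a b" and q: "proper q"
  shows "proper a"
  unfolding proper_def
proof (intro conjI allI impI)
  show "a \<in> ars Var" by (rule is_pullbackD[OF pb])
  fix p' a' b' assume pb': "is_pullback Var p' a a' b'"
  have "is_pullback Var (p \<cdot>\<^bsub>Var\<^esub> p') q a' (b \<cdot>\<^bsub>Var\<^esub> b')"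
    by (rule is_pullback_sym, rule is_pullback_paste[OF Var_category is_pullback_sym[OF pb] is_pullback_sym[OF pb']])
  then show "closed_map (ktop (src a')) (ktop (tgt a')) (bas a')" using q unfolding proper_def by blast
qed

section \<open>Diagrams of varieties\<close>

lemma DiaVar_simps:
  "obs DiaVar = {F. is_diag F}" "ars DiaVar = {f. is_dmor f}" "dm DiaVar = dsrc" "cd DiaVar = dtgt"
  by (simp_all add: DiaVar_def)

lemma dcomp_simps:
  "dsrc (g \<cdot>\<^bsub>DiaVar\<^esub> f) = dsrc f" "dtgt (g \<cdot>\<^bsub>DiaVar\<^esub> f) = dtgt g"
  "ixO (g \<cdot>\<^bsub>DiaVar\<^esub> f) = (\<lambda>j\<in>obs (idx (dsrc f)). ixO g (ixO f j))"
  "ixA (g \<cdot>\<^bsub>DiaVar\<^esub> f) = (\<lambda>a\<in>ars (idx (dsrc f)). ixA g (ixA f a))"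
  "comp_at (g \<cdot>\<^bsub>DiaVar\<^esub> f) = (\<lambda>j\<in>obs (idx (dsrc f)). comp_at g (ixO f j) \<cdot>\<^bsub>Var\<^esub> comp_at f j)"
  by (simp_all add: DiaVar_def)

lemma is_dmorD:
  assumes "is_dmor f"
  shows "is_diag (dsrc f)" "is_diag (dtgt f)" "ixO f \<in> extensional (obs (idx (dsrc f)))"
    "ixA f \<in> extensional (ars (idx (dsrc f)))" "comp_at f \<in> extensional (obs (idx (dsrc f)))"
    "is_functor (idx (dsrc f)) (idx (dtgt f)) (ixO f) (ixA f)"
    "\<And>j. j \<in> obs (idx (dsrc f)) \<Longrightarrow> comp_at f j \<in> homs Var (dob (dsrc f) j) (dob (dtgt f) (ixO f j))"
    "\<And>a. a \<in> ars (idx (dsrc f)) \<Longrightarrow>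
      comp_at f (cd (idx (dsrc f)) a) \<cdot>\<^bsub>Var\<^esub> dar (dsrc f) a = dar (dtgt f) (ixA f a) \<cdot>\<^bsub>Var\<^esub> comp_at f (dm (idx (dsrc f)) a)"
  using assms by (auto simp: is_dmor_def Let_def)

lemma is_functorD:
  assumes "is_functor C D F G"
  shows "\<And>a. a \<in> obs C \<Longrightarrow> F a \<in> obs D" "\<And>a. a \<in> obs C \<Longrightarrow> G (idn C a) = idn D (F a)"
    "\<And>f. f \<in> ars C \<Longrightarrow> G f \<in> homs D (F (dm C f)) (F (cd C f))"
    "\<And>f g. f \<in> ars C \<Longrightarrow> g \<in> ars C \<Longrightarrow> cd C f = dm C g \<Longrightarrow> G (g \<cdot>\<^bsub>C\<^esub> f) = G g \<cdot>\<^bsub>D\<^esub> G f"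
  using assms by (auto simp: is_functor_def)

lemma dmor_eqI:
  assumes "is_dmor f" "is_dmor g" "dsrc f = dsrc g" "dtgt f = dtgt g"
    "\<And>j. j \<in> obs (idx (dsrc f)) \<Longrightarrow> ixO f j = ixO g j" "\<And>a. a \<in> ars (idx (dsrc f)) \<Longrightarrow> ixA f a = ixA g a"
    "\<And>j. j \<in> obs (idx (dsrc f)) \<Longrightarrow> comp_at f j = comp_at g j"
  shows "f = g"
proof -
  have "ixO f = ixO g" using is_dmorD(3)[OF assms(1)] is_dmorD(3)[OF assms(2)] assms(3,5)
    by (auto intro: extensionalityI)
  moreover have "ixA f = ixA g" using is_dmorD(4)[OF assms(1)] is_dmorD(4)[OF assms(2)] assms(3,6)
    by (auto intro: extensionalityI)
  moreover have "comp_at f = comp_at g" using is_dmorD(5)[OF assms(1)] is_dmorD(5)[OF assms(2)] assms(3,7)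
    by (auto intro: extensionalityI)
  ultimately show ?thesis using assms(3,4) by (cases f, cases g) simp
qed

lemma dcomp_ars:
  assumes f: "f \<in> ars DiaVar" and g: "g \<in> ars DiaVar" and fg: "dtgt f = dsrc g"
  shows "g \<cdot>\<^bsub>DiaVar\<^esub> f \<in> ars DiaVar"
proof -
  let ?J = "idx (dsrc f)" and ?I = "idx (dsrc g)" and ?K = "idx (dtgt g)"
  have fd: "is_dmor f" and gd: "is_dmor g" using f g by (auto simp: DiaVar_simps)
  note F = is_dmorD[OF fd, unfolded fg] and G = is_dmorD[OF gd]
  note Ff = is_functorD[OF F(6)] and Gf = is_functorD[OF G(6)]
  have J: "category ?J" using F(1) by (simp add: is_diag_def)
  have fc: "is_functor ?J ?K (\<lambda>j\<in>obs ?J. ixO g (ixO f j)) (\<lambda>a\<in>ars ?J. ixA g (ixA f a))"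
    using Ff Gf J by (auto simp: is_functor_def homs_def dm_obs cd_obs idn_ars cmp_ars)
  have sq: "(comp_at g (ixO f (cd ?J a)) \<cdot>\<^bsub>Var\<^esub> comp_at f (cd ?J a)) \<cdot>\<^bsub>Var\<^esub> dar (dsrc f) a =
      dar (dtgt g) (ixA g (ixA f a)) \<cdot>\<^bsub>Var\<^esub> (comp_at g (ixO f (dm ?J a)) \<cdot>\<^bsub>Var\<^esub> comp_at f (dm ?J a))"
    if a: "a \<in> ars ?J" for a
  proof -
    have o: "dm ?J a \<in> obs ?J" "cd ?J a \<in> obs ?J" using a J by (auto simp: dm_obs cd_obs)
    have x: "dar (dsrc f) a \<in> homs Var (dob (dsrc f) (dm ?J a)) (dob (dsrc f) (cd ?J a))"
      using F(1) a is_functorD(3) by (auto simp: is_diag_def)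
    have fa: "ixA f a \<in> homs ?I (ixO f (dm ?J a)) (ixO f (cd ?J a))" by (rule Ff(3)[OF a])
    have y: "dar (dsrc g) (ixA f a) \<in> homs Var (dob (dsrc g) (ixO f (dm ?J a))) (dob (dsrc g) (ixO f (cd ?J a)))"
      using is_functorD(3)[of ?I Var "dob (dsrc g)" "dar (dsrc g)" "ixA f a"] G(1) homsD[OF fa]
      by (simp add: is_diag_def)
    have ga: "ixA g (ixA f a) \<in> homs ?K (ixO g (ixO f (dm ?J a))) (ixO g (ixO f (cd ?J a)))"
      using Gf(3)[OF homsD(1)[OF fa]] homsD[OF fa] by simp
    have z: "dar (dtgt g) (ixA g (ixA f a)) \<in>
        homs Var (dob (dtgt g) (ixO g (ixO f (dm ?J a)))) (dob (dtgt g) (ixO g (ixO f (cd ?J a))))"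
      using is_functorD(3)[of ?K Var "dob (dtgt g)" "dar (dtgt g)" "ixA g (ixA f a)"] G(2) homsD[OF ga]
      by (simp add: is_diag_def)
    note c1 = F(7)[OF o(1)] and c2 = F(7)[OF o(2)] and c3 = G(7)[OF Ff(1)[OF o(1)]] and c4 = G(7)[OF Ff(1)[OF o(2)]]
    have "(comp_at g (ixO f (cd ?J a)) \<cdot>\<^bsub>Var\<^esub> comp_at f (cd ?J a)) \<cdot>\<^bsub>Var\<^esub> dar (dsrc f) a =
        comp_at g (ixO f (cd ?J a)) \<cdot>\<^bsub>Var\<^esub> (dar (dsrc g) (ixA f a) \<cdot>\<^bsub>Var\<^esub> comp_at f (dm ?J a))"
      using cmp_assoc_homs[OF Var_category x c2 c4] F(8)[OF a] by simp
    also have "\<dots> = (dar (dtgt g) (ixA g (ixA f a)) \<cdot>\<^bsub>Var\<^esub> comp_at g (ixO f (dm ?J a))) \<cdot>\<^bsub>Var\<^esub> comp_at f (dm ?J a)"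
      using cmp_assoc_homs[OF Var_category c1 y c4, symmetric] G(8)[OF homsD(1)[OF fa]] homsD[OF fa] by simp
    also have "\<dots> = dar (dtgt g) (ixA g (ixA f a)) \<cdot>\<^bsub>Var\<^esub> (comp_at g (ixO f (dm ?J a)) \<cdot>\<^bsub>Var\<^esub> comp_at f (dm ?J a))"
      by (rule cmp_assoc_homs[OF Var_category c1 c3 z])
    finally show ?thesis .
  qed
  have c: "comp_at g (ixO f j) \<cdot>\<^bsub>Var\<^esub> comp_at f j \<in> homs Var (dob (dsrc f) j) (dob (dtgt g) (ixO g (ixO f j)))"
    if "j \<in> obs ?J" for j
    using cmp_homs[OF Var_category F(7)[OF that] G(7)[OF Ff(1)[OF that]]] .
  have o: "dm ?J a \<in> obs ?J" "cd ?J a \<in> obs ?J" if "a \<in> ars ?J" for a using that J by (auto simp: dm_obs cd_obs)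
  show ?thesis
    unfolding DiaVar_simps mem_Collect_eq is_dmor_def dcomp_simps Let_def
    using F(1) G(2) fc c sq o by simp
qed

lemma term_category: "category term_cat"
  by (auto simp: category_def term_cat_def homs_def)

lemma cdiag_simps: "idx (cdiag I X) = I" "dob (cdiag I X) i = X" "dar (cdiag I X) a = kid X"
  by (simp_all add: cdiag_def)

lemma kid_homs: "X \<in> obs Var \<Longrightarrow> kid X \<in> homs Var X X"
  using idn_homs[OF Var_category] by (simp add: Var_simps)

lemma kid_cmp: "f \<in> homs Var X Y \<Longrightarrow> kid Y \<cdot>\<^bsub>Var\<^esub> f = f" "f \<in> homs Var X Y \<Longrightarrow> f \<cdot>\<^bsub>Var\<^esub> kid X = f"
  using idn_cmp[OF Var_category, of f Y] cmp_idn[OF Var_category, of f X] by (auto simp: homs_def Var_simps)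

lemma cdiag_obs:
  assumes "category I" "X \<in> obs Var"
  shows "cdiag I X \<in> obs DiaVar"
  using assms kid_homs[OF assms(2)] kid_cmp(1)[OF kid_homs[OF assms(2)]]
  by (simp add: DiaVar_simps is_diag_def is_functor_def cdiag_simps Var_simps)

lemma cmor_simps:
  "dsrc (cmor I g) = cdiag I (src g)" "dtgt (cmor I g) = cdiag I (tgt g)"
  "ixO (cmor I g) = (\<lambda>i\<in>obs I. i)" "ixA (cmor I g) = (\<lambda>a\<in>ars I. a)" "comp_at (cmor I g) = (\<lambda>i\<in>obs I. g)"
  by (simp_all add: cmor_def)

lemma is_functor_id: "category I \<Longrightarrow> is_functor I I (\<lambda>i\<in>obs I. i) (\<lambda>a\<in>ars I. a)"
  by (auto simp: is_functor_def homs_def dm_obs cd_obs idn_ars cmp_ars)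

lemma cmor_ars:
  assumes I: "category I" and g: "g \<in> ars Var"
  shows "cmor I g \<in> ars DiaVar"
proof -
  have o: "src g \<in> obs Var" "tgt g \<in> obs Var" and gh: "g \<in> homs Var (src g) (tgt g)"
    using g by (auto simp: Var_simps homs_def)
  show ?thesis
    unfolding DiaVar_simps mem_Collect_eq is_dmor_def cmor_simps cdiag_simps Let_def
    using cdiag_obs[OF I o(1)] cdiag_obs[OF I o(2)] is_functor_id[OF I] gh kid_cmp[OF gh] I
    by (simp add: DiaVar_simps dm_obs cd_obs)
qed

lemma cmor_over_id: "category I \<Longrightarrow> g \<in> ars Var \<Longrightarrow> over_id (cmor I g)"
  by (simp add: over_id_def cmor_ars cmor_simps cdiag_simps)

lemma rdiag_cdiag: "rdiag (cdiag I X) J \<alpha> \<alpha>' = cdiag J X"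
  by (simp add: rdiag_def cdiag_def)

lemma proj_simps:
  "dsrc (proj I X) = cdiag I X" "dtgt (proj I X) = cdiag term_cat X"
  "ixO (proj I X) = (\<lambda>i\<in>obs I. (0, 1))" "ixA (proj I X) = (\<lambda>a\<in>ars I. ((0, 1), (0, 1), [0]))"
  "comp_at (proj I X) = (\<lambda>i\<in>obs I. kid X)"
  by (simp_all add: proj_def reindex_def rdiag_cdiag cdiag_simps restrict_def)

lemma proj_functor: "category I \<Longrightarrow> is_functor I term_cat (\<lambda>_. (0, 1)) (\<lambda>_. ((0, 1), (0, 1), [0]))"
  by (simp add: is_functor_def term_cat_def homs_def)

lemma proj_ars:
  assumes I: "category I" and X: "X \<in> obs Var"
  shows "proj I X \<in> ars DiaVar"
proof -
  have "is_functor I term_cat (\<lambda>i\<in>obs I. (0, 1)) (\<lambda>a\<in>ars I. ((0, 1), (0, 1), [0]))"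
    using I by (simp add: is_functor_def term_cat_def homs_def idn_ars cmp_ars dm_obs cd_obs)
  then show ?thesis
    unfolding DiaVar_simps mem_Collect_eq is_dmor_def proj_simps cdiag_simps Let_def
    using cdiag_obs[OF I X] cdiag_obs[OF term_category X] kid_homs[OF X] kid_cmp(1)[OF kid_homs[OF X]] I
    by (simp add: DiaVar_simps dm_obs cd_obs)
qed

lemma proj_smooth: "X \<in> obs Var \<Longrightarrow> argwise smooth (proj I X)"
  by (simp add: argwise_def proj_simps cdiag_simps smooth_kid)

lemma over_idD:
  assumes "over_id f"
  shows "f \<in> ars DiaVar" "idx (dsrc f) = idx (dtgt f)" "ixO f = (\<lambda>i\<in>obs (idx (dtgt f)). i)"
    "ixA f = (\<lambda>a\<in>ars (idx (dtgt f)). a)" "category (idx (dtgt f))"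
proof -
  show f: "f \<in> ars DiaVar" "idx (dsrc f) = idx (dtgt f)" "ixO f = (\<lambda>i\<in>obs (idx (dtgt f)). i)"
    "ixA f = (\<lambda>a\<in>ars (idx (dtgt f)). a)" using assms by (auto simp: over_id_def)
  show "category (idx (dtgt f))"
    using is_dmorD(2)[of f] f(1) by (simp add: DiaVar_simps is_diag_def)
qed

lemma over_id_comp_at:
  assumes "over_id f" "i \<in> obs (idx (dtgt f))"
  shows "comp_at f i \<in> homs Var (dob (dsrc f) i) (dob (dtgt f) i)"
  using is_dmorD(7)[of f i] over_idD[OF assms(1)] assms(2) by (simp add: DiaVar_simps)

lemma over_id_natural:
  assumes "over_id f" "a \<in> ars (idx (dtgt f))"
  shows "comp_at f (cd (idx (dtgt f)) a) \<cdot>\<^bsub>Var\<^esub> dar (dsrc f) a =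
      dar (dtgt f) a \<cdot>\<^bsub>Var\<^esub> comp_at f (dm (idx (dtgt f)) a)"
  using is_dmorD(8)[of f a] over_idD[OF assms(1)] assms(2) by (simp add: DiaVar_simps)

lemma over_id_comp:
  assumes f: "over_id f" and g: "over_id g" and fg: "dtgt f = dsrc g"
  shows "over_id (g \<cdot>\<^bsub>DiaVar\<^esub> f)" 
    "i \<in> obs (idx (dtgt f)) \<Longrightarrow> comp_at (g \<cdot>\<^bsub>DiaVar\<^esub> f) i = comp_at g i \<cdot>\<^bsub>Var\<^esub> comp_at f i"
  using dcomp_ars[OF over_idD(1)[OF f] over_idD(1)[OF g] fg] over_idD(2-)[OF f] over_idD(2-)[OF g] fg
  by (auto simp: over_id_def dcomp_simps)

lemma over_id_eqI:
  assumes "over_id f" "over_id g" "dsrc f = dsrc g" "dtgt f = dtgt g"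
    "\<And>i. i \<in> obs (idx (dtgt f)) \<Longrightarrow> comp_at f i = comp_at g i"
  shows "f = g"
  using over_idD[OF assms(1)] over_idD[OF assms(2)] assms(3-)
  by (intro dmor_eqI) (auto simp: DiaVar_simps)

lemma proj_natural:
  assumes I: "category I" and g: "g \<in> ars Var"
  shows "proj I (tgt g) \<cdot>\<^bsub>DiaVar\<^esub> cmor I g = \<langle>g\<rangle> \<cdot>\<^bsub>DiaVar\<^esub> proj I (src g)"
proof -
  have o: "src g \<in> obs Var" "tgt g \<in> obs Var" and gh: "g \<in> homs Var (src g) (tgt g)"
    using g by (auto simp: Var_simps homs_def)
  note c = cmor_ars[OF I g] cmor_ars[OF term_category g] proj_ars[OF I o(1)] proj_ars[OF I o(2)]
  have t: "(0, 1) \<in> obs term_cat" "((0, 1), (0, 1), [0]) \<in> ars term_cat" by (simp_all add: term_cat_def)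
  show ?thesis
  proof (rule dmor_eqI)
    show "is_dmor (proj I (tgt g) \<cdot>\<^bsub>DiaVar\<^esub> cmor I g)" "is_dmor (\<langle>g\<rangle> \<cdot>\<^bsub>DiaVar\<^esub> proj I (src g))"
      using dcomp_ars[OF c(1,4)] dcomp_ars[OF c(3,2)] by (simp_all add: cmor_simps proj_simps DiaVar_simps)
  qed (use t kid_cmp[OF gh] in \<open>simp_all add: dcomp_simps cmor_simps proj_simps cdiag_simps\<close>)
qed

section \<open>Exchange morphisms in a derivator\<close>

text \<open>Composition with the unit equals the action of \<open>L\<close> on maps followed by the
  adjunction bijection, so Yoneda applies.\<close>

lemma unit_iso_if_fully_faithful:
  assumes a: "adj C D L R un co" and b: "b \<in> obs C"
    and ff: "\<And>c. c \<in> obs C \<Longrightarrow> bij_betw (onA L) (homs C c b) (homs D (onO L c) (onO L b))"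
  shows "is_iso C (un b)"
proof -
  note C = adjD(1)[OF a]
  have ob: "onO L b \<in> obs D" "onO R (onO L b) \<in> obs C"
    using b fctrD(3)[OF adjD(3)[OF a]] fctrD(3)[OF adjD(4)[OF a]] by auto
  have unb: "un b \<in> homs C b (onO R (onO L b))" using nat_transD(1)[OF adjD(5)[OF a] b] by simp
  show ?thesis
  proof (rule is_iso_if_post_bij[OF C unb b ob(2)])
    fix c assume c: "c \<in> obs C"
    have "bij_betw ((\<lambda>f. onA R f \<cdot>\<^bsub>C\<^esub> un c) \<circ> onA L) (homs C c b) (homs C c (onO R (onO L b)))"
      by (rule bij_betw_trans[OF ff[OF c] adj_bij_right[OF a c ob(1)]])
    then show "bij_betw (\<lambda>x. un b \<cdot>\<^bsub>C\<^esub> x) (homs C c b) (homs C c (onO R (onO L b)))"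
    proof (rule bij_betw_cong[THEN iffD1, rotated])
      fix f assume f: "f \<in> homs C c b"
      show "((\<lambda>f. onA R f \<cdot>\<^bsub>C\<^esub> un c) \<circ> onA L) f = un b \<cdot>\<^bsub>C\<^esub> f"
        using nat_trans_natural[OF adjD(5)[OF a] f] by simp
    qed
  qed
qed

text \<open>Naturality of \<open>t\<close> writes \<open>onA L f\<close> as the conjugate of
  \<open>f\<close> by two isomorphisms.\<close>

lemma fully_faithful_if_iso_id:
  assumes L: "fctr C C L" and t: "nat_trans C C ftr_id L t" and iso: "\<And>a. a \<in> obs C \<Longrightarrow> is_iso C (t a)"
    and ab: "a \<in> obs C" "b \<in> obs C"
  shows "bij_betw (onA L) (homs C a b) (homs C (onO L a) (onO L b))"
proof -
  note C = fctrD(1)[OF L]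
  have ta: "t a \<in> homs C a (onO L a)" "t b \<in> homs C b (onO L b)"
    using nat_transD(1)[OF t ab(1)] nat_transD(1)[OF t ab(2)] by simp_all
  have ob: "onO L a \<in> obs C" "onO L b \<in> obs C" using fctrD(3)[OF L] ab by auto
  have "bij_betw ((\<lambda>x. x \<cdot>\<^bsub>C\<^esub> inver C (t a)) \<circ> (\<lambda>x. t b \<cdot>\<^bsub>C\<^esub> x)) (homs C a b) (homs C (onO L a) (onO L b))"
    by (rule bij_betw_trans[OF iso_post_bij[OF C iso[OF ab(2)] ta(2) ab(1)]
          iso_pre_bij[OF C is_iso_inver[OF C iso[OF ab(1)]] inver_homs[OF C iso[OF ab(1)] ta(1)] ob(2)]])
  then show ?thesis
  proof (rule bij_betw_cong[THEN iffD1, rotated])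
    fix f assume f: "f \<in> homs C a b"
    have Lf: "onA L f \<in> homs C (onO L a) (onO L b)" by (rule fctr_homs[OF L f])
    have "(t b \<cdot>\<^bsub>C\<^esub> f) \<cdot>\<^bsub>C\<^esub> inver C (t a) = (onA L f \<cdot>\<^bsub>C\<^esub> t a) \<cdot>\<^bsub>C\<^esub> inver C (t a)"
      using nat_trans_natural[OF t f] by simp
    also have "\<dots> = onA L f \<cdot>\<^bsub>C\<^esub> (t a \<cdot>\<^bsub>C\<^esub> inver C (t a))"
      by (rule cmp_assoc_homs[OF C inver_homs[OF C iso[OF ab(1)] ta(1)] ta(1) Lf])
    also have "\<dots> = onA L f"
      using cmp_inver[OF C iso[OF ab(1)]] homsD[OF ta(1)] homsD[OF Lf] by (simp add: cmp_idn[OF C])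
    finally show "((\<lambda>x. x \<cdot>\<^bsub>C\<^esub> inver C (t a)) \<circ> (\<lambda>x. t b \<cdot>\<^bsub>C\<^esub> x)) f = onA L f" by simp
  qed
qed

definition dsquare ::
  "('p, 'r, 'k::field) dmor \<Rightarrow> ('p, 'r, 'k) dmor \<Rightarrow> ('p, 'r, 'k) dmor \<Rightarrow> ('p, 'r, 'k) dmor \<Rightarrow> bool" where
  "dsquare p q a b \<longleftrightarrow> p \<in> ars DiaVar \<and> q \<in> ars DiaVar \<and> a \<in> ars DiaVar \<and> b \<in> ars DiaVar \<and>
     dtgt p = dtgt q \<and> dsrc a = dsrc b \<and> dtgt a = dsrc p \<and> dtgt b = dsrc q \<and>
     p \<cdot>\<^bsub>DiaVar\<^esub> a = q \<cdot>\<^bsub>DiaVar\<^esub> b"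

lemma dsquareD:
  assumes "dsquare p q a b"
  shows "p \<in> ars DiaVar" "q \<in> ars DiaVar" "a \<in> ars DiaVar" "b \<in> ars DiaVar"
     "dtgt q = dtgt p" "dsrc b = dsrc a" "dtgt a = dsrc p" "dtgt b = dsrc q"
     "p \<cdot>\<^bsub>DiaVar\<^esub> a = q \<cdot>\<^bsub>DiaVar\<^esub> b"
  using assms by (auto simp: dsquare_def)

lemma dsquare_sym: "dsquare p q a b \<Longrightarrow> dsquare q p b a"
  by (auto simp: dsquare_def)

lemma argwise_pullback_dsquare:
  assumes "argwise_pullback p q a b"
  shows "dsquare p q a b"
proof -
  have o: "over_id p" "over_id q" "over_id a" "over_id b" and
    e: "dtgt p = dtgt q" "dsrc a = dsrc b" "dtgt a = dsrc p" "dtgt b = dsrc q" and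
    pb: "\<And>i. i \<in> obs (idx (dsrc a)) \<Longrightarrow> is_pullback Var (comp_at p i) (comp_at q i) (comp_at a i) (comp_at b i)"
    using assms by (auto simp: argwise_pullback_def)
  have "p \<cdot>\<^bsub>DiaVar\<^esub> a = q \<cdot>\<^bsub>DiaVar\<^esub> b"
    by (rule over_id_eqI[OF over_id_comp(1)[OF o(3,1) e(3)] over_id_comp(1)[OF o(4,2) e(4)]])
      (use e over_id_comp(2)[OF o(3,1) e(3)] over_id_comp(2)[OF o(4,2) e(4)] is_pullbackD(9)[OF pb]
        over_idD(2)[OF o(1)] over_idD(2)[OF o(2)] over_idD(2)[OF o(3)] in \<open>auto simp: dcomp_simps\<close>)
  then show ?thesis using o e by (simp add: dsquare_def over_idD(1))
qed

locale derivator =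
  fixes D :: "('p, 'r, 'k::field, 'o, 'm) deriv"
  assumes shd: "stable_homotopical_derivator D"
begin

lemma axioms: "pre_derivator D" "has_adjoints D" "derivator_axioms D" "homotopical_axioms D" "proper_axioms D"
  using shd by (auto simp: stable_homotopical_derivator_def)

lemma tc_triangulated: "F \<in> obs DiaVar \<Longrightarrow> triangulated (tc D F)"
  using axioms(1) by (simp add: pre_derivator_def)

lemma tc_category: "F \<in> obs DiaVar \<Longrightarrow> category (tc D F)"
  by (rule triangulated_category[OF tc_triangulated])

lemma dmor_obs: "f \<in> ars DiaVar \<Longrightarrow> dsrc f \<in> obs DiaVar" "f \<in> ars DiaVar \<Longrightarrow> dtgt f \<in> obs DiaVar"
  using is_dmorD(1,2) by (auto simp: DiaVar_simps)

lemma cu: 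
  assumes "F \<in> obs DiaVar"
  shows "nat_trans (tc D F) (tc D F) ftr_id (ls D (idn DiaVar F)) (cu D F)"
    "A \<in> obs (tc D F) \<Longrightarrow> is_iso (tc D F) (cu D F A)"
  using axioms(1) assms by (simp_all add: pre_derivator_def)

lemma ls_triangulated: "f \<in> ars DiaVar \<Longrightarrow> triangulated_functor (tc D (dtgt f)) (tc D (dsrc f)) (ls D f)"
  using axioms(1) by (simp add: pre_derivator_def)

lemma ls_fctr: "f \<in> ars DiaVar \<Longrightarrow> fctr (tc D (dtgt f)) (tc D (dsrc f)) (ls D f)"
  by (intro triangulated_functor_fctr ls_triangulated tc_triangulated dmor_obs)

lemma cc:
  assumes "p \<in> ars DiaVar" "a \<in> ars DiaVar" "dtgt a = dsrc p"
  shows "nat_trans (tc D (dtgt p)) (tc D (dsrc a)) (ls D a \<odot> ls D p) (ls D (p \<cdot>\<^bsub>DiaVar\<^esub> a)) (cc D p a)"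
    "A \<in> obs (tc D (dtgt p)) \<Longrightarrow> is_iso (tc D (dsrc a)) (cc D p a A)"
proof -
  have "\<forall>p\<in>ars DiaVar. \<forall>a\<in>ars DiaVar. dtgt a = dsrc p \<longrightarrow>
        nat_trans (tc D (dtgt p)) (tc D (dsrc a)) (ls D a \<odot> ls D p) (ls D (p \<cdot>\<^bsub>DiaVar\<^esub> a)) (cc D p a) \<and>
        (\<forall>A\<in>obs (tc D (dtgt p)). is_iso (tc D (dsrc a)) (cc D p a A))"
    using axioms(1) unfolding pre_derivator_def by (elim conjE) assumption
  then show "nat_trans (tc D (dtgt p)) (tc D (dsrc a)) (ls D a \<odot> ls D p) (ls D (p \<cdot>\<^bsub>DiaVar\<^esub> a)) (cc D p a)"
    "A \<in> obs (tc D (dtgt p)) \<Longrightarrow> is_iso (tc D (dsrc a)) (cc D p a A)"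
    using assms by simp_all
qed

lemma us_triangulated: "f \<in> ars DiaVar \<Longrightarrow> triangulated_functor (tc D (dsrc f)) (tc D (dtgt f)) (us D f)"
  using axioms(2) by (simp add: has_adjoints_def)

lemma us_fctr: "f \<in> ars DiaVar \<Longrightarrow> fctr (tc D (dsrc f)) (tc D (dtgt f)) (us D f)"
  by (intro triangulated_functor_fctr us_triangulated tc_triangulated dmor_obs)

lemma us_adj: "f \<in> ars DiaVar \<Longrightarrow> adj (tc D (dtgt f)) (tc D (dsrc f)) (ls D f) (us D f) (us_un D f) (us_co D f)"
  using axioms(2) by (simp add: has_adjoints_def adj_def tc_category dmor_obs)

lemma sh_triangulated:
  "f \<in> ars DiaVar \<Longrightarrow> argwise smooth f \<Longrightarrow> triangulated_functor (tc D (dsrc f)) (tc D (dtgt f)) (sh D f)"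
  using axioms(2) by (simp add: has_adjoints_def)

lemma sh_fctr: "f \<in> ars DiaVar \<Longrightarrow> argwise smooth f \<Longrightarrow> fctr (tc D (dsrc f)) (tc D (dtgt f)) (sh D f)"
  by (intro triangulated_functor_fctr sh_triangulated tc_triangulated dmor_obs)

lemma sh_adjunction:
  "f \<in> ars DiaVar \<Longrightarrow> argwise smooth f \<Longrightarrow>
    adjunction (tc D (dsrc f)) (tc D (dtgt f)) (sh D f) (ls D f) (sh_un D f) (sh_co D f)"
  using axioms(2) by (simp add: has_adjoints_def)

lemma sh_adj:
  "f \<in> ars DiaVar \<Longrightarrow> argwise smooth f \<Longrightarrow>
    adj (tc D (dsrc f)) (tc D (dtgt f)) (sh D f) (ls D f) (sh_un D f) (sh_co D f)"
  by (simp add: sh_adjunction adj_def tc_category dmor_obs)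

lemma ex_ls:
  assumes s: "dsquare p q a b"
  shows "nat_trans (tc D (dtgt p)) (tc D (dsrc a)) (ls D a \<odot> ls D p) (ls D b \<odot> ls D q) (ex_ls D p q a b)"
    "A \<in> obs (tc D (dtgt p)) \<Longrightarrow> is_iso (tc D (dsrc a)) (ex_ls D p q a b A)"
proof -
  note d = dsquareD[OF s]
  let ?X = "tc D (dtgt p)" and ?W = "tc D (dsrc a)"
  note W = tc_category[OF dmor_obs(1)[OF d(3)]]
  note c = cc[OF d(1,3,7)] and c' = cc[OF d(2,4,8), unfolded d(5,6)]
  have pa: "p \<cdot>\<^bsub>DiaVar\<^esub> a \<in> ars DiaVar" by (rule dcomp_ars[OF d(3,1,7)])
  have f: "fctr ?X ?W (ls D (p \<cdot>\<^bsub>DiaVar\<^esub> a))" using ls_fctr[OF pa] by (simp add: dcomp_simps)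
  have f1: "fctr ?X ?W (ls D a \<odot> ls D p)" using fctr_comp[OF ls_fctr[OF d(1)]] ls_fctr[OF d(3)] d(7) by simp
  have f2: "fctr ?X ?W (ls D b \<odot> ls D q)"
    using fctr_comp[OF ls_fctr[OF d(2)]] ls_fctr[OF d(4)] d(5,6,8) by simp
  have e: "ex_ls D p q a b = (\<lambda>A. inver ?W (cc D q b A) \<cdot>\<^bsub>?W\<^esub> cc D p a A)"
    by (rule ext) (simp add: ex_ls_def Let_def)
  note i = nat_trans_inver[OF f2 f c'(1)[folded d(9)] c'(2)]
  show "nat_trans ?X ?W (ls D a \<odot> ls D p) (ls D b \<odot> ls D q) (ex_ls D p q a b)"
    unfolding e by (rule nat_trans_vcomp[OF f1 f f2 c(1) i])
  show "is_iso ?W (ex_ls D p q a b A)" if "A \<in> obs ?X"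
    unfolding e using that nat_transD(3,4)[OF c(1) that] nat_transD(3)[OF i that]
    by (intro is_iso_cmp[OF W] is_iso_inver[OF W] c(2) c'(2)) auto
qed

lemma ex_square:
  assumes s: "dsquare p q a b"
  shows "square (tc D (dtgt p)) (tc D (dsrc p)) (tc D (dsrc q)) (tc D (dsrc a))
    (ls D p) (ls D a) (ls D q) (ls D b) (ex_ls D p q a b)"
  using ls_fctr[OF dsquareD(1)[OF s]] ls_fctr[OF dsquareD(2)[OF s]] ls_fctr[OF dsquareD(3)[OF s]]
    ls_fctr[OF dsquareD(4)[OF s]] ex_ls(1)[OF s] dsquareD(5-8)[OF s]
  by unfold_locales simp_all

lemma square_adj:
  assumes s: "dsquare p q a b"
  shows "adj (tc D (dtgt p)) (tc D (dsrc p)) (ls D p) (us D p) (us_un D p) (us_co D p)"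
    "adj (tc D (dtgt p)) (tc D (dsrc q)) (ls D q) (us D q) (us_un D q) (us_co D q)"
    "adj (tc D (dsrc p)) (tc D (dsrc a)) (ls D a) (us D a) (us_un D a) (us_co D a)"
    "adj (tc D (dsrc q)) (tc D (dsrc a)) (ls D b) (us D b) (us_un D b) (us_co D b)"
    "argwise smooth p \<Longrightarrow> adj (tc D (dsrc p)) (tc D (dtgt p)) (sh D p) (ls D p) (sh_un D p) (sh_co D p)"
    "argwise smooth b \<Longrightarrow> adj (tc D (dsrc a)) (tc D (dsrc q)) (sh D b) (ls D b) (sh_un D b) (sh_co D b)"
  using us_adj[OF dsquareD(1)[OF s]] us_adj[OF dsquareD(2)[OF s]] us_adj[OF dsquareD(3)[OF s]]
    us_adj[OF dsquareD(4)[OF s]] sh_adj[OF dsquareD(1)[OF s]] sh_adj[OF dsquareD(4)[OF s]] dsquareD(5-8)[OF s]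
  by simp_all

lemma ex_us_mate:
  assumes s: "dsquare p q a b"
  shows "ex_us D p q a b = square.us_mate (tc D (dsrc p)) (tc D (dsrc a)) (ls D p) (ls D b) (ex_ls D p q a b)
    (us D q) (us D a) (us_co D q) (us_un D a)"
  by (rule ext) (simp add: square.us_mate_def[OF ex_square[OF s]] ex_us_def Let_def dsquareD(7)[OF s])

lemma ex_us_nat:
  assumes s: "dsquare p q a b"
  shows "nat_trans (tc D (dsrc q)) (tc D (dsrc p)) (ls D p \<odot> us D q) (us D a \<odot> ls D b) (ex_us D p q a b)"
  unfolding ex_us_mate[OF s]
  by (rule square.us_mate_nat[OF ex_square[OF s] square_adj(2)[OF s] square_adj(3)[OF s]])

lemma ex_sh_mate:
  assumes s: "dsquare p q a b"
  shows "ex_sh D p q a b = square.sh_mate (tc D (dsrc q)) (tc D (dsrc a)) (ls D a) (ls D q) (ex_ls D p q a b)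
    (sh D p) (sh D b) (sh_un D p) (sh_co D b)"
  by (rule ext) (simp add: square.sh_mate_def[OF ex_square[OF s]] ex_sh_def Let_def dsquareD(8)[OF s])

text \<open>The second part turns a statement about direct images into one about left adjoints. It
  is the way in which restriction of index categories, assumed to commute with direct images, is
  seen to make inverse images commute with the homotopy colimit in the nearby cycles.\<close>

lemma
  assumes s: "dsquare p q a b" and smooth: "argwise smooth p" "argwise smooth b"
  shows ex_sh_nat: "nat_trans (tc D (dsrc p)) (tc D (dsrc q)) (sh D b \<odot> ls D a) (ls D q \<odot> sh D p) (ex_sh D p q a b)"
    and ex_sh_iso: "(\<And>B. B \<in> obs (tc D (dsrc q)) \<Longrightarrow> is_iso (tc D (dsrc p)) (ex_us D p q a b B)) \<Longrightarrow>
      B \<in> obs (tc D (dsrc p)) \<Longrightarrow> is_iso (tc D (dsrc q)) (ex_sh D p q a b B)"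
  unfolding ex_sh_mate[OF s] ex_us_mate[OF s]
  by (rule square.sh_mate_nat[OF ex_square[OF s] square_adj(5,6)[OF s]], rule smooth, rule smooth)
    (rule square.sh_mate_iso[OF ex_square[OF s] square_adj(2,3,5,6)[OF s]]; (rule smooth)?)

text \<open>The formula for \<open>ex_usus\<close> starts from the comparison of inverse images in
  the opposite direction, so it is the mate of the transposed square.\<close>

lemma ex_usus_mate:
  assumes s: "dsquare p q a b"
  shows "ex_usus D p q a b = square.usus_mate (tc D (dtgt q)) (tc D (dsrc q)) (tc D (dsrc b)) (ls D q)
    (ls D a) (ex_ls D q p b a) (us D q) (us D b) (us D p) (us D a) (us_un D q) (us_un D b) (us_co D p) (us_co D a)"
  unfolding square.usus_mate_def[OF ex_square[OF dsquare_sym[OF s]], abs_def]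
  by (rule ext) (simp add: ex_usus_def Let_def dsquareD(5-8)[OF s])

lemma
  assumes s: "dsquare p q a b"
  shows ex_usus_nat: "nat_trans (tc D (dsrc a)) (tc D (dtgt p)) (us D p \<odot> us D a) (us D q \<odot> us D b) (ex_usus D p q a b)"
    and ex_usus_iso: "B \<in> obs (tc D (dsrc a)) \<Longrightarrow> is_iso (tc D (dtgt p)) (ex_usus D p q a b B)"
proof -
  note s' = dsquare_sym[OF s]
  note sq = ex_square[OF s'] and A = square_adj(1,3,2,4)[OF s']
  show "nat_trans (tc D (dsrc a)) (tc D (dtgt p)) (us D p \<odot> us D a) (us D q \<odot> us D b) (ex_usus D p q a b)"
    unfolding ex_usus_mate[OF s] using square.usus_mate_nat[OF sq A] dsquareD(5,6)[OF s] by simp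
  show "is_iso (tc D (dtgt p)) (ex_usus D p q a b B)" if "B \<in> obs (tc D (dsrc a))"
    unfolding ex_usus_mate[OF s]
    using square.usus_mate_iso[OF sq A ex_ls(2)[OF s'], of B] that dsquareD(5,6)[OF s] by simp
qed

lemma ex_shus_mate:
  assumes s: "dsquare p q a b"
  shows "ex_shus D p q a b = square.shus_mate (tc D (dtgt p)) (tc D (dsrc p)) (tc D (dsrc a)) (ls D p) (ls D b)
    (ex_ls D p q a b) (us D q) (us D a) (sh D p) (sh D b) (sh_co D p) (us_co D q) (us_un D a) (sh_un D b)"
  by (rule ext) (simp add: square.shus_mate_def[OF ex_square[OF s]] ex_shus_def Let_def ex_us_mate[OF s]
      dsquareD(7)[OF s])

lemma ex_shus_nat:
  assumes s: "dsquare p q a b" and smooth: "argwise smooth p" "argwise smooth b"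
    and iso: "\<And>B. B \<in> obs (tc D (dsrc q)) \<Longrightarrow> is_iso (tc D (dsrc p)) (ex_us D p q a b B)"
  shows "nat_trans (tc D (dsrc a)) (tc D (dtgt p)) (sh D p \<odot> us D a) (us D q \<odot> sh D b) (ex_shus D p q a b)"
  unfolding ex_shus_mate[OF s]
  by (rule square.shus_mate_nat[OF ex_square[OF s] square_adj(2,3)[OF s] square_adj(5)[OF s smooth(1)]
        square_adj(6)[OF s smooth(2)]])
    (use iso in \<open>simp add: ex_us_mate[OF s]\<close>)

lemma SH_triangulated: "X \<in> obs Var \<Longrightarrow> triangulated (SH D X)"
  unfolding SH_def by (intro tc_triangulated cdiag_obs term_category)

lemma idn_DiaVar: "idn DiaVar (cdiag I X) = cmor I (kid X)"
  by (simp add: DiaVar_def cmor_def cdiag_simps kid_simps)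

text \<open>Smooth base change along the fibre square of a monomorphism with itself shows that the counit
  of the inverse and direct images is invertible.\<close>

lemma sh_unit_iso:
  assumes u: "u \<in> ars Var" "smooth u"
    and mono: "is_pullback Var u u (kid (src u)) (kid (src u))"
    and B: "B \<in> obs (SH D (src u))"
  shows "is_iso (SH D (src u)) (sh_un D \<langle>u\<rangle> B)"
proof -
  have Y: "src u \<in> obs Var" using u by (simp add: Var_simps)
  let ?i = "\<langle>kid (src u)\<rangle>"
  have k: "kid (src u) \<in> ars Var" using homsD(1)[OF kid_homs[OF Y]] .
  note ud = cmor_ars[OF term_category u(1)] and id = cmor_ars[OF term_category k]
  let ?C = "SH D (src u)"
  have Ct: "?C = tc D (dsrc \<langle>u\<rangle>)" "?C = tc D (dsrc ?i)" "?C = tc D (dtgt ?i)"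
    by (simp_all add: SH_def cmor_simps kid_simps)
  note C = triangulated_category[OF SH_triangulated[OF Y]]
  have ap: "argwise_pullback \<langle>u\<rangle> \<langle>u\<rangle> ?i ?i"
    using mono cmor_over_id[OF term_category u(1)] cmor_over_id[OF term_category k]
    by (simp add: argwise_pullback_def cmor_simps kid_simps cdiag_simps)
  have as: "argwise smooth \<langle>u\<rangle>" using u(2) by (simp add: argwise_def cmor_simps cdiag_simps)
  have bc: "is_iso ?C (ex_us D \<langle>u\<rangle> \<langle>u\<rangle> ?i ?i b)" if "b \<in> obs ?C" for b
    using axioms(4) ap as that unfolding homotopical_axioms_def Ct(1) by blast
  note s = argwise_pullback_dsquare[OF ap]
  have ai: "adj ?C ?C (ls D ?i) (us D ?i) (us_un D ?i) (us_co D ?i)"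
    using us_adj[OF id] unfolding Ct[symmetric] .
  have au: "adj (SH D (tgt u)) ?C (ls D \<langle>u\<rangle>) (us D \<langle>u\<rangle>) (us_un D \<langle>u\<rangle>) (us_co D \<langle>u\<rangle>)"
    using us_adj[OF ud] unfolding Ct[symmetric] by (simp add: SH_def cmor_simps)
  have ash: "adj ?C (SH D (tgt u)) (sh D \<langle>u\<rangle>) (ls D \<langle>u\<rangle>) (sh_un D \<langle>u\<rangle>) (sh_co D \<langle>u\<rangle>)"
    using sh_adj[OF ud as] unfolding Ct[symmetric] by (simp add: SH_def cmor_simps)
  have "nat_trans ?C ?C ftr_id (ls D ?i) (cu D (cdiag term_cat (src u)))"
    "\<And>A. A \<in> obs ?C \<Longrightarrow> is_iso ?C (cu D (cdiag term_cat (src u)) A)"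
    using cu[OF cdiag_obs[OF term_category Y]] unfolding idn_DiaVar SH_def by auto
  note ff = fully_faithful_if_iso_id[OF adjD(3)[OF ai] this]
  \<comment> \<open>Inverse image along an identity is isomorphic to the identity functor by
    \<open>cu\<close>, but not equal to it. It is therefore fully faithful, and the unit of its
    adjunction is invertible.\<close>
  have uni: "is_iso ?C (us_un D ?i b)" if "b \<in> obs ?C" for b
    using unit_iso_if_fully_faithful[OF ai that ff] that by blast
  have "is_iso ?C (us_co D \<langle>u\<rangle> b)" if b: "b \<in> obs ?C" for b
  proof -
    let ?R = "onO (us D \<langle>u\<rangle>) b" and ?co = "us_co D \<langle>u\<rangle> b"
    note simps = fctrD(3-)[OF adjD(3)[OF ai]] fctrD(3-)[OF adjD(4)[OF ai]] fctrD(3-)[OF adjD(3)[OF au]]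
      fctrD(3-)[OF adjD(4)[OF au]] nat_transD(2-4)[OF adjD(6)[OF au], simplified]
      nat_transD(2-4)[OF adjD(5)[OF ai], simplified]
    \<comment> \<open>The two composites of the square are the same pair of morphisms, so the
      comparison is \<open>cc\<close> followed by its own inverse. The base change morphism thus
      reduces to the counit of \<open>u\<close> followed by a unit known to be invertible.\<close>
    have "ex_ls D \<langle>u\<rangle> \<langle>u\<rangle> ?i ?i ?R = idn ?C (onO (ls D ?i) (onO (ls D \<langle>u\<rangle>) ?R))"
    proof -
      have c: "is_iso ?C (cc D \<langle>u\<rangle> ?i ?R)"
        using cc(2)[OF ud id, of ?R] b fctrD(3)[OF adjD(4)[OF au] b]
        unfolding Ct[symmetric] by (simp add: cmor_simps kid_simps SH_def)
      have "dm ?C (cc D \<langle>u\<rangle> ?i ?R) = onO (ls D ?i) (onO (ls D \<langle>u\<rangle>) ?R)"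
        using nat_transD(3)[OF cc(1)[OF ud id], of ?R] fctrD(3)[OF adjD(4)[OF au] b]
        unfolding Ct[symmetric] by (simp add: cmor_simps kid_simps SH_def)
      then show ?thesis
        using inver_cmp[OF C c] by (simp add: ex_ls_def Let_def SH_def cmor_simps kid_simps)
    qed
    then have "ex_us D \<langle>u\<rangle> \<langle>u\<rangle> ?i ?i b =
        onA (us D ?i) (onA (ls D ?i) ?co) \<cdot>\<^bsub>?C\<^esub> us_un D ?i (onO (ls D \<langle>u\<rangle>) ?R)"
      using b by (simp add: ex_us_def Let_def Ct[symmetric] simps cmp_idn[OF C])
    also have "\<dots> = us_un D ?i b \<cdot>\<^bsub>?C\<^esub> ?co"
      using nat_transD(5)[OF adjD(5)[OF ai], of ?co] b by (simp add: simps)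
    finally have "is_iso ?C (us_un D ?i b \<cdot>\<^bsub>?C\<^esub> ?co)" using bc[OF b] by simp
    then show ?thesis
      by (rule is_iso_cancel_left[OF C _ uni[OF b]]) (use b in \<open>auto simp: homs_def simps\<close>)
  qed
  from unit_iso_if_counit_iso[OF ash au this B] show ?thesis .
qed

end

section \<open>The base change morphisms of nearby cycles\<close>

text \<open>One rung of a tower. The transformation \<open>s\<close> moves an inverse image past one
  factor of the composite, and \<open>t\<close> has already moved it past the remaining factors.
  Four rungs carry it through the five factors of the nearby cycles functor, with naturality and
  invertibility established together.\<close>

lemma ladder_left:
  assumes Q: "fctr B B2 Q" and P: "fctr B2 D P" and P': "fctr B C P'" and Q': "fctr C D Q'"
    and T: "fctr A B T" and T': "fctr A' C T'" and P'': "fctr A A' P''"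
    and s: "nat_trans B D (P \<odot> Q) (Q' \<odot> P') s" and t: "nat_trans A C (P' \<odot> T) (T' \<odot> P'') t"
  shows "nat_trans A D (P \<odot> (Q \<odot> T)) ((Q' \<odot> T') \<odot> P'') (\<lambda>X. onA Q' (t X) \<cdot>\<^bsub>D\<^esub> s (onO T X))"
    "(\<And>b. b \<in> obs B \<Longrightarrow> is_iso D (s b)) \<Longrightarrow> (\<And>X. X \<in> obs A \<Longrightarrow> is_iso C (t X)) \<Longrightarrow> X \<in> obs A \<Longrightarrow>
      is_iso D (onA Q' (t X) \<cdot>\<^bsub>D\<^esub> s (onO T X))"
proof -
  note fctr = assms(1-7) fctr_comp
  have 1: "nat_trans A D (P \<odot> (Q \<odot> T)) (Q' \<odot> (P' \<odot> T)) (\<lambda>X. s (onO T X))"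
    using nat_trans_whisker_right[OF T s] by (simp add: ftr_comp_assoc)
  have 2: "nat_trans A D (Q' \<odot> (P' \<odot> T)) ((Q' \<odot> T') \<odot> P'') (\<lambda>X. onA Q' (t X))"
    unfolding ftr_comp_assoc by (rule nat_trans_whisker_left[OF Q' _ _ t]) (rule fctr)+
  from 1 2 show "nat_trans A D (P \<odot> (Q \<odot> T)) ((Q' \<odot> T') \<odot> P'') (\<lambda>X. onA Q' (t X) \<cdot>\<^bsub>D\<^esub> s (onO T X))"
    by (rule nat_trans_vcomp[rotated 3]) (rule fctr)+
  assume i: "\<And>b. b \<in> obs B \<Longrightarrow> is_iso D (s b)" "\<And>X. X \<in> obs A \<Longrightarrow> is_iso C (t X)" and X: "X \<in> obs A"
  show "is_iso D (onA Q' (t X) \<cdot>\<^bsub>D\<^esub> s (onO T X))"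
    by (rule is_iso_cmp[OF fctrD(2)[OF P] i(1) fctr_iso[OF Q' i(2)[OF X]]])
      (use X fctrD(3)[OF T] nat_transD(4)[OF 1 X] nat_transD(3)[OF 2 X] in simp_all)
qed

text \<open>The same rung for transformations pointing the other way: here the transformation
  \<open>t\<close> of the inner factors is applied first.\<close>

lemma ladder_right:
  assumes Q: "fctr C D Q" and P': "fctr B C P'" and P: "fctr B2 D P" and Q': "fctr B B2 Q'"
    and T: "fctr A' C T" and P'': "fctr A A' P''" and T': "fctr A B T'"
    and s: "nat_trans B D (Q \<odot> P') (P \<odot> Q') s" and t: "nat_trans A C (T \<odot> P'') (P' \<odot> T') t"
  shows "nat_trans A D ((Q \<odot> T) \<odot> P'') (P \<odot> (Q' \<odot> T')) (\<lambda>X. s (onO T' X) \<cdot>\<^bsub>D\<^esub> onA Q (t X))"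
    "(\<And>b. b \<in> obs B \<Longrightarrow> is_iso D (s b)) \<Longrightarrow> (\<And>X. X \<in> obs A \<Longrightarrow> is_iso C (t X)) \<Longrightarrow> X \<in> obs A \<Longrightarrow>
      is_iso D (s (onO T' X) \<cdot>\<^bsub>D\<^esub> onA Q (t X))"
proof -
  note fctr = assms(1-7) fctr_comp
  have 1: "nat_trans A D ((Q \<odot> T) \<odot> P'') (Q \<odot> (P' \<odot> T')) (\<lambda>X. onA Q (t X))"
    unfolding ftr_comp_assoc by (rule nat_trans_whisker_left[OF Q _ _ t]) (rule fctr)+
  have 2: "nat_trans A D (Q \<odot> (P' \<odot> T')) (P \<odot> (Q' \<odot> T')) (\<lambda>X. s (onO T' X))"
    using nat_trans_whisker_right[OF T' s] by (simp add: ftr_comp_assoc)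
  from 1 2 show "nat_trans A D ((Q \<odot> T) \<odot> P'') (P \<odot> (Q' \<odot> T')) (\<lambda>X. s (onO T' X) \<cdot>\<^bsub>D\<^esub> onA Q (t X))"
    by (rule nat_trans_vcomp[rotated 3]) (rule fctr)+
  assume i: "\<And>b. b \<in> obs B \<Longrightarrow> is_iso D (s b)" "\<And>X. X \<in> obs A \<Longrightarrow> is_iso C (t X)" and X: "X \<in> obs A"
  show "is_iso D (s (onO T' X) \<cdot>\<^bsub>D\<^esub> onA Q (t X))"
    by (rule is_iso_cmp[OF fctrD(2)[OF Q] fctr_iso[OF Q i(2)[OF X]] i(1)])
      (use X fctrD(3)[OF T'] nat_transD(4)[OF 1 X] nat_transD(3)[OF 2 X] in simp_all)
qed

lemma DeltaN_category: "base_data S \<Longrightarrow> category DeltaN"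
  by (auto simp: base_data_def DiaVar_simps is_diag_def)

lemma fibre_dataD:
  assumes "fibre_data S f N"
  shows "is_pullback Var f (jm S) (jj N) (fe N)" "is_pullback Var f (zsec S) (ii N) (fs N)"
    "over_id (th_f N)" "dtgt (th_f N) = cdiag DeltaN (eta N)" "over_id (rp N)" "dtgt (rp N) = RR S"
    "dsrc (rp N) = dsrc (th_f N)"
    "\<And>i. i \<in> obs DeltaN \<Longrightarrow> is_pullback Var (fe N) (th S i) (comp_at (th_f N) i) (comp_at (rp N) i)"
  using assms by (auto simp: fibre_data_def)

text \<open>One morphism together with the nearby cycles data of its target and its source. The
  final proof uses two instances, for the proper and for the open part of the compactification; they
  share the data of the intermediate variety.\<close>

locale fibres_morphism = derivator D for D :: "('p, 'r, 'k::field, 'o, 'm) deriv" +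
  fixes S :: "('p, 'r, 'k) base" and f g :: "('p, 'r, 'k) kmor" and N N' :: "('p, 'r, 'k) fibres"
  assumes base: "base_data S" and f: "f \<in> ars Var" and g: "g \<in> ars Var" and fg: "tgt g = src f"
    and N: "fibre_data S f N" and N': "fibre_data S (f \<cdot>\<^bsub>Var\<^esub> g) N'"
begin

abbreviation "I \<equiv> DeltaN"
abbreviation "ge \<equiv> g_eta N N' g"
abbreviation "gs \<equiv> g_sig N N' g"
abbreviation "gR \<equiv> g_R N N' g"

lemmas I = DeltaN_category[OF base]
lemmas FN = fibre_dataD[OF N] and FN' = fibre_dataD[OF N']

lemma ge: "ge \<in> homs Var (eta N') (eta N)" "fe N \<cdot>\<^bsub>Var\<^esub> ge = fe N'" "is_pullback Var g (jj N) (jj N') ge"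
  using is_pullback_induced[OF Var_category FN(1) FN'(1) g] fg
  unfolding g_eta_def[symmetric] by (simp_all add: Var_simps)

lemma gs: "gs \<in> homs Var (sig N') (sig N)" "is_pullback Var g (ii N) (ii N') gs"
  using is_pullback_induced[OF Var_category FN(2) FN'(2) g] fg
  unfolding g_sig_def[symmetric] by (simp_all add: Var_simps)

lemma ars_Var: "ge \<in> ars Var" "gs \<in> ars Var" "jj N \<in> ars Var" "jj N' \<in> ars Var" "ii N \<in> ars Var" "ii N' \<in> ars Var"
  using homsD[OF ge(1)] homsD[OF gs(1)] is_pullbackD[OF FN(1)] is_pullbackD[OF FN'(1)]
    is_pullbackD[OF FN(2)] is_pullbackD[OF FN'(2)] by auto

lemma ends: "src ge = eta N'" "tgt ge = eta N" "src gs = sig N'" "tgt gs = sig N"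
    "tgt (jj N) = tgt g" "tgt (ii N) = tgt g" "tgt (jj N') = src g" "tgt (ii N') = src g"
  using homsD[OF ge(1)] homsD[OF gs(1)] is_pullbackD[OF FN(1)] is_pullbackD[OF FN'(1)]
    is_pullbackD[OF FN(2)] is_pullbackD[OF FN'(2)] fg by (auto simp: Var_simps kcomp_simps)

lemma obs_Var: "eta N \<in> obs Var" "eta N' \<in> obs Var" "sig N \<in> obs Var" "sig N' \<in> obs Var"
    "src g \<in> obs Var" "tgt g \<in> obs Var"
  using ars_Var g by (auto simp: Var_simps)

lemma idx_th: "idx (dtgt (th_f N)) = I" "idx (dtgt (th_f N')) = I" "idx (dsrc (th_f N)) = I" "idx (dsrc (th_f N')) = I"
  using FN(4) FN'(4) over_idD(2)[OF FN(3)] over_idD(2)[OF FN'(3)] by (simp_all add: cdiag_simps)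

text \<open>Cancellation of fibre squares once more, at each index, for the two squares over
  \<open>th S i\<close>.\<close>

lemma gR_at:
  assumes i: "i \<in> obs I"
  shows "comp_at gR i \<in> homs Var (dob (dsrc (th_f N')) i) (dob (dsrc (th_f N)) i)"
    "comp_at (rp N) i \<cdot>\<^bsub>Var\<^esub> comp_at gR i = comp_at (rp N') i"
    "is_pullback Var ge (comp_at (th_f N) i) (comp_at (th_f N') i) (comp_at gR i)"
proof -
  have gc: "comp_at gR i = pb_lift Var (comp_at (th_f N) i) (comp_at (rp N) i)
      (ge \<cdot>\<^bsub>Var\<^esub> comp_at (th_f N') i) (comp_at (rp N') i)"
    using i by (simp add: g_R_def)
  have d: "dm Var (comp_at (th_f N) i) = dob (dsrc (th_f N)) i" "dm Var (comp_at (th_f N') i) = dob (dsrc (th_f N')) i"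
    using homsD[OF over_id_comp_at[OF FN(3), of i]] homsD[OF over_id_comp_at[OF FN'(3), of i]] i idx_th by simp_all
  have "cd Var ge = dm Var (fe N)" using is_pullbackD[OF FN(1)] ends by (simp add: Var_simps)
  note P = is_pullback_induced[OF Var_category FN(8)[OF i] FN'(8)[OF i, folded ge(2)] ars_Var(1) this, folded gc]
  show "comp_at gR i \<in> homs Var (dob (dsrc (th_f N')) i) (dob (dsrc (th_f N)) i)" using P(1) d by simp
  show "comp_at (rp N) i \<cdot>\<^bsub>Var\<^esub> comp_at gR i = comp_at (rp N') i" by (rule P(2))
  show "is_pullback Var ge (comp_at (th_f N) i) (comp_at (th_f N') i) (comp_at gR i)" by (rule P(3))
qed

lemma gR_simps: "dsrc gR = dsrc (th_f N')" "dtgt gR = dsrc (th_f N)" "ixO gR = (\<lambda>i\<in>obs I. i)" "ixA gR = (\<lambda>a\<in>ars I. a)"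
  by (simp_all add: g_R_def)

text \<open>The components of \<open>gR\<close> are chosen index by index, so naturality has to be
  proved. The projections \<open>th_f\<close> and \<open>rp\<close> are jointly monic, and after
  each of them the equation is clear: the first goes to a constant diagram, the second commutes with
  the transition maps of \<open>RR S\<close>.\<close>

lemma gR_over_id: "over_id gR"
proof -
  have F: "is_diag (dsrc (th_f N))" "is_diag (dsrc (th_f N'))"
    using dmor_obs(1)[OF over_idD(1)[OF FN(3)]] dmor_obs(1)[OF over_idD(1)[OF FN'(3)]] by (simp_all add: DiaVar_simps)
  have nat: "comp_at gR (cd I a) \<cdot>\<^bsub>Var\<^esub> dar (dsrc (th_f N')) a = dar (dsrc (th_f N)) a \<cdot>\<^bsub>Var\<^esub> comp_at gR (dm I a)"
    if a: "a \<in> ars I" for a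
  proof -
    let ?d = "dar (dsrc (th_f N)) a" and ?d' = "dar (dsrc (th_f N')) a"
    let ?t = "comp_at (th_f N)" and ?t' = "comp_at (th_f N')" and ?r = "comp_at (rp N)" and ?r' = "comp_at (rp N')"
    have o: "dm I a \<in> obs I" "cd I a \<in> obs I" using a by (auto simp: dm_obs[OF I] cd_obs[OF I])
    note g1 = gR_at[OF o(1)] and g2 = gR_at[OF o(2)]
    have d: "?d \<in> homs Var (dob (dsrc (th_f N)) (dm I a)) (dob (dsrc (th_f N)) (cd I a))"
      "?d' \<in> homs Var (dob (dsrc (th_f N')) (dm I a)) (dob (dsrc (th_f N')) (cd I a))"
      using F is_functorD(3)[of I Var "dob (dsrc (th_f N))" "dar (dsrc (th_f N))" a]
        is_functorD(3)[of I Var "dob (dsrc (th_f N'))" "dar (dsrc (th_f N'))" a] a idx_th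
      by (simp_all add: is_diag_def)
    have ri: "idx (dtgt (rp N)) = I" "idx (dtgt (rp N')) = I"
      using over_idD(2)[OF FN(5)] over_idD(2)[OF FN'(5)] FN(7) FN'(7) idx_th by simp_all
    have dr: "dar (RR S) a \<in> homs Var (dob (RR S) (dm I a)) (dob (RR S) (cd I a))"
      using base a is_functorD(3)[of I Var "dob (RR S)" "dar (RR S)" a]
      by (auto simp: base_data_def DiaVar_simps is_diag_def)
    have t: "?t i \<in> homs Var (dob (dsrc (th_f N)) i) (eta N)" "?t' i \<in> homs Var (dob (dsrc (th_f N')) i) (eta N')"
      "?r i \<in> homs Var (dob (dsrc (th_f N)) i) (dob (RR S) i)" "?r' i \<in> homs Var (dob (dsrc (th_f N')) i) (dob (RR S) i)"
      if "i \<in> obs I" for i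
      using that over_id_comp_at[OF FN(3), of i] over_id_comp_at[OF FN'(3), of i] over_id_comp_at[OF FN(5), of i]
        over_id_comp_at[OF FN'(5), of i] FN(4,6,7) FN'(4,6,7) idx_th ri by (simp_all add: cdiag_simps)
    have n: "?t (cd I a) \<cdot>\<^bsub>Var\<^esub> ?d = ?t (dm I a)" "?t' (cd I a) \<cdot>\<^bsub>Var\<^esub> ?d' = ?t' (dm I a)"
      using over_id_natural[OF FN(3), of a] over_id_natural[OF FN'(3), of a] FN(4) FN'(4) a
        kid_cmp(1)[OF t(1)[OF o(1)]] kid_cmp(1)[OF t(2)[OF o(1)]] by (simp_all add: cdiag_simps)
    have nr: "?r (cd I a) \<cdot>\<^bsub>Var\<^esub> ?d = dar (RR S) a \<cdot>\<^bsub>Var\<^esub> ?r (dm I a)"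
      "?r' (cd I a) \<cdot>\<^bsub>Var\<^esub> ?d' = dar (RR S) a \<cdot>\<^bsub>Var\<^esub> ?r' (dm I a)"
      using over_id_natural[OF FN(5), of a] over_id_natural[OF FN'(5), of a] ri FN(6,7) FN'(6,7) a by simp_all
    note cd1 = cmp_homs[OF Var_category d(2) g2(1)] and cd2 = cmp_homs[OF Var_category g1(1) d(1)]
    have tg: "?t i \<cdot>\<^bsub>Var\<^esub> comp_at gR i = ge \<cdot>\<^bsub>Var\<^esub> ?t' i" if "i \<in> obs I" for i
      using is_pullbackD(9)[OF gR_at(3)[OF that]] by simp
    note as = cmp_assoc_homs[OF Var_category]
    show ?thesis
    proof (rule is_pullback_jointly_mono[OF Var_category FN(8)[OF o(2)]])
      show "comp_at gR (cd I a) \<cdot>\<^bsub>Var\<^esub> ?d' \<in> homs Var (dob (dsrc (th_f N')) (dm I a)) (dm Var (?t (cd I a)))"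
        "?d \<cdot>\<^bsub>Var\<^esub> comp_at gR (dm I a) \<in> homs Var (dob (dsrc (th_f N')) (dm I a)) (dm Var (?t (cd I a)))"
        using cd1 cd2 homsD[OF t(1)[OF o(2)]] by simp_all
      have "?t (cd I a) \<cdot>\<^bsub>Var\<^esub> (comp_at gR (cd I a) \<cdot>\<^bsub>Var\<^esub> ?d') = ge \<cdot>\<^bsub>Var\<^esub> ?t' (dm I a)"
        using as[OF d(2) g2(1) t(1)[OF o(2)]] tg[OF o(2)] as[OF d(2) t(2)[OF o(2)] ge(1)] n(2) by simp
      also have "\<dots> = ?t (cd I a) \<cdot>\<^bsub>Var\<^esub> (?d \<cdot>\<^bsub>Var\<^esub> comp_at gR (dm I a))"
        using as[OF g1(1) d(1) t(1)[OF o(2)]] n(1) tg[OF o(1)] by simp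
      finally show "?t (cd I a) \<cdot>\<^bsub>Var\<^esub> (comp_at gR (cd I a) \<cdot>\<^bsub>Var\<^esub> ?d') =
          ?t (cd I a) \<cdot>\<^bsub>Var\<^esub> (?d \<cdot>\<^bsub>Var\<^esub> comp_at gR (dm I a))" .
      have "?r (cd I a) \<cdot>\<^bsub>Var\<^esub> (comp_at gR (cd I a) \<cdot>\<^bsub>Var\<^esub> ?d') = dar (RR S) a \<cdot>\<^bsub>Var\<^esub> ?r' (dm I a)"
        using as[OF d(2) g2(1) t(3)[OF o(2)]] g2(2) nr(2) by simp
      also have "\<dots> = ?r (cd I a) \<cdot>\<^bsub>Var\<^esub> (?d \<cdot>\<^bsub>Var\<^esub> comp_at gR (dm I a))"
        using as[OF g1(1) d(1) t(3)[OF o(2)]] nr(1) as[OF g1(1) t(3)[OF o(1)] dr] g1(2) by simp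
      finally show "?r (cd I a) \<cdot>\<^bsub>Var\<^esub> (comp_at gR (cd I a) \<cdot>\<^bsub>Var\<^esub> ?d') =
          ?r (cd I a) \<cdot>\<^bsub>Var\<^esub> (?d \<cdot>\<^bsub>Var\<^esub> comp_at gR (dm I a))" .
    qed
  qed
  have ext: "comp_at gR \<in> extensional (obs I)" by (simp add: g_R_def)
  have "is_dmor gR"
    unfolding is_dmor_def gR_simps idx_th Let_def
    using F nat ext is_functor_id[OF I] gR_at(1) I by (simp add: dm_obs cd_obs)
  then show ?thesis by (simp add: over_id_def gR_simps idx_th DiaVar_simps)
qed

lemma cmor_g: "over_id (cmor I g)" "over_id (cmor I ge)" "over_id (cmor I gs)" "over_id (cmor I (ii N))"
    "over_id (cmor I (ii N'))" "over_id (cmor I (jj N))" "over_id (cmor I (jj N'))"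
  using cmor_over_id[OF I] g ars_Var by auto

lemma jth: "over_id (jth N)" "dsrc (jth N) = dsrc (th_f N)" "dtgt (jth N) = cdiag I (tgt g)"
    "i \<in> obs I \<Longrightarrow> comp_at (jth N) i = jj N \<cdot>\<^bsub>Var\<^esub> comp_at (th_f N) i"
  using over_id_comp[OF FN(3) cmor_g(6)] FN(4) ends unfolding jth_def
  by (simp_all add: dcomp_simps cmor_simps cdiag_simps)

lemma jth': "over_id (jth N')" "dsrc (jth N') = dsrc (th_f N')" "dtgt (jth N') = cdiag I (src g)"
    "i \<in> obs I \<Longrightarrow> comp_at (jth N') i = jj N' \<cdot>\<^bsub>Var\<^esub> comp_at (th_f N') i"
  using over_id_comp[OF FN'(3) cmor_g(7)] FN'(4) ends unfolding jth_def
  by (simp_all add: dcomp_simps cmor_simps cdiag_simps)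

text \<open>This and the next two lemmas provide the cartesian squares, at each index, to which base
  change is applied inside the nearby cycles functor.\<close>

lemma square_i: "argwise_pullback (cmor I (ii N)) (cmor I g) (cmor I gs) (cmor I (ii N'))"
  using cmor_g is_pullback_sym[OF gs(2)] ends by (simp add: argwise_pullback_def cmor_simps cdiag_simps)

lemma square_j: "argwise_pullback (cmor I g) (jth N) (jth N') gR"
  using cmor_g jth jth' gR_over_id ends is_pullback_paste[OF Var_category ge(3) gR_at(3)]
  by (simp add: argwise_pullback_def cmor_simps cdiag_simps gR_simps idx_th)

lemma square_th: "argwise_pullback (th_f N) (cmor I ge) gR (th_f N')"
  using cmor_g FN(3,4) FN'(3,4) gR_over_id ends is_pullback_sym[OF gR_at(3)]
  by (simp add: argwise_pullback_def cmor_simps cdiag_simps gR_simps idx_th)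

lemma square_proj: "h \<in> ars Var \<Longrightarrow> dsquare (proj I (tgt h)) \<langle>h\<rangle> (cmor I h) (proj I (src h))"
  using proj_natural[OF I, of h] proj_ars[OF I] cmor_ars[OF I, of h] cmor_ars[OF term_category, of h]
  by (auto simp: dsquare_def cmor_simps proj_simps Var_simps)

text \<open>The derivator axiom on restriction along a functor of index categories, for the functor
  from \<open>DeltaN\<close> to the one-point category: passing to constant diagrams commutes with
  direct images.\<close>

lemma proj_ex_us_iso:
  assumes h: "h \<in> ars Var" and B: "B \<in> obs (SH D (src h))"
  shows "is_iso (tc D (cdiag I (tgt h))) (ex_us D (proj I (tgt h)) \<langle>h\<rangle> (cmor I h) (proj I (src h)) B)"
proof -
  let ?\<alpha> = "\<lambda>_::iob. (0, 1) :: iob" and ?\<alpha>' = "\<lambda>_::iar. ((0, 1), (0, 1), [0]) :: iar"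
  have "\<forall>f J \<alpha> \<alpha>'. over_id f \<and> category J \<and> is_functor J (idx (dtgt f)) \<alpha> \<alpha>' \<longrightarrow>
        (\<forall>B\<in>obs (tc D (dsrc f)). is_iso (tc D (rdiag (dtgt f) J \<alpha> \<alpha>'))
           (ex_us D (reindex (dtgt f) J \<alpha> \<alpha>') f (restr_mor f J \<alpha> \<alpha>') (reindex (dsrc f) J \<alpha> \<alpha>') B))"
    using axioms(3) unfolding derivator_axioms_def by (elim conjE) assumption
  from this[rule_format, of "\<langle>h\<rangle>" I ?\<alpha> ?\<alpha>' B]
  have "is_iso (tc D (rdiag (dtgt \<langle>h\<rangle>) I ?\<alpha> ?\<alpha>'))
      (ex_us D (reindex (dtgt \<langle>h\<rangle>) I ?\<alpha> ?\<alpha>') \<langle>h\<rangle> (restr_mor \<langle>h\<rangle> I ?\<alpha> ?\<alpha>') (reindex (dsrc \<langle>h\<rangle>) I ?\<alpha> ?\<alpha>') B)"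
    using cmor_over_id[OF term_category h] I proj_functor[OF I] B
    by (simp add: cmor_simps cdiag_simps SH_def)
  moreover have "restr_mor \<langle>h\<rangle> I ?\<alpha> ?\<alpha>' = cmor I h"
    by (simp add: restr_mor_def cmor_def rdiag_cdiag term_cat_def restrict_def)
  ultimately show ?thesis by (simp add: cmor_simps rdiag_cdiag proj_def)
qed

section \<open>The nearby cycles functor as a composite of five triangulated functors\<close>

lemma Psi_factors:
  "fctr (SH D (eta N)) (tc D (cdiag I (eta N))) (ls D (proj I (eta N)))"
  "fctr (tc D (cdiag I (eta N))) (tc D (dsrc (th_f N))) (ls D (th_f N))"
  "fctr (tc D (dsrc (th_f N))) (tc D (cdiag I (tgt g))) (us D (jth N))"
  "fctr (tc D (cdiag I (tgt g))) (tc D (cdiag I (sig N))) (ls D (cmor I (ii N)))"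
  "fctr (tc D (cdiag I (sig N))) (SH D (sig N)) (sh D (proj I (sig N)))"
  using ls_fctr[OF proj_ars[OF I obs_Var(1)]] ls_fctr[OF over_idD(1)[OF FN(3)]]
    us_fctr[OF over_idD(1)[OF jth(1)]] ls_fctr[OF over_idD(1)[OF cmor_g(4)]]
    sh_fctr[OF proj_ars[OF I obs_Var(3)] proj_smooth[OF obs_Var(3)]] FN(4) jth ends
  by (simp_all add: proj_simps cmor_simps SH_def)

lemma Psi_factors':
  "fctr (SH D (eta N')) (tc D (cdiag I (eta N'))) (ls D (proj I (eta N')))"
  "fctr (tc D (cdiag I (eta N'))) (tc D (dsrc (th_f N'))) (ls D (th_f N'))"
  "fctr (tc D (dsrc (th_f N'))) (tc D (cdiag I (src g))) (us D (jth N'))"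
  "fctr (tc D (cdiag I (src g))) (tc D (cdiag I (sig N'))) (ls D (cmor I (ii N')))"
  "fctr (tc D (cdiag I (sig N'))) (SH D (sig N')) (sh D (proj I (sig N')))"
  using ls_fctr[OF proj_ars[OF I obs_Var(2)]] ls_fctr[OF over_idD(1)[OF FN'(3)]]
    us_fctr[OF over_idD(1)[OF jth'(1)]] ls_fctr[OF over_idD(1)[OF cmor_g(5)]]
    sh_fctr[OF proj_ars[OF I obs_Var(4)] proj_smooth[OF obs_Var(4)]] FN'(4) jth' ends
  by (simp_all add: proj_simps cmor_simps SH_def)

lemma Psi_fctr: "fctr (SH D (eta N)) (SH D (sig N)) (Psi D N)"
  unfolding Psi_def by (intro fctr_comp[OF fctr_comp[OF fctr_comp[OF fctr_comp[OF Psi_factors(1,2)]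
    Psi_factors(3)] Psi_factors(4)] Psi_factors(5)])

lemma Psi_fctr': "fctr (SH D (eta N')) (SH D (sig N')) (Psi D N')"
  unfolding Psi_def by (intro fctr_comp[OF fctr_comp[OF fctr_comp[OF fctr_comp[OF Psi_factors'(1,2)]
    Psi_factors'(3)] Psi_factors'(4)] Psi_factors'(5)])

lemma Psi_triangulated: "triangulated_functor (SH D (eta N)) (SH D (sig N)) (Psi D N)"
proof -
  have T: "triangulated_functor (SH D (eta N)) (tc D (cdiag I (eta N))) (ls D (proj I (eta N)))"
    "triangulated_functor (tc D (cdiag I (eta N))) (tc D (dsrc (th_f N))) (ls D (th_f N))"
    "triangulated_functor (tc D (dsrc (th_f N))) (tc D (cdiag I (tgt g))) (us D (jth N))"
    "triangulated_functor (tc D (cdiag I (tgt g))) (tc D (cdiag I (sig N))) (ls D (cmor I (ii N)))"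
    "triangulated_functor (tc D (cdiag I (sig N))) (SH D (sig N)) (sh D (proj I (sig N)))"
    using ls_triangulated[OF proj_ars[OF I obs_Var(1)]] ls_triangulated[OF over_idD(1)[OF FN(3)]]
      us_triangulated[OF over_idD(1)[OF jth(1)]] ls_triangulated[OF over_idD(1)[OF cmor_g(4)]]
      sh_triangulated[OF proj_ars[OF I obs_Var(3)] proj_smooth[OF obs_Var(3)]] FN(4) jth ends
    by (simp_all add: proj_simps cmor_simps SH_def)
  note t = SH_triangulated[OF obs_Var(1)] cdiag_obs[OF I obs_Var(1), THEN tc_triangulated]
    dmor_obs(1)[OF over_idD(1)[OF FN(3)], THEN tc_triangulated]
    cdiag_obs[OF I obs_Var(6), THEN tc_triangulated]
    cdiag_obs[OF I obs_Var(3), THEN tc_triangulated] SH_triangulated[OF obs_Var(3)]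
  note c2 = triangulated_functor_comp[OF t(1,2,3) T(1,2)]
  note c3 = triangulated_functor_comp[OF t(1,3,4) c2 T(3)]
  note c4 = triangulated_functor_comp[OF t(1,4,5) c3 T(4)]
  note c5 = triangulated_functor_comp[OF t(1,5,6) c4 T(5)]
  show ?thesis unfolding Psi_def by (rule c5)
qed

lemma factors:
  "fctr (SH D (eta N)) (SH D (eta N')) (ls D \<langle>ge\<rangle>)" "fctr (SH D (eta N')) (SH D (eta N)) (us D \<langle>ge\<rangle>)"
  "fctr (tc D (cdiag I (eta N))) (tc D (cdiag I (eta N'))) (ls D (cmor I ge))"
  "fctr (tc D (cdiag I (eta N'))) (tc D (cdiag I (eta N))) (us D (cmor I ge))"
  "fctr (tc D (dsrc (th_f N))) (tc D (dsrc (th_f N'))) (ls D gR)"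
  "fctr (tc D (dsrc (th_f N'))) (tc D (dsrc (th_f N))) (us D gR)"
  "fctr (tc D (cdiag I (tgt g))) (tc D (cdiag I (src g))) (ls D (cmor I g))"
  "fctr (tc D (cdiag I (src g))) (tc D (cdiag I (tgt g))) (us D (cmor I g))"
  "fctr (tc D (cdiag I (sig N))) (tc D (cdiag I (sig N'))) (ls D (cmor I gs))"
  "fctr (tc D (cdiag I (sig N'))) (tc D (cdiag I (sig N))) (us D (cmor I gs))"
  "fctr (SH D (sig N)) (SH D (sig N')) (ls D \<langle>gs\<rangle>)" "fctr (SH D (sig N')) (SH D (sig N)) (us D \<langle>gs\<rangle>)"
  using ls_fctr[OF cmor_ars[OF term_category ars_Var(1)]] us_fctr[OF cmor_ars[OF term_category ars_Var(1)]]
    ls_fctr[OF cmor_ars[OF I ars_Var(1)]] us_fctr[OF cmor_ars[OF I ars_Var(1)]]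
    ls_fctr[OF over_idD(1)[OF gR_over_id]] us_fctr[OF over_idD(1)[OF gR_over_id]]
    ls_fctr[OF cmor_ars[OF I g]] us_fctr[OF cmor_ars[OF I g]]
    ls_fctr[OF cmor_ars[OF I ars_Var(2)]] us_fctr[OF cmor_ars[OF I ars_Var(2)]]
    ls_fctr[OF cmor_ars[OF term_category ars_Var(2)]] us_fctr[OF cmor_ars[OF term_category ars_Var(2)]] ends
  by (simp_all add: cmor_simps gR_simps SH_def)

text \<open>Of the five factors, three compare inverse images and are always invertible. The one
  past the direct image along \<open>jth N\<close> is smooth base change. The one past the homotopy
  colimit is the inverse of a left exchange morphism, which is invertible because its conjugate in
  \<open>proj_ex_us_iso\<close> is.\<close>

lemma
  assumes smooth: "smooth g"
  shows nc_alpha_nat: "nat_trans (SH D (eta N)) (SH D (sig N')) (ls D \<langle>gs\<rangle> \<odot> Psi D N) (Psi D N' \<odot> ls D \<langle>ge\<rangle>)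
      (nc_alpha D N N' g)"
    and nc_alpha_iso: "A \<in> obs (SH D (eta N)) \<Longrightarrow> is_iso (SH D (sig N')) (nc_alpha D N N' g A)"
proof -
  note F = Psi_factors and F' = Psi_factors' and H = factors
  note qe = square_proj[OF ars_Var(1), unfolded ends] and qs = square_proj[OF ars_Var(2), unfolded ends]
  have 5: "nat_trans (SH D (eta N)) (tc D (cdiag I (eta N'))) (ls D (cmor I ge) \<odot> ls D (proj I (eta N)))
      (ls D (proj I (eta N')) \<odot> ls D \<langle>ge\<rangle>) (ex_ls D (proj I (eta N)) \<langle>ge\<rangle> (cmor I ge) (proj I (eta N')))"
    "A \<in> obs (SH D (eta N)) \<Longrightarrow> is_iso (tc D (cdiag I (eta N')))
      (ex_ls D (proj I (eta N)) \<langle>ge\<rangle> (cmor I ge) (proj I (eta N')) A)" for A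
    using ex_ls(1)[OF qe] ex_ls(2)[OF qe, of A] ends by (simp_all add: proj_simps cmor_simps SH_def)
  note st = argwise_pullback_dsquare[OF square_th]
  have 4: "nat_trans (tc D (cdiag I (eta N))) (tc D (dsrc (th_f N'))) (ls D gR \<odot> ls D (th_f N))
      (ls D (th_f N') \<odot> ls D (cmor I ge)) (ex_ls D (th_f N) (cmor I ge) gR (th_f N'))"
    "A \<in> obs (tc D (cdiag I (eta N))) \<Longrightarrow> is_iso (tc D (dsrc (th_f N')))
      (ex_ls D (th_f N) (cmor I ge) gR (th_f N') A)" for A
    using ex_ls(1)[OF st] ex_ls(2)[OF st, of A] FN(4) by (simp_all add: gR_simps)
  note sj = argwise_pullback_dsquare[OF square_j]
  have 3: "nat_trans (tc D (dsrc (th_f N))) (tc D (cdiag I (src g))) (ls D (cmor I g) \<odot> us D (jth N))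
      (us D (jth N') \<odot> ls D gR) (ex_us D (cmor I g) (jth N) (jth N') gR)"
    using ex_us_nat[OF sj] jth(2) by (simp add: cmor_simps)
  have 3: "nat_trans (tc D (dsrc (th_f N))) (tc D (cdiag I (src g))) (ls D (cmor I g) \<odot> us D (jth N))
      (us D (jth N') \<odot> ls D gR) (ex_us D (cmor I g) (jth N) (jth N') gR)"
    "A \<in> obs (tc D (dsrc (th_f N))) \<Longrightarrow> is_iso (tc D (cdiag I (src g))) (ex_us D (cmor I g) (jth N) (jth N') gR A)" for A
  proof -
    have "argwise smooth (cmor I g)" using smooth by (simp add: argwise_def cmor_simps cdiag_simps)
    then have "\<forall>B\<in>obs (tc D (dsrc (jth N))). is_iso (tc D (dsrc (cmor I g))) (ex_us D (cmor I g) (jth N) (jth N') gR B)"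
      using axioms(4) square_j unfolding homotopical_axioms_def by blast
    then show "A \<in> obs (tc D (dsrc (th_f N))) \<Longrightarrow> is_iso (tc D (cdiag I (src g))) (ex_us D (cmor I g) (jth N) (jth N') gR A)"
      using jth(2) by (simp add: cmor_simps)
  qed (rule 3)
  note si = argwise_pullback_dsquare[OF square_i]
  have 2: "nat_trans (tc D (cdiag I (tgt g))) (tc D (cdiag I (sig N'))) (ls D (cmor I gs) \<odot> ls D (cmor I (ii N)))
      (ls D (cmor I (ii N')) \<odot> ls D (cmor I g)) (ex_ls D (cmor I (ii N)) (cmor I g) (cmor I gs) (cmor I (ii N')))"
    "A \<in> obs (tc D (cdiag I (tgt g))) \<Longrightarrow> is_iso (tc D (cdiag I (sig N')))
      (ex_ls D (cmor I (ii N)) (cmor I g) (cmor I gs) (cmor I (ii N')) A)" for A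
    using ex_ls(1)[OF si] ex_ls(2)[OF si, of A] ends by (simp_all add: cmor_simps)
  let ?e = "ex_sh D (proj I (sig N)) \<langle>gs\<rangle> (cmor I gs) (proj I (sig N'))"
  note ps = proj_smooth[OF obs_Var(3)] proj_smooth[OF obs_Var(4)]
  have 0: "nat_trans (tc D (cdiag I (sig N))) (SH D (sig N')) (sh D (proj I (sig N')) \<odot> ls D (cmor I gs))
      (ls D \<langle>gs\<rangle> \<odot> sh D (proj I (sig N))) ?e"
    using ex_sh_nat[OF qs ps] ends by (simp add: proj_simps cmor_simps SH_def)
  have 0: "nat_trans (tc D (cdiag I (sig N))) (SH D (sig N')) (sh D (proj I (sig N')) \<odot> ls D (cmor I gs))
      (ls D \<langle>gs\<rangle> \<odot> sh D (proj I (sig N))) ?e"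
    "A \<in> obs (tc D (cdiag I (sig N))) \<Longrightarrow> is_iso (SH D (sig N')) (?e A)" for A
  proof -
    have "is_iso (tc D (dsrc (proj I (sig N)))) (ex_us D (proj I (sig N)) \<langle>gs\<rangle> (cmor I gs) (proj I (sig N')) B)"
      if "B \<in> obs (tc D (dsrc \<langle>gs\<rangle>))" for B
      using proj_ex_us_iso[OF ars_Var(2), of B] that ends by (simp add: proj_simps cmor_simps SH_def)
    from ex_sh_iso[OF qs ps this, of A]
    show "A \<in> obs (tc D (cdiag I (sig N))) \<Longrightarrow> is_iso (SH D (sig N')) (?e A)"
      using ends by (simp add: proj_simps cmor_simps SH_def)
  qed (rule 0)
  note 1 = nat_trans_inver[OF fctr_comp[OF H(9) F'(5)] fctr_comp[OF F(5) H(11)] 0]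
  have 1: "nat_trans (tc D (cdiag I (sig N))) (SH D (sig N')) (ls D \<langle>gs\<rangle> \<odot> sh D (proj I (sig N)))
      (sh D (proj I (sig N')) \<odot> ls D (cmor I gs)) (\<lambda>A. inver (SH D (sig N')) (?e A))"
    "A \<in> obs (tc D (cdiag I (sig N))) \<Longrightarrow> is_iso (SH D (sig N')) (inver (SH D (sig N')) (?e A))" for A
    using 1 is_iso_inver[OF fctrD(2)[OF F'(5)] 0(2)] by auto
  note l4 = ladder_left[OF F(2) H(5) H(3) F'(2) F(1) F'(1) H(1) 4(1) 5(1)]
  note l3 = ladder_left[OF F(3) H(7) H(5) F'(3) fctr_comp[OF F(1,2)] fctr_comp[OF F'(1,2)] H(1) 3(1) l4(1)]
  note l2 = ladder_left[OF F(4) H(9) H(7) F'(4) fctr_comp[OF fctr_comp[OF F(1,2)] F(3)]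
      fctr_comp[OF fctr_comp[OF F'(1,2)] F'(3)] H(1) 2(1) l3(1)]
  note l1 = ladder_left[OF F(5) H(11) H(9) F'(5) fctr_comp[OF fctr_comp[OF fctr_comp[OF F(1,2)] F(3)] F(4)]
      fctr_comp[OF fctr_comp[OF fctr_comp[OF F'(1,2)] F'(3)] F'(4)] H(1) 1(1) l2(1)]
  \<comment> \<open>The definition in exactly the bracketing that the four rungs produce, so that
    they match it by unification.\<close>
  have eq: "nc_alpha D N N' g = (\<lambda>X. onA (sh D (proj I (sig N')))
      (onA (ls D (cmor I (ii N')))
        (onA (us D (jth N'))
          (onA (ls D (th_f N')) (ex_ls D (proj I (eta N)) \<langle>ge\<rangle> (cmor I ge) (proj I (eta N')) X)
            \<cdot>\<^bsub>tc D (dsrc (th_f N'))\<^esub> ex_ls D (th_f N) (cmor I ge) gR (th_f N') (onO (ls D (proj I (eta N))) X))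
          \<cdot>\<^bsub>tc D (cdiag I (src g))\<^esub> ex_us D (cmor I g) (jth N) (jth N') gR
              (onO (ls D (th_f N) \<odot> ls D (proj I (eta N))) X))
        \<cdot>\<^bsub>tc D (cdiag I (sig N'))\<^esub> ex_ls D (cmor I (ii N)) (cmor I g) (cmor I gs) (cmor I (ii N'))
            (onO (us D (jth N) \<odot> ls D (th_f N) \<odot> ls D (proj I (eta N))) X))
      \<cdot>\<^bsub>SH D (sig N')\<^esub> inver (SH D (sig N')) (?e (onO (ls D (cmor I (ii N)) \<odot> us D (jth N) \<odot>
            ls D (th_f N) \<odot> ls D (proj I (eta N))) X)))"
    by (rule ext) (simp add: nc_alpha_def Let_def ends)
  show "nat_trans (SH D (eta N)) (SH D (sig N')) (ls D \<langle>gs\<rangle> \<odot> Psi D N) (Psi D N' \<odot> ls D \<langle>ge\<rangle>) (nc_alpha D N N' g)"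
    using l1(1) unfolding eq Psi_def .
  show "is_iso (SH D (sig N')) (nc_alpha D N N' g A)" if "A \<in> obs (SH D (eta N))"
    unfolding eq
    by (rule l1(2)[OF 1(2) l2(2)[OF 2(2) l3(2)[OF 3(2) l4(2)[OF 4(2) 5(2)]]] that])
qed

text \<open>Of the five factors, the first is \<open>proj_ex_us_iso\<close>, and the second and
  fourth are proper base change, along the base change of \<open>g\<close> to the generic fibre and
  along \<open>g\<close> itself. The third compares right adjoints of isomorphic functors, and the
  last is the compatibility of proper direct images with homotopy colimits.\<close>

lemma
  assumes proper: "proper g"
  shows nc_beta_nat: "nat_trans (SH D (eta N')) (SH D (sig N)) (Psi D N \<odot> us D \<langle>ge\<rangle>) (us D \<langle>gs\<rangle> \<odot> Psi D N')
      (nc_beta D N N' g)"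
    and nc_beta_iso: "B \<in> obs (SH D (eta N')) \<Longrightarrow> is_iso (SH D (sig N)) (nc_beta D N N' g B)"
proof -
  note F = Psi_factors and F' = Psi_factors' and H = factors
  note qe = square_proj[OF ars_Var(1), unfolded ends] and qs = square_proj[OF ars_Var(2), unfolded ends]
  have pge: "proper ge" and pgs: "proper gs"
    using proper_base_change[OF is_pullback_sym[OF ge(3)] proper]
      proper_base_change[OF is_pullback_sym[OF gs(2)] proper] by auto
  have bc: "is_iso (tc D (dsrc p)) (ex_us D p q a b B)"
    if "argwise_pullback p q a b" "argwise proper q" "B \<in> obs (tc D (dsrc q))" for p q a b B
    using axioms(5) that unfolding proper_axioms_def by blast
  have ex1: "is_iso (tc D (cdiag I (tgt h))) (ex_us D (proj I (tgt h)) \<langle>h\<rangle> (cmor I h) (proj I (src h)) A)"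
    if "h \<in> ars Var" "A \<in> obs (SH D (src h))" for h A
    using proj_ex_us_iso[OF that] .
  have 1: "nat_trans (SH D (eta N')) (tc D (cdiag I (eta N))) (ls D (proj I (eta N)) \<odot> us D \<langle>ge\<rangle>)
      (us D (cmor I ge) \<odot> ls D (proj I (eta N'))) (ex_us D (proj I (eta N)) \<langle>ge\<rangle> (cmor I ge) (proj I (eta N')))"
    using ex_us_nat[OF qe] ends by (simp add: proj_simps cmor_simps SH_def)
  have 1: "nat_trans (SH D (eta N')) (tc D (cdiag I (eta N))) (ls D (proj I (eta N)) \<odot> us D \<langle>ge\<rangle>)
      (us D (cmor I ge) \<odot> ls D (proj I (eta N'))) (ex_us D (proj I (eta N)) \<langle>ge\<rangle> (cmor I ge) (proj I (eta N')))"
    "A \<in> obs (SH D (eta N')) \<Longrightarrow> is_iso (tc D (cdiag I (eta N)))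
      (ex_us D (proj I (eta N)) \<langle>ge\<rangle> (cmor I ge) (proj I (eta N')) A)" for A
    using 1 ex1[OF ars_Var(1), of A] ends by simp_all
  note st = argwise_pullback_dsquare[OF square_th]
  have 2: "nat_trans (tc D (cdiag I (eta N'))) (tc D (dsrc (th_f N))) (ls D (th_f N) \<odot> us D (cmor I ge))
      (us D gR \<odot> ls D (th_f N')) (ex_us D (th_f N) (cmor I ge) gR (th_f N'))"
    "A \<in> obs (tc D (cdiag I (eta N'))) \<Longrightarrow> is_iso (tc D (dsrc (th_f N)))
      (ex_us D (th_f N) (cmor I ge) gR (th_f N') A)" for A
    using ex_us_nat[OF st] bc[OF square_th, of A] pge ends
    by (simp_all add: cmor_simps argwise_def cdiag_simps)
  note sj = dsquare_sym[OF argwise_pullback_dsquare[OF square_j]]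
  have 3: "nat_trans (tc D (dsrc (th_f N'))) (tc D (cdiag I (tgt g))) (us D (jth N) \<odot> us D gR)
      (us D (cmor I g) \<odot> us D (jth N')) (ex_usus D (jth N) (cmor I g) gR (jth N'))"
    "A \<in> obs (tc D (dsrc (th_f N'))) \<Longrightarrow> is_iso (tc D (cdiag I (tgt g)))
      (ex_usus D (jth N) (cmor I g) gR (jth N') A)" for A
    using ex_usus_nat[OF sj] ex_usus_iso[OF sj, of A] jth(3) by (simp_all add: gR_simps)
  note si = argwise_pullback_dsquare[OF square_i]
  have 4: "nat_trans (tc D (cdiag I (src g))) (tc D (cdiag I (sig N))) (ls D (cmor I (ii N)) \<odot> us D (cmor I g))
      (us D (cmor I gs) \<odot> ls D (cmor I (ii N'))) (ex_us D (cmor I (ii N)) (cmor I g) (cmor I gs) (cmor I (ii N')))"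
    "A \<in> obs (tc D (cdiag I (src g))) \<Longrightarrow> is_iso (tc D (cdiag I (sig N)))
      (ex_us D (cmor I (ii N)) (cmor I g) (cmor I gs) (cmor I (ii N')) A)" for A
    using ex_us_nat[OF si] bc[OF square_i, of A] proper ends
    by (simp_all add: cmor_simps argwise_def cdiag_simps)
  let ?e = "ex_shus D (proj I (sig N)) \<langle>gs\<rangle> (cmor I gs) (proj I (sig N'))"
  note ps = proj_smooth[OF obs_Var(3)] proj_smooth[OF obs_Var(4)]
  have us: "is_iso (tc D (dsrc (proj I (sig N)))) (ex_us D (proj I (sig N)) \<langle>gs\<rangle> (cmor I gs) (proj I (sig N')) B)"
    if "B \<in> obs (tc D (dsrc \<langle>gs\<rangle>))" for B
    using proj_ex_us_iso[OF ars_Var(2), of B] that ends by (simp add: proj_simps cmor_simps SH_def)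
  have "\<forall>g I. proper g \<and> category I \<longrightarrow> (\<forall>B\<in>obs (tc D (cdiag I (src g))).
        is_iso (SH D (tgt g)) (ex_shus D (proj I (tgt g)) \<langle>g\<rangle> (cmor I g) (proj I (src g)) B))"
    using axioms(5) unfolding proper_axioms_def by (elim conjE) assumption
  from this[rule_format, of gs I] pgs I
  have iso5: "is_iso (SH D (sig N)) (?e A)" if "A \<in> obs (tc D (cdiag I (sig N')))" for A
    using that ends by simp
  have 5: "nat_trans (tc D (cdiag I (sig N'))) (SH D (sig N)) (sh D (proj I (sig N)) \<odot> us D (cmor I gs))
      (us D \<langle>gs\<rangle> \<odot> sh D (proj I (sig N'))) ?e"
    using ex_shus_nat[OF qs ps us] ends by (simp add: proj_simps cmor_simps SH_def)
  note l2 = ladder_right[OF F(2) H(4) H(6) F'(2) F(1) H(2) F'(1) 2(1) 1(1)]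
  note l3 = ladder_right[OF F(3) H(6) H(8) F'(3) fctr_comp[OF F(1,2)] H(2) fctr_comp[OF F'(1,2)] 3(1) l2(1)]
  note l4 = ladder_right[OF F(4) H(8) H(10) F'(4) fctr_comp[OF fctr_comp[OF F(1,2)] F(3)] H(2)
      fctr_comp[OF fctr_comp[OF F'(1,2)] F'(3)] 4(1) l3(1)]
  note l5 = ladder_right[OF F(5) H(10) H(12) F'(5) fctr_comp[OF fctr_comp[OF fctr_comp[OF F(1,2)] F(3)] F(4)] H(2)
      fctr_comp[OF fctr_comp[OF fctr_comp[OF F'(1,2)] F'(3)] F'(4)] 5(1) l4(1)]
  have eq: "nc_beta D N N' g = (\<lambda>X. ?e (onO (ls D (cmor I (ii N')) \<odot> us D (jth N') \<odot> ls D (th_f N') \<odot>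
        ls D (proj I (eta N'))) X)
      \<cdot>\<^bsub>SH D (sig N)\<^esub> onA (sh D (proj I (sig N)))
        (ex_us D (cmor I (ii N)) (cmor I g) (cmor I gs) (cmor I (ii N'))
            (onO (us D (jth N') \<odot> ls D (th_f N') \<odot> ls D (proj I (eta N'))) X)
          \<cdot>\<^bsub>tc D (cdiag I (sig N))\<^esub> onA (ls D (cmor I (ii N)))
            (ex_usus D (jth N) (cmor I g) gR (jth N') (onO (ls D (th_f N') \<odot> ls D (proj I (eta N'))) X)
              \<cdot>\<^bsub>tc D (cdiag I (tgt g))\<^esub> onA (us D (jth N))
                (ex_us D (th_f N) (cmor I ge) gR (th_f N') (onO (ls D (proj I (eta N'))) X)
                  \<cdot>\<^bsub>tc D (dsrc (th_f N))\<^esub> onA (ls D (th_f N))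
                    (ex_us D (proj I (eta N)) \<langle>ge\<rangle> (cmor I ge) (proj I (eta N')) X)))))"
    by (rule ext) (simp add: nc_beta_def Let_def ends)
  show "nat_trans (SH D (eta N')) (SH D (sig N)) (Psi D N \<odot> us D \<langle>ge\<rangle>) (us D \<langle>gs\<rangle> \<odot> Psi D N') (nc_beta D N N' g)"
    using l5(1) unfolding eq Psi_def .
  show "is_iso (SH D (sig N)) (nc_beta D N N' g B)" if "B \<in> obs (SH D (eta N'))"
    unfolding eq
    by (rule l5(2)[OF iso5 l4(2)[OF 4(2) l3(2)[OF 3(2) l2(2)[OF 2(2) 1(2)]]] that])
qed

end

section \<open>Functorial cones\<close>

text \<open>The shape of the conclusion of the theorem, for an arbitrary transformation
  \<open>t\<close>. It is stable under precomposition, postcomposition and change of source or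
  target along an isomorphism, which is all that leads from the counit to
  \<open>nc_mu\<close>.\<close>

definition functorial_cone ::
  "('o, 'm) tcat \<Rightarrow> ('o, 'm) tcat \<Rightarrow> ('o, 'm) ftr \<Rightarrow> ('o, 'm) ftr \<Rightarrow> ('o \<Rightarrow> 'm) \<Rightarrow> bool" where
  "functorial_cone A E G H t \<longleftrightarrow> nat_trans A E G H t \<and>
     (\<exists>Q b c. triangulated_functor A E Q \<and> nat_trans A E H Q b \<and>
        nat_trans A E Q (shift_ftr E \<odot> G) c \<and> (\<forall>X\<in>obs A. (t X, b X, c X) \<in> tri E))"

lemma functorial_coneE:
  assumes "functorial_cone A E G H t"
  obtains Q b c where "nat_trans A E G H t" "triangulated_functor A E Q" "nat_trans A E H Q b"
    "nat_trans A E Q (shift_ftr E \<odot> G) c" "\<And>X. X \<in> obs A \<Longrightarrow> (t X, b X, c X) \<in> tri E"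
proof -
  obtain Q b c where *: "triangulated_functor A E Q \<and> nat_trans A E H Q b \<and>
        nat_trans A E Q (shift_ftr E \<odot> G) c \<and> (\<forall>X\<in>obs A. (t X, b X, c X) \<in> tri E)"
    using conjunct2[OF iffD1[OF functorial_cone_def assms]] by (elim exE)
  show ?thesis by (rule that[of Q b c]) (use * assms in \<open>simp_all add: functorial_cone_def\<close>)
qed

lemma functorial_coneI:
  assumes "nat_trans A E G H t" "triangulated_functor A E Q" "nat_trans A E H Q b"
    "nat_trans A E Q (shift_ftr E \<odot> G) c" "\<And>X. X \<in> obs A \<Longrightarrow> (t X, b X, c X) \<in> tri E"
  shows "functorial_cone A E G H t"
  unfolding functorial_cone_def using assms by (intro conjI exI[of _ Q] exI[of _ b] exI[of _ c]) auto

lemma (in coreflection) functorial_cone_counit: "functorial_cone E E (L \<odot> R) ftr_id co"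
  by (rule functorial_coneI[OF adjD(6)[OF adj] cone_triangulated cone_in_nat cone_out_nat cone_tri])

lemma functorial_cone_precomp:
  assumes A: "triangulated A" and B: "triangulated B" and E: "triangulated E"
    and T: "triangulated_functor A B T" and cone: "functorial_cone B E G H t"
  shows "functorial_cone A E (G \<odot> T) (H \<odot> T) (\<lambda>X. t (onO T X))"
proof -
  obtain Q b c where *: "nat_trans B E G H t" "triangulated_functor B E Q" "nat_trans B E H Q b"
    "nat_trans B E Q (shift_ftr E \<odot> G) c" "\<And>X. X \<in> obs B \<Longrightarrow> (t X, b X, c X) \<in> tri E"
    using functorial_coneE[OF cone] by blast
  note Tf = triangulated_functor_fctr[OF A B T]
  show ?thesis
  proof (rule functorial_coneI)
    show "nat_trans A E (G \<odot> T) (H \<odot> T) (\<lambda>X. t (onO T X))" by (rule nat_trans_whisker_right[OF Tf *(1)])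
    show "triangulated_functor A E (Q \<odot> T)" by (rule triangulated_functor_comp[OF A B E T *(2)])
    show "nat_trans A E (H \<odot> T) (Q \<odot> T) (\<lambda>X. b (onO T X))" by (rule nat_trans_whisker_right[OF Tf *(3)])
    show "nat_trans A E (Q \<odot> T) (shift_ftr E \<odot> (G \<odot> T)) (\<lambda>X. c (onO T X))"
      using nat_trans_whisker_right[OF Tf *(4)] by (simp add: ftr_comp_assoc)
    show "(t (onO T X), b (onO T X), c (onO T X)) \<in> tri E" if "X \<in> obs A" for X
      using *(5) fctrD(3)[OF Tf that] .
  qed
qed

text \<open>A triangulated functor commutes with the shift only up to isomorphism, so the connecting
  map is corrected by the shift isomorphism \<open>s\<close>.\<close>

lemma functorial_cone_postcomp:
  assumes A: "triangulated A" and E: "triangulated E" and F: "triangulated F"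
    and V: "triangulated_functor E F V" and G: "fctr A E G" and H: "fctr A E H"
    and cone: "functorial_cone A E G H t"
  shows "functorial_cone A F (V \<odot> G) (V \<odot> H) (\<lambda>X. onA V (t X))"
proof -
  interpret E: triangulated_cat E by unfold_locales (rule E)
  interpret F: triangulated_cat F by unfold_locales (rule F)
  obtain Q b c where *: "nat_trans A E G H t" "triangulated_functor A E Q" "nat_trans A E H Q b"
    "nat_trans A E Q (shift_ftr E \<odot> G) c" "\<And>X. X \<in> obs A \<Longrightarrow> (t X, b X, c X) \<in> tri E"
    using functorial_coneE[OF cone] by blast
  obtain s where s: "nat_trans E F (V \<odot> shift_ftr E) (shift_ftr F \<odot> V) s"
    "\<And>f g h. (f, g, h) \<in> tri E \<Longrightarrow> (onA V f, onA V g, s (dm E f) \<cdot>\<^bsub>F\<^esub> onA V h) \<in> tri F"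
    using triangulated_functorE[OF V] by metis
  note Vf = triangulated_functor_fctr[OF E F V] and Qf = triangulated_functor_fctr[OF A E *(2)]
  note fctr = Vf Qf G H E.shift_fctr F.shift_fctr fctr_comp
  show ?thesis
  proof (rule functorial_coneI)
    show "nat_trans A F (V \<odot> G) (V \<odot> H) (\<lambda>X. onA V (t X))"
      by (rule nat_trans_whisker_left[OF Vf G H *(1)])
    show "triangulated_functor A F (V \<odot> Q)" by (rule triangulated_functor_comp[OF A E F *(2) V])
    show "nat_trans A F (V \<odot> H) (V \<odot> Q) (\<lambda>X. onA V (b X))"
      by (rule nat_trans_whisker_left[OF Vf H Qf *(3)])
    have "nat_trans A F (V \<odot> Q) (V \<odot> shift_ftr E \<odot> G) (\<lambda>X. onA V (c X))"
      by (rule nat_trans_whisker_left[OF Vf Qf fctr_comp[OF G E.shift_fctr] *(4)])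
    moreover have "nat_trans A F (V \<odot> shift_ftr E \<odot> G) (shift_ftr F \<odot> (V \<odot> G)) (\<lambda>X. s (onO G X))"
      using nat_trans_whisker_right[OF G s(1)] by (simp add: ftr_comp_assoc)
    ultimately show "nat_trans A F (V \<odot> Q) (shift_ftr F \<odot> (V \<odot> G)) (\<lambda>X. s (onO G X) \<cdot>\<^bsub>F\<^esub> onA V (c X))"
      by (rule nat_trans_vcomp[rotated 3]) (rule fctr)+
    show "(onA V (t X), onA V (b X), s (onO G X) \<cdot>\<^bsub>F\<^esub> onA V (c X)) \<in> tri F" if "X \<in> obs A" for X
      using s(2)[OF *(5)[OF that]] nat_transD(3)[OF *(1) that] by simp
  qed
qed

text \<open>The cone and the map to it stay the same; only the connecting map is corrected, by the
  shifted inverse of \<open>a\<close>.\<close>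

lemma functorial_cone_iso_source:
  assumes A: "triangulated A" and E: "triangulated E" and G: "fctr A E G" and G': "fctr A E G'" and H: "fctr A E H"
    and cone: "functorial_cone A E G H t"
    and a: "nat_trans A E G' G a" "\<And>X. X \<in> obs A \<Longrightarrow> is_iso E (a X)"
  shows "functorial_cone A E G' H (\<lambda>X. t X \<cdot>\<^bsub>E\<^esub> a X)"
proof -
  interpret E: triangulated_cat E by unfold_locales (rule E)
  obtain Q b c where *: "nat_trans A E G H t" "triangulated_functor A E Q" "nat_trans A E H Q b"
    "nat_trans A E Q (shift_ftr E \<odot> G) c" "\<And>X. X \<in> obs A \<Longrightarrow> (t X, b X, c X) \<in> tri E"
    using functorial_coneE[OF cone] by blast
  note Qf = triangulated_functor_fctr[OF A E *(2)]
  note i = nat_trans_inver[OF G' G a]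
  let ?c = "\<lambda>X. sha E (inver E (a X)) \<cdot>\<^bsub>E\<^esub> c X"
  show ?thesis
  proof (rule functorial_coneI[OF nat_trans_vcomp[OF G' G H a(1) *(1)] *(2,3)])
    have "nat_trans A E (shift_ftr E \<odot> G) (shift_ftr E \<odot> G') (\<lambda>X. onA (shift_ftr E) (inver E (a X)))"
      by (rule nat_trans_whisker_left[OF E.shift_fctr G G' i])
    from nat_trans_vcomp[OF Qf fctr_comp[OF G E.shift_fctr] fctr_comp[OF G' E.shift_fctr] *(4) this]
    show "nat_trans A E Q (shift_ftr E \<odot> G') ?c" by (simp add: shift_ftr_def)
    fix X assume X: "X \<in> obs A"
    note o = fctrD(3)[OF G X] fctrD(3)[OF G' X] fctrD(3)[OF H X] fctrD(3)[OF Qf X]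
    note h = nat_transD(1)[OF *(1) X] nat_transD(1)[OF *(3) X] nat_transD(1)[OF *(4) X]
      nat_transD(1)[OF a(1) X] nat_transD(1)[OF i X]
    have c: "c X \<in> homs E (onO Q X) (sho E (onO G X))" using h(3) by (simp add: shift_ftr_def)
    have si: "sha E (inver E (a X)) \<in> homs E (sho E (onO G X)) (sho E (onO G' X))"
      using fctr_homs[OF E.shift_fctr h(5)] by (simp add: shift_ftr_def)
    note ta = cmp_homs[OF E.cat h(4,1)] and cc = cmp_homs[OF E.cat c si]
    show "(t X \<cdot>\<^bsub>E\<^esub> a X, b X, ?c X) \<in> tri E"
    proof (rule E.tri_iso[OF *(5)[OF X]])
      show "pre_triangle E (t X \<cdot>\<^bsub>E\<^esub> a X) (b X) (?c X)"
        using homsD[OF ta] homsD[OF h(2)] homsD[OF cc] by (simp add: pre_triangle_def)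
      show "inver E (a X) \<in> homs E (dm E (t X)) (dm E (t X \<cdot>\<^bsub>E\<^esub> a X))"
        using h(5) homsD[OF h(1)] homsD[OF ta] by simp
      show "idn E (onO H X) \<in> homs E (dm E (b X)) (dm E (b X))" "idn E (onO Q X) \<in> homs E (dm E (c X)) (dm E (?c X))"
        using o homsD[OF h(2)] homsD[OF c] homsD[OF cc] idn_homs[OF E.cat] by simp_all
      show "is_iso E (inver E (a X))" "is_iso E (idn E (onO H X))" "is_iso E (idn E (onO Q X))"
        using a(2)[OF X] o by (simp_all add: is_iso_inver[OF E.cat] is_iso_idn[OF E.cat])
      have "(t X \<cdot>\<^bsub>E\<^esub> a X) \<cdot>\<^bsub>E\<^esub> inver E (a X) = t X"
        using cmp_assoc_homs[OF E.cat h(5,4,1)] cmp_inver[OF E.cat a(2)[OF X]] homsD[OF h(4)] homsD[OF h(1)]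
        by (simp add: cmp_idn[OF E.cat])
      then show "idn E (onO H X) \<cdot>\<^bsub>E\<^esub> t X = (t X \<cdot>\<^bsub>E\<^esub> a X) \<cdot>\<^bsub>E\<^esub> inver E (a X)"
        using homsD[OF h(1)] by (simp add: idn_cmp[OF E.cat])
      show "idn E (onO Q X) \<cdot>\<^bsub>E\<^esub> b X = b X \<cdot>\<^bsub>E\<^esub> idn E (onO H X)"
        using homsD[OF h(2)] by (simp add: idn_cmp[OF E.cat] cmp_idn[OF E.cat])
      show "sha E (inver E (a X)) \<cdot>\<^bsub>E\<^esub> c X = ?c X \<cdot>\<^bsub>E\<^esub> idn E (onO Q X)"
        using homsD[OF cc] by (simp add: cmp_idn[OF E.cat])
    qed
  qed
qed

text \<open>The cone and the connecting map stay the same; the map to the cone is preceded by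
  \<open>a\<close>.\<close>

lemma functorial_cone_iso_target:
  assumes A: "triangulated A" and E: "triangulated E" and G: "fctr A E G" and H: "fctr A E H" and H': "fctr A E H'"
    and cone: "functorial_cone A E G H t"
    and a: "nat_trans A E H' H a" "\<And>X. X \<in> obs A \<Longrightarrow> is_iso E (a X)"
  shows "functorial_cone A E G H' (\<lambda>X. inver E (a X) \<cdot>\<^bsub>E\<^esub> t X)"
proof -
  interpret E: triangulated_cat E by unfold_locales (rule E)
  obtain Q b c where *: "nat_trans A E G H t" "triangulated_functor A E Q" "nat_trans A E H Q b"
    "nat_trans A E Q (shift_ftr E \<odot> G) c" "\<And>X. X \<in> obs A \<Longrightarrow> (t X, b X, c X) \<in> tri E"
    using functorial_coneE[OF cone] by blast
  note Qf = triangulated_functor_fctr[OF A E *(2)]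
  note i = nat_trans_inver[OF H' H a]
  show ?thesis
  proof (rule functorial_coneI[OF nat_trans_vcomp[OF G H H' *(1) i] *(2) nat_trans_vcomp[OF H' H Qf a(1) *(3)] *(4)])
    fix X assume X: "X \<in> obs A"
    note o = fctrD(3)[OF G X] fctrD(3)[OF H X] fctrD(3)[OF H' X] fctrD(3)[OF Qf X]
    note h = nat_transD(1)[OF *(1) X] nat_transD(1)[OF *(3) X] nat_transD(1)[OF *(4) X]
      nat_transD(1)[OF a(1) X] nat_transD(1)[OF i X]
    have c: "c X \<in> homs E (onO Q X) (sho E (onO G X))" using h(3) by (simp add: shift_ftr_def)
    note it = cmp_homs[OF E.cat h(1,5)] and ba = cmp_homs[OF E.cat h(4,2)]
    show "(inver E (a X) \<cdot>\<^bsub>E\<^esub> t X, b X \<cdot>\<^bsub>E\<^esub> a X, c X) \<in> tri E"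
    proof (rule E.tri_iso[OF *(5)[OF X]])
      show "pre_triangle E (inver E (a X) \<cdot>\<^bsub>E\<^esub> t X) (b X \<cdot>\<^bsub>E\<^esub> a X) (c X)"
        using homsD[OF it] homsD[OF ba] homsD[OF c] by (simp add: pre_triangle_def)
      show "idn E (onO G X) \<in> homs E (dm E (t X)) (dm E (inver E (a X) \<cdot>\<^bsub>E\<^esub> t X))"
        "inver E (a X) \<in> homs E (dm E (b X)) (dm E (b X \<cdot>\<^bsub>E\<^esub> a X))" "idn E (onO Q X) \<in> homs E (dm E (c X)) (dm E (c X))"
        using o h(5) homsD[OF h(1)] homsD[OF h(2)] homsD[OF c] homsD[OF it] homsD[OF ba] idn_homs[OF E.cat]
        by simp_all
      show "is_iso E (idn E (onO G X))" "is_iso E (inver E (a X))" "is_iso E (idn E (onO Q X))"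
        using a(2)[OF X] o by (simp_all add: is_iso_inver[OF E.cat] is_iso_idn[OF E.cat])
      show "inver E (a X) \<cdot>\<^bsub>E\<^esub> t X = (inver E (a X) \<cdot>\<^bsub>E\<^esub> t X) \<cdot>\<^bsub>E\<^esub> idn E (onO G X)"
        using homsD[OF it] by (simp add: cmp_idn[OF E.cat])
      show "idn E (onO Q X) \<cdot>\<^bsub>E\<^esub> b X = (b X \<cdot>\<^bsub>E\<^esub> a X) \<cdot>\<^bsub>E\<^esub> inver E (a X)"
        using cmp_assoc_homs[OF E.cat h(5,4,2)] cmp_inver[OF E.cat a(2)[OF X]] homsD[OF h(4)] homsD[OF h(2)]
        by (simp add: cmp_idn[OF E.cat] idn_cmp[OF E.cat])
      show "sha E (idn E (onO G X)) \<cdot>\<^bsub>E\<^esub> c X = c X \<cdot>\<^bsub>E\<^esub> idn E (onO Q X)"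
        using homsD[OF c] o by (simp add: cmp_idn[OF E.cat] idn_cmp[OF E.cat] E.shift_simps)
    qed
  qed
qed

section \<open>Open immersions and nearby cycles\<close>

text \<open>The monomorphism property, in the form of a fibre square that \<open>sh_unit_iso\<close>
  requires.\<close>

lemma open_immersion_kernel_pair:
  assumes u: "u \<in> ars Var" "open_immersion u"
  shows "is_pullback Var u u (kid (src u)) (kid (src u))"
proof (rule is_pullbackI)
  have Y: "src u \<in> obs Var" and uh: "u \<in> homs Var (src u) (tgt u)" using u by (auto simp: Var_simps homs_def)
  note k = homsD[OF kid_homs[OF Y]]
  show "u \<in> ars Var" "u \<in> ars Var" by (rule u)+
  show "kid (src u) \<in> ars Var" "kid (src u) \<in> ars Var" by (rule k)+
  show "cd Var (kid (src u)) = dm Var u" "cd Var (kid (src u)) = dm Var u" by (simp_all add: Var_simps kid_simps)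
  fix x y assume x: "x \<in> ars Var" "y \<in> ars Var" "dm Var x = dm Var y" "cd Var x = dm Var u" "cd Var y = dm Var u"
    "u \<cdot>\<^bsub>Var\<^esub> x = u \<cdot>\<^bsub>Var\<^esub> y"
  have "x = y" by (rule open_immersion_mono[OF u(2)]) (use x in \<open>auto simp: Var_simps\<close>)
  moreover have "x \<in> homs Var (src x) (src u)" using x by (simp add: homs_def Var_simps)
  ultimately show "\<exists>m. m \<in> homs Var (dm Var x) (dm Var (kid (src u))) \<and> kid (src u) \<cdot>\<^bsub>Var\<^esub> m = x \<and>
      kid (src u) \<cdot>\<^bsub>Var\<^esub> m = y"
    using kid_cmp(1)[of x "src x" "src u"] by (intro exI[of _ x]) (simp add: Var_simps kid_simps)
next
  fix t m m' assume m: "m \<in> homs Var t (dm Var (kid (src u)))" "m' \<in> homs Var t (dm Var (kid (src u)))"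
    "kid (src u) \<cdot>\<^bsub>Var\<^esub> m = kid (src u) \<cdot>\<^bsub>Var\<^esub> m'"
  then have "m \<in> homs Var t (src u)" "m' \<in> homs Var t (src u)" by (simp_all add: Var_simps kid_simps)
  then show "m = m'" using m(3) kid_cmp(1)[of m t "src u"] kid_cmp(1)[of m' t "src u"] by simp
qed auto

context fibres_morphism
begin

lemma nc_gamma_functorial_cone:
  assumes oi: "open_immersion g"
  shows "functorial_cone (SH D (eta N')) (SH D (sig N)) (sh D \<langle>gs\<rangle> \<odot> Psi D N') (Psi D N \<odot> sh D \<langle>ge\<rangle>)
    (nc_gamma D N N' g)"
proof -
  let ?A = "SH D (eta N')" and ?E = "SH D (sig N)" and ?C = "SH D (sig N')" and ?B = "SH D (eta N)"
  have oe: "open_immersion ge" and os: "open_immersion gs"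
    using open_immersion_base_change[OF is_pullback_sym[OF ge(3)] oi]
      open_immersion_base_change[OF is_pullback_sym[OF gs(2)] oi] by auto
  have sm: "smooth g" "smooth ge" "smooth gs"
    using smooth_open_immersion[OF g oi] smooth_open_immersion[OF ars_Var(1) oe]
      smooth_open_immersion[OF ars_Var(2) os] by auto
  have as: "argwise smooth \<langle>ge\<rangle>" "argwise smooth \<langle>gs\<rangle>"
    using sm by (simp_all add: argwise_def cmor_simps cdiag_simps)
  note ce = cmor_ars[OF term_category ars_Var(1)] and cs = cmor_ars[OF term_category ars_Var(2)]
  have adj_e: "adj ?A ?B (sh D \<langle>ge\<rangle>) (ls D \<langle>ge\<rangle>) (sh_un D \<langle>ge\<rangle>) (sh_co D \<langle>ge\<rangle>)"
    using sh_adj[OF ce as(1)] ends by (simp add: cmor_simps SH_def)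
  have adj_s: "adjunction ?C ?E (sh D \<langle>gs\<rangle>) (ls D \<langle>gs\<rangle>) (sh_un D \<langle>gs\<rangle>) (sh_co D \<langle>gs\<rangle>)"
    using sh_adjunction[OF cs as(2)] ends by (simp add: cmor_simps SH_def)
  have tr: "triangulated_functor ?A ?B (sh D \<langle>ge\<rangle>)" "triangulated_functor ?C ?E (sh D \<langle>gs\<rangle>)"
    "triangulated_functor ?E ?C (ls D \<langle>gs\<rangle>)"
    using sh_triangulated[OF ce as(1)] sh_triangulated[OF cs as(2)] ls_triangulated[OF cs] ends
    by (simp_all add: cmor_simps SH_def)
  note t = SH_triangulated[OF obs_Var(2)] SH_triangulated[OF obs_Var(1)] SH_triangulated[OF obs_Var(4)]
    SH_triangulated[OF obs_Var(3)]
  interpret C: triangulated_cat ?C by unfold_locales (rule t)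
  interpret E: triangulated_cat ?E by unfold_locales (rule t)
  \<comment> \<open>Invertible units serve two purposes: for \<open>gs\<close> they give the
    coreflection whose counit has a functorial cone, for \<open>ge\<close> they make the change of
    source \<open>?a\<close> invertible.\<close>
  have un_s: "is_iso ?C (sh_un D \<langle>gs\<rangle> X)" if "X \<in> obs ?C" for X
    using sh_unit_iso[OF ars_Var(2) sm(3) open_immersion_kernel_pair[OF ars_Var(2) os]] that ends by simp
  have un_e: "is_iso ?A (sh_un D \<langle>ge\<rangle> X)" if "X \<in> obs ?A" for X
    using sh_unit_iso[OF ars_Var(1) sm(2) open_immersion_kernel_pair[OF ars_Var(1) oe]] that ends by simp
  interpret coreflection ?C ?E "sh D \<langle>gs\<rangle>" "ls D \<langle>gs\<rangle>" "sh_un D \<langle>gs\<rangle>" "sh_co D \<langle>gs\<rangle>"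
    by unfold_locales (use adj_s tr un_s in auto)
  note fe = triangulated_functor_fctr[OF t(1,2) tr(1)] and fs = triangulated_functor_fctr[OF t(3,4) tr(2)]
    and fl = triangulated_functor_fctr[OF t(4,3) tr(3)] and fle = adjD(4)[OF adj_e]
  \<comment> \<open>The isomorphism from the nearby cycles on the open part to the restriction,
    along \<open>gs\<close>, of the nearby cycles of \<open>sh D\<close> of \<open>ge\<close>: the
    unit of \<open>ge\<close>, then the inverse of the base change morphism. Its transpose under the
    adjunction of \<open>gs\<close> is \<open>nc_gamma\<close>.\<close>
  let ?a = "\<lambda>B. inver ?C (nc_alpha D N N' g (onO (sh D \<langle>ge\<rangle>) B)) \<cdot>\<^bsub>?C\<^esub> onA (Psi D N') (sh_un D \<langle>ge\<rangle> B)"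
  note al = nc_alpha_nat[OF sm(1)] nc_alpha_iso[OF sm(1)]
  have 1: "nat_trans ?A ?C (Psi D N') (Psi D N' \<odot> ls D \<langle>ge\<rangle> \<odot> sh D \<langle>ge\<rangle>) (\<lambda>B. onA (Psi D N') (sh_un D \<langle>ge\<rangle> B))"
    using nat_trans_whisker_left[OF Psi_fctr' fctr_id[OF adjD(1)[OF adj_e]] fctr_comp[OF fe fle] adjD(5)[OF adj_e]]
    by simp
  have "nat_trans ?B ?C (Psi D N' \<odot> ls D \<langle>ge\<rangle>) (ls D \<langle>gs\<rangle> \<odot> Psi D N) (\<lambda>A. inver ?C (nc_alpha D N N' g A))"
    by (rule nat_trans_inver[OF fctr_comp[OF Psi_fctr fl] fctr_comp[OF fle Psi_fctr'] al])
  from nat_trans_whisker_right[OF fe this]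
  have 2: "nat_trans ?A ?C (Psi D N' \<odot> ls D \<langle>ge\<rangle> \<odot> sh D \<langle>ge\<rangle>) (ls D \<langle>gs\<rangle> \<odot> Psi D N \<odot> sh D \<langle>ge\<rangle>)
      (\<lambda>B. inver ?C (nc_alpha D N N' g (onO (sh D \<langle>ge\<rangle>) B)))"
    by (simp add: ftr_comp_assoc)
  have a: "nat_trans ?A ?C (Psi D N') (ls D \<langle>gs\<rangle> \<odot> Psi D N \<odot> sh D \<langle>ge\<rangle>) ?a"
    by (rule nat_trans_vcomp[OF Psi_fctr' fctr_comp[OF fctr_comp[OF fe fle] Psi_fctr']
      fctr_comp[OF fctr_comp[OF fe Psi_fctr] fl] 1 2])
  have ai: "is_iso ?C (?a B)" if B: "B \<in> obs ?A" for B
  proof (rule is_iso_cmp[OF C.cat])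
    show "is_iso ?C (onA (Psi D N') (sh_un D \<langle>ge\<rangle> B))" by (rule fctr_iso[OF Psi_fctr' un_e[OF B]])
    show "is_iso ?C (inver ?C (nc_alpha D N N' g (onO (sh D \<langle>ge\<rangle>) B)))"
      by (rule is_iso_inver[OF C.cat al(2)[OF fctrD(3)[OF fe B]]])
    show "cd ?C (onA (Psi D N') (sh_un D \<langle>ge\<rangle> B)) = dm ?C (inver ?C (nc_alpha D N N' g (onO (sh D \<langle>ge\<rangle>) B)))"
      using nat_transD(4)[OF 1 B] nat_transD(3)[OF 2 B] by simp
  qed
  note PG = triangulated_functor_comp[OF t(1,2,4) tr(1) Psi_triangulated]
  note PGf = fctr_comp[OF fe Psi_fctr]
  \<comment> \<open>The cone of the counit is evaluated on the image of a triangulated functor;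
    changing the source along \<open>?a\<close> then turns the counit into
    \<open>nc_gamma\<close>.\<close>
  have "functorial_cone ?A ?E (sh D \<langle>gs\<rangle> \<odot> ls D \<langle>gs\<rangle> \<odot> Psi D N \<odot> sh D \<langle>ge\<rangle>) (Psi D N \<odot> sh D \<langle>ge\<rangle>)
      (\<lambda>B. sh_co D \<langle>gs\<rangle> (onO (Psi D N \<odot> sh D \<langle>ge\<rangle>) B))"
    using functorial_cone_precomp[OF t(1,4,4) PG functorial_cone_counit] by (simp add: ftr_comp_assoc)
  from functorial_cone_iso_source[OF t(1,4) fctr_comp[OF fctr_comp[OF PGf fl] fs] fctr_comp[OF Psi_fctr' fs] PGf
      this nat_trans_whisker_left[OF fs Psi_fctr' fctr_comp[OF PGf fl] a] fctr_iso[OF fs ai]]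
  show ?thesis by (simp add: nc_gamma_def[abs_def] Let_def)
qed

end

theorem theorem2p2:
  fixes D :: "('p, 'r, 'k::field_char_0, 'o, 'm) deriv"
    and S :: "('p, 'r, 'k) base"
    and X Y :: "('p, 'r, 'k) kspace"
    and f g v u :: "('p, 'r, 'k) kmor"
    and NX NY NZ :: "('p, 'r, 'k) fibres"
  assumes "stable_homotopical_derivator D"
    and "base_data S"
    and "X \<in> obs Var" and "Y \<in> obs Var"
    and "g \<in> homs Var Y X" and "f \<in> homs Var X (A1 S)"
    and "nagata g v u"
    and "fibre_data S f NX"
    and "fibre_data S (f \<cdot>\<^bsub>Var\<^esub> g) NY"
    and "fibre_data S (f \<cdot>\<^bsub>Var\<^esub> v) NZ"
  shows "\<exists>Psi_inf b c.
    triangulated_functor (SH D (eta NY)) (SH D (sig NX)) Psi_inf \<and>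
    nat_trans (SH D (eta NY)) (SH D (sig NX))
      (sig_shriek D NX NZ NY v u \<odot> Psi D NY) (Psi D NX \<odot> eta_shriek D NX NZ NY v u)
      (nc_mu D NX NZ NY v u) \<and>
    nat_trans (SH D (eta NY)) (SH D (sig NX))
      (Psi D NX \<odot> eta_shriek D NX NZ NY v u) Psi_inf b \<and>
    nat_trans (SH D (eta NY)) (SH D (sig NX))
      Psi_inf (shift_ftr (SH D (sig NX)) \<odot> (sig_shriek D NX NZ NY v u \<odot> Psi D NY)) c \<and>
    (\<forall>A\<in>obs (SH D (eta NY)).
       (nc_mu D NX NZ NY v u A, b A, c A) \<in> tri (SH D (sig NX)))"
proof -
  interpret derivator D by unfold_locales (rule assms(1))
  have uv: "u \<in> ars Var" "open_immersion u" "proper v" "tgt u = src v" "g = v \<cdot>\<^bsub>Var\<^esub> u"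
    using assms(7) by (auto simp: nagata_def)
  have v: "v \<in> ars Var" using uv(3) by (simp add: proper_def)
  have vX: "tgt v = X" using homsD[OF assms(5)] uv(5) by (simp add: Var_simps kcomp_simps)
  have f: "f \<in> ars Var" "src f = X" using homsD[OF assms(6)] by (simp_all add: Var_simps)
  have fv: "f \<cdot>\<^bsub>Var\<^esub> v \<in> ars Var" "src (f \<cdot>\<^bsub>Var\<^esub> v) = src v"
    using cmp_ars[OF Var_category v f(1)] vX f(2) by (simp_all add: Var_simps kcomp_simps)
  \<comment> \<open>Lets the fibre data of f g serve as the data of the composite of f v with
    \<open>u\<close>, so that both instances of the locale apply to one factorization.\<close>
  have fvu: "f \<cdot>\<^bsub>Var\<^esub> g = (f \<cdot>\<^bsub>Var\<^esub> v) \<cdot>\<^bsub>Var\<^esub> u"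
    using cmp_assoc[OF Var_category uv(1) v f(1)] uv(4,5) vX f(2) by (simp add: Var_simps)
  interpret V: fibres_morphism D S f v NX NZ
    by unfold_locales (use assms(2,8,10) f v vX in auto)
  interpret U: fibres_morphism D S "f \<cdot>\<^bsub>Var\<^esub> v" u NZ NY
    by unfold_locales (use assms(2,9,10) fv fvu uv in auto)
  let ?A = "SH D (eta NY)" and ?F = "SH D (sig NX)" and ?E = "SH D (sig NZ)"
  note t = SH_triangulated[OF U.obs_Var(2)] SH_triangulated[OF V.obs_Var(4)] SH_triangulated[OF V.obs_Var(3)]
  have vt: "triangulated_functor ?E ?F (us D \<langle>V.gs\<rangle>)"
    using us_triangulated[OF cmor_ars[OF term_category V.ars_Var(2)]] V.ends by (simp add: cmor_simps SH_def)
  note cone = U.nc_gamma_functorial_cone[OF uv(2)]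
  have oe: "open_immersion U.ge" "open_immersion U.gs"
    using open_immersion_base_change[OF is_pullback_sym[OF U.ge(3)] uv(2)]
      open_immersion_base_change[OF is_pullback_sym[OF U.gs(2)] uv(2)] by auto
  have ue: "fctr ?A (SH D (eta NZ)) (sh D \<langle>U.ge\<rangle>)" "fctr (SH D (sig NY)) ?E (sh D \<langle>U.gs\<rangle>)"
    using sh_fctr[OF cmor_ars[OF term_category U.ars_Var(1)]] sh_fctr[OF cmor_ars[OF term_category U.ars_Var(2)]]
      smooth_open_immersion[OF U.ars_Var(1) oe(1)] smooth_open_immersion[OF U.ars_Var(2) oe(2)] U.ends
    by (simp_all add: argwise_def cmor_simps cdiag_simps SH_def)
  note fs = fctr_comp[OF U.Psi_fctr' ue(2)] fctr_comp[OF ue(1) V.Psi_fctr']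
  note fV = V.factors(12) and fVe = V.factors(2)
  note cone2 = functorial_cone_postcomp[OF t vt fs cone]
  have "nat_trans ?A ?F (Psi D NX \<odot> us D \<langle>V.ge\<rangle> \<odot> sh D \<langle>U.ge\<rangle>) (us D \<langle>V.gs\<rangle> \<odot> Psi D NZ \<odot> sh D \<langle>U.ge\<rangle>)
      (\<lambda>B. nc_beta D NX NZ v (onO (sh D \<langle>U.ge\<rangle>) B))"
    using nat_trans_whisker_right[OF ue(1) V.nc_beta_nat[OF uv(3)]] by (simp add: ftr_comp_assoc)
  from functorial_cone_iso_target[OF t(1,3) fctr_comp[OF fs(1) fV] fctr_comp[OF fs(2) fV]
      fctr_comp[OF fctr_comp[OF ue(1) fVe] V.Psi_fctr] cone2 this V.nc_beta_iso[OF uv(3) fctrD(3)[OF ue(1)]]]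
  have "functorial_cone ?A ?F (sig_shriek D NX NZ NY v u \<odot> Psi D NY) (Psi D NX \<odot> eta_shriek D NX NZ NY v u)
      (nc_mu D NX NZ NY v u)"
    by (simp add: sig_shriek_def eta_shriek_def nc_mu_def[abs_def] ftr_comp_assoc)
  then show ?thesis
    by (elim functorial_coneE) blast
qed

end
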